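(* Let $\gamma\in\mathbb{T}$ and let $\sigma$ be a finite positive Borel measure on $\mathbb{T}$. Let $\{\mu_{nk}:n\in\mathbb{N},1\le k\le k_n\}\subset\mathcal{M}_{\mathbb{T}}^{\times}$ be an infinitesimal array and let $\{\lambda_n\}_{n=1}^\infty\subset\mathbb{T}$ be a sequence. The following statements are equivalent: (1) The sequence $\delta_{\lambda_n}\uplus_{\times}\mu_{n1}\uplus_{\times}\mu_{n2}\uplus_{\times}\cdots\uplus_{\times}\mu_{nk_n}$ converges weakly to $\nu_{\uplus_\times}^{\gamma,\sigma}$ as $n\to\infty$. (2) The sequence $\delta_{\lambda_n}\boxtimes\mu_{n1}\boxtimes\mu_{n2}\boxtimes\cdots\boxtimes\mu_{nk_n}$ converges weakly to $\nu_{\boxtimes}^{\gamma,\sigma}$ as $n\to\infty$. (3) The sequence of measures $d\sigma_n(\zeta)=\sum_{k=1}^{k_n}(1-\Re\zeta)\,d\mu_{nk}^{\circ}(\zeta)$ converges weakly on $\mathbb{T}$ to $\sigma$, and $\lim_{n\to\infty}\gamma_n=\gamma$, where $$\gamma_n=\exp\left(i\arg\lambda_n+i\sum_{k=1}^{k_n}\arg b_{nk}+i\sum_{k=1}^{k_n}\int_{\mathbb{T}}\Im\zeta\,d\mu_{nk}^{\circ}(\zeta)\right).$$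
   Context: $\mathbb{T}$ is the unit circle, $\mathbb{D}$ the open unit disk; $\mathcal{M}_{\mathbb{T}}^{\times}$ is the set of Borel probability measures $\mu$ on $\mathbb{T}$ with $\int_{\mathbb{T}}\zeta\,d\mu(\zeta)\ne0$; $\delta_\lambda$ is the point mass at $\lambda$. $\{k_n\}$ is a sequence of natural numbers. An array $\{\mu_{nk}\}_{n\in\mathbb{N},1\le k\le k_n}$ of probability measures on $\mathbb{T}$ is infinitesimal if $\lim_{n\to\infty}\max_{1\le k\le k_n}\mu_{nk}(\{\zeta\in\mathbb{T}:|\zeta-1|\ge\varepsilon\})=0$ for every $\varepsilon>0$. For a probability measure $\mu$ on $\mathbb{T}$ put $\psi_\mu(z)=\int_{\mathbb{T}}\frac{\zeta z}{1-\zeta z}\,d\mu(\zeta)$ and $B_\mu(z)=\frac1z\frac{\psi_\mu(z)}{1+\psi_\mu(z)}$, $z\in\mathbb{D}$ (with the singularity at $0$ removed). The map $\mu\mapsto B_\mu$ is a bijection from probability measures on $\mathbb{T}$ to analytic functions $\mathbb{D}\to\overline{\mathbb{D}}$. The multiplicative boolean convolution $\mu_1\uplus_\times\mu_2$ is the probability measure determined by $B_{\mu_1\uplus_\times\mu_2}(z)=B_{\mu_1}(z)B_{\mu_2}(z)$, $z\in\mathbb{D}$. $\boxtimes$ is the free multiplicative convolution of probability measures on $\mathbb{T}$ (the distribution of a product of two freely independent unitaries with the given distributions). For $\nu\in\mathcal{M}_{\mathbb{T}}^\times$ the function $\psi_\nu$ has an inverse $\psi_\nu^{-1}$ near $0$;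 put $\Sigma_\nu(z)=\frac1z\psi_\nu^{-1}\left(\frac{z}{1-z}\right)$ for $z$ near $0$. For $\mu,\nu\in\mathcal{M}_{\mathbb{T}}^\times$, $\Sigma_{\mu\boxtimes\nu}=\Sigma_\mu\Sigma_\nu$ near $0$. For $\gamma\in\mathbb{T}$ and $\sigma$ a finite positive Borel measure on $\mathbb{T}$: $\nu_{\uplus_\times}^{\gamma,\sigma}$ is the probability measure with $B_\nu(z)=\gamma\exp\left(-\int_{\mathbb{T}}\frac{1+\zeta z}{1-\zeta z}\,d\sigma(\zeta)\right)$, $z\in\mathbb{D}$; and $\nu_{\boxtimes}^{\gamma,\sigma}$ is the probability measure in $\mathcal{M}_{\mathbb{T}}^\times$ with $\Sigma_\nu(z)=\overline{\gamma}\exp\left(\int_{\mathbb{T}}\frac{1+\zeta z}{1-\zeta z}\,d\sigma(\zeta)\right)$ for $z$ near $0$. $\arg$ is the principal value of the argument. Fix a constant $\tau\in(0,\pi)$, and set $b_{nk}=\exp\left(i\int_{|\arg\zeta|<\tau}\arg\zeta\,d\mu_{nk}(\zeta)\right)$ and $d\mu_{nk}^\circ(\zeta)=d\mu_{nk}(b_{nk}\zeta)$, i.e. $\mu_{nk}^\circ(A)=\mu_{nk}(b_{nk}A)$ for Borel $A\subset\mathbb{T}$. *)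

theory Defs
  imports
    "HOL-Probability.Probability"
    "HOL-Complex_Analysis.Complex_Analysis"
    "HOL-Algebra.Ring"
begin

section \<open>Measures on the unit circle\<close>

abbreviation unit_circle :: "complex set" where
  "unit_circle \<equiv> sphere 0 1"

definition circle_borel :: "complex measure" where
  "circle_borel = restrict_space borel unit_circle"

definition circle_prob :: "complex measure set" where
  "circle_prob = {\<mu>. prob_space \<mu> \<and> sets \<mu> = sets circle_borel}"

text \<open>Probability measures on the circle with nonzero mean.\<close>

definition circle_prob_times :: "complex measure set" where
  "circle_prob_times = {\<mu> \<in> circle_prob. (\<integral>\<zeta>. \<zeta> \<partial>\<mu>) \<noteq> 0}"

definition point_mass :: "complex \<Rightarrow> complex measure" where
  "point_mass l = return circle_borel l"

text \<open>The library's weak convergence is specific to distribution functions on the real line.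
  On the compact circle every continuous test function is bounded.\<close>

definition circle_weak_conv :: "(nat \<Rightarrow> complex measure) \<Rightarrow> complex measure \<Rightarrow> bool" where
  "circle_weak_conv M L \<longleftrightarrow>
     (\<forall>f :: complex \<Rightarrow> real. continuous_on unit_circle f \<longrightarrow>
        (\<lambda>n. \<integral>\<zeta>. f \<zeta> \<partial>M n) \<longlonglongrightarrow> (\<integral>\<zeta>. f \<zeta> \<partial>L))"


section \<open>Multiplicative boolean convolution\<close>

definition psi :: "complex measure \<Rightarrow> complex \<Rightarrow> complex" where
  "psi \<mu> z = (\<integral>\<zeta>. \<zeta> * z / (1 - \<zeta> * z) \<partial>\<mu>)"

definition B_transform :: "complex measure \<Rightarrow> complex \<Rightarrow> complex" where
  "B_transform \<mu> = remove_sings (\<lambda>z. 1 / z * (psi \<mu> z / (1 + psi \<mu> z)))"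

definition boolean_conv :: "complex measure \<Rightarrow> complex measure \<Rightarrow> complex measure" where
  "boolean_conv \<mu> \<nu> =
     (THE \<rho>. \<rho> \<in> circle_prob \<and>
        (\<forall>z\<in>ball 0 1. B_transform \<rho> z = B_transform \<mu> z * B_transform \<nu> z))"


section \<open>Free multiplicative convolution\<close>

text \<open>A \<open>*\<close>-probability space: a unital complex \<open>*\<close>-algebra, given by a ring structure \<open>A\<close>, a
  scalar multiplication \<open>scl\<close> and an involution \<open>star\<close>, together with a state \<open>\<phi>\<close>.\<close>

locale star_prob_space = ring A for A (structure) +
  fixes scl :: "complex \<Rightarrow> 'a \<Rightarrow> 'a"
    and star :: "'a \<Rightarrow> 'a"
    and \<phi> :: "'a \<Rightarrow> complex"
  assumes scl_closed: "x \<in> carrier A \<Longrightarrow> scl c x \<in> carrier A"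
    and scl_add_right: "x \<in> carrier A \<Longrightarrow> y \<in> carrier A \<Longrightarrow> scl c (x \<oplus> y) = scl c x \<oplus> scl c y"
    and scl_add_left: "x \<in> carrier A \<Longrightarrow> scl (c + d) x = scl c x \<oplus> scl d x"
    and scl_scl: "x \<in> carrier A \<Longrightarrow> scl c (scl d x) = scl (c * d) x"
    and scl_one: "x \<in> carrier A \<Longrightarrow> scl 1 x = x"
    and scl_mult_left: "x \<in> carrier A \<Longrightarrow> y \<in> carrier A \<Longrightarrow> scl c x \<otimes> y = scl c (x \<otimes> y)"
    and scl_mult_right: "x \<in> carrier A \<Longrightarrow> y \<in> carrier A \<Longrightarrow> x \<otimes> scl c y = scl c (x \<otimes> y)"
    and star_closed: "x \<in> carrier A \<Longrightarrow> star x \<in> carrier A"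
    and star_add: "x \<in> carrier A \<Longrightarrow> y \<in> carrier A \<Longrightarrow> star (x \<oplus> y) = star x \<oplus> star y"
    and star_scl: "x \<in> carrier A \<Longrightarrow> star (scl c x) = scl (cnj c) (star x)"
    and star_mult: "x \<in> carrier A \<Longrightarrow> y \<in> carrier A \<Longrightarrow> star (x \<otimes> y) = star y \<otimes> star x"
    and star_star: "x \<in> carrier A \<Longrightarrow> star (star x) = x"
    and state_add: "x \<in> carrier A \<Longrightarrow> y \<in> carrier A \<Longrightarrow> \<phi> (x \<oplus> y) = \<phi> x + \<phi> y"
    and state_scl: "x \<in> carrier A \<Longrightarrow> \<phi> (scl c x) = c * \<phi> x"
    and state_one: "\<phi> \<one> = 1"
    and state_pos: "x \<in> carrier A \<Longrightarrow> \<phi> (star x \<otimes> x) \<in> \<real>\<^sub>\<ge>\<^sub>0"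
begin

definition star_subalgebra :: "'a set \<Rightarrow> bool" where
  "star_subalgebra B \<longleftrightarrow>
     B \<subseteq> carrier A \<and> \<one> \<in> B \<and>
     (\<forall>x\<in>B. \<forall>y\<in>B. x \<oplus> y \<in> B \<and> x \<otimes> y \<in> B) \<and>
     (\<forall>c. \<forall>x\<in>B. scl c x \<in> B) \<and> (\<forall>x\<in>B. star x \<in> B)"

definition star_algebra_gen :: "'a set \<Rightarrow> 'a set" where
  "star_algebra_gen S = \<Inter>{B. star_subalgebra B \<and> S \<subseteq> B}"

definition unitary :: "'a \<Rightarrow> bool" where
  "unitary u \<longleftrightarrow> u \<in> carrier A \<and> star u \<otimes> u = \<one> \<and> u \<otimes> star u = \<one>"

text \<open>The sets \<open>B i\<close> are free if \<open>\<phi> (b\<^sub>1 \<cdots> b\<^sub>m) = 0\<close> whenever \<open>m \<ge> 1\<close>, \<open>b\<^sub>j \<in> B (i\<^sub>j)\<close>,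
  \<open>\<phi> b\<^sub>j = 0\<close> and neighbouring indices \<open>i\<^sub>j\<close> are distinct; the list \<open>w\<close> consists of
  the pairs \<open>(i\<^sub>j, b\<^sub>j)\<close>.\<close>

definition free_family :: "('i \<Rightarrow> 'a set) \<Rightarrow> bool" where
  "free_family B \<longleftrightarrow>
     (\<forall>w. w \<noteq> [] \<and> distinct_adj (map fst w) \<and> (\<forall>(i, b)\<in>set w. b \<in> B i \<and> \<phi> b = 0) \<longrightarrow>
        \<phi> (foldr (\<otimes>) (map snd w) \<one>) = 0)"

definition free_elements :: "'a \<Rightarrow> 'a \<Rightarrow> bool" where
  "free_elements u v \<longleftrightarrow>
     free_family (\<lambda>i. if i then star_algebra_gen {u} else star_algebra_gen {v})"

definition unitary_law :: "'a \<Rightarrow> complex measure \<Rightarrow> bool" where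
  "unitary_law u \<mu> \<longleftrightarrow> \<mu> \<in> circle_prob \<and>
     (\<forall>k::nat. (\<integral>\<zeta>. \<zeta> ^ k \<partial>\<mu>) = \<phi> (u [^] k) \<and> (\<integral>\<zeta>. cnj \<zeta> ^ k \<partial>\<mu>) = \<phi> (star u [^] k))"

end

text \<open>Types cannot be quantified existentially, so the underlying type of the
  \<open>*\<close>-probability space has to be fixed. Nothing is lost by this: the law of a product of two
  unitaries only depends on the \<open>*\<close>-algebra they generate, which has at most the cardinality of
  the continuum, so it can be transported to the following type.\<close>

type_synonym nc_carrier = "(bool \<times> int) list \<Rightarrow> complex"

definition free_conv :: "complex measure \<Rightarrow> complex measure \<Rightarrow> complex measure" where
  "free_conv \<mu> \<nu> =
     (THE \<rho>. \<exists>(A :: nc_carrier ring) scl star \<phi> u v.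
        star_prob_space A scl star \<phi> \<and>
        star_prob_space.unitary A star u \<and> star_prob_space.unitary A star v \<and>
        star_prob_space.free_elements A scl star \<phi> u v \<and>
        star_prob_space.unitary_law A star \<phi> u \<mu> \<and>
        star_prob_space.unitary_law A star \<phi> v \<nu> \<and>
        star_prob_space.unitary_law A star \<phi> (u \<otimes>\<^bsub>A\<^esub> v) \<rho>)"

text \<open>Only the germ at \<open>0\<close> of the inverse is determined.\<close>

definition psi_inverse :: "complex measure \<Rightarrow> complex \<Rightarrow> complex" where
  "psi_inverse \<nu> =
     (SOME g. g analytic_on {0} \<and> g 0 = 0 \<and>
        (\<forall>\<^sub>F w in nhds 0. psi \<nu> (g w) = w) \<and> (\<forall>\<^sub>F z in nhds 0. g (psi \<nu> z) = z))"

definition Sigma_transform :: "complex measure \<Rightarrow> complex \<Rightarrow> complex" where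
  "Sigma_transform \<nu> = remove_sings (\<lambda>z. 1 / z * psi_inverse \<nu> (z / (1 - z)))"


section \<open>The limit laws\<close>

definition nu_boolean :: "complex \<Rightarrow> complex measure \<Rightarrow> complex measure" where
  "nu_boolean \<gamma> \<sigma> =
     (THE \<nu>. \<nu> \<in> circle_prob \<and>
        (\<forall>z\<in>ball 0 1. B_transform \<nu> z =
           \<gamma> * exp (- (\<integral>\<zeta>. (1 + \<zeta> * z) / (1 - \<zeta> * z) \<partial>\<sigma>))))"

definition nu_free :: "complex \<Rightarrow> complex measure \<Rightarrow> complex measure" where
  "nu_free \<gamma> \<sigma> =
     (THE \<nu>. \<nu> \<in> circle_prob_times \<and>
        (\<forall>\<^sub>F z in nhds 0. Sigma_transform \<nu> z =
           cnj \<gamma> * exp (\<integral>\<zeta>. (1 + \<zeta> * z) / (1 - \<zeta> * z) \<partial>\<sigma>)))"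


section \<open>Arrays\<close>

text \<open>Rows are indexed by \<open>n \<ge> 1\<close>; row \<open>n\<close> has the entries \<open>\<mu> n 1, \<dots>, \<mu> n (k n)\<close>.\<close>

definition infinitesimal :: "(nat \<Rightarrow> nat) \<Rightarrow> (nat \<Rightarrow> nat \<Rightarrow> complex measure) \<Rightarrow> bool" where
  "infinitesimal k \<mu> \<longleftrightarrow>
     (\<forall>\<epsilon>>0. (\<lambda>n. MAX j\<in>{1..k n}. measure (\<mu> n j) {\<zeta> \<in> unit_circle. cmod (\<zeta> - 1) \<ge> \<epsilon>})
               \<longlonglongrightarrow> 0)"

definition center :: "real \<Rightarrow> complex measure \<Rightarrow> complex" where
  "center \<tau> \<mu> =
     exp (\<i> * complex_of_real (LINT \<zeta>:{\<zeta> \<in> unit_circle. \<bar>Arg \<zeta>\<bar> < \<tau>}|\<mu>. Arg \<zeta>))"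

text \<open>With \<open>b = center \<tau> \<mu>\<close>, the preimage of \<open>A\<close> under \<open>\<zeta> \<mapsto> \<zeta> / b\<close> is \<open>b A\<close>.\<close>

definition centered :: "real \<Rightarrow> complex measure \<Rightarrow> complex measure" where
  "centered \<tau> \<mu> = distr \<mu> circle_borel (\<lambda>\<zeta>. \<zeta> / center \<tau> \<mu>)"

definition sigma_row :: "real \<Rightarrow> (nat \<Rightarrow> nat) \<Rightarrow> (nat \<Rightarrow> nat \<Rightarrow> complex measure) \<Rightarrow>
    nat \<Rightarrow> complex measure" where
  "sigma_row \<tau> k \<mu> n = measure_of unit_circle (sets circle_borel)
     (\<lambda>A. \<Sum>j=1..k n. emeasure (density (centered \<tau> (\<mu> n j)) (\<lambda>\<zeta>. ennreal (1 - Re \<zeta>))) A)"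

definition gamma_row :: "real \<Rightarrow> (nat \<Rightarrow> nat) \<Rightarrow> (nat \<Rightarrow> nat \<Rightarrow> complex measure) \<Rightarrow>
    (nat \<Rightarrow> complex) \<Rightarrow> nat \<Rightarrow> complex" where
  "gamma_row \<tau> k \<mu> l n =
     exp (\<i> * complex_of_real (Arg (l n))
        + \<i> * complex_of_real (\<Sum>j=1..k n. Arg (center \<tau> (\<mu> n j)))
        + \<i> * complex_of_real (\<Sum>j=1..k n. \<integral>\<zeta>. Im \<zeta> \<partial>centered \<tau> (\<mu> n j)))"

end

theory Submission
  imports Defs "HOL-Library.Poly_Mapping"
begin

text \<open>Both convolutions become products of analytic functions. Write \<open>eta \<mu> z = z B\<^sub>\<mu> (z)\<close>. The boolean
  convolution multiplies the functions \<open>B\<close> on the disk, the free convolution multiplies the germs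
  \<open>\<Sigma>\<close> for which \<open>z \<Sigma> (z)\<close> is a local inverse of \<open>eta\<close>. For a measure \<open>m\<close> concentrated near \<open>1\<close>
  these two functions carry the same first order information. The exact identity
  \<open>levy m z = q (1 - B\<^sub>m (z))\<close>, where \<open>q\<close> is close to \<open>1\<close> and
  \<open>levy m z = \<integral> (1 - Re \<zeta>) (1 + \<zeta> z) / (1 - \<zeta> z) dm - i \<integral> Im \<zeta> dm\<close>, gives \<open>B\<^sub>m \<approx> exp (- levy m)\<close>, and
  since then \<open>eta m z \<approx> z\<close>, inverting \<open>eta m\<close> gives \<open>\<Sigma>\<^sub>m \<approx> exp (levy m)\<close>. For the errors of a whole row to
  be negligible, each of them has to be small compared to the defect \<open>\<integral> (1 - Re \<zeta>) dm\<close>; this is what the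
  centering achieves, because it makes the drift \<open>\<integral> Im \<zeta> dm\<close> at most a multiple of the defect.

  Multiplying over a row, the \<open>B\<close> of the boolean convolution and the \<open>1 / \<Sigma>\<close> of the free convolution
  both have the form \<open>\<gamma>\<^sub>n exp (- H\<^sub>n (z) + e\<^sub>n (z))\<close> on a fixed disk, with the Herglotz transform \<open>H\<^sub>n\<close>
  of \<open>\<sigma>\<^sub>n\<close> and \<open>|e\<^sub>n| \<le> \<epsilon>\<^sub>n \<sigma>\<^sub>n (\<T>)\<close>, \<open>\<epsilon>\<^sub>n \<rightarrow> 0\<close>. Such functions converge to
  \<open>\<gamma> exp (- H)\<close> near \<open>0\<close> if and only if \<open>\<sigma>\<^sub>n \<rightarrow> \<sigma>\<close> and \<open>\<gamma>\<^sub>n \<rightarrow> \<gamma>\<close>: the absolute value at \<open>0\<close>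
  bounds the masses, so the errors vanish, and near \<open>0\<close> the exponential can be inverted. That is the
  content of the locale \<open>exponential_rows\<close>, and it makes the third statement of the theorem equivalent to
  the convergence of either function.

  It remains to compare this with weak convergence. For the boolean rows, weak convergence is pointwise
  convergence of \<open>B\<close>. For the free rows the germs \<open>\<Sigma>\<close> may a priori live on shrinking disks; bounded masses
  yield a common disk (\<open>common_disk\<close>), and upper and lower Lipschitz bounds for \<open>eta\<close> which are uniform in
  the measure transfer convergence between the functions \<open>z \<Sigma> (z)\<close> and their inverses.

  Two facts from analysis and free probability make the transforms available. Herglotz' theorem shows
  that every analytic map of the disk into its closure is some \<open>B\<close>, so boolean convolutions and boolean
  limit laws exist. For the free convolution, \<open>free_pair_exists\<close> constructs free unitaries with given laws
  on a free product space, \<open>unitary_law_exists\<close> gives the law of their product, and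
  \<open>free_product_resolvent\<close> shows that its germ is the product of the germs, whence it depends only on
  the two laws. The free limit law is a fixed point of an iteration through boolean-type transforms
  (\<open>eta_fixed_point_exists\<close>).\<close>

section \<open>Finite measures on the unit circle\<close>

definition circle_finite :: "complex measure \<Rightarrow> bool" where
  "circle_finite \<mu> \<longleftrightarrow> finite_measure \<mu> \<and> sets \<mu> = sets circle_borel"

lemma space_circle_borel: "space circle_borel = unit_circle"
  by (simp add: circle_borel_def space_restrict_space)

lemma circle_finite_space: "circle_finite \<mu> \<Longrightarrow> space \<mu> = unit_circle"
  by (metis circle_finite_def sets_eq_imp_space_eq space_circle_borel)

lemma circle_prob_finite: "\<mu> \<in> circle_prob \<Longrightarrow> circle_finite \<mu>"
  by (auto simp: circle_prob_def circle_finite_def prob_space_def)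

lemma circle_prob_measure_space: "\<mu> \<in> circle_prob \<Longrightarrow> measure \<mu> (space \<mu>) = 1"
  by (simp add: circle_prob_def prob_space.prob_space)

lemma circle_finite_measurable:
  fixes f :: "complex \<Rightarrow> 'b::{banach, second_countable_topology}"
  assumes "circle_finite \<mu>" "continuous_on unit_circle f"
  shows "f \<in> borel_measurable \<mu>"
proof -
  have "f \<in> borel_measurable circle_borel"
    unfolding circle_borel_def by (rule borel_measurable_continuous_on_restrict[OF assms(2)])
  then show ?thesis
    using assms(1) by (simp add: circle_finite_def cong: measurable_cong_sets)
qed

lemma circle_bounded:
  fixes f :: "complex \<Rightarrow> 'b::real_normed_vector"
  assumes "continuous_on unit_circle f"
  obtains B where "B > 0" "\<And>\<zeta>. \<zeta> \<in> unit_circle \<Longrightarrow> norm (f \<zeta>) \<le> B"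
proof -
  have "compact (f ` unit_circle)"
    by (intro compact_continuous_image assms) auto
  then show ?thesis
    by (metis bounded_pos compact_imp_bounded imageI that)
qed

lemma circle_integrable:
  fixes f :: "complex \<Rightarrow> 'b::{banach, second_countable_topology}"
  assumes "circle_finite \<mu>" "continuous_on unit_circle f"
  shows "integrable \<mu> f"
proof -
  obtain B where "\<And>\<zeta>. \<zeta> \<in> unit_circle \<Longrightarrow> norm (f \<zeta>) \<le> B"
    using circle_bounded[OF assms(2)] by metis
  then show ?thesis
    using assms circle_finite_measurable[OF assms] circle_finite_space[OF assms(1)]
    by (intro finite_measure.integrable_const_bound[where B = B] AE_I2)
       (auto simp: circle_finite_def)
qed

lemma circle_integral_norm_le:
  fixes f :: "complex \<Rightarrow> 'b::{banach, second_countable_topology}"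
  assumes "circle_finite \<mu>" "continuous_on unit_circle f" "continuous_on unit_circle g"
    and "\<And>\<zeta>. \<zeta> \<in> unit_circle \<Longrightarrow> norm (f \<zeta>) \<le> g \<zeta>"
  shows "norm (\<integral>\<zeta>. f \<zeta> \<partial>\<mu>) \<le> (\<integral>\<zeta>. g \<zeta> \<partial>\<mu>)"
proof -
  have "norm (\<integral>\<zeta>. f \<zeta> \<partial>\<mu>) \<le> (\<integral>\<zeta>. norm (f \<zeta>) \<partial>\<mu>)"
    by (rule integral_norm_bound)
  also have "\<dots> \<le> (\<integral>\<zeta>. g \<zeta> \<partial>\<mu>)"
    using assms circle_finite_space[OF assms(1)]
    by (intro integral_mono circle_integrable integrable_norm) auto
  finally show ?thesis .
qed

lemma circle_integral_bound:
  fixes f :: "complex \<Rightarrow> 'b::{banach, second_countable_topology}"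
  assumes "circle_finite \<mu>" "continuous_on unit_circle f"
    and "\<And>\<zeta>. \<zeta> \<in> unit_circle \<Longrightarrow> norm (f \<zeta>) \<le> C"
  shows "norm (\<integral>\<zeta>. f \<zeta> \<partial>\<mu>) \<le> C * measure \<mu> unit_circle"
  using circle_integral_norm_le[OF assms(1,2), of "\<lambda>_. C"] assms circle_finite_space[OF assms(1)]
  by (simp add: mult.commute)

lemma circle_integral_cong:
  assumes "circle_finite \<mu>" "\<And>\<zeta>. \<zeta> \<in> unit_circle \<Longrightarrow> f \<zeta> = g \<zeta>"
  shows "(\<integral>\<zeta>. f \<zeta> \<partial>\<mu>) = (\<integral>\<zeta>. g \<zeta> \<partial>\<mu>)"
  using assms by (intro Bochner_Integration.integral_cong) (auto simp: circle_finite_space)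

lemma circle_weak_convD:
  fixes f :: "complex \<Rightarrow> complex"
  assumes "circle_weak_conv M L" "\<And>n. circle_finite (M n)" "circle_finite L"
    and f: "continuous_on unit_circle f"
  shows "(\<lambda>n. \<integral>\<zeta>. f \<zeta> \<partial>M n) \<longlonglongrightarrow> (\<integral>\<zeta>. f \<zeta> \<partial>L)"
proof -
  have c: "continuous_on unit_circle (\<lambda>\<zeta>. Re (f \<zeta>))" "continuous_on unit_circle (\<lambda>\<zeta>. Im (f \<zeta>))"
    using f by (auto intro!: continuous_intros)
  have "(\<lambda>n. Complex (\<integral>\<zeta>. Re (f \<zeta>) \<partial>M n) (\<integral>\<zeta>. Im (f \<zeta>) \<partial>M n))
      \<longlonglongrightarrow> Complex (\<integral>\<zeta>. Re (f \<zeta>) \<partial>L) (\<integral>\<zeta>. Im (f \<zeta>) \<partial>L)"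
    using assms(1) c unfolding circle_weak_conv_def by (intro tendsto_Complex) auto
  moreover have "Complex (\<integral>\<zeta>. Re (f \<zeta>) \<partial>N) (\<integral>\<zeta>. Im (f \<zeta>) \<partial>N) = (\<integral>\<zeta>. f \<zeta> \<partial>N)"
    if "circle_finite N" for N
    using circle_integrable[OF that f] by (simp add: complex_eq_iff)
  ultimately show ?thesis using assms by simp
qed

subsection \<open>Moments\<close>

lemma Re_poly_mult_cnj:
  "\<exists>r. \<forall>\<zeta>\<in>unit_circle. Re (poly p \<zeta> * cnj (poly q \<zeta>)) = Re (poly r \<zeta>)"
proof (induction p arbitrary: q)
  case 0
  then show ?case by (intro exI[of _ 0]) auto
next
  case (pCons a p)
  obtain b q' where q: "q = pCons b q'" by (cases q)
  obtain r where r: "\<forall>\<zeta>\<in>unit_circle. Re (poly p \<zeta> * cnj (poly q' \<zeta>)) = Re (poly r \<zeta>)"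
    using pCons.IH by blast
  show ?case
  proof (intro exI ballI)
    fix \<zeta> :: complex assume \<zeta>: "\<zeta> \<in> unit_circle"
    then have u: "\<zeta> * cnj \<zeta> = 1" by (simp add: complex_norm_square[symmetric])
    have "poly (pCons a p) \<zeta> * cnj (poly q \<zeta>) =
       a * cnj b + cnj (cnj a * (\<zeta> * poly q' \<zeta>)) + cnj b * (\<zeta> * poly p \<zeta>)
       + (\<zeta> * cnj \<zeta>) * (poly p \<zeta> * cnj (poly q' \<zeta>))"
      by (simp add: q algebra_simps)
    then have "Re (poly (pCons a p) \<zeta> * cnj (poly q \<zeta>)) =
       Re (a * cnj b) + Re (cnj a * (\<zeta> * poly q' \<zeta>)) + Re (cnj b * (\<zeta> * poly p \<zeta>))
       + Re (poly p \<zeta> * cnj (poly q' \<zeta>))"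
      by (simp only: u plus_complex.simps cnj.simps mult_1)
    also have "Re (poly p \<zeta> * cnj (poly q' \<zeta>)) = Re (poly r \<zeta>)" using r \<zeta> by blast
    also have "Re (a * cnj b) + Re (cnj a * (\<zeta> * poly q' \<zeta>)) + Re (cnj b * (\<zeta> * poly p \<zeta>)) + Re (poly r \<zeta>)
        = Re (a * cnj b + cnj a * (\<zeta> * poly q' \<zeta>) + cnj b * (\<zeta> * poly p \<zeta>) + poly r \<zeta>)"
      by (simp only: plus_complex.simps)
    also have "a * cnj b + cnj a * (\<zeta> * poly q' \<zeta>) + cnj b * (\<zeta> * poly p \<zeta>) + poly r \<zeta> =
        poly ([:a * cnj b:] + pCons 0 (smult (cnj a) q' + smult (cnj b) p) + r) \<zeta>"
      by (simp add: algebra_simps)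
    finally show "Re (poly (pCons a p) \<zeta> * cnj (poly q \<zeta>)) =
      Re (poly ([:a * cnj b:] + pCons 0 (smult (cnj a) q' + smult (cnj b) p) + r) \<zeta>)" .
  qed
qed

text \<open>By the Stone--Weierstrass theorem, the real parts of the polynomials in \<open>\<zeta>\<close> are dense among the
  real continuous functions on the circle, because they form an algebra: on the circle,
  \<open>2 Re p Re q = Re (p q) + Re (p \<cdot> cnj q)\<close> and negative powers of \<open>\<zeta>\<close> are conjugates of positive ones.
  Hence the moments of nonnegative order determine everything.\<close>

lemma Re_poly_dense:
  assumes "continuous_on unit_circle (f :: complex \<Rightarrow> real)" "e > 0"
  obtains p :: "complex poly" where "\<And>\<zeta>. \<zeta> \<in> unit_circle \<Longrightarrow> \<bar>f \<zeta> - Re (poly p \<zeta>)\<bar> < e"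
proof -
  have *: "\<exists>p. \<forall>\<zeta>\<in>unit_circle. g \<zeta> = Re (poly p \<zeta>)" if "real_polynomial_function g" for g
    using that
  proof induction
    case (linear g)
    have "g \<zeta> = Re (poly [:0, Complex (g 1) (- g \<i>):] \<zeta>)" for \<zeta>
    proof -
      interpret bounded_linear g by fact
      have "g (Re \<zeta> *\<^sub>R 1 + Im \<zeta> *\<^sub>R \<i>) = Re \<zeta> * g 1 + Im \<zeta> * g \<i>"
        by (simp only: add scaleR real_scaleR_def)
      moreover have "Re \<zeta> *\<^sub>R 1 + Im \<zeta> *\<^sub>R \<i> = \<zeta>" by (simp add: complex_eq_iff)
      ultimately have "g \<zeta> = Re \<zeta> * g 1 + Im \<zeta> * g \<i>" by simp
      then show ?thesis by simp
    qed
    then show ?case by blast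
  next
    case (const c)
    then show ?case by (intro exI[of _ "[:of_real c:]"]) auto
  next
    case (add f g)
    then obtain p q where "\<forall>\<zeta>\<in>unit_circle. f \<zeta> = Re (poly p \<zeta>)" "\<forall>\<zeta>\<in>unit_circle. g \<zeta> = Re (poly q \<zeta>)"
      by blast
    then show ?case by (intro exI[of _ "p + q"]) auto
  next
    case (mult f g)
    then obtain p q where pq: "\<forall>\<zeta>\<in>unit_circle. f \<zeta> = Re (poly p \<zeta>)" "\<forall>\<zeta>\<in>unit_circle. g \<zeta> = Re (poly q \<zeta>)"
      by blast
    obtain r where r: "\<forall>\<zeta>\<in>unit_circle. Re (poly p \<zeta> * cnj (poly q \<zeta>)) = Re (poly r \<zeta>)"
      using Re_poly_mult_cnj by blast
    have "f \<zeta> * g \<zeta> = Re (poly (smult (1/2) (p * q + r)) \<zeta>)" if \<zeta>: "\<zeta> \<in> unit_circle" for \<zeta>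
    proof -
      have "Re (poly (smult (1/2) (p * q + r)) \<zeta>) = (Re (poly p \<zeta> * poly q \<zeta>) + Re (poly r \<zeta>)) / 2"
        by simp
      also have "Re (poly r \<zeta>) = Re (poly p \<zeta> * cnj (poly q \<zeta>))" using r \<zeta> by simp
      also have "(Re (poly p \<zeta> * poly q \<zeta>) + Re (poly p \<zeta> * cnj (poly q \<zeta>))) / 2
          = Re (poly p \<zeta>) * Re (poly q \<zeta>)" by simp
      finally show ?thesis using pq \<zeta> by simp
    qed
    then show ?case by blast
  qed
  obtain g where g: "real_polynomial_function g" "\<And>\<zeta>. \<zeta> \<in> unit_circle \<Longrightarrow> \<bar>f \<zeta> - g \<zeta>\<bar> < e"
    using Stone_Weierstrass_real_polynomial_function[OF compact_sphere assms] by metis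
  show ?thesis using that g *[OF g(1)] by force
qed

lemma integral_Re_poly:
  assumes "circle_finite \<mu>"
  shows "(\<integral>\<zeta>. Re (poly p \<zeta>) \<partial>\<mu>) = Re (\<Sum>i\<le>degree p. coeff p i * (\<integral>\<zeta>. \<zeta> ^ i \<partial>\<mu>))"
proof -
  have i: "integrable \<mu> (\<lambda>\<zeta>. coeff p i * \<zeta> ^ i)" for i
    by (intro circle_integrable assms continuous_intros)
  have "(\<integral>\<zeta>. Re (poly p \<zeta>) \<partial>\<mu>) = Re (\<integral>\<zeta>. poly p \<zeta> \<partial>\<mu>)"
    using circle_integrable[OF assms, of "poly p"] by (simp add: continuous_intros)
  also have "(\<integral>\<zeta>. poly p \<zeta> \<partial>\<mu>) = (\<Sum>i\<le>degree p. (\<integral>\<zeta>. coeff p i * \<zeta> ^ i \<partial>\<mu>))"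
    unfolding poly_altdef using i by (intro Bochner_Integration.integral_sum) auto
  finally show ?thesis by simp
qed

text \<open>Convergence of the moment of order \<open>0\<close> bounds the masses, so the uniform approximation by
  polynomials passes to the integrals.\<close>

lemma weak_conv_of_moments:
  assumes M: "\<And>n. circle_finite (M n)" and L: "circle_finite L"
    and mom: "\<And>k. (\<lambda>n. \<integral>\<zeta>. \<zeta> ^ k \<partial>M n) \<longlonglongrightarrow> (\<integral>\<zeta>. \<zeta> ^ k \<partial>L)"
  shows "circle_weak_conv M L"
  unfolding circle_weak_conv_def
proof (intro allI impI)
  fix f :: "complex \<Rightarrow> real" assume f: "continuous_on unit_circle f"
  have mass: "(\<integral>\<zeta>. \<zeta> ^ 0 \<partial>N) = complex_of_real (measure N unit_circle)" if "circle_finite N" for N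
    using that by (simp add: circle_finite_space scaleR_conv_of_real)
  have m: "(\<lambda>n. measure (M n) unit_circle) \<longlonglongrightarrow> measure L unit_circle"
    using mom[of 0] M L by (simp only: mass) (simp only: tendsto_of_real_iff)
  obtain C where C: "C > 0" "\<And>n. measure (M n) unit_circle \<le> C"
    using convergent_imp_Bseq[OF convergentI[OF m]] unfolding Bseq_def by auto
  have CL: "measure L unit_circle \<le> C"
    using LIMSEQ_le_const2[OF m] C(2) by blast
  show "(\<lambda>n. \<integral>\<zeta>. f \<zeta> \<partial>M n) \<longlonglongrightarrow> (\<integral>\<zeta>. f \<zeta> \<partial>L)"
  proof (rule LIMSEQ_I)
    fix e :: real assume e: "e > 0"
    obtain p :: "complex poly" where p: "\<And>\<zeta>. \<zeta> \<in> unit_circle \<Longrightarrow> \<bar>f \<zeta> - Re (poly p \<zeta>)\<bar> < e / (4 * C)"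
      using Re_poly_dense[OF f, of "e / (4 * C)"] e C by auto
    have d: "\<bar>(\<integral>\<zeta>. f \<zeta> \<partial>N) - (\<integral>\<zeta>. Re (poly p \<zeta>) \<partial>N)\<bar> \<le> e / 4"
      if N: "circle_finite N" "measure N unit_circle \<le> C" for N
    proof -
      have c: "continuous_on unit_circle (\<lambda>\<zeta>. Re (poly p \<zeta>))" by (intro continuous_intros)
      have "\<bar>(\<integral>\<zeta>. f \<zeta> \<partial>N) - (\<integral>\<zeta>. Re (poly p \<zeta>) \<partial>N)\<bar> = norm (\<integral>\<zeta>. f \<zeta> - Re (poly p \<zeta>) \<partial>N)"
        by (subst Bochner_Integration.integral_diff) (auto intro!: circle_integrable N f c)
      also have "\<dots> \<le> e / (4 * C) * measure N unit_circle"
        using p by (intro circle_integral_bound N continuous_intros f) (auto intro: less_imp_le)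
      also have "\<dots> \<le> e / (4 * C) * C"
        using e C N by (intro mult_left_mono) auto
      finally show ?thesis using C by simp
    qed
    have "(\<lambda>n. \<integral>\<zeta>. Re (poly p \<zeta>) \<partial>M n) \<longlonglongrightarrow> (\<integral>\<zeta>. Re (poly p \<zeta>) \<partial>L)"
      using M L by (simp only: integral_Re_poly) (intro tendsto_intros mom)
    then obtain n0 where n0: "\<And>n. n \<ge> n0 \<Longrightarrow> \<bar>(\<integral>\<zeta>. Re (poly p \<zeta>) \<partial>M n) - (\<integral>\<zeta>. Re (poly p \<zeta>) \<partial>L)\<bar> < e / 4"
      using e unfolding LIMSEQ_iff real_norm_def by (meson divide_pos_pos zero_less_numeral)
    show "\<exists>no. \<forall>n\<ge>no. norm ((\<integral>\<zeta>. f \<zeta> \<partial>M n) - (\<integral>\<zeta>. f \<zeta> \<partial>L)) < e"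
    proof (intro exI[of _ n0] allI impI)
      fix n assume "n \<ge> n0"
      from n0[OF this] d[OF M C(2), of n] d[OF L CL] e
      show "norm ((\<integral>\<zeta>. f \<zeta> \<partial>M n) - (\<integral>\<zeta>. f \<zeta> \<partial>L)) < e"
        unfolding real_norm_def abs_less_iff abs_le_iff by linarith
    qed
  qed
qed

text \<open>The indicator of a closed set is a decreasing limit of continuous functions of the distance to it,
  and the closed sets generate the Borel sets.\<close>

lemma circle_measure_eqI_continuous:
  assumes \<mu>: "circle_finite \<mu>" and \<nu>: "circle_finite \<nu>"
    and eq: "\<And>f :: complex \<Rightarrow> real. continuous_on unit_circle f \<Longrightarrow> (\<integral>\<zeta>. f \<zeta> \<partial>\<mu>) = (\<integral>\<zeta>. f \<zeta> \<partial>\<nu>)"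
  shows "\<mu> = \<nu>"
proof -
  have id: "(\<lambda>\<zeta>. \<zeta>) \<in> borel_measurable N" if "circle_finite N" for N
    by (rule circle_finite_measurable[OF that]) (rule continuous_on_id)
  have cl: "measure \<mu> (K \<inter> unit_circle) = measure \<nu> (K \<inter> unit_circle)" if K: "closed K" "K \<noteq> {}" for K
  proof -
    define f where "f j \<zeta> = max 0 (1 - real j * infdist \<zeta> K)" for j \<zeta>
    have cf: "continuous_on unit_circle (f j)" for j
      unfolding f_def by (intro continuous_intros)
    have lim: "(\<lambda>j. f j \<zeta>) \<longlonglongrightarrow> indicator K \<zeta>" for \<zeta>
    proof (cases "\<zeta> \<in> K")
      case True
      then show ?thesis by (simp add: f_def)
    next
      case False
      then have d: "infdist \<zeta> K > 0"
        using K by (meson infdist_pos_not_in_closed)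
      have "\<forall>\<^sub>F j in sequentially. f j \<zeta> = 0"
      proof -
        obtain j0 :: nat where "1 / infdist \<zeta> K < j0" using reals_Archimedean2 by blast
        then have "real j * infdist \<zeta> K \<ge> 1" if "j \<ge> j0" for j
        proof -
          have "1 \<le> real j0 * infdist \<zeta> K" using \<open>1 / infdist \<zeta> K < j0\<close> d by (simp add: field_simps)
          also have "\<dots> \<le> real j * infdist \<zeta> K" using that d by (intro mult_right_mono) auto
          finally show ?thesis .
        qed
        then show ?thesis unfolding f_def eventually_sequentially by (intro exI[of _ j0]) auto
      qed
      then show ?thesis using False by (simp add: tendsto_eventually)
    qed
    have "(\<lambda>j. \<integral>\<zeta>. f j \<zeta> \<partial>N) \<longlonglongrightarrow> measure N (K \<inter> unit_circle)" if N: "circle_finite N" for N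
    proof -
      have KN: "K \<inter> unit_circle \<in> sets N"
        using N K by (auto simp: circle_finite_def circle_borel_def sets_restrict_space)
      have "(\<lambda>j. \<integral>\<zeta>. f j \<zeta> \<partial>N) \<longlonglongrightarrow> (\<integral>\<zeta>. indicator (K \<inter> unit_circle) \<zeta> \<partial>N)"
      proof (rule integral_dominated_convergence[where w = "\<lambda>_. 1"])
        show "AE \<zeta> in N. (\<lambda>j. f j \<zeta>) \<longlonglongrightarrow> indicator (K \<inter> unit_circle) \<zeta>"
        proof (rule AE_I2)
          fix \<zeta> assume "\<zeta> \<in> space N"
          then have "indicator (K \<inter> unit_circle) \<zeta> = (indicator K \<zeta> :: real)"
            using circle_finite_space[OF N] by (simp add: indicator_def)
          then show "(\<lambda>j. f j \<zeta>) \<longlonglongrightarrow> indicator (K \<inter> unit_circle) \<zeta>" using lim by simp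
        qed
        show "integrable N (\<lambda>_. 1::real)" using circle_integrable[OF N, of "\<lambda>_. 1::real"] by auto
        show "AE \<zeta> in N. norm (f j \<zeta>) \<le> 1" for j
          by (auto simp: f_def infdist_nonneg)
        show "f j \<in> borel_measurable N" for j by (rule circle_finite_measurable[OF N cf])
      qed (use KN in auto)
      then show ?thesis using KN sets.sets_into_space[OF KN] by (simp add: Int_absorb2)
    qed
    from this[OF \<mu>] this[OF \<nu>] show ?thesis
      using eq[OF cf] by (simp add: LIMSEQ_unique)
  qed
  have sp: "space \<mu> = unit_circle" "space \<nu> = unit_circle" using \<mu> \<nu> by (auto simp: circle_finite_space)
  interpret \<mu>: finite_measure \<mu> using \<mu> by (simp add: circle_finite_def)
  interpret \<nu>: finite_measure \<nu> using \<nu> by (simp add: circle_finite_def)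
  have D: "distr \<mu> borel (\<lambda>x. x) = distr \<nu> borel (\<lambda>x. x)"
  proof (rule measure_eqI_generator_eq[where E = "Collect closed" and \<Omega> = UNIV and A = "\<lambda>_. UNIV"])
    show "emeasure (distr \<mu> borel (\<lambda>x. x)) X = emeasure (distr \<nu> borel (\<lambda>x. x)) X" if "X \<in> Collect closed" for X
      using that cl[of X] id[OF \<mu>] id[OF \<nu>]
      by (cases "X = {}") (auto simp: emeasure_distr sp \<mu>.emeasure_eq_measure \<nu>.emeasure_eq_measure)
    show "emeasure (distr \<mu> borel (\<lambda>x. x)) UNIV \<noteq> \<infinity>" for i :: nat
      using id[OF \<mu>] by (simp add: emeasure_distr)
  qed (auto simp: Int_stable_def borel_eq_closed)
  show ?thesis
  proof (rule measure_eqI)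
    show "sets \<mu> = sets \<nu>" using \<mu> \<nu> by (simp add: circle_finite_def)
    fix A assume A: "A \<in> sets \<mu>"
    then have "A \<in> sets borel" "A \<subseteq> unit_circle"
      using \<mu> sets.sets_into_space[OF A] sp
      by (auto simp: circle_finite_def circle_borel_def sets_restrict_space)
    then have "emeasure N A = emeasure (distr N borel (\<lambda>x. x)) A" if "circle_finite N" for N
      using id[OF that] that by (simp add: emeasure_distr circle_finite_space Int_absorb2)
    then show "emeasure \<mu> A = emeasure \<nu> A" using D \<mu> \<nu> by metis
  qed
qed

lemma circle_measure_eqI_moments:
  assumes \<mu>: "circle_finite \<mu>" and \<nu>: "circle_finite \<nu>"
    and eq: "\<And>k. (\<integral>\<zeta>. \<zeta> ^ k \<partial>\<mu>) = (\<integral>\<zeta>. \<zeta> ^ k \<partial>\<nu>)"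
  shows "\<mu> = \<nu>"
proof (rule circle_measure_eqI_continuous[OF \<mu> \<nu>])
  fix f :: "complex \<Rightarrow> real" assume "continuous_on unit_circle f"
  then show "(\<integral>\<zeta>. f \<zeta> \<partial>\<mu>) = (\<integral>\<zeta>. f \<zeta> \<partial>\<nu>)"
    using weak_conv_of_moments[OF \<mu> \<nu>] eq by (auto simp: circle_weak_conv_def LIMSEQ_const_iff)
qed

subsection \<open>Compactness\<close>

lemma circle_prob_distr:
  assumes "prob_space M" "f \<in> measurable M circle_borel"
  shows "distr M circle_borel f \<in> circle_prob"
  using assms by (simp add: circle_prob_def prob_space.prob_space_distr)

lemma measurable_circle_borelI:
  assumes "f \<in> borel_measurable M" "\<And>x. x \<in> space M \<Longrightarrow> f x \<in> unit_circle"
  shows "f \<in> measurable M circle_borel"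
  unfolding circle_borel_def using assms by (intro measurable_restrict_space2) auto

lemma circle_test_measurable:
  fixes f :: "complex \<Rightarrow> 'b::{banach, second_countable_topology}"
  shows "continuous_on unit_circle f \<Longrightarrow> f \<in> borel_measurable circle_borel"
  unfolding circle_borel_def by (rule borel_measurable_continuous_on_restrict)

lemma Arg_measurable: "Arg \<in> borel_measurable borel"
proof -
  have "Arg = (\<lambda>z. if z = 0 then 0 else Im (Ln z))"
    by (rule ext) (metis Arg_eq_Im_Ln Arg_zero)
  moreover have "(\<lambda>z. if z = 0 then 0 else Im (Ln z)) \<in> borel_measurable borel"
    by measurable
  ultimately show ?thesis by simp
qed

lemma circle_finite_borel_measurable:
  assumes "circle_finite \<mu>" "f \<in> borel_measurable borel"
  shows "f \<in> borel_measurable \<mu>"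
proof -
  have "f \<in> borel_measurable circle_borel"
    unfolding circle_borel_def by (rule measurable_restrict_space1[OF assms(2)])
  then show ?thesis
    using assms(1) by (simp add: circle_finite_def cong: measurable_cong_sets)
qed

text \<open>Helly's selection theorem, transported to the circle through the argument.\<close>

lemma circle_prob_compact:
  assumes M: "\<And>n. M n \<in> circle_prob"
  obtains r :: "nat \<Rightarrow> nat" and L where "strict_mono r" "L \<in> circle_prob" "circle_weak_conv (M \<circ> r) L"
proof -
  have Arg: "Arg \<in> borel_measurable (M n)" for n
    by (rule circle_finite_borel_measurable[OF circle_prob_finite[OF M] Arg_measurable])
  define D where "D n = distr (M n) borel Arg" for n
  have rd: "real_distribution (D n)" for n
  proof -
    have "prob_space (M n)" using M[of n] by (simp only: circle_prob_def mem_Collect_eq)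
    from prob_space.real_distribution_distr[OF this Arg] show ?thesis unfolding D_def .
  qed
  have "tight D"
    unfolding tight_def
  proof (intro conjI allI impI rd)
    fix \<epsilon> :: real assume \<epsilon>: "\<epsilon> > 0"
    have "measure (D n) {-4<..4} = 1" for n
    proof -
      have "Arg \<zeta> \<in> {-4<..4}" for \<zeta>
        using Arg_bounded[of \<zeta>] pi_less_4 by auto
      then have "Arg -` {-4<..4} \<inter> space (M n) = space (M n)" by auto
      then show ?thesis
        unfolding D_def using Arg[of n] by (simp add: measure_distr circle_prob_measure_space[OF M])
    qed
    then show "\<exists>a b. a < b \<and> (\<forall>n. 1 - \<epsilon> < measure (D n) {a<..b})"
      using \<epsilon> by (intro exI[of _ "-4"] exI[of _ 4]) auto
  qed
  from tight_imp_convergent_subsubsequence[OF this strict_mono_id]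
  obtain r N where r: "strict_mono r" "real_distribution N" "weak_conv_m (D \<circ> r) N"
    by (auto simp: o_def id_def)
  interpret N: real_distribution N by fact
  have cis: "cis \<in> measurable N circle_borel"
  proof (rule measurable_circle_borelI)
    have "cis \<in> borel_measurable borel"
      by (intro borel_measurable_continuous_onI continuous_intros)
    then show "cis \<in> borel_measurable N" by simp
  qed simp
  define L where "L = distr N circle_borel cis"
  have "L \<in> circle_prob"
    unfolding L_def by (intro circle_prob_distr cis) unfold_locales
  moreover have "circle_weak_conv (M \<circ> r) L"
    unfolding circle_weak_conv_def
  proof (intro allI impI)
    fix f :: "complex \<Rightarrow> real" assume f: "continuous_on unit_circle f"
    obtain B where B: "\<And>\<zeta>. \<zeta> \<in> unit_circle \<Longrightarrow> norm (f \<zeta>) \<le> B"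
      using circle_bounded[OF f] by metis
    have fc: "continuous_on UNIV (\<lambda>x. f (cis x))"
      by (rule continuous_on_compose2[OF f continuous_on_cis[OF continuous_on_id]]) auto
    have fm: "(\<lambda>x. f (cis x)) \<in> borel_measurable borel"
      by (rule borel_measurable_continuous_onI[OF fc])
    have "(\<lambda>n. integral\<^sup>L ((D \<circ> r) n) (\<lambda>x. f (cis x))) \<longlonglongrightarrow> integral\<^sup>L N (\<lambda>x. f (cis x))"
    proof (rule weak_conv_imp_integral_bdd_continuous_conv[where B = B])
      show "isCont (\<lambda>x. f (cis x)) x" for x
        using fc by (simp add: continuous_on_eq_continuous_at)
      show "norm (f (cis x)) \<le> B" for x by (rule B) simp
    qed (use rd in simp, rule r(2), rule r(3))
    moreover have "integral\<^sup>L N (\<lambda>x. f (cis x)) = (\<integral>\<zeta>. f \<zeta> \<partial>L)"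
      unfolding L_def by (rule integral_distr[symmetric, OF cis circle_test_measurable[OF f]])
    moreover have "integral\<^sup>L ((D \<circ> r) n) (\<lambda>x. f (cis x)) = (\<integral>\<zeta>. f \<zeta> \<partial>(M \<circ> r) n)" for n
    proof -
      have "integral\<^sup>L (D (r n)) (\<lambda>x. f (cis x)) = (\<integral>\<zeta>. f (cis (Arg \<zeta>)) \<partial>M (r n))"
        unfolding D_def by (rule integral_distr[OF Arg fm])
      also have "\<dots> = (\<integral>\<zeta>. f \<zeta> \<partial>M (r n))"
      proof (intro circle_integral_cong circle_prob_finite M)
        fix \<zeta> :: complex assume "\<zeta> \<in> unit_circle"
        then have "\<zeta> \<noteq> 0" "sgn \<zeta> = \<zeta>" by (auto simp: sgn_eq)
        then show "f (cis (Arg \<zeta>)) = f \<zeta>" by (simp add: cis_Arg)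
      qed
      finally show ?thesis by simp
    qed
    ultimately show "(\<lambda>n. \<integral>\<zeta>. f \<zeta> \<partial>(M \<circ> r) n) \<longlonglongrightarrow> (\<integral>\<zeta>. f \<zeta> \<partial>L)" by simp
  qed
  ultimately show ?thesis using that r(1) by blast
qed

lemma circle_prob_of_moment_limits:
  assumes M: "\<And>n. M n \<in> circle_prob"
    and lim: "\<And>k. (\<lambda>n. \<integral>\<zeta>. \<zeta> ^ k \<partial>M n) \<longlonglongrightarrow> m k"
  obtains L where "L \<in> circle_prob" "\<And>k. (\<integral>\<zeta>. \<zeta> ^ k \<partial>L) = m k"
proof -
  obtain r :: "nat \<Rightarrow> nat" and L where r: "strict_mono r" "L \<in> circle_prob" "circle_weak_conv (M \<circ> r) L"
    using circle_prob_compact[of M, OF M] .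
  have "(\<integral>\<zeta>. \<zeta> ^ k \<partial>L) = m k" for k
  proof -
    have "(\<lambda>n. \<integral>\<zeta>. \<zeta> ^ k \<partial>(M \<circ> r) n) \<longlonglongrightarrow> (\<integral>\<zeta>. \<zeta> ^ k \<partial>L)"
      by (rule circle_weak_convD[OF r(3)])
         (use M r in \<open>auto intro!: circle_prob_finite continuous_intros\<close>)
    moreover have "(\<lambda>n. \<integral>\<zeta>. \<zeta> ^ k \<partial>(M \<circ> r) n) \<longlonglongrightarrow> m k"
      using LIMSEQ_subseq_LIMSEQ[OF lim r(1)] by (simp add: o_def)
    ultimately show ?thesis by (rule LIMSEQ_unique)
  qed
  then show ?thesis using that r by blast
qed

subsection \<open>Power series with bounded coefficients\<close>

lemma summable_bounded_coeffs:
  fixes a :: "nat \<Rightarrow> complex"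
  assumes "\<And>k. norm (a k) \<le> C" "norm z < 1"
  shows "summable (\<lambda>k. a k * z ^ k)"
proof (rule summable_comparison_test')
  show "summable (\<lambda>k. C * norm z ^ k)" using assms(2) by (intro summable_mult summable_geometric) auto
  show "norm (a k * z ^ k) \<le> C * norm z ^ k" for k
    using assms(1) by (simp add: norm_mult norm_power mult_right_mono)
qed

lemma suminf_bounded_coeffs:
  fixes a :: "nat \<Rightarrow> complex"
  assumes "\<And>k. norm (a k) \<le> C" "norm z < 1"
  shows "norm (suminf (\<lambda>k. a k * z ^ k)) \<le> C / (1 - norm z)"
proof -
  have g: "(\<lambda>k. C * norm z ^ k) sums (C * (1 / (1 - norm z)))"
    using assms(2) by (intro sums_mult geometric_sums) auto
  have "norm (suminf (\<lambda>k. a k * z ^ k)) \<le> suminf (\<lambda>k. C * norm z ^ k)"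
    using assms sums_summable[OF g] by (intro norm_suminf_le) (auto simp: norm_mult norm_power mult_right_mono)
  also have "\<dots> = C / (1 - norm z)"
    using sums_unique[OF g] by simp
  finally show ?thesis .
qed

lemma powser_split_head:
  fixes c :: "nat \<Rightarrow> complex"
  assumes "\<And>k. norm (c k) \<le> C" "norm z < 1"
  shows "suminf (\<lambda>k. c k * z ^ k) = c 0 + z * suminf (\<lambda>k. c (Suc k) * z ^ k)"
proof -
  have "suminf (\<lambda>k. c k * z ^ k) = suminf (\<lambda>k. c (Suc k) * z ^ Suc k) + c 0"
    using suminf_split_head[OF summable_bounded_coeffs[of c C z]] assms by simp
  also have "suminf (\<lambda>k. c (Suc k) * z ^ Suc k) = suminf (\<lambda>k. z * (c (Suc k) * z ^ k))"
    by (intro suminf_cong) simp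
  also have "\<dots> = z * suminf (\<lambda>k. c (Suc k) * z ^ k)"
    using assms by (intro suminf_mult summable_bounded_coeffs[of "\<lambda>k. c (Suc k)" C z]) auto
  finally show ?thesis by simp
qed

text \<open>Uniformly bounded coefficients turn pointwise convergence near \<open>0\<close> into convergence of every
  coefficient: peel off the coefficients one at a time and let \<open>z\<close> tend to \<open>0\<close>.\<close>

lemma constant_coeff_tendsto:
  fixes a :: "nat \<Rightarrow> nat \<Rightarrow> complex" and b :: "nat \<Rightarrow> complex"
  assumes a: "\<And>n k. norm (a n k) \<le> C" and b: "\<And>k. norm (b k) \<le> C" and r: "0 < r"
    and lim: "\<And>z. z \<noteq> 0 \<Longrightarrow> norm z < r \<Longrightarrow> (\<lambda>n. suminf (\<lambda>k. a n k * z ^ k)) \<longlonglongrightarrow> suminf (\<lambda>k. b k * z ^ k)"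
  shows "(\<lambda>n. a n 0) \<longlonglongrightarrow> b 0"
proof -
  have C: "C \<ge> 0" using order_trans[OF norm_ge_zero b] .
  show ?thesis
  proof (rule LIMSEQ_I)
    fix e :: real assume e: "e > 0"
    define t where "t = min (r / 2) (min (1/2) (e / (8 * C + 8)))"
    have "0 < e / (8 * C + 8)" using e C by simp
    then have "t \<le> r / 2" "t \<le> 1/2" "t \<le> e / (8 * C + 8)" "0 < t"
      unfolding t_def using r by linarith+
    then have t: "0 < t" "t < r" "t \<le> 1/2" "t \<le> e / (8 * C + 8)" using r by linarith+
    have t2: "4 * C * t \<le> e / 2"
    proof -
      have "t * (8 * C + 8) \<le> e" using t(4) C by (simp add: pos_le_divide_eq)
      then show ?thesis using t C by (simp add: algebra_simps)
    qed
    let ?z = "complex_of_real t"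
    have z: "norm ?z = t" using t by simp
    then have z1: "norm ?z < 1" using t by simp
    obtain n0 where n0: "\<And>n. n \<ge> n0 \<Longrightarrow> norm (suminf (\<lambda>k. a n k * ?z ^ k) - suminf (\<lambda>k. b k * ?z ^ k)) < e / 2"
    proof -
      have "(\<lambda>n. suminf (\<lambda>k. a n k * ?z ^ k)) \<longlonglongrightarrow> suminf (\<lambda>k. b k * ?z ^ k)"
        by (rule lim) (use t z in auto)
      from LIMSEQ_D[OF this, of "e / 2"] e that show ?thesis by (metis half_gt_zero)
    qed
    have tail: "norm (?z * suminf (\<lambda>k. c (Suc k) * ?z ^ k)) \<le> 2 * C * t"
      if "\<And>k. norm (c k) \<le> C" for c :: "nat \<Rightarrow> complex"
    proof -
      have "norm (suminf (\<lambda>k. c (Suc k) * ?z ^ k)) \<le> C / (1 - t)"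
        using suminf_bounded_coeffs[of "\<lambda>k. c (Suc k)" C ?z, OF that z1] unfolding z .
      also have "\<dots> \<le> 2 * C"
      proof -
        have "C * 1 \<le> C * (2 * (1 - t))" using t C by (intro mult_left_mono) auto
        then show ?thesis using t by (simp add: pos_divide_le_eq algebra_simps)
      qed
      finally have "t * norm (suminf (\<lambda>k. c (Suc k) * ?z ^ k)) \<le> t * (2 * C)"
        using t by (intro mult_left_mono) auto
      then show ?thesis using t by (simp add: norm_mult algebra_simps)
    qed
    show "\<exists>no. \<forall>n\<ge>no. norm (a n 0 - b 0) < e"
    proof (intro exI[of _ n0] allI impI)
      fix n assume n: "n \<ge> n0"
      have "a n 0 - b 0 = (suminf (\<lambda>k. a n k * ?z ^ k) - suminf (\<lambda>k. b k * ?z ^ k))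
          - ?z * suminf (\<lambda>k. a n (Suc k) * ?z ^ k) + ?z * suminf (\<lambda>k. b (Suc k) * ?z ^ k)"
        using powser_split_head[of "a n" C ?z, OF a z1] powser_split_head[of b C ?z, OF b z1] by simp
      then have "norm (a n 0 - b 0) \<le> norm ((suminf (\<lambda>k. a n k * ?z ^ k) - suminf (\<lambda>k. b k * ?z ^ k))
          - ?z * suminf (\<lambda>k. a n (Suc k) * ?z ^ k)) + norm (?z * suminf (\<lambda>k. b (Suc k) * ?z ^ k))"
        by (simp only: norm_triangle_ineq)
      also have "\<dots> \<le> (norm (suminf (\<lambda>k. a n k * ?z ^ k) - suminf (\<lambda>k. b k * ?z ^ k))
          + norm (?z * suminf (\<lambda>k. a n (Suc k) * ?z ^ k))) + norm (?z * suminf (\<lambda>k. b (Suc k) * ?z ^ k))"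
        by (intro add_right_mono norm_triangle_ineq4)
      also have "\<dots> < (e / 2 + 2 * C * t) + 2 * C * t"
        by (rule add_less_le_mono[OF add_less_le_mono[OF n0[OF n] tail[of "a n", OF a]] tail[of b, OF b]])
      finally show "norm (a n 0 - b 0) < e" using t2 by simp
    qed
  qed
qed

lemma coeffs_tendsto:
  fixes a :: "nat \<Rightarrow> nat \<Rightarrow> complex" and b :: "nat \<Rightarrow> complex"
  assumes "\<And>n k. norm (a n k) \<le> C" "\<And>k. norm (b k) \<le> C" "0 < r" "r \<le> 1"
    and "\<And>z. z \<noteq> 0 \<Longrightarrow> norm z < r \<Longrightarrow> (\<lambda>n. suminf (\<lambda>k. a n k * z ^ k)) \<longlonglongrightarrow> suminf (\<lambda>k. b k * z ^ k)"
  shows "(\<lambda>n. a n k) \<longlonglongrightarrow> b k"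
  using assms
proof (induction k arbitrary: a b)
  case 0
  show ?case by (rule constant_coeff_tendsto[of a C b r, OF 0(1,2,3,5)])
next
  case (Suc k)
  have a0: "(\<lambda>n. a n 0) \<longlonglongrightarrow> b 0"
    by (rule constant_coeff_tendsto[of a C b r, OF Suc.prems(1,2,3,5)])
  show ?case
  proof (rule Suc.IH[of "\<lambda>n k. a n (Suc k)" "\<lambda>k. b (Suc k)", OF Suc.prems(1,2,3,4)])
    fix z :: complex assume z: "z \<noteq> 0" "norm z < r"
    then have z1: "norm z < 1" using Suc.prems(4) by linarith
    have q: "suminf (\<lambda>k. c (Suc k) * z ^ k) = (suminf (\<lambda>k. c k * z ^ k) - c 0) / z"
      if "\<And>k. norm (c k) \<le> C" for c :: "nat \<Rightarrow> complex"
      using powser_split_head[of c C z, OF that z1] z by simp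
    have "(\<lambda>n. (suminf (\<lambda>k. a n k * z ^ k) - a n 0) / z) \<longlonglongrightarrow> (suminf (\<lambda>k. b k * z ^ k) - b 0) / z"
      by (intro tendsto_intros a0 z Suc.prems(5))
    then show "(\<lambda>n. suminf (\<lambda>k. a n (Suc k) * z ^ k)) \<longlonglongrightarrow> suminf (\<lambda>k. b (Suc k) * z ^ k)"
      using q[of "a n" for n, OF Suc.prems(1)] q[of b, OF Suc.prems(2)] by simp
  qed
qed

section \<open>The Cauchy transform of a measure on the circle and the B-transform\<close>

definition Cauchy_tr :: "complex measure \<Rightarrow> complex \<Rightarrow> complex" where
  "Cauchy_tr \<mu> z = (\<integral>\<zeta>. 1 / (1 - \<zeta> * z) \<partial>\<mu>)"

text \<open>On the disk this is the B-transform, written without the removable singularity at \<open>0\<close>.\<close>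

definition Bf :: "complex measure \<Rightarrow> complex \<Rightarrow> complex" where
  "Bf \<mu> z = (\<integral>\<zeta>. \<zeta> / (1 - \<zeta> * z) \<partial>\<mu>) / Cauchy_tr \<mu> z"

definition eta :: "complex measure \<Rightarrow> complex \<Rightarrow> complex" where
  "eta \<mu> z = z * Bf \<mu> z"

lemma kernel_nonzero:
  fixes z :: complex
  assumes "\<zeta> \<in> unit_circle" "norm z < 1"
  shows "1 - \<zeta> * z \<noteq> 0"
proof
  assume "1 - \<zeta> * z = 0"
  then have "norm (\<zeta> * z) = 1" by (metis eq_iff_diff_eq_0 norm_one)
  then show False using assms by (simp add: norm_mult)
qed

lemma continuous_on_kernel:
  fixes z :: complex
  assumes "norm z < 1" "continuous_on unit_circle g"
  shows "continuous_on unit_circle (\<lambda>\<zeta>. g \<zeta> / (1 - \<zeta> * z))"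
  using kernel_nonzero[OF _ assms(1)] by (intro continuous_intros assms) auto

lemma norm_kernel_ge:
  fixes z :: complex
  assumes "\<zeta> \<in> unit_circle"
  shows "norm (1 - \<zeta> * z) \<ge> 1 - norm z"
  using norm_triangle_ineq2[of 1 "\<zeta> * z"] assms by (simp add: norm_mult)

lemma norm_kernel_le:
  fixes z :: complex
  assumes "\<zeta> \<in> unit_circle" "norm z < 1" "norm w \<le> C"
  shows "norm (w / (1 - \<zeta> * z)) \<le> C / (1 - norm z)"
proof -
  have "norm w / norm (1 - \<zeta> * z) \<le> C / (1 - norm z)"
    using norm_kernel_ge[OF assms(1), of z] assms order_trans[OF norm_ge_zero assms(3)]
    by (intro frac_le) auto
  then show ?thesis by (simp add: norm_divide)
qed

text \<open>The geometric series turns the kernel into the generating function of the moments.\<close>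

lemma moment_series:
  assumes \<mu>: "circle_finite \<mu>" and z: "norm z < 1"
  shows "(\<lambda>k. (\<integral>\<zeta>. \<zeta> ^ (k + j) \<partial>\<mu>) * z ^ k) sums (\<integral>\<zeta>. \<zeta> ^ j / (1 - \<zeta> * z) \<partial>\<mu>)"
proof -
  define R where "R N = (\<integral>\<zeta>. (\<zeta> ^ j * (\<zeta> * z) ^ N) / (1 - \<zeta> * z) \<partial>\<mu>)" for N
  have part: "(\<Sum>k<N. (\<integral>\<zeta>. \<zeta> ^ (k + j) \<partial>\<mu>) * z ^ k) = (\<integral>\<zeta>. \<zeta> ^ j / (1 - \<zeta> * z) \<partial>\<mu>) - R N" for N
  proof -
    have "(\<Sum>k<N. (\<integral>\<zeta>. \<zeta> ^ (k + j) \<partial>\<mu>) * z ^ k) = (\<integral>\<zeta>. (\<Sum>k<N. \<zeta> ^ (k + j) * z ^ k) \<partial>\<mu>)"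
      by (subst Bochner_Integration.integral_sum)
         (auto intro!: circle_integrable \<mu> continuous_intros sum.cong)
    also have "\<dots> = (\<integral>\<zeta>. \<zeta> ^ j / (1 - \<zeta> * z) - (\<zeta> ^ j * (\<zeta> * z) ^ N) / (1 - \<zeta> * z) \<partial>\<mu>)"
    proof (rule circle_integral_cong[OF \<mu>])
      fix \<zeta> :: complex assume \<zeta>: "\<zeta> \<in> unit_circle"
      have nz: "1 - \<zeta> * z \<noteq> 0" by (rule kernel_nonzero[OF \<zeta> z])
      have "(\<Sum>k<N. \<zeta> ^ (k + j) * z ^ k) = \<zeta> ^ j * (\<Sum>k<N. (\<zeta> * z) ^ k)"
        by (simp add: sum_distrib_left power_add power_mult_distrib mult_ac)
      also have "(\<Sum>k<N. (\<zeta> * z) ^ k) = (1 - (\<zeta> * z) ^ N) / (1 - \<zeta> * z)"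
        using nz by (subst sum_gp_strict) auto
      finally show "(\<Sum>k<N. \<zeta> ^ (k + j) * z ^ k) = \<zeta> ^ j / (1 - \<zeta> * z) - (\<zeta> ^ j * (\<zeta> * z) ^ N) / (1 - \<zeta> * z)"
        by (simp add: diff_divide_distrib algebra_simps)
    qed
    also have "\<dots> = (\<integral>\<zeta>. \<zeta> ^ j / (1 - \<zeta> * z) \<partial>\<mu>) - R N"
      unfolding R_def
      by (rule Bochner_Integration.integral_diff)
         (intro circle_integrable \<mu> continuous_on_kernel z continuous_intros)+
    finally show ?thesis .
  qed
  have "R \<longlonglongrightarrow> 0"
  proof (rule Lim_null_comparison)
    show "\<forall>\<^sub>F N in sequentially. norm (R N) \<le> (norm z ^ N / (1 - norm z)) * measure \<mu> unit_circle"
      unfolding R_def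
      by (intro always_eventually allI circle_integral_bound \<mu> continuous_on_kernel z
            norm_kernel_le continuous_intros)
         (auto simp: norm_mult norm_power)
    have "(\<lambda>N. (norm z ^ N / (1 - norm z)) * measure \<mu> unit_circle) \<longlonglongrightarrow> (0 / (1 - norm z)) * measure \<mu> unit_circle"
      using z by (intro tendsto_intros LIMSEQ_realpow_zero) auto
    then show "(\<lambda>N. (norm z ^ N / (1 - norm z)) * measure \<mu> unit_circle) \<longlonglongrightarrow> 0" by simp
  qed
  then have "(\<lambda>N. (\<integral>\<zeta>. \<zeta> ^ j / (1 - \<zeta> * z) \<partial>\<mu>) - R N) \<longlonglongrightarrow> (\<integral>\<zeta>. \<zeta> ^ j / (1 - \<zeta> * z) \<partial>\<mu>) - 0"
    by (intro tendsto_intros)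
  then show ?thesis unfolding sums_def part by simp
qed

lemma Cauchy_tr_sums:
  assumes "circle_finite \<mu>" "norm z < 1"
  shows "(\<lambda>k. (\<integral>\<zeta>. \<zeta> ^ k \<partial>\<mu>) * z ^ k) sums Cauchy_tr \<mu> z"
  using moment_series[OF assms, of 0] by (simp add: Cauchy_tr_def)

lemma norm_moment_le:
  assumes "\<mu> \<in> circle_prob"
  shows "norm (\<integral>\<zeta>. \<zeta> ^ k \<partial>\<mu>) \<le> 1"
proof -
  have "norm (\<integral>\<zeta>. \<zeta> ^ k \<partial>\<mu>) \<le> 1 * measure \<mu> unit_circle"
    by (rule circle_integral_bound[OF circle_prob_finite[OF assms]])
       (auto intro!: continuous_intros simp: norm_power)
  then show ?thesis
    using circle_prob_measure_space[OF assms] circle_finite_space[OF circle_prob_finite[OF assms]] by simp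
qed

lemma Cauchy_tr_eq_suminf:
  assumes "circle_finite \<mu>" "norm z < 1"
  shows "Cauchy_tr \<mu> z = suminf (\<lambda>k. (\<integral>\<zeta>. \<zeta> ^ k \<partial>\<mu>) * z ^ k)"
  using Cauchy_tr_sums[OF assms] by (rule sums_unique)

lemma kernel_holomorphic:
  assumes \<mu>: "circle_finite \<mu>"
  shows "(\<lambda>z. \<integral>\<zeta>. \<zeta> ^ j / (1 - \<zeta> * z) \<partial>\<mu>) holomorphic_on ball 0 1"
proof (rule power_series_holomorphic)
  fix w :: complex assume "w \<in> ball 0 1"
  then show "(\<lambda>k. (\<integral>\<zeta>. \<zeta> ^ (k + j) \<partial>\<mu>) * (w - 0) ^ k) sums (\<integral>\<zeta>. \<zeta> ^ j / (1 - \<zeta> * w) \<partial>\<mu>)"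
    using moment_series[OF \<mu>, of w j] by simp
qed

lemma Cauchy_tr_holomorphic: "circle_finite \<mu> \<Longrightarrow> Cauchy_tr \<mu> holomorphic_on ball 0 1"
  using kernel_holomorphic[of \<mu> 0] by (simp add: Cauchy_tr_def[abs_def])

lemma circle_prob_integral_const:
  "\<mu> \<in> circle_prob \<Longrightarrow> (\<integral>\<zeta>. (c::'a::{banach, second_countable_topology}) \<partial>\<mu>) = c"
  by (simp add: circle_prob_measure_space)

lemma Cauchy_tr_minus_one:
  assumes \<mu>: "\<mu> \<in> circle_prob" and z: "norm z < 1"
  shows "Cauchy_tr \<mu> z - 1 = z * (\<integral>\<zeta>. \<zeta> / (1 - \<zeta> * z) \<partial>\<mu>)"
proof -
  note f = circle_prob_finite[OF \<mu>]
  have "Cauchy_tr \<mu> z - 1 = (\<integral>\<zeta>. 1 / (1 - \<zeta> * z) - 1 \<partial>\<mu>)"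
    unfolding Cauchy_tr_def
    by (subst Bochner_Integration.integral_diff)
       (auto intro!: circle_integrable f continuous_on_kernel z continuous_intros
          simp: circle_prob_measure_space[OF \<mu>])
  also have "\<dots> = (\<integral>\<zeta>. z * (\<zeta> / (1 - \<zeta> * z)) \<partial>\<mu>)"
  proof (rule circle_integral_cong[OF f])
    fix \<zeta> :: complex assume "\<zeta> \<in> unit_circle"
    then have "1 - \<zeta> * z \<noteq> 0" using kernel_nonzero z by blast
    then show "1 / (1 - \<zeta> * z) - 1 = z * (\<zeta> / (1 - \<zeta> * z))" by (simp add: field_simps)
  qed
  finally show ?thesis unfolding integral_mult_right_zero .
qed

text \<open>The kernel \<open>1 / (1 - \<zeta> z)\<close> lies in the half plane \<open>Re w > 1/2\<close>, and \<open>w \<mapsto> 1 - 1 / w\<close> maps this half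
  plane into the disk.\<close>

lemma Re_Cauchy_tr:
  assumes \<mu>: "\<mu> \<in> circle_prob" and z: "norm z < 1"
  shows "Re (Cauchy_tr \<mu> z) > 1 / 2"
proof -
  note f = circle_prob_finite[OF \<mu>]
  define c where "c = (1 - (norm z)\<^sup>2) / (2 * (1 + norm z)\<^sup>2)"
  have c: "c > 0" proof -
    have "(norm z)\<^sup>2 < 1" using z by (simp add: abs_square_less_1)
    moreover have "(1 + norm z)\<^sup>2 > 0" by (intro zero_less_power add_pos_nonneg) auto
    ultimately show ?thesis by (simp add: c_def)
  qed
  have i: "integrable \<mu> (\<lambda>\<zeta>. 1 / (1 - \<zeta> * z))"
    by (intro circle_integrable f continuous_on_kernel z continuous_intros)
  have pw: "1 / 2 + c \<le> Re (1 / (1 - \<zeta> * z))" if "\<zeta> \<in> unit_circle" for \<zeta>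
  proof -
    define w where "w = \<zeta> * z"
    have w: "norm w = norm z" using that by (simp add: w_def norm_mult)
    have "w \<noteq> 1" using w z by auto
    then have pos: "norm (1 - w) > 0" by simp
    have up: "norm (1 - w) \<le> 1 + norm z" using norm_triangle_ineq4[of 1 w] w by simp
    have "c \<le> (1 - (norm z)\<^sup>2) / (2 * (norm (1 - w))\<^sup>2)"
      unfolding c_def using z pos up
      by (intro divide_left_mono mult_left_mono power_mono mult_pos_pos zero_less_power)
         (auto simp: abs_square_le_1 intro: add_pos_nonneg)
    moreover have "Re (1 / (1 - w)) = 1 / 2 + (1 - (norm w)\<^sup>2) / (2 * (norm (1 - w))\<^sup>2)"
    proof -
      have "Re (1 / (1 - w)) = (1 - Re w) / (norm (1 - w))\<^sup>2"
        by (simp add: Re_divide cmod_power2)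
      moreover have "(norm (1 - w))\<^sup>2 = 1 - 2 * Re w + (norm w)\<^sup>2"
        unfolding cmod_power2 by (simp add: power2_eq_square algebra_simps)
      moreover have Q: "(1 - a) / D = 1 / 2 + (1 - n) / (2 * D)" if "D = 1 - 2 * a + n" "D > 0" for a n D :: real
      proof -
        have "n = D - 1 + 2 * a" using that by simp
        then show ?thesis using that(2) by (simp only:) (simp add: field_simps)
      qed
      ultimately show ?thesis using Q[of "(norm (1 - w))\<^sup>2" "Re w" "(norm w)\<^sup>2"] pos
        by (metis zero_less_power)
    qed
    ultimately show ?thesis using w by (simp add: w_def)
  qed
  have "1 / 2 + c = (\<integral>\<zeta>. 1 / 2 + c \<partial>\<mu>)" using circle_prob_integral_const[OF \<mu>, of "1 / 2 + c"] by simp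
  also have "\<dots> \<le> (\<integral>\<zeta>. Re (1 / (1 - \<zeta> * z)) \<partial>\<mu>)"
    using pw circle_finite_space[OF f]
    by (intro integral_mono circle_integrable f continuous_on_kernel z continuous_intros integrable_Re i) auto
  also have "\<dots> = Re (Cauchy_tr \<mu> z)" unfolding Cauchy_tr_def using i by simp
  finally show ?thesis using c by simp
qed

lemma Cauchy_tr_nonzero: "\<mu> \<in> circle_prob \<Longrightarrow> norm z < 1 \<Longrightarrow> Cauchy_tr \<mu> z \<noteq> 0"
  using Re_Cauchy_tr by fastforce

lemma eta_eq:
  assumes "\<mu> \<in> circle_prob" "norm z < 1"
  shows "eta \<mu> z = 1 - 1 / Cauchy_tr \<mu> z"
  using Cauchy_tr_minus_one[OF assms] Cauchy_tr_nonzero[OF assms]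
  by (simp add: eta_def Bf_def field_simps)

lemma Cauchy_tr_eq:
  assumes "\<mu> \<in> circle_prob" "norm z < 1"
  shows "Cauchy_tr \<mu> z = 1 / (1 - eta \<mu> z)" "1 - eta \<mu> z \<noteq> 0"
  using Cauchy_tr_nonzero[OF assms] by (simp_all add: eta_eq[OF assms])

lemma Bf_holomorphic:
  assumes "\<mu> \<in> circle_prob"
  shows "Bf \<mu> holomorphic_on ball 0 1"
proof -
  have "(\<lambda>z. (\<integral>\<zeta>. \<zeta> ^ 1 / (1 - \<zeta> * z) \<partial>\<mu>) / Cauchy_tr \<mu> z) holomorphic_on ball 0 1"
    using assms by (intro holomorphic_on_divide kernel_holomorphic Cauchy_tr_holomorphic circle_prob_finite)
      (auto simp: Cauchy_tr_nonzero)
  then show ?thesis by (simp add: Bf_def[abs_def])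
qed

lemma eta_holomorphic: "\<mu> \<in> circle_prob \<Longrightarrow> eta \<mu> holomorphic_on ball 0 1"
  unfolding eta_def[abs_def] by (intro holomorphic_intros Bf_holomorphic)

lemma Bf_0: "\<mu> \<in> circle_prob \<Longrightarrow> Bf \<mu> 0 = (\<integral>\<zeta>. \<zeta> \<partial>\<mu>)"
  by (simp add: Bf_def Cauchy_tr_def circle_prob_measure_space)

lemma eta_0 [simp]: "eta \<mu> 0 = 0"
  by (simp add: eta_def)

lemma norm_eta_less:
  assumes "\<mu> \<in> circle_prob" "norm z < 1"
  shows "norm (eta \<mu> z) < 1"
proof -
  define w where "w = Cauchy_tr \<mu> z"
  have w: "Re w > 1 / 2" "w \<noteq> 0" using Re_Cauchy_tr[OF assms] Cauchy_tr_nonzero[OF assms] by (auto simp: w_def)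
  have "(norm (w - 1))\<^sup>2 < (norm w)\<^sup>2"
    using w unfolding cmod_power2 by (simp add: power2_eq_square algebra_simps)
  then have "norm (w - 1) < norm w" by (rule power_less_imp_less_base) simp
  moreover have "eta \<mu> z = (w - 1) / w" using w by (simp add: eta_eq[OF assms] w_def field_simps)
  ultimately show ?thesis using w by (simp add: norm_divide)
qed

lemma norm_Bf_le:
  assumes "\<mu> \<in> circle_prob" "norm z < 1"
  shows "norm (Bf \<mu> z) \<le> 1"
proof (cases "z = 0")
  case True
  then show ?thesis using norm_moment_le[OF assms(1), of 1] Bf_0[OF assms(1)] by simp
next
  case False
  have "norm (eta \<mu> z) \<le> norm z"
    using assms by (intro Schwarz_Lemma(1) eta_holomorphic norm_eta_less) auto
  then have "norm z * norm (Bf \<mu> z) \<le> norm z * 1" by (simp add: eta_def norm_mult)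
  then show ?thesis using False by (subst (asm) mult_le_cancel_left_pos) auto
qed

lemma Bf_isCont:
  assumes "\<mu> \<in> circle_prob" "norm z < 1"
  shows "isCont (Bf \<mu>) z"
  using holomorphic_on_imp_continuous_on[OF Bf_holomorphic[OF assms(1)]] assms(2)
  by (simp add: continuous_on_eq_continuous_at)

lemma eventually_nhds_norm_less: "e > 0 \<Longrightarrow> \<forall>\<^sub>F z in nhds (0::complex). norm z < e"
  using eventually_nhds_in_open[of "ball 0 e" "0::complex"] by (auto elim: eventually_mono)

lemma B_transform_eq:
  assumes \<mu>: "\<mu> \<in> circle_prob" and z: "norm z < 1"
  shows "B_transform \<mu> z = Bf \<mu> z"
  unfolding B_transform_def
proof (rule remove_sings_eqI)
  have "Bf \<mu> \<midarrow>z\<rightarrow> Bf \<mu> z" using Bf_isCont[OF assms] by (simp add: isCont_def)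
  moreover have "\<forall>\<^sub>F w in at z. Bf \<mu> w = 1 / w * (psi \<mu> w / (1 + psi \<mu> w))"
  proof -
    have "\<forall>\<^sub>F w in at z. w \<in> ball 0 1 - {0}"
    proof -
      have "\<forall>\<^sub>F w in at z. w \<in> ball 0 1" using z by (intro eventually_at_in_open') auto
      moreover have "\<forall>\<^sub>F w in at z. w \<noteq> 0" by (rule eventually_neq_at_within)
      ultimately show ?thesis by eventually_elim auto
    qed
    then show ?thesis
    proof eventually_elim
      case (elim w)
      then have w: "norm w < 1" "w \<noteq> 0" by auto
      have "psi \<mu> w = Cauchy_tr \<mu> w - 1"
        unfolding Cauchy_tr_minus_one[OF \<mu> w(1)] psi_def by (simp add: mult.commute flip: integral_mult_right_zero)
      moreover have "1 + psi \<mu> w = Cauchy_tr \<mu> w" by (simp add: calculation)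
      ultimately show ?case using w Cauchy_tr_minus_one[OF \<mu> w(1)] by (simp add: Bf_def)
    qed
  qed
  ultimately show "(\<lambda>w. 1 / w * (psi \<mu> w / (1 + psi \<mu> w))) \<midarrow>z\<rightarrow> Bf \<mu> z"
    by (rule Lim_transform_eventually)
qed

lemma psi_eq:
  assumes \<mu>: "\<mu> \<in> circle_prob" and w: "norm w < 1"
  shows "psi \<mu> w = Cauchy_tr \<mu> w - 1"
  unfolding Cauchy_tr_minus_one[OF \<mu> w(1)] psi_def by (simp add: mult.commute flip: integral_mult_right_zero)

lemma weak_conv_imp_Bf:
  assumes w: "circle_weak_conv M L" and M: "\<And>n. M n \<in> circle_prob" and L: "L \<in> circle_prob"
    and z: "norm z < 1"
  shows "(\<lambda>n. Bf (M n) z) \<longlonglongrightarrow> Bf L z"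
  unfolding Bf_def Cauchy_tr_def
  by (intro tendsto_divide circle_weak_convD[OF w] circle_prob_finite M L continuous_on_kernel z
        continuous_intros Cauchy_tr_nonzero[OF L z, unfolded Cauchy_tr_def])

text \<open>The Cauchy transform \<open>1 / (1 - eta)\<close> generates the moments, which are bounded by \<open>1\<close>; so convergence on
  any punctured neighbourhood of \<open>0\<close> is enough.\<close>

lemma weak_conv_of_eta:
  assumes M: "\<And>n. M n \<in> circle_prob" and L: "L \<in> circle_prob" and r: "0 < r"
    and lim: "\<And>z. z \<noteq> 0 \<Longrightarrow> norm z < r \<Longrightarrow> (\<lambda>n. eta (M n) z) \<longlonglongrightarrow> eta L z"
  shows "circle_weak_conv M L"
proof (rule weak_conv_of_moments)
  fix k
  show "(\<lambda>n. \<integral>\<zeta>. \<zeta> ^ k \<partial>M n) \<longlonglongrightarrow> (\<integral>\<zeta>. \<zeta> ^ k \<partial>L)"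
  proof (rule coeffs_tendsto[where C = 1 and r = "min r 1" and a = "\<lambda>n k. \<integral>\<zeta>. \<zeta> ^ k \<partial>M n" and b = "\<lambda>k. \<integral>\<zeta>. \<zeta> ^ k \<partial>L"])
    fix z :: complex assume z: "z \<noteq> 0" "norm z < min r 1"
    then have z1: "norm z < 1" "norm z < r" by auto
    have "(\<lambda>n. 1 / (1 - eta (M n) z)) \<longlonglongrightarrow> 1 / (1 - eta L z)"
      by (intro tendsto_intros lim z z1 Cauchy_tr_eq(2) L)
    then have "(\<lambda>n. Cauchy_tr (M n) z) \<longlonglongrightarrow> Cauchy_tr L z"
      by (simp only: Cauchy_tr_eq(1)[OF M z1(1)] Cauchy_tr_eq(1)[OF L z1(1)])
    then show "(\<lambda>n. suminf (\<lambda>k. (\<integral>\<zeta>. \<zeta> ^ k \<partial>M n) * z ^ k)) \<longlonglongrightarrow> suminf (\<lambda>k. (\<integral>\<zeta>. \<zeta> ^ k \<partial>L) * z ^ k)"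
      by (simp only: Cauchy_tr_eq_suminf[OF circle_prob_finite[OF M] z1(1)]
           Cauchy_tr_eq_suminf[OF circle_prob_finite[OF L] z1(1)])
  qed (use r in \<open>auto intro: norm_moment_le M L\<close>)
qed (intro circle_prob_finite M L)+

lemma circle_prob_eqI_eta:
  assumes \<mu>: "\<mu> \<in> circle_prob" and \<nu>: "\<nu> \<in> circle_prob" and r: "0 < r"
    and eq: "\<And>z. z \<noteq> 0 \<Longrightarrow> norm z < r \<Longrightarrow> eta \<mu> z = eta \<nu> z"
  shows "\<mu> = \<nu>"
proof (rule circle_measure_eqI_moments)
  have "circle_weak_conv (\<lambda>_. \<mu>) \<nu>"
    by (rule weak_conv_of_eta[OF \<mu> \<nu> r]) (simp add: eq)
  then show "(\<integral>\<zeta>. \<zeta> ^ k \<partial>\<mu>) = (\<integral>\<zeta>. \<zeta> ^ k \<partial>\<nu>)" for k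
    using circle_weak_convD[of "\<lambda>_. \<mu>" \<nu> "\<lambda>\<zeta>. \<zeta> ^ k"] circle_prob_finite[OF \<mu>] circle_prob_finite[OF \<nu>]
    by (simp add: LIMSEQ_const_iff continuous_on_power continuous_on_id)
qed (intro circle_prob_finite \<mu> \<nu>)+

section \<open>The Herglotz representation\<close>

text \<open>Cauchy's formula for the derivatives at \<open>0\<close>, as a Fourier integral over the circle of radius \<open>r\<close>.\<close>

lemma circle_mean_coeffs:
  fixes P :: "complex \<Rightarrow> complex"
  assumes P: "P holomorphic_on ball 0 1" and r: "0 < r" "r < 1"
  shows "((\<lambda>t. P (of_real r * cis (2 * pi * t)) * cis (- (2 * pi * real k * t))) has_integral
           ((deriv ^^ k) P 0 / fact k * of_real r ^ k)) {0..1}"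
proof -
  have sub: "cball 0 r \<subseteq> ball (0::complex) 1" using r by auto
  have "((\<lambda>u. P u / (u - 0) ^ Suc k) has_contour_integral ((2 * pi * \<i>) / fact k * (deriv ^^ k) P 0)) (circlepath 0 r)"
    using P sub r
    by (intro Cauchy_has_contour_integral_higher_derivative_circlepath
          holomorphic_on_imp_continuous_on holomorphic_on_subset[OF P]) auto
  then have "((\<lambda>t. P (circlepath 0 r t) / circlepath 0 r t ^ Suc k * vector_derivative (circlepath 0 r) (at t within {0..1}))
      has_integral ((2 * pi * \<i>) / fact k * (deriv ^^ k) P 0)) {0..1}"
    unfolding has_contour_integral_def by simp
  then have H: "((\<lambda>t. (of_real r ^ k / (2 * pi * \<i>)) * (P (circlepath 0 r t) / circlepath 0 r t ^ Suc k *
         vector_derivative (circlepath 0 r) (at t within {0..1})))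
      has_integral (of_real r ^ k / (2 * pi * \<i>)) * ((2 * pi * \<i>) / fact k * (deriv ^^ k) P 0)) {0..1}"
    by (rule has_integral_mult_right)
  have K: "(of_real r ^ k / (2 * pi * \<i>)) * ((2 * pi * \<i>) / fact k * (deriv ^^ k) P 0)
      = (deriv ^^ k) P 0 / fact k * of_real r ^ k"
  proof -
    have *: "(a / b) * (b / c * d) = d / c * a" if "b \<noteq> 0" for a b c d :: complex
      using that by (simp add: field_simps)
    show ?thesis by (rule *) simp
  qed
  have L: "(of_real r ^ k / (2 * pi * \<i>)) * (P (circlepath 0 r t) / circlepath 0 r t ^ Suc k *
         vector_derivative (circlepath 0 r) (at t within {0..1}))
      = P (of_real r * cis (2 * pi * t)) * cis (- (2 * pi * real k * t))" if t: "t \<in> {0..1}" for t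
  proof -
    define E where "E = exp (2 * of_real pi * \<i> * of_real t)"
    have E: "cis (2 * pi * t) = E" unfolding E_def cis_conv_exp by (rule arg_cong[of _ _ exp]) simp
    have Ek: "cis (- (2 * pi * real k * t)) = inverse (E ^ k)"
      unfolding E[symmetric] Complex.DeMoivre cis_inverse by (simp add: mult_ac)
    have c: "circlepath 0 r t = of_real r * E" by (simp add: circlepath E_def mult_ac)
    have vd: "vector_derivative (circlepath 0 r) (at t within {0..1}) = 2 * pi * \<i> * r * E"
      unfolding E_def using t by (subst vector_derivative_circlepath01) auto
    have "E \<noteq> 0" by (simp add: E_def)
    have *: "(R ^ k / b) * (p / (R * E) ^ Suc k * (b * R * E)) = p * inverse (E ^ k)"
      if "b \<noteq> 0" "R \<noteq> 0" for b R p :: complex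
      using that \<open>E \<noteq> 0\<close> by (simp add: divide_simps power_mult_distrib)
    show ?thesis unfolding E Ek c vd using r by (intro *) auto
  qed
  show ?thesis by (rule has_integral_eq[OF L H[unfolded K]])
qed

text \<open>A holomorphic function has no Fourier coefficients of negative order: this is the mean value of
  \<open>z\<^sup>k P z\<close>, which vanishes at \<open>0\<close>.\<close>

lemma circle_mean_zero:
  fixes P :: "complex \<Rightarrow> complex"
  assumes P: "P holomorphic_on ball 0 1" and r: "0 < r" "r < 1" and k: "k > 0"
  shows "((\<lambda>t. P (of_real r * cis (2 * pi * t)) * cis (2 * pi * real k * t)) has_integral 0) {0..1}"
proof -
  have "((\<lambda>t. (of_real r * cis (2 * pi * t)) ^ k * P (of_real r * cis (2 * pi * t)) * cis (- (2 * pi * real 0 * t)))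
      has_integral ((deriv ^^ 0) (\<lambda>z. z ^ k * P z) 0 / fact 0 * of_real r ^ 0)) {0..1}"
    by (rule circle_mean_coeffs) (intro holomorphic_intros P r)+
  then have "((\<lambda>t. inverse (of_real r ^ k) * ((of_real r * cis (2 * pi * t)) ^ k * P (of_real r * cis (2 * pi * t))))
      has_integral inverse (of_real r ^ k) * 0) {0..1}"
    using k by (intro has_integral_mult_right) (simp add: zero_power)
  moreover have "inverse (of_real r ^ k) * ((of_real r * cis (2 * pi * t)) ^ k * P (of_real r * cis (2 * pi * t)))
     = P (of_real r * cis (2 * pi * t)) * cis (2 * pi * real k * t)" for t
    using r by (simp add: power_mult_distrib Complex.DeMoivre mult_ac)
  ultimately show ?thesis by simp
qed

text \<open>The push-forward of the density uses \<open>t \<mapsto> cis (- 2 \<pi> t)\<close>, so that the moments of the measure are the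
  Fourier coefficients of \<open>w\<close> without conjugation.\<close>

lemma circle_measure_of_positive_function:
  fixes w :: "real \<Rightarrow> real"
  assumes w: "continuous_on {0..1} w" "\<And>t. t \<in> {0..1} \<Longrightarrow> w t \<ge> 0" "(w has_integral 1) {0..1}"
  obtains \<mu> where "\<mu> \<in> circle_prob"
    "\<And>k m. ((\<lambda>t. of_real (w t) * cis (- (2 * pi * real k * t))) has_integral m) {0..1} \<Longrightarrow> (\<integral>\<zeta>. \<zeta> ^ k \<partial>\<mu>) = m"
proof -
  define g where "g t = indicator {0..1} t * w t" for t
  have int: "set_integrable lborel {0..1} w" by (rule borel_integrable_atLeastAtMost'[OF w(1)])
  then have gi: "integrable lborel g" by (simp add: set_integrable_def g_def[abs_def])
  then have gm: "g \<in> borel_measurable lborel" by (rule borel_measurable_integrable)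
  have g0: "g t \<ge> 0" for t using w(2) by (simp add: g_def indicator_def)
  have "(LINT t|lborel. g t) = 1"
    using set_borel_integral_eq_integral(2)[OF int] integral_unique[OF w(3)]
    by (simp add: set_lebesgue_integral_def g_def)
  then have "(\<integral>\<^sup>+t. ennreal (g t) \<partial>lborel) = 1"
    using nn_integral_eq_integral[OF gi] g0 by simp
  then have ps: "prob_space (density lborel (\<lambda>t. ennreal (g t)))"
    using gm by (intro prob_spaceI) (simp add: emeasure_density)
  have c: "(\<lambda>t. cis (- (2 * pi * t))) \<in> measurable (density lborel (\<lambda>t. ennreal (g t))) circle_borel"
  proof (rule measurable_circle_borelI)
    have "(\<lambda>t. cis (- (2 * pi * t))) \<in> borel_measurable borel"
      by (intro borel_measurable_continuous_onI continuous_intros)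
    then show "(\<lambda>t. cis (- (2 * pi * t))) \<in> borel_measurable (density lborel (\<lambda>t. ennreal (g t)))" by simp
  qed simp
  define \<mu> where "\<mu> = distr (density lborel (\<lambda>t. ennreal (g t))) circle_borel (\<lambda>t. cis (- (2 * pi * t)))"
  show ?thesis
  proof (rule that[of \<mu>])
    show "\<mu> \<in> circle_prob" unfolding \<mu>_def by (rule circle_prob_distr[OF ps c])
    fix k m assume m: "((\<lambda>t. of_real (w t) * cis (- (2 * pi * real k * t))) has_integral m) {0..1}"
    have cm: "(\<lambda>\<zeta>. \<zeta> ^ k) \<in> borel_measurable circle_borel"
      by (intro circle_test_measurable continuous_intros)
    have pm: "(\<lambda>t. cis (- (2 * pi * t)) ^ k) \<in> borel_measurable lborel"
    proof -
      have "(\<lambda>t. cis (- (2 * pi * t)) ^ k) \<in> borel_measurable borel"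
        by (intro borel_measurable_continuous_onI continuous_intros)
      then show ?thesis by simp
    qed
    have "(\<integral>\<zeta>. \<zeta> ^ k \<partial>\<mu>) = (LINT t|density lborel (\<lambda>t. ennreal (g t)). cis (- (2 * pi * t)) ^ k)"
      unfolding \<mu>_def by (rule integral_distr[OF c cm])
    also have "\<dots> = (LINT t|lborel. g t *\<^sub>R cis (- (2 * pi * t)) ^ k)"
      using gm g0 by (intro integral_density pm) auto
    also have "\<dots> = (LINT t:{0..1}|lborel. of_real (w t) * cis (- (2 * pi * real k * t)))"
      unfolding set_lebesgue_integral_def
      by (intro Bochner_Integration.integral_cong)
         (auto simp: g_def indicator_def Complex.DeMoivre scaleR_conv_of_real mult_ac)
    also have "\<dots> = integral {0..1} (\<lambda>t. of_real (w t) * cis (- (2 * pi * real k * t)))"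
      by (intro set_borel_integral_eq_integral borel_integrable_atLeastAtMost' continuous_intros w)
    finally show "(\<integral>\<zeta>. \<zeta> ^ k \<partial>\<mu>) = m" using m by (simp add: integral_unique)
  qed
qed

text \<open>On the circle of radius \<open>r\<close>, the probability density \<open>Re P\<close> has half the Taylor coefficients of \<open>P\<close>,
  damped by powers of \<open>r\<close>, as Fourier coefficients of positive order. As \<open>r\<close> tends to \<open>1\<close>, a limit point of
  these measures has the undamped coefficients as moments.\<close>

theorem Herglotz:
  fixes P :: "complex \<Rightarrow> complex"
  assumes P: "P holomorphic_on ball 0 1" and Re: "\<And>z. norm z < 1 \<Longrightarrow> Re (P z) \<ge> 0" and P0: "P 0 = 1"
  obtains \<mu> where "\<mu> \<in> circle_prob" "\<And>z. norm z < 1 \<Longrightarrow> 2 * Cauchy_tr \<mu> z - 1 = P z"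
proof -
  define a where "a k = (deriv ^^ k) P 0 / fact k" for k
  have a0: "a 0 = 1" by (simp add: a_def P0)
  define r where "r n = 1 - 1 / (real n + 2)" for n
  have r: "0 < r n" "r n < 1" for n by (auto simp: r_def field_simps)
  have "\<exists>\<mu>. \<mu> \<in> circle_prob \<and> (\<forall>k. (\<integral>\<zeta>. \<zeta> ^ k \<partial>\<mu>) = (if k = 0 then 1 else a k / 2 * of_real (r n) ^ k))" for n
  proof -
    define w where "w t = Re (P (of_real (r n) * cis (2 * pi * t)))" for t
    have nz: "norm (of_real (r n) * cis (2 * pi * t)) < 1" for t
      using r[of n] by (simp add: norm_mult)
    have cP: "continuous_on {0..1} (\<lambda>t. P (of_real (r n) * cis (2 * pi * t)))"
      by (rule continuous_on_compose2[OF holomorphic_on_imp_continuous_on[OF P]])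
         (use nz in \<open>auto intro!: continuous_intros\<close>)
    have W: "((\<lambda>t. of_real (w t) * cis (- (2 * pi * real k * t))) has_integral
       (if k = 0 then 1 else a k / 2 * of_real (r n) ^ k)) {0..1}" for k
    proof -
      let ?f = "\<lambda>t. P (of_real (r n) * cis (2 * pi * t))"
      have 1: "((\<lambda>t. ?f t * cis (- (2 * pi * real k * t))) has_integral (a k * of_real (r n) ^ k)) {0..1}"
        unfolding a_def by (rule circle_mean_coeffs[OF P r])
      have "((\<lambda>t. ?f t * cis (2 * pi * real k * t)) has_integral (if k = 0 then 1 else 0)) {0..1}"
        using circle_mean_zero[OF P r[of n], of k] circle_mean_coeffs[OF P r[of n], of 0] P0 by (cases "k = 0") auto
      then have "(cnj \<circ> (\<lambda>t. ?f t * cis (2 * pi * real k * t)) has_integral cnj (if k = 0 then 1 else 0)) {0..1}"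
        by (simp only: has_integral_cnj)
      then have 2: "((\<lambda>t. cnj (?f t) * cis (- (2 * pi * real k * t))) has_integral (if k = 0 then 1 else 0)) {0..1}"
        by (simp add: o_def cis_cnj if_distrib cong: if_cong)
      have "((\<lambda>t. (1/2) * (?f t * cis (- (2 * pi * real k * t)) + cnj (?f t) * cis (- (2 * pi * real k * t)))) has_integral
          (1/2) * (a k * of_real (r n) ^ k + (if k = 0 then 1 else 0))) {0..1}"
        by (intro has_integral_mult_right has_integral_add 1 2)
      moreover have "(1/2) * (?f t * cis (- (2 * pi * real k * t)) + cnj (?f t) * cis (- (2 * pi * real k * t)))
          = of_real (w t) * cis (- (2 * pi * real k * t))" for t
        unfolding w_def using complex_add_cnj[of "?f t"]
        by (simp flip: distrib_right)
      moreover have "(1/2) * (a k * of_real (r n) ^ k + (if k = 0 then 1 else 0)) = (if k = 0 then 1 else a k / 2 * of_real (r n) ^ k)"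
        by (simp add: a0)
      ultimately show ?thesis by simp
    qed
    have wc: "continuous_on {0..1} w" unfolding w_def by (intro continuous_intros cP)
    have w1: "(w has_integral 1) {0..1}"
    proof -
      have "((\<lambda>t. complex_of_real (w t)) has_integral 1) {0..1}" using W[of 0] by simp
      from has_integral_Re[OF this] show ?thesis by simp
    qed
    have w0: "w t \<ge> 0" if "t \<in> {0..1}" for t unfolding w_def by (rule Re[OF nz])
    from circle_measure_of_positive_function[OF wc w0 w1]
    obtain \<mu> where "\<mu> \<in> circle_prob"
      "\<And>k m. ((\<lambda>t. of_real (w t) * cis (- (2 * pi * real k * t))) has_integral m) {0..1} \<Longrightarrow> (\<integral>\<zeta>. \<zeta> ^ k \<partial>\<mu>) = m"
      by metis
    then show ?thesis using W by blast
  qed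
  then obtain M where M: "\<And>n. M n \<in> circle_prob"
    "\<And>n k. (\<integral>\<zeta>. \<zeta> ^ k \<partial>M n) = (if k = 0 then 1 else a k / 2 * of_real (r n) ^ k)" by metis
  have r1: "r \<longlonglongrightarrow> 1" unfolding r_def by real_asymp
  have "(\<lambda>n. \<integral>\<zeta>. \<zeta> ^ k \<partial>M n) \<longlonglongrightarrow> (if k = 0 then 1 else a k / 2)" for k
  proof -
    have "(\<lambda>n. a k / 2 * of_real (r n) ^ k) \<longlonglongrightarrow> a k / 2 * of_real 1 ^ k"
      by (intro tendsto_intros r1)
    then show ?thesis unfolding M(2) by (cases "k = 0") auto
  qed
  from circle_prob_of_moment_limits[of M, OF M(1) this]
  obtain \<mu> where \<mu>: "\<mu> \<in> circle_prob" "\<And>k. (\<integral>\<zeta>. \<zeta> ^ k \<partial>\<mu>) = (if k = 0 then 1 else a k / 2)" by metis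
  have "2 * Cauchy_tr \<mu> z - 1 = P z" if z: "norm z < 1" for z
  proof -
    have "(\<lambda>k. a k * z ^ k) sums P z"
      unfolding a_def using holomorphic_power_series[OF P, of z] z by simp
    moreover have "(\<lambda>k. 2 * ((if k = 0 then 1 else a k / 2) * z ^ k) - (if k = 0 then 1 else 0) * z ^ k) sums (2 * Cauchy_tr \<mu> z - 1)"
      using Cauchy_tr_sums[OF circle_prob_finite[OF \<mu>(1)] z] powser_sums_if[of 0 z]
      unfolding \<mu>(2) by (intro sums_diff sums_mult) auto
    moreover have "2 * ((if k = 0 then 1 else a k / 2) * z ^ k) - (if k = 0 then 1 else 0) * z ^ k = a k * z ^ k" for k
      by (simp add: a0)
    ultimately show ?thesis by (simp add: sums_unique2)
  qed
  then show ?thesis using that \<mu>(1) by blast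
qed

text \<open>If \<open>z h z\<close> is to be \<open>eta \<mu>\<close>, then \<open>2 Cauchy_tr \<mu> - 1\<close> has to be its Cayley transform, which has nonnegative
  real part because \<open>|z h z| < 1\<close>.\<close>

corollary circle_prob_with_Bf:
  assumes h: "h holomorphic_on ball 0 1" and le: "\<And>z. norm z < 1 \<Longrightarrow> norm (h z) \<le> 1"
  obtains \<mu> where "\<mu> \<in> circle_prob" "\<And>z. norm z < 1 \<Longrightarrow> Bf \<mu> z = h z"
proof -
  define P where "P z = (1 + z * h z) / (1 - z * h z)" for z
  have lt: "norm (z * h z) < 1" if "norm z < 1" for z
    using le[OF that] that mult_left_le[of "norm (h z)" "norm z"] by (simp add: norm_mult)
  have nz: "1 - z * h z \<noteq> 0" if "norm z < 1" for z using lt[OF that] by auto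
  have "P holomorphic_on ball 0 1" unfolding P_def using nz by (intro holomorphic_intros h) auto
  moreover have "Re (P z) \<ge> 0" if "norm z < 1" for z
  proof -
    define w where "w = z * h z"
    have "(norm w)\<^sup>2 \<le> 1" using lt[OF that] by (simp add: w_def abs_square_le_1)
    then have "Re ((1 + w) * cnj (1 - w)) \<ge> 0"
      unfolding cmod_power2 by (simp add: power2_eq_square algebra_simps)
    then show ?thesis unfolding P_def w_def[symmetric] by (subst complex_div_cnj) (simp add: Re_divide_of_real)
  qed
  moreover have "P 0 = 1" by (simp add: P_def)
  ultimately obtain \<mu> where \<mu>: "\<mu> \<in> circle_prob" "\<And>z. norm z < 1 \<Longrightarrow> 2 * Cauchy_tr \<mu> z - 1 = P z"
    using Herglotz[of P] by metis
  have *: "Bf \<mu> z = h z" if z: "norm z < 1" "z \<noteq> 0" for z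
  proof -
    have "Cauchy_tr \<mu> z = (P z + 1) / 2" using \<mu>(2)[OF z(1)] by (simp add: field_simps)
    also have "\<dots> = 1 / (1 - z * h z)" using nz[OF z(1)] by (simp add: P_def field_simps)
    finally have "eta \<mu> z = z * h z" using nz[OF z(1)] by (simp add: eta_eq[OF \<mu>(1) z(1)])
    then show ?thesis using z by (simp add: eta_def)
  qed
  moreover have "Bf \<mu> 0 = h 0"
  proof -
    have "Bf \<mu> \<midarrow>0\<rightarrow> Bf \<mu> 0" using Bf_isCont[OF \<mu>(1), of 0] by (simp add: isCont_def)
    moreover have hl: "h \<midarrow>0\<rightarrow> h 0"
      using holomorphic_on_imp_continuous_on[OF h] by (simp add: continuous_on_eq_continuous_at isCont_def)
    moreover have "\<forall>\<^sub>F z in at 0. h z = Bf \<mu> z"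
      using eventually_nhds_norm_less[of 1] unfolding eventually_at_filter
      by (auto elim!: eventually_mono simp: *)
    then have "Bf \<mu> \<midarrow>0\<rightarrow> h 0" by (rule Lim_transform_eventually[OF hl])
    ultimately show ?thesis using LIM_unique by blast
  qed
  ultimately show ?thesis using that[OF \<mu>(1)] by metis
qed

section \<open>Free unitaries\<close>

context star_prob_space
begin

lemma scl_zero: "x \<in> carrier A \<Longrightarrow> scl 0 x = \<zero>"
proof -
  assume x: "x \<in> carrier A"
  have "scl 0 x \<oplus> scl 0 x = scl 0 x" using scl_add_left[OF x, of 0 0] by simp
  then have "\<ominus> scl 0 x \<oplus> (scl 0 x \<oplus> scl 0 x) = \<ominus> scl 0 x \<oplus> scl 0 x" by simp
  then show ?thesis using scl_closed[OF x, of 0] by (simp add: a_assoc[symmetric] l_neg)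
qed

lemma scl_minus_one: "x \<in> carrier A \<Longrightarrow> scl (-1) x = \<ominus> x"
proof -
  assume x: "x \<in> carrier A"
  have "scl (-1) x \<oplus> x = scl (-1 + 1) x" using scl_add_left[OF x, of "-1" 1] scl_one[OF x] by simp
  also have "\<dots> = \<zero>" using scl_zero[OF x] by simp
  finally show ?thesis using x scl_closed[OF x] by (metis minus_equality)
qed

lemma state_zero: "\<phi> \<zero> = 0"
  using state_scl[of \<one> 0] scl_zero[of \<one>] by simp

lemma state_uminus: "x \<in> carrier A \<Longrightarrow> \<phi> (\<ominus> x) = - \<phi> x"
  using state_scl[of x "-1"] scl_minus_one[of x] by simp

lemma state_minus: "x \<in> carrier A \<Longrightarrow> y \<in> carrier A \<Longrightarrow> \<phi> (x \<ominus> y) = \<phi> x - \<phi> y"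
  by (simp add: a_minus_def state_add state_uminus)

lemma star_one: "star \<one> = \<one>"
proof -
  have "star \<one> = \<one> \<otimes> star \<one>" by (simp add: star_closed)
  also have "\<dots> = star (star \<one> \<otimes> \<one>)"
    using star_mult[of "star \<one>" \<one>] by (metis one_closed star_closed star_star l_one r_one)
  finally show ?thesis by (simp add: star_closed star_star)
qed

lemma unitary_one: "unitary \<one>"
  by (simp add: unitary_def star_one)

lemma unitary_mult:
  assumes "unitary u" "unitary v" shows "unitary (u \<otimes> v)"
proof -
  have c: "u \<in> carrier A" "v \<in> carrier A" "star u \<in> carrier A" "star v \<in> carrier A"
    using assms by (auto simp: unitary_def star_closed)
  have "star (u \<otimes> v) \<otimes> (u \<otimes> v) = star v \<otimes> (star u \<otimes> u) \<otimes> v"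
    using c by (simp add: star_mult m_assoc)
  moreover have "(u \<otimes> v) \<otimes> star (u \<otimes> v) = u \<otimes> (v \<otimes> star v) \<otimes> star u"
    using c by (simp add: star_mult m_assoc)
  ultimately show ?thesis using assms c by (simp add: unitary_def)
qed

lemma unitary_pow: "unitary u \<Longrightarrow> unitary (u [^] (n::nat))"
  by (induction n) (auto simp: unitary_one unitary_mult)

lemma unitary_star: "unitary u \<Longrightarrow> unitary (star u)"
  by (simp add: unitary_def star_closed star_star)

text \<open>Positivity of \<open>\<phi> ((1 + c x)\<^sup>* (1 + c x))\<close>.\<close>

lemma state_pos_expand:
  assumes x: "x \<in> carrier A"
  shows "1 + c * \<phi> x + (cnj c * \<phi> (star x) + cnj c * c * \<phi> (star x \<otimes> x)) \<in> \<real>\<^sub>\<ge>\<^sub>0"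
proof -
  define y where "y = \<one> \<oplus> scl c x"
  have c: "star x \<in> carrier A" "scl c x \<in> carrier A" "scl (cnj c) (star x) \<in> carrier A" "y \<in> carrier A"
    using x by (auto simp: star_closed scl_closed y_def)
  have sy: "star y = \<one> \<oplus> scl (cnj c) (star x)"
    using x by (simp add: y_def star_add star_scl scl_closed star_one)
  have "star y \<otimes> y = \<one> \<oplus> scl c x \<oplus> (scl (cnj c) (star x) \<oplus> scl (cnj c * c) (star x \<otimes> x))"
    unfolding sy unfolding y_def using x c
    by (simp add: l_distr r_distr scl_closed scl_mult_left scl_mult_right scl_scl scl_add_right mult.commute a_ac)
  then have "\<phi> (star y \<otimes> y) = 1 + c * \<phi> x + (cnj c * \<phi> (star x) + cnj c * c * \<phi> (star x \<otimes> x))"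
    using x c by (simp add: state_add state_scl state_one scl_closed)
  then show ?thesis using state_pos[OF c(4)] by simp
qed

text \<open>Taking \<open>c = 1\<close> and \<open>c = i\<close> in the positive expression determines both parts of \<open>\<phi> (x\<^sup>*)\<close>.\<close>

lemma state_star:
  assumes x: "x \<in> carrier A"
  shows "\<phi> (star x) = cnj (\<phi> x)"
proof -
  have r: "Im (\<phi> (star x \<otimes> x)) = 0"
    using state_pos[OF x] by (simp add: complex_nonneg_Reals_iff)
  show ?thesis
    using state_pos_expand[OF x, of 1] state_pos_expand[OF x, of \<i>] r
    by (simp add: complex_nonneg_Reals_iff complex_eq_iff)
qed

lemma norm_state_unitary:
  assumes u: "unitary u"
  shows "norm (\<phi> u) \<le> 1"
proof (cases "\<phi> u = 0")
  case False
  \<comment> \<open>with this phase, positivity of the expanded square reads \<open>2 - 2 |\<phi> u| \<ge> 0\<close>\<close>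
  define c where "c = - cnj (\<phi> u) / norm (\<phi> u)"
  have uc: "u \<in> carrier A" "star u \<otimes> u = \<one>" using u by (auto simp: unitary_def)
  have c: "c * \<phi> u = - of_real (norm (\<phi> u))"
    using False by (simp add: c_def complex_norm_square[symmetric] power2_eq_square mult.commute[of "cnj _"])
  have "norm c = 1" using False by (simp add: c_def norm_divide)
  then have cc: "cnj c * c = 1" by (simp add: complex_norm_square[symmetric] mult.commute)
  have "cnj c * \<phi> (star u) = cnj (c * \<phi> u)" using uc by (simp add: state_star)
  then show ?thesis
    using state_pos_expand[OF uc(1), of c] uc(2) state_one
    by (simp add: complex_nonneg_Reals_iff cc c)
qed simp

text \<open>\<open>norm1_le x C\<close> says that \<open>x\<close> is a linear combination of unitaries with \<open>\<ell>\<^sup>1\<close>-norm at most \<open>C\<close>.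
  This replaces a norm on the algebra: it is submultiplicative and bounds the state.\<close>

inductive norm1_le :: "'a \<Rightarrow> real \<Rightarrow> bool" where
  unit: "unitary w \<Longrightarrow> norm c \<le> C \<Longrightarrow> norm1_le (scl c w) C"
| add: "norm1_le x C \<Longrightarrow> norm1_le y D \<Longrightarrow> norm1_le (x \<oplus> y) (C + D)"

lemma norm1_le_closed: "norm1_le x C \<Longrightarrow> x \<in> carrier A"
  by (induction rule: norm1_le.induct) (auto simp: scl_closed unitary_def)

lemma norm1_le_nonneg: "norm1_le x C \<Longrightarrow> C \<ge> 0"
  by (induction rule: norm1_le.induct) (auto intro: order_trans[OF norm_ge_zero])

lemma norm1_le_mono: "norm1_le x C \<Longrightarrow> C \<le> D \<Longrightarrow> norm1_le x D"
proof (induction arbitrary: D rule: norm1_le.induct)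
  case (unit w c C)
  then show ?case by (intro norm1_le.unit) auto
next
  case (add x C y D')
  have "norm1_le (x \<oplus> y) (C + (D - C))" using add by (intro norm1_le.add) auto
  then show ?case by simp
qed

lemma norm1_le_unitary: "unitary w \<Longrightarrow> norm1_le w 1"
  using norm1_le.unit[of w 1 1] by (simp add: scl_one unitary_def)

lemma norm1_le_scl: "norm1_le x C \<Longrightarrow> norm1_le (scl c x) (norm c * C)"
proof (induction rule: norm1_le.induct)
  case (unit w d C)
  then have "scl c (scl d w) = scl (c * d) w" by (simp add: scl_scl unitary_def)
  then show ?case using unit by (auto intro!: norm1_le.unit simp: norm_mult mult_left_mono)
next
  case (add x C y D)
  then show ?case
    by (auto simp: scl_add_right norm1_le_closed distrib_left intro: norm1_le.add)
qed

lemma norm1_le_mult: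
  assumes "norm1_le x C" "norm1_le y D" shows "norm1_le (x \<otimes> y) (C * D)"
  using assms
proof (induction arbitrary: y D rule: norm1_le.induct)
  case (unit w c C)
  from unit(3) show ?case
  proof (induction rule: norm1_le.induct)
    case (unit v d D)
    have "scl c w \<otimes> scl d v = scl (c * d) (w \<otimes> v)"
      using \<open>unitary w\<close> \<open>unitary v\<close>
      by (simp add: scl_mult_left scl_mult_right scl_scl scl_closed unitary_def mult.commute)
    moreover have "norm (c * d) \<le> C * D"
      using \<open>norm c \<le> C\<close> unit order_trans[OF norm_ge_zero \<open>norm c \<le> C\<close>] by (simp add: norm_mult mult_mono)
    ultimately show ?case using \<open>unitary w\<close> unit by (simp add: norm1_le.unit unitary_mult)
  next
    case (add x D y E)
    then show ?case using \<open>unitary w\<close>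
      by (auto simp: r_distr norm1_le_closed scl_closed unitary_def distrib_left intro: norm1_le.add)
  qed
next
  case (add x C x' D')
  have y: "y \<in> carrier A" using add norm1_le_closed by blast
  have "norm1_le (x \<otimes> y \<oplus> x' \<otimes> y) (C * D + D' * D)"
    using add by (intro norm1_le.add) auto
  then show ?case using y add by (simp add: l_distr norm1_le_closed distrib_right)
qed

lemma norm1_le_state: "norm1_le x C \<Longrightarrow> norm (\<phi> x) \<le> C"
proof (induction rule: norm1_le.induct)
  case (unit w c C)
  have "norm c * norm (\<phi> w) \<le> C * 1"
    using unit norm_state_unitary[of w] by (intro mult_mono) (auto intro: order_trans[OF norm_ge_zero])
  then show ?case using unit by (simp add: state_scl unitary_def norm_mult)
next
  case (add x C y D)
  then show ?case by (simp add: state_add norm1_le_closed norm_triangle_mono)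
qed

lemma norm1_le_zero: "norm1_le \<zero> 0"
  using norm1_le.unit[OF unitary_one, of 0 0] scl_zero[of \<one>] by simp

lemma norm1_le_uminus: "norm1_le x C \<Longrightarrow> norm1_le (\<ominus> x) C"
  using norm1_le_scl[of x C "-1"] scl_minus_one[of x] norm1_le_closed[of x C] by simp

lemma norm1_le_minus: "norm1_le x C \<Longrightarrow> norm1_le y D \<Longrightarrow> norm1_le (x \<ominus> y) (C + D)"
  unfolding a_minus_def by (intro norm1_le.add norm1_le_uminus)

lemma norm1_le_scl_one: "norm1_le (scl c \<one>) (norm c)"
  using norm1_le.unit[OF unitary_one, of c "norm c"] by simp

definition geom :: "complex \<Rightarrow> 'a \<Rightarrow> nat \<Rightarrow> 'a" where
  "geom c u N = (\<Oplus>j\<in>{..<N}. scl (c ^ j) (u [^] j))"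

lemma geom_closed: "u \<in> carrier A \<Longrightarrow> geom c u N \<in> carrier A"
  unfolding geom_def by (intro finsum_closed) (auto simp: scl_closed)

lemma geom_Suc: "u \<in> carrier A \<Longrightarrow> geom c u (Suc N) = geom c u N \<oplus> scl (c ^ N) (u [^] N)"
  unfolding geom_def lessThan_Suc by (subst finsum_insert) (auto simp: scl_closed a_comm)

lemma geom_0: "geom c u 0 = \<zero>"
  by (simp add: geom_def)

lemma scl_mult: "x \<in> carrier A \<Longrightarrow> y \<in> carrier A \<Longrightarrow> scl c x \<otimes> scl d y = scl (c * d) (x \<otimes> y)"
  by (simp add: scl_mult_left scl_mult_right scl_scl scl_closed mult.commute)

text \<open>The partial sums invert \<open>1 - c u\<close> up to the term \<open>c\<^sup>N u\<^sup>N\<close>.\<close>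

lemma geom_telescope:
  assumes u: "u \<in> carrier A"
  shows "scl c u \<otimes> geom c u N = geom c u N \<ominus> \<one> \<oplus> scl (c ^ N) (u [^] N)"
    and "geom c u N \<otimes> scl c u = geom c u N \<ominus> \<one> \<oplus> scl (c ^ N) (u [^] N)"
proof -
  have g: "geom c u M \<in> carrier A" "scl d (u [^] (M::nat)) \<in> carrier A" for M d
    using u by (auto simp: geom_closed scl_closed)
  have cu: "scl c u \<in> carrier A" using u by (simp add: scl_closed)
  have comm: "u \<otimes> u [^] (N::nat) = u [^] N \<otimes> u" for N
    using u by (metis nat_pow_Suc nat_pow_Suc2)
  show "scl c u \<otimes> geom c u N = geom c u N \<ominus> \<one> \<oplus> scl (c ^ N) (u [^] N)"
  proof (induction N)
    case 0
    show ?case using u by (simp add: geom_0 scl_closed scl_one a_minus_def l_neg)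
  next
    case (Suc N)
    have "scl c u \<otimes> geom c u (Suc N) = scl c u \<otimes> geom c u N \<oplus> scl c u \<otimes> scl (c ^ N) (u [^] N)"
      using g cu u by (simp add: geom_Suc r_distr)
    also have "scl c u \<otimes> scl (c ^ N) (u [^] N) = scl (c ^ Suc N) (u [^] Suc N)"
      using u comm by (simp add: scl_mult)
    also have "scl c u \<otimes> geom c u N = geom c u (Suc N) \<ominus> \<one>"
      unfolding Suc geom_Suc[OF u] a_minus_def using g u by (simp add: a_ac)
    finally show ?case .
  qed
  show "geom c u N \<otimes> scl c u = geom c u N \<ominus> \<one> \<oplus> scl (c ^ N) (u [^] N)"
  proof (induction N)
    case 0
    show ?case using u by (simp add: geom_0 scl_closed scl_one a_minus_def l_neg)
  next
    case (Suc N)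
    have "geom c u (Suc N) \<otimes> scl c u = geom c u N \<otimes> scl c u \<oplus> scl (c ^ N) (u [^] N) \<otimes> scl c u"
      using g cu u by (simp add: geom_Suc l_distr)
    also have "scl (c ^ N) (u [^] N) \<otimes> scl c u = scl (c ^ Suc N) (u [^] Suc N)"
      using u by (simp add: scl_mult mult.commute)
    also have "geom c u N \<otimes> scl c u = geom c u (Suc N) \<ominus> \<one>"
      unfolding Suc geom_Suc[OF u] a_minus_def using g u by (simp add: a_ac)
    finally show ?case .
  qed
qed

lemma state_geom: "u \<in> carrier A \<Longrightarrow> \<phi> (geom c u N) = (\<Sum>j<N. \<phi> (u [^] j) * c ^ j)"
proof (induction N)
  case 0
  show ?case by (simp add: geom_0 state_zero)
next
  case (Suc N)
  then show ?case by (simp add: geom_Suc state_add state_scl geom_closed scl_closed mult.commute)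
qed

lemma norm1_le_pow: "norm1_le x K \<Longrightarrow> norm1_le (x [^] (n::nat)) (K ^ n)"
proof (induction n)
  case 0
  show ?case using norm1_le_unitary[OF unitary_one] by simp
next
  case (Suc n)
  then show ?case using norm1_le_mult[of "x [^] n" "K ^ n" x K] by (simp add: mult.commute)
qed

lemma norm1_le_scl_pow: "norm1_le x K \<Longrightarrow> norm1_le (scl (c ^ n) (x [^] (n::nat))) ((norm c * K) ^ n)"
  using norm1_le_scl[OF norm1_le_pow[of x K n], of "c ^ n"] by (simp add: norm_power power_mult_distrib)

lemma norm1_le_geom_part: "norm1_le x K \<Longrightarrow> norm1_le (geom c x N) (\<Sum>j<N. (norm c * K) ^ j)"
proof (induction N)
  case 0
  show ?case by (simp add: geom_0 norm1_le_zero)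
next
  case (Suc N)
  then have "norm1_le (geom c x N \<oplus> scl (c ^ N) (x [^] N)) ((\<Sum>j<N. (norm c * K) ^ j) + (norm c * K) ^ N)"
    by (intro norm1_le.add norm1_le_scl_pow) auto
  then show ?case using Suc by (simp add: geom_Suc norm1_le_closed)
qed

lemma sum_geom_le:
  fixes t :: real
  assumes "0 \<le> t" "t < 1" shows "(\<Sum>j<N. t ^ j) \<le> 1 / (1 - t)"
  using assms by (subst sum_gp_strict) (auto intro!: divide_right_mono)

lemma norm1_le_geom: "norm1_le x K \<Longrightarrow> norm c * K < 1 \<Longrightarrow> norm1_le (geom c x N) (1 / (1 - norm c * K))"
  using norm1_le_nonneg by (intro norm1_le_mono[OF norm1_le_geom_part sum_geom_le]) auto

lemma norm1_le_geom_unitary: "unitary u \<Longrightarrow> norm c < 1 \<Longrightarrow> norm1_le (geom c u N) (1 / (1 - norm c))"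
  using norm1_le_geom[OF norm1_le_unitary, of u c N] by simp

text \<open>The moments of a unitary are positive definite: up to an error of size \<open>\<bar>z\<bar>\<^sup>N\<close>, a multiple of
  \<open>\<phi> (y\<^sup>* y)\<close> with \<open>y = \<Sum>\<^bsub>j<N\<^esub> z\<^sup>j u\<^sup>j\<close> equals \<open>2 Re \<phi> y - 1\<close>.\<close>

lemma Re_moment_series_nonneg:
  assumes u: "unitary u" and z: "norm z < 1"
  shows "Re (2 * suminf (\<lambda>k. \<phi> (u [^] k) * z ^ k) - 1) \<ge> 0"
proof -
  have uc: "u \<in> carrier A" "star u \<in> carrier A" "star u \<otimes> u = \<one>" using u by (auto simp: unitary_def star_closed)
  let ?y = "geom z u"
  have yc: "?y N \<in> carrier A" for N using uc by (simp add: geom_closed)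
  have b: "norm (\<phi> (u [^] k)) \<le> 1" for k :: nat by (intro norm_state_unitary unitary_pow u)
  have sum: "summable (\<lambda>k. \<phi> (u [^] k) * z ^ k)" by (rule summable_bounded_coeffs[OF b z])
  have lim: "(\<lambda>N. Re (2 * \<phi> (?y N) - 1)) \<longlonglongrightarrow> Re (2 * suminf (\<lambda>k. \<phi> (u [^] k) * z ^ k) - 1)"
    using summable_LIMSEQ[OF sum] unfolding state_geom[OF uc(1)] by (intro tendsto_intros)
  define K where "K = 1 / (1 - norm z) + 1"
  have low: "norm z ^ N * (2 * K) + norm z ^ N * norm z ^ N + Re (2 * \<phi> (?y N) - 1) \<ge> 0" for N
  proof -
    define e where "e = scl (z ^ N) (u [^] N)"
    define t where "t = ?y N \<ominus> \<one>"
    have ec: "e \<in> carrier A" "star e \<in> carrier A" "t \<in> carrier A" "star t \<in> carrier A"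
      using uc yc by (auto simp: e_def t_def scl_closed star_closed)
    have en: "norm1_le e (norm z ^ N)"
      unfolding e_def by (intro norm1_le.unit unitary_pow u) (simp add: norm_power)
    have zu: "scl z u \<otimes> ?y N = t \<oplus> e" using geom_telescope(1)[OF uc(1)] by (simp add: e_def t_def)
    define p where "p = \<phi> (star (?y N) \<otimes> ?y N)"
    have p: "p \<in> \<real>\<^sub>\<ge>\<^sub>0" unfolding p_def by (rule state_pos[OF yc])
    have sy: "star (?y N) \<in> carrier A" by (rule star_closed[OF yc])
    have "\<phi> (star (scl z u \<otimes> ?y N) \<otimes> (scl z u \<otimes> ?y N)) = (cnj z * z) * p"
    proof -
      have "star (scl z u \<otimes> ?y N) \<otimes> (scl z u \<otimes> ?y N)
          = scl (cnj z * z) (star (?y N) \<otimes> (star u \<otimes> u) \<otimes> ?y N)"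
        using uc(1,2) sy yc[of N]
        by (simp add: star_mult star_scl scl_closed scl_mult_left scl_mult_right scl_scl m_assoc mult.commute)
      then show ?thesis using uc sy yc[of N] by (simp add: state_scl p_def)
    qed
    then have 1: "(cnj z * z) * p = \<phi> (star t \<otimes> t) + \<phi> (star t \<otimes> e) + (\<phi> (star e \<otimes> t) + \<phi> (star e \<otimes> e))"
    proof -
      have "star (t \<oplus> e) \<otimes> (t \<oplus> e) = star t \<otimes> t \<oplus> star t \<otimes> e \<oplus> (star e \<otimes> t \<oplus> star e \<otimes> e)"
        using ec by (simp add: star_add l_distr r_distr a_ac)
      then have "\<phi> (star (t \<oplus> e) \<otimes> (t \<oplus> e)) = \<phi> (star t \<otimes> t) + \<phi> (star t \<otimes> e) + (\<phi> (star e \<otimes> t) + \<phi> (star e \<otimes> e))"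
        using ec by (simp only: state_add m_closed a_closed)
      then show ?thesis using \<open>\<phi> (star (scl z u \<otimes> ?y N) \<otimes> (scl z u \<otimes> ?y N)) = (cnj z * z) * p\<close> zu by simp
    qed
    have "star t \<otimes> t = star (?y N) \<otimes> ?y N \<ominus> star (?y N) \<ominus> ?y N \<oplus> \<one>"
    proof -
      have "star t = star (?y N) \<ominus> \<one>"
        unfolding t_def using yc[of N] scl_minus_one[of \<one>]
        by (metis a_minus_def one_closed star_add star_one star_scl add.inv_closed complex_cnj_minus complex_cnj_one)
      then show ?thesis unfolding t_def a_minus_def using yc[of N] sy
        by (simp add: l_distr r_distr l_minus r_minus a_ac minus_add minus_minus)
    qed
    then have 2: "\<phi> (star t \<otimes> t) = p - cnj (\<phi> (?y N)) - \<phi> (?y N) + 1"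
      using yc[of N] sy by (simp add: state_add state_minus state_one state_star p_def)
    have 3: "\<phi> (star t \<otimes> e) = cnj (\<phi> (star e \<otimes> t))"
      using ec state_star[of "star e \<otimes> t"] by (simp add: star_mult star_star)
    have sn: "norm1_le (star e) (norm z ^ N)"
    proof -
      have "star e = scl (cnj (z ^ N)) (star (u [^] N))" unfolding e_def using uc(1) by (simp add: star_scl)
      then show ?thesis
        by (simp only:) (intro norm1_le.unit unitary_star unitary_pow u, simp add: norm_power)
    qed
    have "norm1_le t K"
      unfolding t_def K_def by (intro norm1_le_minus norm1_le_geom_unitary u z norm1_le_unitary unitary_one)
    then have 4: "norm (\<phi> (star e \<otimes> t)) \<le> norm z ^ N * K"
      by (intro norm1_le_state norm1_le_mult sn)
    have 5: "norm (\<phi> (star e \<otimes> e)) \<le> norm z ^ N * norm z ^ N"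
      by (intro norm1_le_state norm1_le_mult sn en)
    have pr: "p = of_real (Re p)" "Re p \<ge> 0" using p by (auto simp: complex_nonneg_Reals_iff complex_eq_iff)
    have zz: "cnj z * z = of_real ((norm z)\<^sup>2)" using complex_norm_square[of z] by (simp add: mult.commute)
    have "Re ((cnj z * z) * p) = (norm z)\<^sup>2 * Re p" unfolding zz by simp
    moreover have "Re ((cnj z * z) * p) = Re p - Re (2 * \<phi> (?y N) - 1) + 2 * Re (\<phi> (star e \<otimes> t)) + Re (\<phi> (star e \<otimes> e))"
      unfolding 1 2 3 by simp
    moreover have "(norm z)\<^sup>2 * Re p \<le> 1 * Re p"
      using z pr by (intro mult_right_mono) (auto simp: abs_square_le_1)
    moreover have "Re (\<phi> (star e \<otimes> t)) \<ge> - (norm z ^ N * K)" "Re (\<phi> (star e \<otimes> e)) \<ge> - (norm z ^ N * norm z ^ N)"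
      using 4 5 abs_Re_le_cmod[of "\<phi> (star e \<otimes> t)"] abs_Re_le_cmod[of "\<phi> (star e \<otimes> e)"] by linarith+
    ultimately show ?thesis by linarith
  qed
  have "(\<lambda>N. norm z ^ N * (2 * K) + norm z ^ N * norm z ^ N + Re (2 * \<phi> (?y N) - 1))
      \<longlonglongrightarrow> 0 * (2 * K) + 0 * 0 + Re (2 * suminf (\<lambda>k. \<phi> (u [^] k) * z ^ k) - 1)"
    using z by (intro tendsto_intros lim LIMSEQ_realpow_zero) auto
  from LIMSEQ_le_const[OF this, of 0] low show ?thesis by auto
qed

subsection \<open>Sequences up to negligible errors\<close>

text \<open>A resolvent \<open>(1 - c x)\<^sup>-\<^sup>1\<close> need not lie in the algebra, since no completeness is available. It is replaced
  by the sequence of partial sums of its geometric series, and identities between resolvents become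
  identities of bounded sequences up to an \<open>\<ell>\<^sup>1\<close>-error that tends to \<open>0\<close>.\<close>

definition bdd_seq :: "(nat \<Rightarrow> 'a) \<Rightarrow> bool" where
  "bdd_seq X \<longleftrightarrow> (\<exists>C. \<forall>N. norm1_le (X N) C)"

definition approx :: "(nat \<Rightarrow> 'a) \<Rightarrow> (nat \<Rightarrow> 'a) \<Rightarrow> bool" where
  "approx X Y \<longleftrightarrow> (\<exists>C. C \<longlonglongrightarrow> (0::real) \<and> (\<forall>N. norm1_le (X N \<ominus> Y N) (C N)))"

lemma bdd_seqI: "(\<And>N. norm1_le (X N) C) \<Longrightarrow> bdd_seq X"
  by (auto simp: bdd_seq_def)

lemma bdd_seq_closed: "bdd_seq X \<Longrightarrow> X N \<in> carrier A"
  by (auto simp: bdd_seq_def intro: norm1_le_closed)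

lemma bdd_seq_mult: "bdd_seq X \<Longrightarrow> bdd_seq Y \<Longrightarrow> bdd_seq (\<lambda>N. X N \<otimes> Y N)"
  unfolding bdd_seq_def by (metis norm1_le_mult)

lemma bdd_seq_minus: "bdd_seq X \<Longrightarrow> bdd_seq Y \<Longrightarrow> bdd_seq (\<lambda>N. X N \<ominus> Y N)"
  unfolding bdd_seq_def by (metis norm1_le_minus)

lemma bdd_seq_scl: "bdd_seq X \<Longrightarrow> bdd_seq (\<lambda>N. scl c (X N))"
  unfolding bdd_seq_def by (metis norm1_le_scl)

lemma bdd_seq_unitary: "unitary w \<Longrightarrow> bdd_seq (\<lambda>_. w)"
  unfolding bdd_seq_def using norm1_le_unitary by blast

lemma approx_ofI:
  assumes "\<And>N. X N = Y N \<oplus> E N" "\<And>N. norm1_le (E N) (C N)" "C \<longlonglongrightarrow> 0" "\<And>N. Y N \<in> carrier A"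
  shows "approx X Y"
  unfolding approx_def
proof (intro exI[of _ C] conjI allI assms(3))
  fix N
  have "E N \<in> carrier A" using assms(2) norm1_le_closed by blast
  then have "X N \<ominus> Y N = E N"
    unfolding assms(1) using assms(4)[of N] by (simp add: a_minus_def a_ac r_neg r_neg1)
  then show "norm1_le (X N \<ominus> Y N) (C N)" using assms(2) by simp
qed

lemma approx_sym:
  assumes "approx X Y" "bdd_seq X" "bdd_seq Y" shows "approx Y X"
proof -
  obtain C where C: "C \<longlonglongrightarrow> 0" "\<And>N. norm1_le (X N \<ominus> Y N) (C N)" using assms(1) unfolding approx_def by blast
  have "Y N \<ominus> X N = \<ominus> (X N \<ominus> Y N)" for N
    using bdd_seq_closed[OF assms(2), of N] bdd_seq_closed[OF assms(3), of N] by (simp add: a_minus_def minus_add a_comm)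
  then have "norm1_le (Y N \<ominus> X N) (C N)" for N using norm1_le_uminus[OF C(2)[of N]] by simp
  then show ?thesis unfolding approx_def using C(1) by blast
qed

lemma approx_trans:
  assumes "approx X Y" "approx Y Z" "bdd_seq X" "bdd_seq Y" "bdd_seq Z" shows "approx X Z"
proof -
  obtain C where C: "C \<longlonglongrightarrow> 0" "\<And>N. norm1_le (X N \<ominus> Y N) (C N)" using assms(1) unfolding approx_def by blast
  obtain D where D: "D \<longlonglongrightarrow> 0" "\<And>N. norm1_le (Y N \<ominus> Z N) (D N)" using assms(2) unfolding approx_def by blast
  have "X N \<ominus> Z N = (X N \<ominus> Y N) \<oplus> (Y N \<ominus> Z N)" for N
    using assms(3-5)[THEN bdd_seq_closed, of N] by (simp add: a_minus_def a_ac r_neg1 r_neg2)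
  then have "norm1_le (X N \<ominus> Z N) (C N + D N)" for N using norm1_le.add[OF C(2)[of N] D(2)[of N]] by simp
  moreover have "(\<lambda>N. C N + D N) \<longlonglongrightarrow> 0" using tendsto_add[OF C(1) D(1)] by simp
  ultimately show ?thesis unfolding approx_def by blast
qed

lemma approx_mult_left:
  assumes "approx X Y" "bdd_seq X" "bdd_seq Y" "bdd_seq Z"
  shows "approx (\<lambda>N. Z N \<otimes> X N) (\<lambda>N. Z N \<otimes> Y N)"
proof -
  obtain C where C: "C \<longlonglongrightarrow> 0" "\<And>N. norm1_le (X N \<ominus> Y N) (C N)" using assms(1) unfolding approx_def by blast
  obtain D where D: "\<And>N. norm1_le (Z N) D" using assms(4) unfolding bdd_seq_def by blast
  have "Z N \<otimes> X N \<ominus> Z N \<otimes> Y N = Z N \<otimes> (X N \<ominus> Y N)" for N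
    using assms(2-4)[THEN bdd_seq_closed, of N] by (simp add: a_minus_def r_distr r_minus)
  then have "norm1_le (Z N \<otimes> X N \<ominus> Z N \<otimes> Y N) (D * C N)" for N using norm1_le_mult[OF D C(2)] by simp
  moreover have "(\<lambda>N. D * C N) \<longlonglongrightarrow> 0" using tendsto_mult_left[OF C(1), of D] by simp
  ultimately show ?thesis unfolding approx_def by blast
qed

lemma approx_mult_right:
  assumes "approx X Y" "bdd_seq X" "bdd_seq Y" "bdd_seq Z"
  shows "approx (\<lambda>N. X N \<otimes> Z N) (\<lambda>N. Y N \<otimes> Z N)"
proof -
  obtain C where C: "C \<longlonglongrightarrow> 0" "\<And>N. norm1_le (X N \<ominus> Y N) (C N)" using assms(1) unfolding approx_def by blast
  obtain D where D: "\<And>N. norm1_le (Z N) D" using assms(4) unfolding bdd_seq_def by blast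
  have "X N \<otimes> Z N \<ominus> Y N \<otimes> Z N = (X N \<ominus> Y N) \<otimes> Z N" for N
    using assms(2-4)[THEN bdd_seq_closed, of N] by (simp add: a_minus_def l_distr l_minus)
  then have "norm1_le (X N \<otimes> Z N \<ominus> Y N \<otimes> Z N) (C N * D)" for N using norm1_le_mult[OF C(2) D] by simp
  moreover have "(\<lambda>N. C N * D) \<longlonglongrightarrow> 0" using tendsto_mult_right[OF C(1), of D] by simp
  ultimately show ?thesis unfolding approx_def by blast
qed

lemma approx_state:
  assumes "approx X Y" "bdd_seq X" "bdd_seq Y"
  shows "(\<lambda>N. \<phi> (X N) - \<phi> (Y N)) \<longlonglongrightarrow> 0"
proof -
  obtain C where C: "C \<longlonglongrightarrow> 0" "\<And>N. norm1_le (X N \<ominus> Y N) (C N)" using assms(1) unfolding approx_def by blast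
  have "norm (\<phi> (X N) - \<phi> (Y N)) \<le> C N" for N
    using norm1_le_state[OF C(2)[of N]] assms(2,3)[THEN bdd_seq_closed, of N] by (simp add: state_minus)
  then show ?thesis by (intro Lim_null_comparison[OF always_eventually C(1)] allI)
qed

subsection \<open>Freeness\<close>

lemma star_subalgebra_carrier: "star_subalgebra (carrier A)"
  by (auto simp: star_subalgebra_def scl_closed star_closed)

lemma star_subalgebra_gen:
  assumes "S \<subseteq> carrier A" shows "star_subalgebra (star_algebra_gen S)"
proof -
  have "star_algebra_gen S \<subseteq> carrier A"
    unfolding star_algebra_gen_def using star_subalgebra_carrier assms by blast
  then show ?thesis
    unfolding star_subalgebra_def[of "star_algebra_gen S"] unfolding star_algebra_gen_def
    by (auto simp: star_subalgebra_def)
qed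

lemma geom_in_gen:
  assumes "u \<in> carrier A" shows "geom c u N \<in> star_algebra_gen {u}"
proof -
  have B: "star_subalgebra (star_algebra_gen {u})" using assms by (intro star_subalgebra_gen) auto
  have u: "u \<in> star_algebra_gen {u}" by (auto simp: star_algebra_gen_def)
  have one: "\<one> \<in> star_algebra_gen {u}" using B by (simp add: star_subalgebra_def)
  have pow: "u [^] (n::nat) \<in> star_algebra_gen {u}" for n
    by (induction n) (use B u one in \<open>auto simp: star_subalgebra_def\<close>)
  show ?thesis
  proof (induction N)
    case 0
    have "scl 0 \<one> \<in> star_algebra_gen {u}" using B one unfolding star_subalgebra_def by blast
    then show ?case by (simp add: geom_0 scl_zero)
  next
    case (Suc N)
    have "scl (c ^ N) (u [^] N) \<in> star_algebra_gen {u}" using B pow unfolding star_subalgebra_def by blast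
    then have "geom c u N \<oplus> scl (c ^ N) (u [^] N) \<in> star_algebra_gen {u}"
      using B Suc unfolding star_subalgebra_def by blast
    then show ?case using assms by (simp add: geom_Suc)
  qed
qed

definition centr :: "'a \<Rightarrow> 'a" where
  "centr x = x \<oplus> scl (- \<phi> x) \<one>"

lemma centr_closed: "x \<in> carrier A \<Longrightarrow> centr x \<in> carrier A"
  by (simp add: centr_def scl_closed)

lemma state_centr: "x \<in> carrier A \<Longrightarrow> \<phi> (centr x) = 0"
  by (simp add: centr_def state_add state_scl state_one scl_closed)

lemma centr_decomp: "x \<in> carrier A \<Longrightarrow> x = centr x \<oplus> scl (\<phi> x) \<one>"
proof -
  assume x: "x \<in> carrier A"
  have "scl (- \<phi> x) \<one> \<oplus> scl (\<phi> x) \<one> = \<zero>"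
    using scl_add_left[of \<one> "- \<phi> x" "\<phi> x"] scl_zero[of \<one>] by simp
  then show ?thesis using x by (simp add: centr_def a_assoc scl_closed)
qed

lemma centr_add:
  assumes "x \<in> carrier A" "y \<in> carrier A" shows "centr (x \<oplus> y) = centr x \<oplus> centr y"
proof -
  have "- \<phi> (x \<oplus> y) = - \<phi> x + - \<phi> y" using assms by (simp add: state_add)
  then have "scl (- \<phi> (x \<oplus> y)) \<one> = scl (- \<phi> x) \<one> \<oplus> scl (- \<phi> y) \<one>"
    using scl_add_left[of \<one> "- \<phi> x" "- \<phi> y"] by simp
  then show ?thesis using assms by (simp add: centr_def scl_closed a_ac)
qed

lemma centr_in_gen:
  assumes "S \<subseteq> carrier A" "x \<in> star_algebra_gen S" shows "centr x \<in> star_algebra_gen S"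
proof -
  have B: "star_subalgebra (star_algebra_gen S)" by (rule star_subalgebra_gen[OF assms(1)])
  then have "scl (- \<phi> x) \<one> \<in> star_algebra_gen S" unfolding star_subalgebra_def by blast
  then show ?thesis using B assms(2) unfolding centr_def star_subalgebra_def by blast
qed

fun alt_word :: "'a \<Rightarrow> 'a \<Rightarrow> bool \<Rightarrow> nat \<Rightarrow> (bool \<times> 'a) list" where
  "alt_word x y b 0 = []"
| "alt_word x y b (Suc n) = (b, if b then x else y) # alt_word x y (\<not> b) n"

definition alt_prod :: "'a \<Rightarrow> 'a \<Rightarrow> bool \<Rightarrow> nat \<Rightarrow> 'a" where
  "alt_prod x y b n = foldr (\<otimes>) (map snd (alt_word x y b n)) \<one>"

lemma alt_prod_simps:
  "alt_prod x y b 0 = \<one>"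
  "alt_prod x y b (Suc n) = (if b then x else y) \<otimes> alt_prod x y (\<not> b) n"
  by (simp_all add: alt_prod_def)

lemma alt_word_distinct_adj: "distinct_adj (map fst (alt_word x y b n))"
proof (induction n arbitrary: b)
  case (Suc n)
  from Suc[of "\<not> b"] show ?case by (cases n) auto
qed simp

lemma alt_word_set: "(i, c) \<in> set (alt_word x y b n) \<Longrightarrow> c = (if i then x else y)"
  by (induction n arbitrary: b) auto

lemma state_alt_prod:
  assumes "free_elements u v" "x \<in> star_algebra_gen {u}" "y \<in> star_algebra_gen {v}" "\<phi> x = 0" "\<phi> y = 0" "n > 0"
  shows "\<phi> (alt_prod x y b n) = 0"
proof -
  have "alt_word x y b n \<noteq> []" using assms(6) by (cases n) auto
  moreover have "\<forall>(i, c)\<in>set (alt_word x y b n). c \<in> (if i then star_algebra_gen {u} else star_algebra_gen {v}) \<and> \<phi> c = 0"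
    using assms(2-5) by (auto dest!: alt_word_set)
  ultimately show ?thesis
    using assms(1) alt_word_distinct_adj unfolding free_elements_def free_family_def alt_prod_def by blast
qed

lemma alt_prod_even: "x \<in> carrier A \<Longrightarrow> y \<in> carrier A \<Longrightarrow> alt_prod x y True (2 * j) = (x \<otimes> y) [^] j"
proof (induction j)
  case (Suc j)
  have "alt_prod x y True (2 * Suc j) = x \<otimes> (y \<otimes> alt_prod x y True (2 * j))" by (simp add: alt_prod_simps)
  also have "\<dots> = (x \<otimes> y) \<otimes> (x \<otimes> y) [^] j" using Suc by (simp add: m_assoc)
  finally show ?case using Suc nat_pow_Suc2[of "x \<otimes> y" j] by simp
qed (simp add: alt_prod_simps)

lemma alt_prod_odd: "x \<in> carrier A \<Longrightarrow> y \<in> carrier A \<Longrightarrow> alt_prod x y True (2 * j + 1) = (x \<otimes> y) [^] j \<otimes> x"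
proof (induction j)
  case (Suc j)
  have "alt_prod x y True (2 * Suc j + 1) = x \<otimes> (y \<otimes> alt_prod x y True (2 * j + 1))" by (simp add: alt_prod_simps)
  also have "\<dots> = (x \<otimes> y) \<otimes> (x \<otimes> y) [^] j \<otimes> x" using Suc by (simp add: m_assoc)
  finally show ?case using Suc nat_pow_Suc2[of "x \<otimes> y" j] by simp
qed (simp add: alt_prod_simps)

text \<open>Centering removes the leading term \<open>1\<close> of the geometric series, so the bound is small for small \<open>c\<close>.\<close>

lemma norm1_le_centr_geom:
  assumes u: "unitary u" and c: "norm c < 1"
  shows "norm1_le (centr (geom c u N)) (2 * norm c / (1 - norm c))"
proof -
  have uc: "u \<in> carrier A" using u by (simp add: unitary_def)
  have z: "0 \<le> 2 * norm c / (1 - norm c)" using c by simp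
  have step: "norm1_le (centr (geom c u (Suc N))) (2 * (\<Sum>j<N. norm c ^ Suc j))" for N
  proof (induction N)
    case 0
    have "geom c u (Suc 0) = \<one>" using uc by (simp add: geom_Suc geom_0 scl_one)
    then have "centr (geom c u (Suc 0)) = \<zero>" by (simp add: centr_def state_one scl_minus_one r_neg)
    then show ?case by (simp add: norm1_le_zero)
  next
    case (Suc N)
    define x where "x = scl (c ^ Suc N) (u [^] Suc N)"
    have xc: "x \<in> carrier A" "geom c u (Suc N) \<in> carrier A" using uc by (auto simp: x_def scl_closed geom_closed)
    have xn: "norm1_le x (norm c ^ Suc N)"
      unfolding x_def by (intro norm1_le.unit unitary_pow u) (simp only: norm_power)
    have "norm (- \<phi> x) \<le> norm c ^ Suc N" using norm1_le_state[OF xn] by simp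
    then have "norm1_le (scl (- \<phi> x) \<one>) (norm c ^ Suc N)" by (intro norm1_le.unit unitary_one)
    then have "norm1_le (centr x) (norm c ^ Suc N + norm c ^ Suc N)"
      unfolding centr_def by (intro norm1_le.add xn)
    then have "norm1_le (centr (geom c u (Suc N)) \<oplus> centr x) (2 * (\<Sum>j<N. norm c ^ Suc j) + (norm c ^ Suc N + norm c ^ Suc N))"
      by (intro norm1_le.add Suc)
    moreover have "centr (geom c u (Suc (Suc N))) = centr (geom c u (Suc N)) \<oplus> centr x"
    proof -
      have "geom c u (Suc (Suc N)) = geom c u (Suc N) \<oplus> x" using uc by (simp only: geom_Suc x_def)
      then show ?thesis using xc by (simp add: centr_add)
    qed
    ultimately show ?case by (simp add: algebra_simps)
  qed
  have le: "2 * (\<Sum>j<N. norm c ^ Suc j) \<le> 2 * norm c / (1 - norm c)" for N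
    using mult_left_mono[OF sum_geom_le[of "norm c" N], of "2 * norm c"] c
    by (simp add: sum_distrib_left mult_ac)
  show ?thesis
  proof (cases N)
    case 0
    have "centr (geom c u N) = \<zero>" by (simp add: 0 geom_0 centr_def state_zero scl_zero)
    then show ?thesis using norm1_le_mono[OF norm1_le_zero z] by simp
  next
    case (Suc M)
    then show ?thesis using norm1_le_mono[OF step le] by simp
  qed
qed

lemma minus_telescope:
  assumes "x \<in> carrier A" "y \<in> carrier A" "e \<in> carrier A"
  shows "x \<ominus> (x \<ominus> y \<oplus> e) = y \<oplus> \<ominus> e"
proof -
  have "x \<ominus> (x \<ominus> y \<oplus> e) = (x \<oplus> \<ominus> x) \<oplus> (y \<oplus> \<ominus> e)"
    using assms by (simp add: a_minus_def minus_add a_ac)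
  then show ?thesis using assms by (simp add: r_neg)
qed

text \<open>Combinations of \<open>x y\<close>, \<open>x\<close>, \<open>y\<close> and \<open>1\<close>, in which the products of the following computation take
  their values. Calculating with the four coefficients shows which of them cancel.\<close>

definition comb4 :: "'a \<Rightarrow> 'a \<Rightarrow> complex \<Rightarrow> complex \<Rightarrow> complex \<Rightarrow> complex \<Rightarrow> 'a" where
  "comb4 x y a b c d = scl a (x \<otimes> y) \<oplus> (scl b x \<oplus> (scl c y \<oplus> scl d \<one>))"

context
  fixes x y assumes xy: "x \<in> carrier A" "y \<in> carrier A"
begin

lemma comb4_closed: "comb4 x y a b c d \<in> carrier A"
  using xy by (simp add: comb4_def scl_closed)

lemma comb4_add:
  "comb4 x y a b c d \<oplus> comb4 x y a' b' c' d' = comb4 x y (a + a') (b + b') (c + c') (d + d')"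
  using xy by (simp add: comb4_def scl_closed scl_add_left a_ac)

lemma comb4_scl: "scl e (comb4 x y a b c d) = comb4 x y (e * a) (e * b) (e * c) (e * d)"
  using xy by (simp add: comb4_def scl_closed scl_add_right scl_scl)

lemma comb4_minus:
  "comb4 x y a b c d \<ominus> comb4 x y a' b' c' d' = comb4 x y (a - a') (b - b') (c - c') (d - d')"
proof -
  have "\<ominus> comb4 x y a' b' c' d' = comb4 x y (- a') (- b') (- c') (- d')"
    using scl_minus_one[OF comb4_closed, of a' b' c' d'] comb4_scl[of "-1" a' b' c' d'] by simp
  then show ?thesis unfolding a_minus_def by (simp add: comb4_add)
qed

lemma comb4_prod: "(x \<oplus> scl a \<one>) \<otimes> (y \<oplus> scl b \<one>) = comb4 x y 1 b a (a * b)"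
  using xy by (simp add: comb4_def scl_closed l_distr r_distr scl_mult_left scl_mult_right scl_scl scl_one scl_add_right a_ac mult.commute)

end

text \<open>Haagerup's computation of the S-transform of a product. With \<open>f = (1 - \<alpha> u)\<^sup>-\<^sup>1\<close>,
  \<open>g = (1 - \<beta> v)\<^sup>-\<^sup>1\<close>, \<open>\<phi> f = \<phi> g = 1 + s\<close> and \<open>w = \<alpha> \<beta> (1 + s) / s\<close>, the terms linear in the
  centred parts \<open>f'\<close>, \<open>g'\<close> cancel in \<open>f (1 - w u v) g = (1 + s) - f' g' / s\<close>, so that by freeness
  \<open>\<phi> ((1 - w u v)\<^sup>-\<^sup>1) = \<phi> (g ((1 + s) - f' g' / s)\<^sup>-\<^sup>1 f) = 1 + s\<close>. All inverses are replaced by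
  partial sums of geometric series; \<open>small\<close> makes the one for \<open>1 - f' g' / (s (1 + s))\<close> converge.\<close>

theorem free_product_resolvent:
  assumes u: "unitary u" and v: "unitary v" and free: "free_elements u v"
    and \<alpha>: "norm \<alpha> < 1" and \<beta>: "norm \<beta> < 1" and s: "s \<noteq> 0" "s \<noteq> -1"
    and Fu: "(\<lambda>j. \<phi> (u [^] j) * \<alpha> ^ j) sums (1 + s)"
    and Fv: "(\<lambda>j. \<phi> (v [^] j) * \<beta> ^ j) sums (1 + s)"
    and small: "norm (1 / (s * (1 + s))) * ((2 * norm \<alpha> / (1 - norm \<alpha>)) * (2 * norm \<beta> / (1 - norm \<beta>))) \<le> 1 / 2"
    and w: "w = \<alpha> * \<beta> * ((1 + s) / s)" "norm w < 1"
  shows "(\<lambda>k. \<phi> ((u \<otimes> v) [^] k) * w ^ k) sums (1 + s)"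
proof -
  have c: "u \<in> carrier A" "v \<in> carrier A" "u \<otimes> v \<in> carrier A" using u v by (auto simp: unitary_def)
  have uv: "unitary (u \<otimes> v)" by (rule unitary_mult[OF u v])
  define f where "f = geom \<alpha> u"
  define g where "g = geom \<beta> v"
  define p where "p N = \<phi> (f N)" for N
  define q where "q N = \<phi> (g N)" for N
  define x where "x N = centr (f N)" for N
  define y where "y N = centr (g N)" for N
  define c0 where "c0 = 1 / (s * (1 + s))"
  define T where "T N = geom c0 (x N \<otimes> y N) N" for N
  define R where "R N = geom w (u \<otimes> v) N" for N
  define d where "d = \<one> \<ominus> scl w (u \<otimes> v)"
  have p: "p \<longlonglongrightarrow> 1 + s"
    using Fu unfolding sums_def p_def f_def state_geom[OF c(1)] .
  have q: "q \<longlonglongrightarrow> 1 + s"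
    using Fv unfolding sums_def q_def g_def state_geom[OF c(2)] .
  have fc: "f N \<in> carrier A" "g N \<in> carrier A" "x N \<in> carrier A" "y N \<in> carrier A" for N
    using c by (auto simp: f_def g_def x_def y_def geom_closed centr_closed)
  have fx: "f N = x N \<oplus> scl (p N) \<one>" "g N = y N \<oplus> scl (q N) \<one>" for N
    using centr_decomp[OF fc(1)] centr_decomp[OF fc(2)] by (auto simp: x_def y_def p_def q_def)
  have nz: "\<alpha> \<noteq> 0" "\<beta> \<noteq> 0"
  proof -
    have "t \<noteq> 0" if "(\<lambda>j. \<phi> (r [^] j) * t ^ j) sums (1 + s)" "r \<in> carrier A" for t r
    proof
      assume "t = 0"
      then have "(\<lambda>j. \<phi> (r [^] j) * t ^ j) = (\<lambda>j. if j = 0 then \<phi> (r [^] j) else 0)" by (auto simp: fun_eq_iff)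
      then have "(\<lambda>j. \<phi> (r [^] j) * t ^ j) sums 1"
        using sums_single[of 0 "\<lambda>j. \<phi> (r [^] j)"] that(2) by (simp add: state_one)
      then show False using that(1) s(1) by (auto dest: sums_unique2)
    qed
    then show "\<alpha> \<noteq> 0" "\<beta> \<noteq> 0" using Fu Fv c by blast+
  qed
  define K where "K = (2 * norm \<alpha> / (1 - norm \<alpha>)) * (2 * norm \<beta> / (1 - norm \<beta>))"
  have xyn: "norm1_le (x N \<otimes> y N) K" for N
    unfolding x_def y_def f_def g_def K_def by (intro norm1_le_mult norm1_le_centr_geom u v \<alpha> \<beta>)
  have cK: "norm c0 * K \<le> 1 / 2" "norm c0 * K < 1" "0 \<le> norm c0 * K"
  proof -
    show *: "norm c0 * K \<le> 1 / 2" using small by (simp only: c0_def K_def)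
    then show "norm c0 * K < 1" by linarith
    show "0 \<le> norm c0 * K" using norm1_le_nonneg[OF xyn] by (intro mult_nonneg_nonneg) auto
  qed
  have bf: "bdd_seq f" unfolding f_def by (rule bdd_seqI[OF norm1_le_geom_unitary[OF u \<alpha>]])
  have bg: "bdd_seq g" unfolding g_def by (rule bdd_seqI[OF norm1_le_geom_unitary[OF v \<beta>]])
  have bR: "bdd_seq R" unfolding R_def by (rule bdd_seqI[OF norm1_le_geom_unitary[OF uv w(2)]])
  have bT: "bdd_seq T" unfolding T_def by (rule bdd_seqI[OF norm1_le_geom[OF xyn cK(2)]])
  have bd: "bdd_seq (\<lambda>_. d)"
    unfolding d_def by (intro bdd_seq_minus bdd_seq_scl bdd_seq_unitary unitary_one uv)
  have b1: "bdd_seq (\<lambda>_. scl t \<one>)" for t by (intro bdd_seq_scl bdd_seq_unitary unitary_one)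
  have bx: "bdd_seq x" unfolding x_def f_def by (rule bdd_seqI[OF norm1_le_centr_geom[OF u \<alpha>]])
  have bxy: "bdd_seq (\<lambda>N. x N \<otimes> y N)" by (rule bdd_seqI[OF xyn])
  have dc: "d \<in> carrier A" using c by (simp add: d_def scl_closed a_minus_def)
  have gp: "(\<lambda>N. norm t ^ N) \<longlonglongrightarrow> 0" if "norm t < 1" for t :: complex
    using that by (intro LIMSEQ_realpow_zero) auto
  \<comment> \<open>\<open>f (1 - w u v) g\<close> up to negligible terms\<close>
  define c1 where "c1 = (1 + s) / s"
  have main: "approx (\<lambda>N. f N \<otimes> d \<otimes> g N) (\<lambda>N. comb4 (x N) (y N) (-1/s) 0 0 (1 + s))"
  proof -
    define e1 where "e1 N = scl (\<alpha> ^ N) (u [^] N)" for N :: nat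
    define e2 where "e2 N = scl (\<beta> ^ N) (v [^] N)" for N :: nat
    have e: "norm1_le (e1 N) (norm \<alpha> ^ N)" "norm1_le (e2 N) (norm \<beta> ^ N)" for N
      unfolding e1_def e2_def by (intro norm1_le.unit unitary_pow u v, simp add: norm_power)+
    have ec: "e1 N \<in> carrier A" "e2 N \<in> carrier A" for N using e norm1_le_closed by blast+
    have fm: "f N \<ominus> \<one> = x N \<oplus> scl (p N - 1) \<one>" "g N \<ominus> \<one> = y N \<oplus> scl (q N - 1) \<one>" for N
    proof -
      have "scl t \<one> \<oplus> \<ominus> \<one> = scl (t - 1) \<one>" for t
        using scl_add_left[of \<one> t "-1"] scl_minus_one[of \<one>] by simp
      then show "f N \<ominus> \<one> = x N \<oplus> scl (p N - 1) \<one>" "g N \<ominus> \<one> = y N \<oplus> scl (q N - 1) \<one>"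
        unfolding fx a_minus_def using fc[of N] by (simp_all add: a_assoc scl_closed)
    qed
    have fmc: "f N \<ominus> \<one> \<in> carrier A" "g N \<ominus> \<one> \<in> carrier A" for N using fc[of N] by (simp_all add: a_minus_def)
    have wc1: "w = c1 * (\<alpha> * \<beta>)" by (simp add: w c1_def mult_ac)
    have "f N \<otimes> d \<otimes> g N = f N \<otimes> g N \<ominus> scl c1 ((f N \<ominus> \<one> \<oplus> e1 N) \<otimes> (g N \<ominus> \<one> \<oplus> e2 N))" for N
    proof -
      have "f N \<otimes> d \<otimes> g N = f N \<otimes> g N \<ominus> f N \<otimes> scl w (u \<otimes> v) \<otimes> g N"
        using fc[of N] c by (simp add: d_def a_minus_def l_distr r_distr scl_closed l_minus r_minus)
      also have "f N \<otimes> scl w (u \<otimes> v) \<otimes> g N = scl c1 ((f N \<otimes> scl \<alpha> u) \<otimes> (scl \<beta> v \<otimes> g N))"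
        using fc[of N] c by (simp add: wc1 scl_closed scl_mult_left scl_mult_right scl_scl m_assoc mult_ac)
      also have "f N \<otimes> scl \<alpha> u = f N \<ominus> \<one> \<oplus> e1 N"
        unfolding f_def e1_def by (rule geom_telescope(2)[OF c(1)])
      also have "scl \<beta> v \<otimes> g N = g N \<ominus> \<one> \<oplus> e2 N"
        unfolding g_def e2_def by (rule geom_telescope(1)[OF c(2)])
      finally show ?thesis .
    qed
    moreover have "(f N \<ominus> \<one> \<oplus> e1 N) \<otimes> (g N \<ominus> \<one> \<oplus> e2 N)
       = (f N \<ominus> \<one>) \<otimes> (g N \<ominus> \<one>) \<oplus> (e1 N \<otimes> (g N \<ominus> \<one> \<oplus> e2 N) \<oplus> (f N \<ominus> \<one>) \<otimes> e2 N)" for N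
      using fmc[of N] ec[of N] by (simp add: l_distr r_distr a_ac)
    moreover have "scl c1 (a \<oplus> b) = scl c1 a \<oplus> scl c1 b" if "a \<in> carrier A" "b \<in> carrier A" for a b
      using that by (rule scl_add_right)
    ultimately have 1: "f N \<otimes> d \<otimes> g N = (f N \<otimes> g N \<ominus> scl c1 ((f N \<ominus> \<one>) \<otimes> (g N \<ominus> \<one>)))
        \<oplus> \<ominus> scl c1 (e1 N \<otimes> (g N \<ominus> \<one> \<oplus> e2 N) \<oplus> (f N \<ominus> \<one>) \<otimes> e2 N)" for N
      using fmc[of N] ec[of N] fc[of N] by (simp add: a_minus_def minus_add a_ac scl_closed)
    have 2: "f N \<otimes> g N \<ominus> scl c1 ((f N \<ominus> \<one>) \<otimes> (g N \<ominus> \<one>))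
       = comb4 (x N) (y N) (-1/s) 0 0 (1 + s) \<oplus>
         comb4 (x N) (y N) 0 (q N - c1 * (q N - 1)) (p N - c1 * (p N - 1)) (p N * q N - c1 * ((p N - 1) * (q N - 1)) - (1 + s))" for N
    proof -
      have "1 - c1 = - 1 / s" using s by (simp add: c1_def field_simps)
      then show ?thesis
        unfolding fm unfolding fx using fc[of N]
        by (simp add: comb4_prod comb4_scl comb4_minus comb4_add)
    qed
    define E where "E N = comb4 (x N) (y N) 0 (q N - c1 * (q N - 1)) (p N - c1 * (p N - 1)) (p N * q N - c1 * ((p N - 1) * (q N - 1)) - (1 + s))
      \<oplus> \<ominus> scl c1 (e1 N \<otimes> (g N \<ominus> \<one> \<oplus> e2 N) \<oplus> (f N \<ominus> \<one>) \<otimes> e2 N)" for N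
    obtain Bf Bg Bx where B: "\<And>N. norm1_le (f N) Bf" "\<And>N. norm1_le (g N) Bg" "\<And>N. norm1_le (x N) Bx"
      using bf bg bx unfolding bdd_seq_def by blast
    obtain By where By: "\<And>N. norm1_le (y N) By"
      using norm1_le_centr_geom[OF v \<beta>] unfolding y_def g_def by blast
    define C where "C N = (norm (0::complex) * K + (norm (q N - c1 * (q N - 1)) * Bx + (norm (p N - c1 * (p N - 1)) * By
        + norm (p N * q N - c1 * ((p N - 1) * (q N - 1)) - (1 + s)))))
        + norm c1 * (norm \<alpha> ^ N * (Bg + 1 + norm \<beta> ^ N) + (Bf + 1) * norm \<beta> ^ N)" for N
    have "norm1_le (E N) (C N)" for N
      unfolding E_def C_def comb4_def
      by (intro norm1_le.add norm1_le_uminus norm1_le_scl norm1_le_mult norm1_le_minus e B By xyn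
            norm1_le_scl_one norm1_le_unitary[OF unitary_one])
    moreover have "C \<longlonglongrightarrow> 0"
    proof -
      have "C \<longlonglongrightarrow> (norm (0::complex) * K + (norm ((1 + s) - c1 * ((1 + s) - 1)) * Bx + (norm ((1 + s) - c1 * ((1 + s) - 1)) * By
        + norm ((1 + s) * (1 + s) - c1 * (((1 + s) - 1) * ((1 + s) - 1)) - (1 + s)))))
        + norm c1 * (0 * (Bg + 1 + 0) + (Bf + 1) * 0)"
        unfolding C_def[abs_def] by (intro tendsto_intros p q gp \<alpha> \<beta>)
      moreover have z: "(1 + s) - c1 * ((1 + s) - 1) = 0" "(1 + s) * (1 + s) - c1 * (((1 + s) - 1) * ((1 + s) - 1)) - (1 + s) = 0"
        using s by (simp_all add: c1_def field_simps)
      ultimately show ?thesis unfolding z by simp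
    qed
    moreover have "f N \<otimes> d \<otimes> g N = comb4 (x N) (y N) (-1/s) 0 0 (1 + s) \<oplus> E N" for N
      unfolding 1 2 E_def using fc[of N] ec[of N] fmc[of N]
      by (subst a_assoc) (auto intro!: comb4_closed scl_closed)
    ultimately show ?thesis
      by (intro approx_ofI[where E = E and C = C]) (auto intro: comb4_closed fc)
  qed
  define M where "M N = comb4 (x N) (y N) (-1/s) 0 0 (1 + s)" for N
  have M_eq: "M N = scl (1 + s) (\<one> \<ominus> scl c0 (x N \<otimes> y N))" for N
  proof -
    have "scl (1 + s) (\<one> \<ominus> scl c0 (x N \<otimes> y N)) = scl (1 + s) (comb4 (x N) (y N) 0 0 0 1 \<ominus> comb4 (x N) (y N) c0 0 0 0)"
      using fc[of N] by (simp add: comb4_def scl_zero scl_one scl_closed)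
    also have "\<dots> = comb4 (x N) (y N) ((1 + s) * (0 - c0)) 0 0 (1 + s)"
      using fc[of N] by (simp add: comb4_minus comb4_scl)
    also have "(1 + s) * (0 - c0) = -1/s"
    proof -
      have "1 + s \<noteq> 0" using s(2) by (metis add.commute add_eq_0_iff)
      then have "(1 + s) * (1 / (s * (1 + s))) = 1 / s" by simp
      then show ?thesis by (simp add: c0_def)
    qed
    finally show ?thesis by (simp add: M_def)
  qed
  have bM: "bdd_seq M"
    unfolding M_eq by (intro bdd_seq_scl bdd_seq_minus bdd_seq_unitary unitary_one bxy)
  have bdg: "bdd_seq (\<lambda>N. f N \<otimes> d \<otimes> g N)" by (intro bdd_seq_mult bf bd bg)
  have TM: "approx (\<lambda>N. T N \<otimes> M N) (\<lambda>_. scl (1 + s) \<one>)"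
  proof (rule approx_ofI)
    fix N
    define r where "r = scl (c0 ^ N) ((x N \<otimes> y N) [^] N)"
    have xyc: "x N \<otimes> y N \<in> carrier A" using fc[of N] by simp
    have cc: "T N \<in> carrier A" "r \<in> carrier A" "scl c0 (x N \<otimes> y N) \<in> carrier A"
      using xyc by (auto simp: T_def r_def geom_closed scl_closed)
    have "T N \<otimes> (\<one> \<ominus> scl c0 (x N \<otimes> y N)) = T N \<ominus> (T N \<ominus> \<one> \<oplus> r)"
      using cc geom_telescope(2)[OF xyc, of c0 N] by (simp add: a_minus_def r_distr r_minus T_def r_def)
    also have "\<dots> = \<one> \<oplus> \<ominus> r"
      using cc by (intro minus_telescope) auto
    finally have "T N \<otimes> M N = scl (1 + s) (\<one> \<oplus> \<ominus> r)"
      unfolding M_eq using cc by (simp add: scl_mult_right a_minus_def)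
    then show "T N \<otimes> M N = scl (1 + s) \<one> \<oplus> scl (1 + s) (\<ominus> scl (c0 ^ N) ((x N \<otimes> y N) [^] N))"
      using cc by (simp add: scl_add_right r_def)
    show "norm1_le (scl (1 + s) (\<ominus> scl (c0 ^ N) ((x N \<otimes> y N) [^] N))) (norm (1 + s) * (norm c0 * K) ^ N)"
      by (intro norm1_le_scl norm1_le_uminus norm1_le_scl_pow xyn)
  next
    have "(\<lambda>N. norm (1 + s) * (norm c0 * K) ^ N) \<longlonglongrightarrow> norm (1 + s) * 0"
      using cK by (intro tendsto_intros LIMSEQ_realpow_zero) auto
    then show "(\<lambda>N. norm (1 + s) * (norm c0 * K) ^ N) \<longlonglongrightarrow> 0" by simp
  qed (simp add: scl_closed)
  \<comment> \<open>\<open>g T f\<close> inverts \<open>1 - w u v\<close> up to the factor \<open>1 + s\<close>\<close>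
  have b0: "bdd_seq (\<lambda>N. g N \<otimes> T N)" "bdd_seq (\<lambda>N. g N \<otimes> T N \<otimes> f N)" "bdd_seq (\<lambda>N. g N \<otimes> T N \<otimes> f N \<otimes> d)"
    by (intro bdd_seq_mult bg bT bf bd)+
  define h where "h = \<one> \<ominus> scl \<beta> v"
  have hc: "h \<in> carrier A" using c by (simp add: h_def scl_closed a_minus_def)
  have bh: "bdd_seq (\<lambda>_. h)" unfolding h_def by (intro bdd_seq_minus bdd_seq_scl bdd_seq_unitary unitary_one v)
  have geom_inv: "approx (\<lambda>N. geom t r N \<otimes> (\<one> \<ominus> scl t r)) (\<lambda>_. \<one>)"
    "approx (\<lambda>N. (\<one> \<ominus> scl t r) \<otimes> geom t r N) (\<lambda>_. \<one>)" if r: "unitary r" "norm t < 1" for t r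
  proof -
    have rc: "r \<in> carrier A" using r by (simp add: unitary_def)
    have gc: "geom t r N \<in> carrier A" "scl (t ^ N) (r [^] N) \<in> carrier A" for N
      using rc by (auto simp: geom_closed scl_closed)
    have sc: "scl t r \<in> carrier A" using rc by (simp add: scl_closed)
    have n: "norm1_le (\<ominus> scl (t ^ N) (r [^] N)) (norm t ^ N)" for N :: nat
      by (intro norm1_le_uminus norm1_le.unit unitary_pow r) (simp add: norm_power)
    have "geom t r N \<otimes> (\<one> \<ominus> scl t r) = geom t r N \<ominus> geom t r N \<otimes> scl t r" for N
      using gc[of N] sc by (simp add: a_minus_def r_distr r_minus)
    then have "geom t r N \<otimes> (\<one> \<ominus> scl t r) = \<one> \<oplus> \<ominus> scl (t ^ N) (r [^] N)" for N
      using gc[of N] minus_telescope[of "geom t r N" \<one> "scl (t ^ N) (r [^] N)"]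
      by (simp add: geom_telescope(2)[OF rc, of t N])
    then show "approx (\<lambda>N. geom t r N \<otimes> (\<one> \<ominus> scl t r)) (\<lambda>_. \<one>)"
      by (intro approx_ofI[OF _ n gp[OF r(2)]]) auto
    have "(\<one> \<ominus> scl t r) \<otimes> geom t r N = geom t r N \<ominus> scl t r \<otimes> geom t r N" for N
      using gc[of N] sc by (simp add: a_minus_def l_distr l_minus)
    then have "(\<one> \<ominus> scl t r) \<otimes> geom t r N = \<one> \<oplus> \<ominus> scl (t ^ N) (r [^] N)" for N
      using gc[of N] minus_telescope[of "geom t r N" \<one> "scl (t ^ N) (r [^] N)"]
      by (simp add: geom_telescope(1)[OF rc, of t N])
    then show "approx (\<lambda>N. (\<one> \<ominus> scl t r) \<otimes> geom t r N) (\<lambda>_. \<one>)"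
      by (intro approx_ofI[OF _ n gp[OF r(2)]]) auto
  qed
  have bone: "bdd_seq (\<lambda>_. \<one>)" by (rule bdd_seq_unitary[OF unitary_one])
  define Q where "Q N = g N \<otimes> T N \<otimes> f N \<otimes> d" for N
  have bQ: "bdd_seq Q" unfolding Q_def by (rule b0(3))
  have cl: "T N \<in> carrier A" "R N \<in> carrier A" "M N \<in> carrier A" "Q N \<in> carrier A" for N
    using bT bR bM bQ by (auto intro: bdd_seq_closed)
  have "approx (\<lambda>N. Q N \<otimes> g N) (\<lambda>N. g N \<otimes> T N \<otimes> M N)"
  proof -
    have "approx (\<lambda>N. (g N \<otimes> T N) \<otimes> (f N \<otimes> d \<otimes> g N)) (\<lambda>N. (g N \<otimes> T N) \<otimes> M N)"
      by (rule approx_mult_left[OF main[folded M_def] bdg bM b0(1)])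
    moreover have "(g N \<otimes> T N) \<otimes> (f N \<otimes> d \<otimes> g N) = Q N \<otimes> g N" for N
      unfolding Q_def using fc[of N] cl[of N] dc by (simp add: m_assoc)
    ultimately show ?thesis by simp
  qed
  moreover have "approx (\<lambda>N. g N \<otimes> T N \<otimes> M N) (\<lambda>N. scl (1 + s) (g N))"
  proof -
    have "approx (\<lambda>N. g N \<otimes> (T N \<otimes> M N)) (\<lambda>N. g N \<otimes> scl (1 + s) \<one>)"
      by (rule approx_mult_left[OF TM bdd_seq_mult[OF bT bM] b1 bg])
    moreover have "g N \<otimes> (T N \<otimes> M N) = g N \<otimes> T N \<otimes> M N" "g N \<otimes> scl (1 + s) \<one> = scl (1 + s) (g N)" for N
      using fc[of N] cl[of N] by (simp_all add: m_assoc scl_mult_right)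
    ultimately show ?thesis by simp
  qed
  ultimately have "approx (\<lambda>N. Q N \<otimes> g N) (\<lambda>N. scl (1 + s) (g N))"
    by (rule approx_trans) (intro bdd_seq_mult bdd_seq_scl bQ bg bM bT)+
  then have A1: "approx (\<lambda>N. Q N \<otimes> g N \<otimes> h) (\<lambda>N. scl (1 + s) (g N) \<otimes> h)"
    by (rule approx_mult_right) (intro bdd_seq_mult bdd_seq_scl bQ bg bh)+
  have A2: "approx Q (\<lambda>N. Q N \<otimes> g N \<otimes> h)"
  proof -
    have "approx (\<lambda>N. Q N \<otimes> (g N \<otimes> h)) (\<lambda>N. Q N \<otimes> \<one>)"
      by (rule approx_mult_left[OF _ bdd_seq_mult[OF bg bh] bone bQ]) (simp add: g_def h_def geom_inv v \<beta>)
    moreover have "Q N \<otimes> (g N \<otimes> h) = Q N \<otimes> g N \<otimes> h" "Q N \<otimes> \<one> = Q N" for N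
      using fc[of N] cl[of N] hc by (simp_all add: m_assoc)
    ultimately have "approx (\<lambda>N. Q N \<otimes> g N \<otimes> h) (\<lambda>N. Q N)" by simp
    then show ?thesis by (rule approx_sym) (intro bdd_seq_mult bQ bg bh)+
  qed
  have A3: "approx (\<lambda>N. scl (1 + s) (g N) \<otimes> h) (\<lambda>_. scl (1 + s) \<one>)"
  proof -
    have "approx (\<lambda>N. scl (1 + s) \<one> \<otimes> (g N \<otimes> h)) (\<lambda>N. scl (1 + s) \<one> \<otimes> \<one>)"
      by (rule approx_mult_left[OF _ bdd_seq_mult[OF bg bh] bone b1]) (simp add: g_def h_def geom_inv v \<beta>)
    moreover have "scl (1 + s) \<one> \<otimes> (g N \<otimes> h) = scl (1 + s) (g N) \<otimes> h" "scl (1 + s) \<one> \<otimes> \<one> = scl (1 + s) \<one>" for N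
      using fc[of N] hc by (simp_all add: scl_mult_left scl_closed)
    ultimately show ?thesis by simp
  qed
  have B: "bdd_seq (\<lambda>N. Q N \<otimes> g N \<otimes> h)" "bdd_seq (\<lambda>N. scl (1 + s) (g N) \<otimes> h)"
    by (intro bdd_seq_mult bdd_seq_scl bQ bg bh)+
  have Q1: "approx Q (\<lambda>_. scl (1 + s) \<one>)"
    by (rule approx_trans[OF approx_trans[OF A2 A1 bQ B] A3 bQ B(2) b1])
  define Y where "Y N = g N \<otimes> T N \<otimes> f N" for N
  have bY: "bdd_seq Y" unfolding Y_def by (rule b0(2))
  have QR: "approx (\<lambda>N. Q N \<otimes> R N) (\<lambda>N. scl (1 + s) \<one> \<otimes> R N)"
    by (rule approx_mult_right[OF Q1 bQ b1 bR])
  have "approx (\<lambda>N. Y N \<otimes> (d \<otimes> R N)) (\<lambda>N. Y N \<otimes> \<one>)"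
    by (rule approx_mult_left[OF _ bdd_seq_mult[OF bd bR] bone bY]) (simp add: d_def R_def geom_inv uv w(2))
  moreover have "Y N \<otimes> (d \<otimes> R N) = Q N \<otimes> R N" "Y N \<otimes> \<one> = Y N" for N
    unfolding Q_def Y_def using fc[of N] cl[of N] dc by (simp_all add: m_assoc)
  ultimately have "approx (\<lambda>N. Q N \<otimes> R N) Y" by simp
  then have QY: "(\<lambda>N. \<phi> (Q N \<otimes> R N) - \<phi> (Y N)) \<longlonglongrightarrow> 0"
    by (rule approx_state[OF _ bdd_seq_mult[OF bQ bR] bY])
  have QR': "(\<lambda>N. \<phi> (Q N \<otimes> R N) - \<phi> (scl (1 + s) \<one> \<otimes> R N)) \<longlonglongrightarrow> 0"
    by (rule approx_state[OF QR bdd_seq_mult[OF bQ bR] bdd_seq_mult[OF b1 bR]])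
  \<comment> \<open>by freeness only the constant term of \<open>T\<close> contributes to \<open>\<phi> (g T f)\<close>\<close>
  have phiY: "\<phi> (Y (Suc N)) = p (Suc N) * q (Suc N)" for N
  proof -
    let ?N = "Suc N"
    define X where "X = x ?N"
    define Z where "Z = y ?N"
    have XZ: "X \<in> carrier A" "Z \<in> carrier A" using fc by (auto simp: X_def Z_def)
    have Xg: "X \<in> star_algebra_gen {u}" "Z \<in> star_algebra_gen {v}"
      unfolding X_def Z_def x_def y_def f_def g_def using c by (intro centr_in_gen geom_in_gen; simp)+
    have X0: "\<phi> X = 0" "\<phi> Z = 0" unfolding X_def Z_def x_def y_def using fc by (simp_all add: state_centr)
    note alt0 = state_alt_prod[OF free Xg X0]
    have trm: "\<phi> (g ?N \<otimes> (X \<otimes> Z) [^] j \<otimes> f ?N) = (if j = 0 then p ?N * q ?N else 0)" for j :: nat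
    proof -
      define W where "W = (X \<otimes> Z) [^] j"
      have W: "W \<in> carrier A" using XZ by (simp add: W_def)
      have "g ?N \<otimes> W \<otimes> f ?N = Z \<otimes> (W \<otimes> X) \<oplus> scl (p ?N) (Z \<otimes> W) \<oplus> (scl (q ?N) (W \<otimes> X) \<oplus> scl (q ?N * p ?N) W)"
        unfolding fx X_def[symmetric] Z_def[symmetric] using XZ W
        by (simp add: l_distr r_distr scl_closed scl_mult_left scl_mult_right scl_scl scl_add_right m_assoc a_ac mult.commute)
      then have "\<phi> (g ?N \<otimes> W \<otimes> f ?N) = \<phi> (Z \<otimes> (W \<otimes> X)) + p ?N * \<phi> (Z \<otimes> W) + (q ?N * \<phi> (W \<otimes> X) + q ?N * p ?N * \<phi> W)"
        using XZ W by (simp add: state_add state_scl scl_closed)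
      moreover have "W \<otimes> X = alt_prod X Z True (2 * j + 1)" "W = alt_prod X Z True (2 * j)"
        unfolding W_def using XZ by (simp_all only: alt_prod_odd alt_prod_even)
      moreover have "Z \<otimes> alt_prod X Z True n = alt_prod X Z False (Suc n)" for n by (simp add: alt_prod_simps)
      ultimately have "\<phi> (g ?N \<otimes> W \<otimes> f ?N) = \<phi> (alt_prod X Z False (Suc (2 * j + 1))) + p ?N * \<phi> (alt_prod X Z False (Suc (2 * j)))
          + (q ?N * \<phi> (alt_prod X Z True (2 * j + 1)) + q ?N * p ?N * \<phi> (alt_prod X Z True (2 * j)))"
        by metis
      also have "\<dots> = (if j = 0 then p ?N * q ?N else 0)"
        using alt0 by (simp add: alt_prod_simps(1) state_one mult.commute)
      finally show ?thesis by (simp add: W_def)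
    qed
    have "\<phi> (g ?N \<otimes> geom c0 (X \<otimes> Z) m \<otimes> f ?N) = (if m = 0 then 0 else p ?N * q ?N)" for m
    proof (induction m)
      case 0
      then show ?case using fc[of ?N] by (simp add: geom_0 state_zero)
    next
      case (Suc m)
      have gc: "geom c0 (X \<otimes> Z) m \<in> carrier A" "scl (c0 ^ m) ((X \<otimes> Z) [^] m) \<in> carrier A"
        using XZ by (auto simp: geom_closed scl_closed)
      have "g ?N \<otimes> geom c0 (X \<otimes> Z) (Suc m) \<otimes> f ?N = g ?N \<otimes> geom c0 (X \<otimes> Z) m \<otimes> f ?N \<oplus> scl (c0 ^ m) (g ?N \<otimes> (X \<otimes> Z) [^] m \<otimes> f ?N)"
        using fc[of ?N] XZ gc by (simp add: geom_Suc l_distr r_distr scl_mult_left scl_mult_right scl_closed)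
      then have "\<phi> (g ?N \<otimes> geom c0 (X \<otimes> Z) (Suc m) \<otimes> f ?N) = \<phi> (g ?N \<otimes> geom c0 (X \<otimes> Z) m \<otimes> f ?N) + c0 ^ m * \<phi> (g ?N \<otimes> (X \<otimes> Z) [^] m \<otimes> f ?N)"
        using fc[of ?N] XZ gc by (simp add: state_add state_scl scl_closed)
      then show ?case unfolding Suc trm by simp
    qed
    from this[of ?N] show ?thesis by (simp add: Y_def T_def X_def Z_def)
  qed
  have "(\<lambda>N. \<phi> (Y (Suc N))) \<longlonglongrightarrow> (1 + s) * (1 + s)"
    unfolding phiY by (intro tendsto_mult LIMSEQ_Suc p q)
  then have Ylim: "(\<lambda>N. \<phi> (Y N)) \<longlonglongrightarrow> (1 + s) * (1 + s)" by (rule LIMSEQ_imp_Suc)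
  have "(\<lambda>N. (\<phi> (Q N \<otimes> R N) - \<phi> (Y N)) + \<phi> (Y N) - (\<phi> (Q N \<otimes> R N) - \<phi> (scl (1 + s) \<one> \<otimes> R N)))
       \<longlonglongrightarrow> 0 + (1 + s) * (1 + s) - 0"
    by (intro tendsto_intros QY QR' Ylim)
  moreover have "\<phi> (scl (1 + s) \<one> \<otimes> R N) = (1 + s) * \<phi> (R N)" for N
    using cl[of N] by (simp add: scl_mult_left state_scl)
  ultimately have "(\<lambda>N. (1 + s) * \<phi> (R N)) \<longlonglongrightarrow> (1 + s) * (1 + s)" by simp
  then have "(\<lambda>N. (1 + s) * \<phi> (R N) / (1 + s)) \<longlonglongrightarrow> (1 + s) * (1 + s) / (1 + s)"
    using s(2) by (intro tendsto_divide tendsto_const) (auto simp: add_eq_0_iff)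
  moreover have "1 + s \<noteq> 0" using s(2) by (metis add.commute add_eq_0_iff)
  ultimately have "(\<lambda>N. \<phi> (R N)) \<longlonglongrightarrow> 1 + s" by simp
  then show ?thesis unfolding sums_def R_def state_geom[OF c(3)] .
qed

end

section \<open>A free pair of unitaries with prescribed laws\<close>

type_synonym word = "(bool \<times> int) list"
type_synonym vec = "word \<Rightarrow>\<^sub>0 complex"

subsection \<open>Linear maps on finitely supported functions\<close>

abbreviation "lookup \<equiv> Poly_Mapping.lookup"
abbreviation "keys \<equiv> Poly_Mapping.keys"

definition smul :: "complex \<Rightarrow> ('k \<Rightarrow>\<^sub>0 complex) \<Rightarrow> ('k \<Rightarrow>\<^sub>0 complex)" where
  "smul c x = Poly_Mapping.map (\<lambda>a. c * a) x"

lemma lookup_smul [simp]: "lookup (smul c x) k = c * lookup x k"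
  unfolding smul_def by (simp add: Poly_Mapping.map.rep_eq when_def)

lemma lookup_eqI: "(\<And>k. lookup x k = lookup y k) \<Longrightarrow> x = y"
  by (simp add: poly_mapping_eqI)

lemma smul_simps [simp]:
  "smul c (x + y) = smul c x + smul c y" "smul (c + d) x = smul c x + smul d x"
  "smul c (smul d x) = smul (c * d) x" "smul 1 x = x" "smul 0 x = 0" "smul c 0 = 0"
  "smul c (x - y) = smul c x - smul c y" "smul c (- x) = - smul c x"
  by (auto intro!: lookup_eqI simp: lookup_add lookup_minus algebra_simps)

definition lin_map :: "(vec \<Rightarrow> vec) \<Rightarrow> bool" where
  "lin_map T \<longleftrightarrow> (\<forall>x y. T (x + y) = T x + T y) \<and> (\<forall>c x. T (smul c x) = smul c (T x))"

definition basis :: "'k \<Rightarrow> ('k \<Rightarrow>\<^sub>0 complex)" where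
  "basis w = Poly_Mapping.single w 1"

lemma lookup_basis: "lookup (basis w) v = (if v = w then 1 else 0)"
  by (auto simp: basis_def lookup_single when_def)

lemma vec_expand: "(\<Sum>w\<in>keys x. smul (lookup x w) (basis w)) = x"
  by (rule lookup_eqI) (simp add: lookup_sum lookup_basis in_keys_iff if_distrib[of "(*) _"] sum.delta' cong: if_cong)

lemma vec_induct [case_names basis add smul]:
  assumes "\<And>w. P (basis w)" "\<And>x y. P x \<Longrightarrow> P y \<Longrightarrow> P (x + y)" "\<And>c x. P x \<Longrightarrow> P (smul c x)"
  shows "P (x :: vec)"
proof -
  have P0: "P 0" using assms(3)[OF assms(1), of 0] by simp
  have "P (\<Sum>w\<in>S. smul (lookup x w) (basis w))" if "finite S" for S
    using that by induction (auto intro: assms P0)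
  from this[of "keys x"] show ?thesis by (simp add: vec_expand)
qed

definition extend :: "(word \<Rightarrow> vec) \<Rightarrow> vec \<Rightarrow> vec" where
  "extend g x = (\<Sum>w\<in>keys x. smul (lookup x w) (g w))"

lemma extend_superset: "finite S \<Longrightarrow> keys x \<subseteq> S \<Longrightarrow> extend g x = (\<Sum>w\<in>S. smul (lookup x w) (g w))"
  unfolding extend_def by (rule sum.mono_neutral_left) (auto simp: in_keys_iff)

lemma extend_basis [simp]: "extend g (basis w) = g w"
  by (subst extend_superset[of "{w}"]) (auto simp: basis_def)

lemma sum_smul: "smul c (sum f S) = (\<Sum>i\<in>S. smul c (f i))"
  by (induction S rule: infinite_finite_induct) auto

lemma keys_smul: "keys (smul c x) \<subseteq> keys x"
  by (auto simp: in_keys_iff)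

lemma lin_extend: "lin_map (extend g)"
  unfolding lin_map_def
proof (intro conjI allI)
  fix x y
  have "extend g (x + y) = (\<Sum>w\<in>keys x \<union> keys y. smul (lookup (x + y) w) (g w))"
    using Poly_Mapping.keys_add[of x y] by (intro extend_superset) auto
  also have "\<dots> = (\<Sum>w\<in>keys x \<union> keys y. smul (lookup x w) (g w)) + (\<Sum>w\<in>keys x \<union> keys y. smul (lookup y w) (g w))"
    by (simp add: lookup_add sum.distrib)
  also have "\<dots> = extend g x + extend g y"
    by (subst (1 2) extend_superset[of "keys x \<union> keys y"]) auto
  finally show "extend g (x + y) = extend g x + extend g y" .
next
  fix c x
  have "extend g (smul c x) = (\<Sum>w\<in>keys x. smul (lookup (smul c x) w) (g w))"
    using keys_smul[of c x] by (intro extend_superset) auto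
  then show "extend g (smul c x) = smul c (extend g x)" by (simp add: extend_def sum_smul)
qed

lemma lin_mapD: "lin_map T \<Longrightarrow> T (x + y) = T x + T y" "lin_map T \<Longrightarrow> T (smul c x) = smul c (T x)"
  by (auto simp: lin_map_def)

lemma lin_map_eqI:
  assumes "lin_map T" "lin_map S" "\<And>w. T (basis w) = S (basis w)" shows "T = S"
proof
  fix x show "T x = S x"
    by (induction x rule: vec_induct) (simp_all add: assms lin_mapD[OF assms(1)] lin_mapD[OF assms(2)])
qed

lemma lin_map_comp: "lin_map T \<Longrightarrow> lin_map S \<Longrightarrow> lin_map (\<lambda>x. T (S x))"
  by (simp add: lin_map_def)

lemma lin_map_id: "lin_map (\<lambda>x. x)" by (simp add: lin_map_def)

lemma lin_map_add: "lin_map T \<Longrightarrow> lin_map S \<Longrightarrow> lin_map (\<lambda>x. T x + S x)"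
  by (simp add: lin_map_def)

lemma lin_map_smul: "lin_map T \<Longrightarrow> lin_map (\<lambda>x. smul c (T x))"
  by (simp add: lin_map_def mult.commute)

definition form :: "(word \<Rightarrow> word \<Rightarrow> complex) \<Rightarrow> vec \<Rightarrow> vec \<Rightarrow> complex" where
  "form k x y = (\<Sum>w\<in>keys x. \<Sum>v\<in>keys y. lookup x w * cnj (lookup y v) * k w v)"

lemma form_superset:
  assumes "finite S" "keys x \<subseteq> S" "finite R" "keys y \<subseteq> R"
  shows "form k x y = (\<Sum>w\<in>S. \<Sum>v\<in>R. lookup x w * cnj (lookup y v) * k w v)"
proof -
  have "form k x y = (\<Sum>w\<in>keys x. \<Sum>v\<in>R. lookup x w * cnj (lookup y v) * k w v)"
    unfolding form_def using assms by (intro sum.cong sum.mono_neutral_left) (auto simp: in_keys_iff)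
  also have "\<dots> = (\<Sum>w\<in>S. \<Sum>v\<in>R. lookup x w * cnj (lookup y v) * k w v)"
    using assms by (intro sum.mono_neutral_left) (auto simp: in_keys_iff)
  finally show ?thesis .
qed

lemma form_basis [simp]: "form k (basis w) (basis v) = k w v"
  by (subst form_superset[of "{w}" _ "{v}"]) (auto simp: basis_def)

lemma form_add_left: "form k (x + x') y = form k x y + form k x' y"
proof -
  let ?S = "keys x \<union> keys x'"
  have "form k (x + x') y = (\<Sum>w\<in>?S. \<Sum>v\<in>keys y. lookup (x + x') w * cnj (lookup y v) * k w v)"
    using Poly_Mapping.keys_add[of x x'] by (intro form_superset) auto
  also have "\<dots> = (\<Sum>w\<in>?S. \<Sum>v\<in>keys y. lookup x w * cnj (lookup y v) * k w v)
       + (\<Sum>w\<in>?S. \<Sum>v\<in>keys y. lookup x' w * cnj (lookup y v) * k w v)"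
    by (simp add: lookup_add algebra_simps sum.distrib)
  also have "\<dots> = form k x y + form k x' y"
    using form_superset[of ?S x "keys y" y k] form_superset[of ?S x' "keys y" y k] by simp
  finally show ?thesis .
qed

lemma form_add_right: "form k x (y + y') = form k x y + form k x y'"
proof -
  let ?S = "keys y \<union> keys y'"
  have "form k x (y + y') = (\<Sum>w\<in>keys x. \<Sum>v\<in>?S. lookup x w * cnj (lookup (y + y') v) * k w v)"
    using Poly_Mapping.keys_add[of y y'] by (intro form_superset) auto
  also have "\<dots> = (\<Sum>w\<in>keys x. \<Sum>v\<in>?S. lookup x w * cnj (lookup y v) * k w v)
       + (\<Sum>w\<in>keys x. \<Sum>v\<in>?S. lookup x w * cnj (lookup y' v) * k w v)"
    by (simp add: lookup_add algebra_simps sum.distrib)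
  also have "\<dots> = form k x y + form k x y'"
    using form_superset[of "keys x" x ?S y k] form_superset[of "keys x" x ?S y' k] by simp
  finally show ?thesis .
qed

lemma form_smul_left: "form k (smul c x) y = c * form k x y"
  using form_superset[of "keys x" "smul c x" "keys y" y k] keys_smul[of c x]
  by (simp add: form_def sum_distrib_left mult_ac)

lemma form_smul_right: "form k x (smul c y) = cnj c * form k x y"
  using form_superset[of "keys x" x "keys y" "smul c y" k] keys_smul[of c y]
  by (simp add: form_def sum_distrib_left mult_ac)

lemmas form_linear = form_add_left form_add_right form_smul_left form_smul_right

lemma form_eqI:
  assumes "lin_map T" "lin_map S" "lin_map T'" "lin_map S'"
    and "\<And>w v. form k (T (basis w)) (S (basis v)) = form k' (T' (basis w)) (S' (basis v))"
  shows "form k (T x) (S y) = form k' (T' x) (S' y)"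
proof -
  have "form k (T x) (S (basis v)) = form k' (T' x) (S' (basis v))" for v
    by (induction x rule: vec_induct)
       (simp_all add: assms(5) form_linear lin_mapD[OF assms(1)] lin_mapD[OF assms(3)])
  then show ?thesis
    by (induction y rule: vec_induct)
       (simp_all add: form_linear lin_mapD[OF assms(2)] lin_mapD[OF assms(4)])
qed

subsection \<open>Reduced words and the inner product\<close>

text \<open>The free product is realised on combinations of words. A letter \<open>(b, n)\<close> stands for the centred power
  \<open>u\<^sub>b\<^sup>n - \<phi> (u\<^sub>b\<^sup>n)\<close>, and in a reduced word neighbouring letters have different colours \<open>b\<close>. Freeness
  prescribes the inner product: it vanishes unless the colours agree letter by letter, and then it is the
  product of the covariances of the letters. Words that are not reduced are kept as null vectors.\<close>

fun red_word :: "word \<Rightarrow> bool" where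
  "red_word [] = True"
| "red_word ((b, n) # w) = (n \<noteq> 0 \<and> red_word w \<and> (\<forall>m v. w \<noteq> (b, m) # v))"

definition starts :: "bool \<Rightarrow> word \<Rightarrow> bool" where
  "starts b w \<longleftrightarrow> (\<exists>n v. w = (b, n) # v)"

lemma red_word_Cons: "red_word ((b, n) # w) \<longleftrightarrow> n \<noteq> 0 \<and> red_word w \<and> \<not> starts b w"
  by (auto simp: starts_def)

declare red_word.simps(2) [simp del]

lemma mult_cnj_nonneg: "(z :: complex) * cnj z \<in> \<real>\<^sub>\<ge>\<^sub>0"
  unfolding complex_norm_square[symmetric] by simp

locale two_laws =
  fixes law :: "bool \<Rightarrow> complex measure"
  assumes law: "law b \<in> circle_prob"
begin

definition mom :: "bool \<Rightarrow> int \<Rightarrow> complex" where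
  "mom b n = (\<integral>\<zeta>. \<zeta> powi n \<partial>law b)"

definition gram :: "bool \<Rightarrow> int \<Rightarrow> int \<Rightarrow> complex" where
  "gram b n n' = mom b (n - n') - mom b n * cnj (mom b n')"

fun kern0 :: "word \<Rightarrow> word \<Rightarrow> complex" where
  "kern0 [] [] = 1"
| "kern0 ((b, n) # x) ((b', n') # x') = (if b = b' then gram b n n' * kern0 x x' else 0)"
| "kern0 _ _ = 0"

definition kern :: "word \<Rightarrow> word \<Rightarrow> complex" where
  "kern w w' = (if red_word w \<and> red_word w' then kern0 w w' else 0)"

lemma cont_powi: "continuous_on unit_circle (\<lambda>\<zeta>::complex. \<zeta> powi n)"
  by (intro continuous_intros) auto

lemma circle_int: "continuous_on unit_circle f \<Longrightarrow> integrable (law b) (f :: complex \<Rightarrow> complex)"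
  by (rule circle_integrable[OF circle_prob_finite[OF law]])

lemma mom_0: "mom b 0 = 1"
  by (simp add: mom_def circle_prob_measure_space[OF law])

lemma cnj_unit: "\<zeta> \<in> unit_circle \<Longrightarrow> cnj \<zeta> = inverse \<zeta>"
  by (metis complex_norm_square dist_0_norm inverse_unique mem_sphere mult.commute of_real_1 power_one)

lemma cnj_powi: "\<zeta> \<in> unit_circle \<Longrightarrow> cnj (\<zeta> powi n) = inverse (\<zeta> powi n)"
  by (cases "n \<ge> 0") (simp_all add: power_int_def cnj_unit power_inverse del: mem_sphere)

lemma gram_integral: "gram b n n' = (\<integral>\<zeta>. (\<zeta> powi n - mom b n) * cnj (\<zeta> powi n' - mom b n') \<partial>law b)"
proof -
  note f = circle_prob_finite[OF law[of b]]
  have c: "continuous_on unit_circle (\<lambda>\<zeta>::complex. cnj (\<zeta> powi n'))"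
    "continuous_on unit_circle (\<lambda>\<zeta>::complex. \<zeta> powi (n - n'))"
    by (intro continuous_intros cont_powi; simp)+
  have e: "(\<integral>\<zeta>. cnj (\<zeta> powi n') \<partial>law b) = cnj (\<integral>\<zeta>. \<zeta> powi n' \<partial>law b)"
    by (rule integral_bounded_linear[OF bounded_linear_cnj circle_int[OF cont_powi]])
  have "(\<integral>\<zeta>. (\<zeta> powi n - mom b n) * cnj (\<zeta> powi n' - mom b n') \<partial>law b)
     = (\<integral>\<zeta>. (\<zeta> powi (n - n') - cnj (mom b n') * \<zeta> powi n) - (mom b n * cnj (\<zeta> powi n') - mom b n * cnj (mom b n')) \<partial>law b)"
  proof (rule circle_integral_cong[OF f])
    fix \<zeta> :: complex assume \<zeta>: "\<zeta> \<in> unit_circle"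
    then have "\<zeta> \<noteq> 0" by auto
    moreover have "cnj (\<zeta> powi n') = inverse (\<zeta> powi n')" by (rule cnj_powi[OF \<zeta>])
    ultimately have "\<zeta> powi n * cnj (\<zeta> powi n') = \<zeta> powi (n - n')"
      by (simp only: power_int_diff divide_inverse de_Morgan_disj simp_thms)
    then show "(\<zeta> powi n - mom b n) * cnj (\<zeta> powi n' - mom b n')
      = (\<zeta> powi (n - n') - cnj (mom b n') * \<zeta> powi n) - (mom b n * cnj (\<zeta> powi n') - mom b n * cnj (mom b n'))"
      by (simp add: algebra_simps)
  qed
  also have "\<dots> = (mom b (n - n') - cnj (mom b n') * mom b n) - (mom b n * cnj (mom b n') - mom b n * cnj (mom b n'))"
    using e circle_int[OF cont_powi, of b n] circle_int[OF c(1), of b] circle_int[OF c(2), of b] circle_int[OF continuous_on_const, of b]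
    by (simp add: mom_def circle_prob_measure_space[OF law])
  finally show ?thesis by (simp add: gram_def mult.commute)
qed

text \<open>Integrating out the first letter against \<open>law b\<close> turns the kernel on words into the kernel on their tails
  with new coefficients, so positivity follows by induction on the length, one tensor factor at a time.\<close>

lemma kern0_pos:
  assumes "finite I" "\<And>i. i \<in> I \<Longrightarrow> length (W i) \<le> L"
  shows "(\<Sum>i\<in>I. \<Sum>j\<in>I. c i * cnj (c j) * kern0 (W i) (W j)) \<in> \<real>\<^sub>\<ge>\<^sub>0"
  using assms
proof (induction L arbitrary: I W c)
  case 0
  then have "(\<Sum>i\<in>I. \<Sum>j\<in>I. c i * cnj (c j) * kern0 (W i) (W j)) = (\<Sum>i\<in>I. \<Sum>j\<in>I. c i * cnj (c j))"
    by (intro sum.cong) auto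
  also have "\<dots> = (\<Sum>i\<in>I. c i) * cnj (\<Sum>i\<in>I. c i)" by (simp add: sum_product)
  also have "\<dots> \<in> \<real>\<^sub>\<ge>\<^sub>0" by (rule mult_cnj_nonneg)
  finally show ?case .
next
  case (Suc L)
  define I0 where "I0 = {i \<in> I. W i = []}"
  define J where "J b = {i \<in> I. starts b (W i)}" for b
  have I: "I = I0 \<union> (J True \<union> J False)" "I0 \<inter> (J True \<union> J False) = {}" "J True \<inter> J False = {}"
    unfolding I0_def J_def starts_def by (auto simp: neq_Nil_conv)
  have fin: "finite I0" "finite (J b)" for b using Suc.prems(1) by (auto simp: I0_def J_def)
  define F where "F A B = (\<Sum>i\<in>A. \<Sum>j\<in>B. c i * cnj (c j) * kern0 (W i) (W j))" for A B
  have Fz: "F I0 (J b) = 0" "F (J b) I0 = 0" "b \<noteq> b' \<Longrightarrow> F (J b) (J b') = 0" for b b'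
    unfolding F_def by (intro sum.neutral ballI; auto simp: I0_def J_def starts_def)+
  have "F I I = F I0 I0 + (F (J True) (J True) + F (J False) (J False))"
  proof -
    have "F (A \<union> A') B = F A B + F A' B" "F B (A \<union> A') = F B A + F B A'"
      if "finite A" "finite A'" "A \<inter> A' = {}" for A A' B
      using that by (simp_all add: F_def sum.union_disjoint sum.distrib)
    then show ?thesis using I(2,3) fin Fz Fz(3)[of True False] Fz(3)[of False True]
      by (subst (1 2) I(1)) simp
  qed
  moreover have "F I0 I0 \<in> \<real>\<^sub>\<ge>\<^sub>0"
  proof -
    have "F I0 I0 = (\<Sum>i\<in>I0. \<Sum>j\<in>I0. c i * cnj (c j))" unfolding F_def by (intro sum.cong) (auto simp: I0_def)
    also have "\<dots> = (\<Sum>i\<in>I0. c i) * cnj (\<Sum>i\<in>I0. c i)" by (simp add: sum_product)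
    also have "\<dots> \<in> \<real>\<^sub>\<ge>\<^sub>0" by (rule mult_cnj_nonneg)
    finally show ?thesis .
  qed
  moreover have "F (J b) (J b) \<in> \<real>\<^sub>\<ge>\<^sub>0" for b
  proof -
    define N where "N i = snd (hd (W i))" for i
    define h where "h i \<zeta> = c i * (\<zeta> powi N i - mom b (N i))" for i and \<zeta> :: complex
    have Wi: "W i = (b, N i) # tl (W i)" if "i \<in> J b" for i
      using that by (auto simp: J_def starts_def N_def)
    have ch: "continuous_on unit_circle (h i)" for i unfolding h_def by (intro continuous_intros) auto
    define S where "S \<zeta> = (\<Sum>i\<in>J b. \<Sum>j\<in>J b. h i \<zeta> * cnj (h j \<zeta>) * kern0 (tl (W i)) (tl (W j)))" for \<zeta>
    have cS: "continuous_on unit_circle S" unfolding S_def by (intro continuous_intros ch)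
    have "F (J b) (J b) = (\<Sum>i\<in>J b. \<Sum>j\<in>J b. (\<integral>\<zeta>. h i \<zeta> * cnj (h j \<zeta>) * kern0 (tl (W i)) (tl (W j)) \<partial>law b))"
      unfolding F_def
    proof (intro sum.cong refl)
      fix i j assume ij: "i \<in> J b" "j \<in> J b"
      have "c i * cnj (c j) * kern0 (W i) (W j) = c i * cnj (c j) * kern0 (tl (W i)) (tl (W j)) * gram b (N i) (N j)"
        by (subst Wi[OF ij(1)], subst Wi[OF ij(2)]) simp
      also have "\<dots> = (\<integral>\<zeta>. c i * cnj (c j) * kern0 (tl (W i)) (tl (W j)) * ((\<zeta> powi N i - mom b (N i)) * cnj (\<zeta> powi N j - mom b (N j))) \<partial>law b)"
        unfolding gram_integral by simp
      also have "\<dots> = (\<integral>\<zeta>. h i \<zeta> * cnj (h j \<zeta>) * kern0 (tl (W i)) (tl (W j)) \<partial>law b)"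
        by (intro Bochner_Integration.integral_cong) (auto simp: h_def mult_ac)
      finally show "c i * cnj (c j) * kern0 (W i) (W j) = (\<integral>\<zeta>. h i \<zeta> * cnj (h j \<zeta>) * kern0 (tl (W i)) (tl (W j)) \<partial>law b)" .
    qed
    also have "\<dots> = (\<integral>\<zeta>. S \<zeta> \<partial>law b)"
      unfolding S_def
      by (subst Bochner_Integration.integral_sum Bochner_Integration.integral_sum;
          (intro circle_int continuous_intros ch)?; intro sum.cong refl;
          subst Bochner_Integration.integral_sum; (intro circle_int continuous_intros ch)?; simp)
    finally have e: "F (J b) (J b) = (\<integral>\<zeta>. S \<zeta> \<partial>law b)" .
    have Sp: "S \<zeta> \<in> \<real>\<^sub>\<ge>\<^sub>0" for \<zeta>
      unfolding S_def
    proof (rule Suc.IH[OF fin(2)])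
      fix i assume "i \<in> J b"
      then show "length (tl (W i)) \<le> L" using Suc.prems(2)[of i] by (auto simp: J_def)
    qed
    have i: "integrable (law b) S" by (rule circle_int[OF cS])
    have "Re (\<integral>\<zeta>. S \<zeta> \<partial>law b) = (\<integral>\<zeta>. Re (S \<zeta>) \<partial>law b)" "Im (\<integral>\<zeta>. S \<zeta> \<partial>law b) = (\<integral>\<zeta>. Im (S \<zeta>) \<partial>law b)"
      using i by simp_all
    moreover have "Re (S \<zeta>) \<ge> 0" "Im (S \<zeta>) = 0" for \<zeta> using Sp[of \<zeta>] by (auto simp: complex_nonneg_Reals_iff)
    ultimately show ?thesis unfolding e complex_nonneg_Reals_iff by simp
  qed
  ultimately show ?case unfolding F_def by (simp add: nonneg_Reals_add_I)
qed

lemma form_pos: "form kern x x \<in> \<real>\<^sub>\<ge>\<^sub>0"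
proof -
  define I where "I = {w \<in> keys x. red_word w}"
  have "form kern x x = (\<Sum>w\<in>keys x. \<Sum>v\<in>keys x. if red_word w \<and> red_word v then lookup x w * cnj (lookup x v) * kern0 w v else 0)"
    unfolding form_def kern_def by (intro sum.cong refl) auto
  also have "\<dots> = (\<Sum>w\<in>I. \<Sum>v\<in>I. lookup x w * cnj (lookup x v) * kern0 w v)"
  proof -
    have "(\<Sum>w\<in>keys x. \<Sum>v\<in>keys x. if red_word w \<and> red_word v then lookup x w * cnj (lookup x v) * kern0 w v else 0)
      = (\<Sum>w\<in>I. \<Sum>v\<in>keys x. if red_word v then lookup x w * cnj (lookup x v) * kern0 w v else 0)"
      unfolding I_def by (rule sum.mono_neutral_cong_right) auto
    also have "\<dots> = (\<Sum>w\<in>I. \<Sum>v\<in>I. lookup x w * cnj (lookup x v) * kern0 w v)"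
      unfolding I_def by (intro sum.cong refl sum.mono_neutral_cong_right) auto
    finally show ?thesis .
  qed
  also have "\<dots> \<in> \<real>\<^sub>\<ge>\<^sub>0"
    by (rule kern0_pos[where L = "Max (insert 0 (length ` I))"]) (auto simp: I_def)
  finally show ?thesis .
qed

subsection \<open>The two unitaries\<close>

text \<open>\<open>split_word b\<close> peels off a leading letter of colour \<open>b\<close>, and the exponent \<open>0\<close> marks its absence;
  \<open>shift b k\<close> adds \<open>k\<close> to this exponent.\<close>

definition split_word :: "bool \<Rightarrow> word \<Rightarrow> int \<times> word" where
  "split_word b w = (case w of [] \<Rightarrow> (0, []) | (b', n) # v \<Rightarrow> if b' = b then (n, v) else (0, w))"

definition join_word :: "bool \<Rightarrow> int \<Rightarrow> word \<Rightarrow> word" where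
  "join_word b n w = (if n = 0 then w else (b, n) # w)"

definition shift :: "bool \<Rightarrow> int \<Rightarrow> word \<Rightarrow> word" where
  "shift b k w = (if red_word w then (case split_word b w of (n, v) \<Rightarrow> join_word b (n + k) v) else w)"

lemma red_word_cases:
  assumes "red_word w"
  obtains n v where "w = join_word b n v" "red_word v" "\<not> starts b v"
proof (cases "starts b w")
  case True
  then obtain n v where w: "w = (b, n) # v" by (auto simp: starts_def)
  then show ?thesis using that[of n v] assms by (auto simp: join_word_def red_word_Cons)
next
  case False
  then show ?thesis using that[of 0 w] assms by (simp add: join_word_def)
qed

lemma split_join: "\<not> starts b v \<Longrightarrow> split_word b (join_word b n v) = (n, v)"
  by (auto simp: split_word_def join_word_def starts_def split: list.splits)

lemma red_word_join: "red_word v \<Longrightarrow> \<not> starts b v \<Longrightarrow> red_word (join_word b n v)"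
  by (auto simp: join_word_def red_word_Cons)

lemma shift_join: "red_word v \<Longrightarrow> \<not> starts b v \<Longrightarrow> shift b k (join_word b n v) = join_word b (n + k) v"
  by (simp add: shift_def red_word_join split_join)

lemma shift_not_reduced: "\<not> red_word w \<Longrightarrow> shift b k w = w"
  by (simp add: shift_def)

lemma red_word_shift: "red_word (shift b k w) = red_word w"
  by (metis red_word_cases red_word_join shift_join shift_not_reduced)

lemma shift_shift: "shift b k (shift b l w) = shift b (k + l) w"
proof (cases "red_word w")
  case True
  then obtain n v where "w = join_word b n v" "red_word v" "\<not> starts b v" using red_word_cases by metis
  then show ?thesis by (simp add: shift_join add_ac)
qed (simp add: shift_not_reduced)

lemma shift_0: "shift b 0 w = w"
proof (cases "red_word w")
  case True
  then obtain n v where "w = join_word b n v" "red_word v" "\<not> starts b v" using red_word_cases by metis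
  then show ?thesis by (simp add: shift_join)
qed (simp add: shift_not_reduced)

text \<open>\<open>to_tensor b\<close> passes from the basis of centred words to the basis in which the leading power of
  \<open>u\<^sub>b\<close> is not centred; there \<open>u\<^sub>b\<close> acts as a shift.\<close>

definition to_tensor :: "bool \<Rightarrow> vec \<Rightarrow> vec" where
  "to_tensor b = extend (\<lambda>w. if red_word w \<and> starts b w
     then basis w - smul (mom b (fst (split_word b w))) (basis (snd (split_word b w))) else basis w)"

definition from_tensor :: "bool \<Rightarrow> vec \<Rightarrow> vec" where
  "from_tensor b = extend (\<lambda>w. if red_word w \<and> starts b w
     then basis w + smul (mom b (fst (split_word b w))) (basis (snd (split_word b w))) else basis w)"

definition shift_op :: "bool \<Rightarrow> int \<Rightarrow> vec \<Rightarrow> vec" where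
  "shift_op b k = extend (\<lambda>w. basis (shift b k w))"

definition tkern :: "bool \<Rightarrow> word \<Rightarrow> word \<Rightarrow> complex" where
  "tkern b w w' = (if red_word w \<and> red_word w' then
     mom b (fst (split_word b w) - fst (split_word b w')) * kern (snd (split_word b w)) (snd (split_word b w')) else 0)"

definition U :: "bool \<Rightarrow> int \<Rightarrow> vec \<Rightarrow> vec" where
  "U b k x = from_tensor b (shift_op b k (to_tensor b x))"

lemma lin_ops: "lin_map (to_tensor b)" "lin_map (from_tensor b)" "lin_map (shift_op b k)"
  unfolding to_tensor_def from_tensor_def shift_op_def by (rule lin_extend)+

lemma lin_U: "lin_map (U b k)"
  using lin_map_comp[OF lin_ops(2) lin_map_comp[OF lin_ops(3) lin_ops(1)]] by (simp add: U_def[abs_def])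

lemma lin_map_diff: "lin_map T \<Longrightarrow> T (x - y) = T x - T y"
  by (metis add_diff_cancel_left' diff_add_cancel lin_mapD(1) add.commute)

lemma starts_join: "\<not> starts b v \<Longrightarrow> starts b (join_word b n v) \<longleftrightarrow> n \<noteq> 0"
  by (auto simp: join_word_def starts_def)

lemma tensor_join:
  assumes "red_word v" "\<not> starts b v"
  shows "to_tensor b (basis (join_word b n v)) = (if n = 0 then basis v else basis (join_word b n v) - smul (mom b n) (basis v))"
    and "from_tensor b (basis (join_word b n v)) = (if n = 0 then basis v else basis (join_word b n v) + smul (mom b n) (basis v))"
  using assms by (auto simp: to_tensor_def from_tensor_def starts_join red_word_join split_join) (simp_all add: join_word_def)

lemma tensor_not_reduced:
  "\<not> red_word w \<Longrightarrow> to_tensor b (basis w) = basis w" "\<not> red_word w \<Longrightarrow> from_tensor b (basis w) = basis w"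
  by (auto simp: to_tensor_def from_tensor_def)

lemma join_0: "join_word b 0 v = v" by (simp add: join_word_def)

lemma tensor_0:
  assumes "red_word v" "\<not> starts b v"
  shows "to_tensor b (basis v) = basis v" "from_tensor b (basis v) = basis v"
  using tensor_join[OF assms, of 0] by (simp_all add: join_0)

lemma to_from: "to_tensor b (from_tensor b x) = x"
proof -
  have "to_tensor b (from_tensor b (basis w)) = basis w" for w
  proof (cases "red_word w")
    case True
    then obtain n v where w: "w = join_word b n v" "red_word v" "\<not> starts b v" using red_word_cases by metis
    show ?thesis
      by (cases "n = 0") (simp_all add: w tensor_join[OF w(2,3)] tensor_0[OF w(2,3)] join_0 lin_mapD[OF lin_ops(1)])
  qed (simp add: tensor_not_reduced)
  then show ?thesis using lin_map_eqI[OF lin_map_comp[OF lin_ops(1) lin_ops(2)] lin_map_id] by metis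
qed

lemma from_to: "from_tensor b (to_tensor b x) = x"
proof -
  have "from_tensor b (to_tensor b (basis w)) = basis w" for w
  proof (cases "red_word w")
    case True
    then obtain n v where w: "w = join_word b n v" "red_word v" "\<not> starts b v" using red_word_cases by metis
    show ?thesis
      by (cases "n = 0") (simp_all add: w tensor_join[OF w(2,3)] tensor_0[OF w(2,3)] join_0 lin_mapD[OF lin_ops(2)] lin_map_diff[OF lin_ops(2)])
  qed (simp add: tensor_not_reduced)
  then show ?thesis using lin_map_eqI[OF lin_map_comp[OF lin_ops(2) lin_ops(1)] lin_map_id] by metis
qed

lemma shift_op_shift_op: "shift_op b k (shift_op b l x) = shift_op b (k + l) x"
proof -
  have "(\<lambda>x. shift_op b k (shift_op b l x)) = shift_op b (k + l)"
    by (rule lin_map_eqI[OF lin_map_comp[OF lin_ops(3) lin_ops(3)] lin_ops(3)]) (simp add: shift_op_def shift_shift)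
  then show ?thesis by (rule fun_cong)
qed

lemma shift_op_0: "shift_op b 0 x = x"
proof -
  have "shift_op b 0 = (\<lambda>x. x)"
    by (rule lin_map_eqI[OF lin_ops(3) lin_map_id]) (simp add: shift_op_def shift_0)
  then show ?thesis by (rule fun_cong)
qed

lemma U_add: "U b k (U b l x) = U b (k + l) x"
  by (simp add: U_def to_from shift_op_shift_op)

lemma U_0: "U b 0 x = x"
  by (simp add: U_def shift_op_0 from_to)

lemma kern_join_same:
  assumes "red_word v" "\<not> starts b v" "red_word v'" "\<not> starts b v'" "n \<noteq> 0" "n' \<noteq> 0"
  shows "kern (join_word b n v) (join_word b n' v') = gram b n n' * kern v v'"
  using assms red_word_join[of v b n] red_word_join[of v' b n'] by (simp add: kern_def join_word_def)

lemma kern0_starts: "starts b w \<Longrightarrow> \<not> starts b v \<Longrightarrow> kern0 w v = 0" "starts b w \<Longrightarrow> \<not> starts b v \<Longrightarrow> kern0 v w = 0"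
  by (cases v; auto simp: starts_def)+

lemma kern_starts: "starts b w \<Longrightarrow> \<not> starts b v \<Longrightarrow> kern w v = 0" "starts b w \<Longrightarrow> \<not> starts b v \<Longrightarrow> kern v w = 0"
  by (simp_all add: kern_def kern0_starts)

lemma tkern_join:
  assumes "red_word v" "\<not> starts b v" "red_word v'" "\<not> starts b v'"
  shows "tkern b (join_word b n v) (join_word b n' v') = mom b (n - n') * kern v v'"
  using assms by (simp add: tkern_def red_word_join split_join)

lemma mom_cnj: "cnj (mom b n) = mom b (- n)"
proof -
  note f = circle_prob_finite[OF law[of b]]
  have "cnj (mom b n) = (\<integral>\<zeta>. cnj (\<zeta> powi n) \<partial>law b)"
    unfolding mom_def
    by (rule integral_bounded_linear[OF bounded_linear_cnj circle_int[OF cont_powi], symmetric])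
  also have "\<dots> = mom b (- n)"
    unfolding mom_def
    by (rule circle_integral_cong[OF f]) (simp only: cnj_powi power_int_minus)
  finally show ?thesis .
qed

lemma form_diff_left: "form k (x - x') y = form k x y - form k x' y"
  using form_add_left[of k "x - x'" x' y] by simp

lemma form_diff_right: "form k x (y - y') = form k x y - form k x y'"
  using form_add_right[of k x "y - y'" y'] by simp

text \<open>On words led by a letter of colour \<open>b\<close>, \<open>gram b\<close> is the covariance of the powers of \<open>u\<^sub>b\<close>; adding the means
  back turns it into \<open>mom b (n - n')\<close>, which \<open>tkern\<close> uses and which depends only on the difference.\<close>

lemma form_to_tensor: "form (tkern b) (to_tensor b x) (to_tensor b y) = form kern x y"
proof (rule form_eqI[OF lin_ops(1) lin_ops(1) lin_map_id lin_map_id])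
  fix w w'
  show "form (tkern b) (to_tensor b (basis w)) (to_tensor b (basis w')) = form kern (basis w) (basis w')"
  proof (cases "red_word w \<and> red_word w'")
    case True
    obtain n v where w: "w = join_word b n v" "red_word v" "\<not> starts b v" using True red_word_cases by metis
    obtain n' v' where w': "w' = join_word b n' v'" "red_word v'" "\<not> starts b v'" using True red_word_cases by metis
    note tk = tkern_join[OF w(2,3) w'(2,3)]
    have tk0: "tkern b v v' = kern v v'" "tkern b (join_word b n v) v' = mom b n * kern v v'"
      "tkern b v (join_word b n' v') = cnj (mom b n') * kern v v'"
      using tk[of 0 0] tk[of n 0] tk[of 0 n'] by (simp_all add: join_0 mom_0 mom_cnj)
    have k0: "n \<noteq> 0 \<Longrightarrow> kern (join_word b n v) v' = 0" "n' \<noteq> 0 \<Longrightarrow> kern v (join_word b n' v') = 0"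
      using kern_starts(1)[of b "join_word b n v" v'] kern_starts(2)[of b "join_word b n' v'" v]
        starts_join[OF w(3), of n] starts_join[OF w'(3), of n'] w(3) w'(3) by simp_all
    note t = tensor_join(1)[OF w(2,3)] tensor_join(1)[OF w'(2,3)]
    note lin = form_diff_left form_diff_right form_smul_left form_smul_right form_basis
    consider "n = 0" "n' = 0" | "n \<noteq> 0" "n' = 0" | "n = 0" "n' \<noteq> 0" | "n \<noteq> 0" "n' \<noteq> 0" by blast
    then show ?thesis
    proof cases
      case 1
      then show ?thesis unfolding w(1) w'(1) by (simp only: join_0 tensor_0[OF w(2,3)] tensor_0[OF w'(2,3)] lin tk0)
    next
      case 2
      then have t2: "to_tensor b (basis (join_word b n v)) = basis (join_word b n v) - smul (mom b n) (basis v)"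
        using t(1) by simp
      show ?thesis unfolding w(1) w'(1) t2 \<open>n' = 0\<close>
        by (simp only: join_0 tensor_0[OF w'(2,3)] lin tk0 k0(1)[OF 2(1)] diff_self)
    next
      case 3
      then have t2: "to_tensor b (basis (join_word b n' v')) = basis (join_word b n' v') - smul (mom b n') (basis v')"
        using t(2) by simp
      show ?thesis unfolding w(1) w'(1) t2 \<open>n = 0\<close>
        by (simp only: join_0 tensor_0[OF w(2,3)] lin tk0 k0(2)[OF 3(2)] diff_self)
    next
      case 4
      then have t2: "to_tensor b (basis (join_word b n v)) = basis (join_word b n v) - smul (mom b n) (basis v)"
        "to_tensor b (basis (join_word b n' v')) = basis (join_word b n' v') - smul (mom b n') (basis v')"
        using t by simp_all
      have "form (tkern b) (to_tensor b (basis (join_word b n v))) (to_tensor b (basis (join_word b n' v')))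
         = gram b n n' * kern v v'"
        unfolding t2 lin tk tk0 gram_def by (simp add: algebra_simps)
      then show ?thesis
        unfolding w(1) w'(1) form_basis kern_join_same[OF w(2,3) w'(2,3) 4] .
    qed
  next
    case False
    have z: "form (tkern b) x y = 0" if "keys x \<subseteq> {v. \<not> red_word v} \<or> keys y \<subseteq> {v. \<not> red_word v}" for x y
      unfolding form_def tkern_def using that by (intro sum.neutral ballI) auto
    have "form (tkern b) (to_tensor b (basis w)) (to_tensor b (basis w')) = 0"
      using False by (intro z) (auto simp: tensor_not_reduced in_keys_iff lookup_basis split: if_splits)
    then show ?thesis using False by (auto simp: kern_def)
  qed
qed

lemma tkern_shift: "tkern b (shift b k w) (shift b k w') = tkern b w w'"
proof (cases "red_word w \<and> red_word w'")
  case True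
  obtain n v where w: "w = join_word b n v" "red_word v" "\<not> starts b v" using True red_word_cases by metis
  obtain n' v' where w': "w' = join_word b n' v'" "red_word v'" "\<not> starts b v'" using True red_word_cases by metis
  show ?thesis unfolding w(1) w'(1) shift_join[OF w(2,3)] shift_join[OF w'(2,3)] tkern_join[OF w(2,3) w'(2,3)] by simp
qed (auto simp: tkern_def red_word_shift)

text \<open>The kernel \<open>tkern b\<close> is invariant under shifts, so in the tensor picture the adjoint of the shift by \<open>k\<close> is
  the shift by \<open>- k\<close>.\<close>

lemma form_U: "form kern (U b k x) y = form kern x (U b (- k) y)"
proof -
  have s: "form (tkern b) (shift_op b k x) (shift_op b k y) = form (tkern b) x y" for x y
    by (rule form_eqI[OF lin_ops(3) lin_ops(3) lin_map_id lin_map_id]) (simp add: shift_op_def tkern_shift)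
  have "form kern (U b k x) y = form (tkern b) (shift_op b k (to_tensor b x)) (to_tensor b y)"
    unfolding form_to_tensor[of b, symmetric] by (simp add: U_def to_from)
  also have "to_tensor b y = shift_op b k (shift_op b (-k) (to_tensor b y))"
    by (simp add: shift_op_shift_op shift_op_0)
  also have "form (tkern b) (shift_op b k (to_tensor b x)) (shift_op b k (shift_op b (-k) (to_tensor b y)))
     = form (tkern b) (to_tensor b x) (shift_op b (-k) (to_tensor b y))" by (rule s)
  also have "\<dots> = form kern x (U b (- k) y)"
    unfolding form_to_tensor[of b, symmetric] by (simp add: U_def to_from)
  finally show ?thesis .
qed

lemma U_basis:
  assumes "red_word v" "\<not> starts b v"
  shows "U b k (basis v) = (if k = 0 then basis v else basis (join_word b k v) + smul (mom b k) (basis v))"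
  using tensor_join(2)[OF assms, of k] shift_join[OF assms, of k 0]
  by (simp add: U_def tensor_0[OF assms] shift_op_def join_0)

subsection \<open>The star-probability space of adjoint pairs\<close>

text \<open>The form is only semidefinite, so adjoints are not unique; an element of the algebra is a linear map
  together with a chosen adjoint, and the involution swaps the two.\<close>

definition adj :: "(vec \<Rightarrow> vec) \<Rightarrow> (vec \<Rightarrow> vec) \<Rightarrow> bool" where
  "adj T S \<longleftrightarrow> lin_map T \<and> lin_map S \<and> (\<forall>x y. form kern (T x) y = form kern x (S y))"

lemma kern_cnj: "kern w v = cnj (kern v w)"
proof -
  have g: "gram b n n' = cnj (gram b n' n)" for b n n'
    by (simp add: gram_def mom_cnj mult.commute)
  have "kern0 w v = cnj (kern0 v w)"
    by (induction w v rule: kern0.induct) (auto simp: g[symmetric])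
  then show ?thesis by (simp add: kern_def)
qed

lemma form_cnj: "form kern x y = cnj (form kern y x)"
proof -
  have "form kern x y = (\<Sum>v\<in>keys y. \<Sum>w\<in>keys x. lookup x w * cnj (lookup y v) * kern w v)"
    unfolding form_def by (rule sum.swap)
  also have "\<dots> = cnj (form kern y x)"
    unfolding form_def cnj_sum by (intro sum.cong refl) (subst kern_cnj, simp add: mult_ac)
  finally show ?thesis .
qed

lemma adj_sym: "adj T S \<Longrightarrow> adj S T"
  unfolding adj_def by (metis form_cnj)

lemma adj_comp: "adj T S \<Longrightarrow> adj T' S' \<Longrightarrow> adj (\<lambda>x. T (T' x)) (\<lambda>x. S' (S x))"
  by (simp add: adj_def lin_map_comp)

lemma adj_add: "adj T S \<Longrightarrow> adj T' S' \<Longrightarrow> adj (\<lambda>x. T x + T' x) (\<lambda>x. S x + S' x)"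
  by (simp add: adj_def lin_map_add form_linear)

lemma adj_smul: "adj T S \<Longrightarrow> adj (\<lambda>x. smul c (T x)) (\<lambda>x. smul (cnj c) (S x))"
  by (simp add: adj_def lin_map_smul form_linear)

lemma adj_id: "adj (\<lambda>x. x) (\<lambda>x. x)"
  by (simp add: adj_def lin_map_id)

lemma adj_zero: "adj (\<lambda>x. 0) (\<lambda>x. 0)"
  using adj_smul[OF adj_id, of 0] by simp

lemma adj_U: "adj (U b k) (U b (- k))"
  by (simp add: adj_def lin_U form_U)

definition vac :: vec where "vac = basis []"

text \<open>The algebra of adjoint pairs has to be carried by functions on words. A pair is determined by the
  matrix entries of its two maps, and these are countably many, so they can be listed on one-letter words.\<close>

definition entry_code :: "(vec \<Rightarrow> vec) \<times> (vec \<Rightarrow> vec) \<Rightarrow> nc_carrier" where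
  "entry_code P l = (let (f, w, v) = inv_into UNIV (\<lambda>a::bool \<times> word \<times> word. [(True, int (to_nat a))]) l
     in lookup ((if f then fst P else snd P) (basis w)) v)"

definition pairs :: "((vec \<Rightarrow> vec) \<times> (vec \<Rightarrow> vec)) set" where
  "pairs = {(T, S). adj T S}"

lemma entry_code_inj: "inj_on entry_code pairs"
proof (rule inj_onI)
  fix P Q assume P: "P \<in> pairs" and Q: "Q \<in> pairs" and eq: "entry_code P = entry_code Q"
  have inj: "inj (\<lambda>a::bool \<times> word \<times> word. [(True, int (to_nat a))])"
    by (auto intro!: injI)
  have "lookup ((if f then fst P else snd P) (basis w)) v = lookup ((if f then fst Q else snd Q) (basis w)) v" for f w v
    using fun_cong[OF eq, of "[(True, int (to_nat (f, w, v)))]"] inv_f_f[OF inj, of "(f, w, v)"]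
    by (simp add: entry_code_def)
  from this[of True] this[of False] have "fst P (basis w) = fst Q (basis w)" "snd P (basis w) = snd Q (basis w)" for w
    by (auto intro!: lookup_eqI)
  moreover have "lin_map (fst P)" "lin_map (snd P)" "lin_map (fst Q)" "lin_map (snd Q)"
    using P Q by (auto simp: pairs_def adj_def)
  ultimately show "P = Q" by (intro prod_eqI lin_map_eqI) auto
qed

definition dec :: "nc_carrier \<Rightarrow> (vec \<Rightarrow> vec) \<times> (vec \<Rightarrow> vec)" where
  "dec = the_inv_into pairs entry_code"

lemma dec_code [simp]: "P \<in> pairs \<Longrightarrow> dec (entry_code P) = P"
  unfolding dec_def by (rule the_inv_into_f_f[OF entry_code_inj])

definition pmult where "pmult P Q = (\<lambda>x. fst P (fst Q x), \<lambda>x. snd Q (snd P x))"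
definition padd where "padd P Q = (\<lambda>x. fst P x + fst Q x, \<lambda>x. snd P x + snd Q x)"
definition pscl where "pscl c P = (\<lambda>x. smul c (fst P x), \<lambda>x. smul (cnj c) (snd P x))"
definition pone where "pone = (\<lambda>x::vec. x, \<lambda>x::vec. x)"
definition pzero where "pzero = (\<lambda>x::vec. 0::vec, \<lambda>x::vec. 0::vec)"

lemma pairs_closed:
  "P \<in> pairs \<Longrightarrow> Q \<in> pairs \<Longrightarrow> pmult P Q \<in> pairs" "P \<in> pairs \<Longrightarrow> Q \<in> pairs \<Longrightarrow> padd P Q \<in> pairs"
  "P \<in> pairs \<Longrightarrow> pscl c P \<in> pairs" "pone \<in> pairs" "pzero \<in> pairs" "P \<in> pairs \<Longrightarrow> prod.swap P \<in> pairs"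
  by (auto simp: pairs_def pmult_def padd_def pscl_def pone_def pzero_def
      intro: adj_comp adj_add adj_smul adj_id adj_zero adj_sym)

definition alg :: "nc_carrier ring" where
  "alg = \<lparr>carrier = entry_code ` pairs,
     monoid.mult = (\<lambda>a b. entry_code (pmult (dec a) (dec b))), one = entry_code pone,
     zero = entry_code pzero, add = (\<lambda>a b. entry_code (padd (dec a) (dec b)))\<rparr>"

definition ascl :: "complex \<Rightarrow> nc_carrier \<Rightarrow> nc_carrier" where "ascl c a = entry_code (pscl c (dec a))"
definition astar :: "nc_carrier \<Rightarrow> nc_carrier" where "astar a = entry_code (prod.swap (dec a))"
definition astate :: "nc_carrier \<Rightarrow> complex" where "astate a = form kern (fst (dec a) vac) vac"

lemma alg_simps [simp]:
  "carrier alg = entry_code ` pairs" "\<one>\<^bsub>alg\<^esub> = entry_code pone" "\<zero>\<^bsub>alg\<^esub> = entry_code pzero"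
  "P \<in> pairs \<Longrightarrow> Q \<in> pairs \<Longrightarrow> entry_code P \<otimes>\<^bsub>alg\<^esub> entry_code Q = entry_code (pmult P Q)"
  "P \<in> pairs \<Longrightarrow> Q \<in> pairs \<Longrightarrow> entry_code P \<oplus>\<^bsub>alg\<^esub> entry_code Q = entry_code (padd P Q)"
  "P \<in> pairs \<Longrightarrow> ascl c (entry_code P) = entry_code (pscl c P)"
  "P \<in> pairs \<Longrightarrow> astar (entry_code P) = entry_code (prod.swap P)"
  "P \<in> pairs \<Longrightarrow> astate (entry_code P) = form kern (fst P vac) vac"
  by (simp_all add: alg_def ascl_def astar_def astate_def)

lemma pair_lin: "P \<in> pairs \<Longrightarrow> lin_map (fst P)" "P \<in> pairs \<Longrightarrow> lin_map (snd P)"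
  by (auto simp: pairs_def adj_def)

lemma pair_form: "P \<in> pairs \<Longrightarrow> form kern (fst P x) y = form kern x (snd P y)"
  by (auto simp: pairs_def adj_def)

lemma form_vac: "form kern vac vac = 1"
  by (simp add: vac_def kern_def)

lemma pring:
  "padd (padd P Q) R = padd P (padd Q R)" "padd P (padd Q R) = padd Q (padd P R)" "padd P Q = padd Q P" "padd pzero P = P"
  "pmult (pmult P Q) R = pmult P (pmult Q R)" "pmult pone P = P" "pmult P pone = P"
  "R \<in> pairs \<Longrightarrow> pmult (padd P Q) R = padd (pmult P R) (pmult Q R)"
  "R \<in> pairs \<Longrightarrow> pmult R (padd P Q) = padd (pmult R P) (pmult R Q)"
  by (simp_all add: padd_def pmult_def pzero_def pone_def add_ac lin_mapD[OF pair_lin(1)] lin_mapD[OF pair_lin(2)])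

lemma pairs_swap: "(T, S) \<in> pairs \<Longrightarrow> (S, T) \<in> pairs"
  using pairs_closed(6)[of "(T, S)"] by simp

lemma alg_ring: "ring alg"
proof (rule ringI)
  show "abelian_group alg"
  proof (rule abelian_groupI)
    fix a assume "a \<in> carrier alg"
    then obtain P where P: "P \<in> pairs" "a = entry_code P" by auto
    have "smul (-1) x + x = 0" for x :: vec by (rule lookup_eqI) (simp add: lookup_add)
    then have "padd (pscl (-1) P) P = pzero" by (simp add: padd_def pscl_def pzero_def)
    then show "\<exists>y\<in>carrier alg. y \<oplus>\<^bsub>alg\<^esub> a = \<zero>\<^bsub>alg\<^esub>"
      using P by (intro bexI[of _ "entry_code (pscl (-1) P)"]) (auto simp: pairs_closed)
  qed (auto simp: pairs_closed pring)
  show "Group.monoid alg"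
    by (rule monoidI) (auto simp: pairs_closed pring)
qed (auto simp: pairs_closed pring)

lemma pscl_simps:
  "pscl c (padd P Q) = padd (pscl c P) (pscl c Q)" "pscl (c + d) P = padd (pscl c P) (pscl d P)"
  "pscl c (pscl d P) = pscl (c * d) P" "pscl 1 P = P"
  "Q \<in> pairs \<Longrightarrow> pmult (pscl c P) Q = pscl c (pmult P Q)" "P \<in> pairs \<Longrightarrow> pmult P (pscl c Q) = pscl c (pmult P Q)"
  by (simp_all add: pscl_def padd_def pmult_def lin_mapD[OF pair_lin(1)] lin_mapD[OF pair_lin(2)])

lemma swap_simps:
  "prod.swap (padd P Q) = padd (prod.swap P) (prod.swap Q)" "prod.swap (pscl c P) = pscl (cnj c) (prod.swap P)"
  "prod.swap (pmult P Q) = pmult (prod.swap Q) (prod.swap P)"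
  by (simp_all add: pscl_def padd_def pmult_def)

lemma fst_simps: "fst (padd P Q) x = fst P x + fst Q x" "fst (pscl c P) x = smul c (fst P x)" "fst pone x = x"
  by (simp_all add: pscl_def padd_def pone_def)

lemma alg_space: "star_prob_space alg ascl astar astate"
proof -
  have pos: "form kern (fst (pmult (S, T) (T, S)) vac) vac \<in> \<real>\<^sub>\<ge>\<^sub>0" if "(T, S) \<in> pairs" for T S
  proof -
    have "form kern (S (T vac)) vac = form kern (T vac) (T vac)"
      using pair_form[OF pairs_swap[OF that], of "T vac" vac] by simp
    then show ?thesis using form_pos by (simp add: pmult_def)
  qed
  show ?thesis
    by (intro star_prob_space.intro star_prob_space_axioms.intro alg_ring)
       (auto simp: pairs_closed pairs_swap pos pscl_simps swap_simps fst_simps form_linear form_vac)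
qed

definition Upair :: "bool \<Rightarrow> int \<Rightarrow> (vec \<Rightarrow> vec) \<times> (vec \<Rightarrow> vec)" where
  "Upair b k = (U b k, U b (- k))"

lemma Upair_in: "Upair b k \<in> pairs"
  by (simp add: Upair_def pairs_def adj_U)

lemma Upair_mult: "pmult (Upair b k) (Upair b l) = Upair b (k + l)"
  by (simp add: Upair_def pmult_def U_add fun_eq_iff add.commute)

lemma Upair_0: "Upair b 0 = pone"
  by (simp add: Upair_def pone_def U_0 fun_eq_iff)

definition gen :: "bool \<Rightarrow> nc_carrier" where
  "gen b = entry_code (Upair b 1)"

interpretation alg: star_prob_space alg ascl astar astate
  by (rule alg_space)

lemma gen_pow: "gen b [^]\<^bsub>alg\<^esub> (n::nat) = entry_code (Upair b (int n))"
proof (induction n)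
  case (Suc n)
  have "gen b [^]\<^bsub>alg\<^esub> Suc n = gen b [^]\<^bsub>alg\<^esub> n \<otimes>\<^bsub>alg\<^esub> gen b" by simp
  then show ?case using Suc by (simp add: gen_def Upair_in Upair_mult add.commute)
qed (simp add: Upair_0)

lemma star_gen: "astar (gen b) = entry_code (Upair b (-1))"
  by (simp add: gen_def Upair_in) (simp add: Upair_def)

lemma star_gen_pow: "astar (gen b) [^]\<^bsub>alg\<^esub> (n::nat) = entry_code (Upair b (- int n))"
proof (induction n)
  case (Suc n)
  have "astar (gen b) [^]\<^bsub>alg\<^esub> Suc n = astar (gen b) [^]\<^bsub>alg\<^esub> n \<otimes>\<^bsub>alg\<^esub> astar (gen b)" by simp
  then show ?case using Suc by (simp add: star_gen Upair_in Upair_mult add.commute)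
qed (simp add: Upair_0)

lemma gen_unitary: "alg.unitary (gen b)"
  unfolding alg.unitary_def star_gen
  by (simp add: gen_def Upair_in Upair_mult Upair_0)

lemma state_U: "astate (entry_code (Upair b k)) = mom b k"
proof -
  have "U b k vac = (if k = 0 then vac else basis [(b, k)] + smul (mom b k) vac)"
    unfolding vac_def by (subst U_basis) (auto simp: starts_def join_word_def)
  then show ?thesis
    by (simp add: Upair_in) (simp add: Upair_def form_linear form_vac mom_0 vac_def kern_def)
qed

lemma gen_law: "alg.unitary_law (gen b) (law b)"
proof -
  note f = circle_prob_finite[OF law[of b]]
  have "(\<integral>\<zeta>. cnj \<zeta> ^ n \<partial>law b) = mom b (- int n)" for n
    unfolding mom_def by (rule circle_integral_cong[OF f]) (simp add: cnj_unit power_int_minus power_inverse del: mem_sphere)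
  moreover have "(\<integral>\<zeta>. \<zeta> ^ n \<partial>law b) = mom b (int n)" for n
    by (simp add: mom_def)
  ultimately show ?thesis
    unfolding alg.unitary_law_def gen_pow star_gen_pow state_U using law by simp
qed

text \<open>These form the star-algebra generated by \<open>u\<^sub>b\<close>: combinations of integer powers. On a word that does not
  start with \<open>b\<close>, such an element acts as its state plus terms in which a letter of colour \<open>b\<close> has been
  prepended. A centred element therefore always prepends, which gives freeness.\<close>

inductive laurent :: "bool \<Rightarrow> (vec \<Rightarrow> vec) \<times> (vec \<Rightarrow> vec) \<Rightarrow> bool" for b where
  pow: "laurent b (Upair b k)"
| add: "laurent b P \<Longrightarrow> laurent b Q \<Longrightarrow> laurent b (padd P Q)"
| scl: "laurent b P \<Longrightarrow> laurent b (pscl c P)"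

lemma laurent_pairs: "laurent b P \<Longrightarrow> P \<in> pairs"
  by (induction rule: laurent.induct) (auto simp: Upair_in pairs_closed)

lemma laurent_mult:
  assumes "laurent b P" "laurent b Q" shows "laurent b (pmult P Q)"
  using assms
proof (induction arbitrary: Q rule: laurent.induct)
  case (pow k)
  from pow show ?case
  proof (induction rule: laurent.induct)
    case (add P Q)
    have "pmult (Upair b k) (padd P Q) = padd (pmult (Upair b k) P) (pmult (Upair b k) Q)"
      by (simp add: pmult_def padd_def Upair_def lin_mapD[OF lin_U])
    then show ?case using add by (simp add: laurent.add)
  next
    case (scl P c)
    have "pmult (Upair b k) (pscl c P) = pscl c (pmult (Upair b k) P)"
      by (simp add: pmult_def pscl_def Upair_def lin_mapD[OF lin_U])
    then show ?case using scl by (simp add: laurent.scl)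
  qed (simp add: Upair_mult laurent.pow)
next
  case (add P P')
  have "pmult (padd P P') Q = padd (pmult P Q) (pmult P' Q)"
    using pair_lin(2)[OF laurent_pairs[OF add.prems]] by (simp add: pmult_def padd_def lin_mapD)
  then show ?case using add by (simp add: laurent.add)
next
  case (scl P c)
  have "pmult (pscl c P) Q = pscl c (pmult P Q)"
    using pair_lin(2)[OF laurent_pairs[OF scl.prems]] by (simp add: pmult_def pscl_def lin_mapD)
  then show ?case using scl by (simp add: laurent.scl)
qed

lemma laurent_swap: "laurent b P \<Longrightarrow> laurent b (prod.swap P)"
proof (induction rule: laurent.induct)
  case (pow k)
  have "prod.swap (Upair b k) = Upair b (- k)" by (simp add: Upair_def)
  then show ?case by (simp add: laurent.pow)
next
  case (add P Q)
  have "prod.swap (padd P Q) = padd (prod.swap P) (prod.swap Q)" by (simp add: padd_def)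
  then show ?case using add by (simp add: laurent.add)
next
  case (scl P c)
  have "prod.swap (pscl c P) = pscl (cnj c) (prod.swap P)" by (simp add: pscl_def)
  then show ?case using scl by (simp add: laurent.scl)
qed

lemma gen_algebra: "alg.star_algebra_gen {gen b} \<subseteq> entry_code ` {P. laurent b P}"
proof -
  have "alg.star_subalgebra (entry_code ` {P. laurent b P})"
    unfolding alg.star_subalgebra_def
    using laurent.pow[of b 0]
    by (auto simp: laurent_pairs Upair_0 laurent_mult laurent_swap laurent.add laurent.scl)
  moreover have "gen b \<in> entry_code ` {P. laurent b P}" by (auto simp: gen_def laurent.pow)
  ultimately show ?thesis unfolding alg.star_algebra_gen_def by blast
qed

definition led :: "bool \<Rightarrow> vec set" where
  "led b = {x. keys x \<subseteq> {w. red_word w \<and> starts b w}}"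

lemma led_add: "x \<in> led b \<Longrightarrow> y \<in> led b \<Longrightarrow> x + y \<in> led b"
  using Poly_Mapping.keys_add[of x y] by (auto simp: led_def)

lemma led_smul: "x \<in> led b \<Longrightarrow> smul c x \<in> led b"
  using keys_smul[of c x] by (auto simp: led_def)

lemma laurent_on_word:
  assumes "laurent b P" "red_word v" "\<not> starts b v"
  shows "\<exists>y\<in>led b. fst P (basis v) = y + smul (form kern (fst P vac) vac) (basis v)"
  using assms(1)
proof (induction rule: laurent.induct)
  case (pow k)
  have s: "form kern (fst (Upair b k) vac) vac = mom b k" using state_U[of b k] by (simp add: Upair_in)
  show ?case
  proof (cases "k = 0")
    case True
    then show ?thesis using s by (intro bexI[of _ 0]) (auto simp: Upair_def U_0 mom_0 led_def)
  next
    case False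
    then have "basis (join_word b k v) \<in> led b"
      using assms(2,3) by (auto simp: led_def in_keys_iff lookup_basis red_word_join starts_join split: if_splits)
    then show ?thesis
      unfolding s using False assms(2,3)
      by (intro bexI[of _ "basis (join_word b k v)"]) (auto simp: Upair_def U_basis)
  qed
next
  case (add P Q)
  then obtain y z where "y \<in> led b" "z \<in> led b"
    "fst P (basis v) = y + smul (form kern (fst P vac) vac) (basis v)"
    "fst Q (basis v) = z + smul (form kern (fst Q vac) vac) (basis v)" by blast
  then show ?case by (intro bexI[of _ "y + z"]) (auto simp: padd_def form_linear led_add)
next
  case (scl P c)
  then obtain y where "y \<in> led b" "fst P (basis v) = y + smul (form kern (fst P vac) vac) (basis v)" by blast
  then show ?case by (intro bexI[of _ "smul c y"]) (auto simp: pscl_def form_linear led_smul)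
qed

lemma laurent_centred:
  assumes P: "laurent b P" "form kern (fst P vac) vac = 0"
    and x: "keys x \<subseteq> {w. red_word w \<and> \<not> starts b w}"
  shows "fst P x \<in> led b"
proof -
  have lin: "lin_map (fst P)" by (rule pair_lin[OF laurent_pairs[OF P(1)]])
  have 0: "fst P 0 = 0" using lin_mapD(2)[OF lin, of 0 0] by simp
  have *: "fst P (\<Sum>w\<in>S. smul (lookup x w) (basis w)) \<in> led b" if "finite S" "S \<subseteq> keys x" for S
    using that
  proof (induction S)
    case empty
    then show ?case by (simp add: 0 led_def)
  next
    case (insert w S)
    then have "red_word w" "\<not> starts b w" using x by auto
    then have "fst P (basis w) \<in> led b" using laurent_on_word[OF P(1), of w] P(2) by auto
    then show ?case using insert by (simp add: lin_mapD[OF lin] led_add led_smul)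
  qed
  show ?thesis using *[of "keys x"] by (simp add: vec_expand)
qed

lemma gen_free: "alg.free_family (\<lambda>b. alg.star_algebra_gen {gen b})"
  unfolding alg.free_family_def
proof (intro allI impI)
  fix w :: "(bool \<times> nc_carrier) list"
  assume w: "w \<noteq> [] \<and> distinct_adj (map fst w) \<and> (\<forall>(i, b)\<in>set w. b \<in> alg.star_algebra_gen {gen i} \<and> astate b = 0)"
  \<comment> \<open>applied to the vacuum, an alternating product of centred elements produces words led by its first letter\<close>
  have "\<exists>P\<in>pairs. foldr (\<otimes>\<^bsub>alg\<^esub>) (map snd w) \<one>\<^bsub>alg\<^esub> = entry_code P \<and> fst P vac \<in> led (fst (hd w))"
    using w
  proof (induction w)
    case (Cons a w)
    obtain b c where a: "a = (b, c)" by (cases a)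
    have c: "c \<in> alg.star_algebra_gen {gen b}" "astate c = 0" using Cons.prems a by auto
    then obtain Q where Q: "laurent b Q" "c = entry_code Q" using gen_algebra by blast
    have Qp: "Q \<in> pairs" by (rule laurent_pairs[OF Q(1)])
    have Q0: "form kern (fst Q vac) vac = 0" using c(2) Q(2) Qp by simp
    have "\<exists>P\<in>pairs. foldr (\<otimes>\<^bsub>alg\<^esub>) (map snd w) \<one>\<^bsub>alg\<^esub> = entry_code P \<and> keys (fst P vac) \<subseteq> {w. red_word w \<and> \<not> starts b w}"
    proof (cases "w = []")
      case True
      then show ?thesis
        by (intro bexI[of _ pone])
           (auto simp: pairs_closed pairs_closed(4)[unfolded pone_def] pone_def vac_def in_keys_iff lookup_basis starts_def split: if_splits)
    next
      case False
      then have ne: "fst (hd w) \<noteq> b" using Cons.prems a by (cases w) auto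
      have "distinct_adj (map fst w)" using Cons.prems a False by (cases w) auto
      then obtain P where P: "P \<in> pairs" "foldr (\<otimes>\<^bsub>alg\<^esub>) (map snd w) \<one>\<^bsub>alg\<^esub> = entry_code P" "fst P vac \<in> led (fst (hd w))"
        using Cons False by auto
      moreover have "\<not> starts b v" if "starts (fst (hd w)) v" for v using that ne by (auto simp: starts_def)
      ultimately show ?thesis by (auto simp: led_def)
    qed
    then obtain P where P: "P \<in> pairs" "foldr (\<otimes>\<^bsub>alg\<^esub>) (map snd w) \<one>\<^bsub>alg\<^esub> = entry_code P"
      "keys (fst P vac) \<subseteq> {w. red_word w \<and> \<not> starts b w}" by blast
    have "fst (pmult Q P) vac \<in> led b"
      using laurent_centred[OF Q(1) Q0 P(3)] by (simp add: pmult_def)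
    then show ?case using P Q Qp a by (intro bexI[of _ "pmult Q P"]) (auto simp: pairs_closed)
  qed simp
  then obtain P b where P: "P \<in> pairs" "foldr (\<otimes>\<^bsub>alg\<^esub>) (map snd w) \<one>\<^bsub>alg\<^esub> = entry_code P" "fst P vac \<in> led b" by blast
  have "form kern (fst P vac) vac = 0"
    unfolding form_def
  proof (intro sum.neutral ballI)
    fix u v assume "u \<in> keys (fst P vac)" "v \<in> keys vac"
    then have "starts b u" "v = []" using P(3) by (auto simp: led_def vac_def in_keys_iff lookup_basis split: if_splits)
    then have "kern u v = 0" using kern_starts(1)[of b u v] by (simp add: starts_def)
    then show "lookup (fst P vac) u * cnj (lookup vac v) * kern u v = 0" by simp
  qed
  then show "astate (foldr (\<otimes>\<^bsub>alg\<^esub>) (map snd w) \<one>\<^bsub>alg\<^esub>) = 0" using P by simp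
qed

end

theorem free_pair_exists:
  assumes "\<mu> \<in> circle_prob" "\<nu> \<in> circle_prob"
  obtains A :: "nc_carrier ring" and scl star \<phi> u v where
    "star_prob_space A scl star \<phi>" "star_prob_space.unitary A star u" "star_prob_space.unitary A star v"
    "star_prob_space.free_elements A scl star \<phi> u v"
    "star_prob_space.unitary_law A star \<phi> u \<mu>" "star_prob_space.unitary_law A star \<phi> v \<nu>"
proof -
  interpret two_laws "\<lambda>b. if b then \<mu> else \<nu>"
    using assms by unfold_locales auto
  interpret alg: star_prob_space alg ascl astar astate by (rule alg_space)
  have "alg.free_elements (gen True) (gen False)"
  proof -
    have "(\<lambda>b. alg.star_algebra_gen {gen b}) = (\<lambda>i. if i then alg.star_algebra_gen {gen True} else alg.star_algebra_gen {gen False})"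
      by (auto simp: fun_eq_iff)
    then show ?thesis unfolding alg.free_elements_def using gen_free by simp
  qed
  then show ?thesis
    using that[OF alg_space gen_unitary[of True] gen_unitary[of False]] gen_law[of True] gen_law[of False] by simp
qed

section \<open>The Sigma-transform\<close>

text \<open>\<open>z \<mapsto> z S z\<close> is a local inverse of \<open>eta \<mu>\<close>. This pins down the germ of the Sigma-transform without
  reference to removable singularities.\<close>

definition Sigma_germ :: "complex measure \<Rightarrow> (complex \<Rightarrow> complex) \<Rightarrow> bool" where
  "Sigma_germ \<mu> S \<longleftrightarrow> S analytic_on {0} \<and> (\<forall>\<^sub>F z in nhds 0. eta \<mu> (z * S z) = z)"

lemma analytic_isCont: "S analytic_on {0} \<Longrightarrow> isCont S (0::complex)"
  by (rule analytic_at_imp_isCont)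

lemma isCont_nhds: "isCont f a \<Longrightarrow> (f \<longlongrightarrow> f a) (nhds a)"
  by (simp add: isCont_def tendsto_at_iff_tendsto_nhds)

lemma id_times_tendsto:
  assumes "S analytic_on {0}"
  shows "((\<lambda>z::complex. z * S z) \<longlongrightarrow> 0) (nhds 0)"
proof -
  have "isCont (\<lambda>z. z * S z) 0" using analytic_isCont[OF assms] by (intro continuous_intros)
  from isCont_nhds[OF this] show ?thesis by simp
qed

lemma id_times_small:
  assumes "S analytic_on {0}" "e > 0"
  shows "\<forall>\<^sub>F z in nhds (0::complex). norm (z * S z) < e"
  using tendstoD[OF id_times_tendsto[OF assms(1)] assms(2)] by simp

lemma nhds_imp_at: "(\<forall>\<^sub>F z in nhds a. P z) \<Longrightarrow> (\<forall>\<^sub>F z in at a. P z)"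
  by (auto simp: eventually_at_filter elim: eventually_mono)

lemma id_times_deriv:
  fixes B :: "complex \<Rightarrow> complex"
  assumes "isCont B 0" shows "((\<lambda>z. z * B z) has_field_derivative B 0) (at 0)"
proof -
  have "B \<midarrow>0\<rightarrow> B 0" using assms by (simp add: isCont_def)
  moreover have "\<forall>\<^sub>F z in at 0. B z = (z * B z - 0 * B 0) / (z - 0)"
    by (auto simp: eventually_at_filter)
  ultimately have "(\<lambda>z. (z * B z - 0 * B 0) / (z - 0)) \<midarrow>0\<rightarrow> B 0"
    by (rule Lim_transform_eventually)
  then show ?thesis by (simp add: has_field_derivative_iff)
qed

text \<open>Divide \<open>eta \<mu> (z S z) = z\<close> by \<open>z\<close> and let \<open>z\<close> tend to \<open>0\<close>.\<close>

lemma Sigma_germ_mean: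
  assumes \<mu>: "\<mu> \<in> circle_prob" and S: "Sigma_germ \<mu> S"
  shows "S 0 * (\<integral>\<zeta>. \<zeta> \<partial>\<mu>) = 1"
proof -
  have S': "S analytic_on {0}" "\<forall>\<^sub>F z in nhds 0. eta \<mu> (z * S z) = z" using S by (auto simp: Sigma_germ_def)
  have "((\<lambda>z. S z * Bf \<mu> (z * S z)) \<longlongrightarrow> S 0 * Bf \<mu> 0) (at 0)"
  proof (intro tendsto_mult)
    show "S \<midarrow>0\<rightarrow> S 0" using analytic_isCont[OF S'(1)] by (simp add: isCont_def)
    have "isCont (Bf \<mu>) 0" using Bf_isCont[OF \<mu>, of 0] by simp
    moreover have "isCont (\<lambda>z. z * S z) 0" using analytic_isCont[OF S'(1)] by (intro continuous_intros)
    ultimately have "isCont (\<lambda>z. Bf \<mu> (z * S z)) 0" using isCont_o2[of 0 "\<lambda>z. z * S z" "Bf \<mu>"] by simp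
    then show "((\<lambda>z. Bf \<mu> (z * S z)) \<longlongrightarrow> Bf \<mu> 0) (at 0)" by (simp add: isCont_def)
  qed
  moreover have "\<forall>\<^sub>F z in at 0. S z * Bf \<mu> (z * S z) = 1"
  proof -
    have "\<forall>\<^sub>F z in at 0. z \<noteq> (0::complex)" by (rule eventually_neq_at_within)
    with nhds_imp_at[OF S'(2)] show ?thesis by eventually_elim (simp add: eta_def)
  qed
  ultimately have "((\<lambda>z::complex. 1) \<longlongrightarrow> S 0 * Bf \<mu> 0) (at 0)" by (rule Lim_transform_eventually)
  then have "S 0 * Bf \<mu> 0 = 1" by (simp add: tendsto_const_iff)
  then show ?thesis by (simp add: Bf_0[OF \<mu>])
qed

lemma Sigma_germ_cong:
  assumes "Sigma_germ \<mu> S" "T analytic_on {0}" "\<forall>\<^sub>F z in nhds 0. S z = T z"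
  shows "Sigma_germ \<mu> T"
proof -
  have "\<forall>\<^sub>F z in nhds 0. eta \<mu> (z * S z) = z" using assms(1) by (simp add: Sigma_germ_def)
  with assms(3) have "\<forall>\<^sub>F z in nhds 0. eta \<mu> (z * T z) = z" by eventually_elim simp
  then show ?thesis using assms(2) by (simp add: Sigma_germ_def)
qed

text \<open>The derivative at \<open>0\<close> is \<open>S 0\<close>, so this is the open mapping property of a local inverse.\<close>

lemma id_times_surj:
  assumes S: "S analytic_on {0}" "S 0 \<noteq> 0" and e: "e > 0"
  obtains d where "d > 0" "\<And>y. norm y < d \<Longrightarrow> \<exists>z::complex. norm z < e \<and> z * S z = y"
proof -
  obtain r0 where r0: "r0 > 0" "S holomorphic_on ball 0 r0"
    using S(1) by (auto simp: analytic_on_def)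
  define \<phi> where "\<phi> z = z * S z" for z
  have hol: "\<phi> holomorphic_on ball 0 (min r0 e)"
    unfolding \<phi>_def[abs_def]
    by (rule holomorphic_on_mult[OF holomorphic_on_ident holomorphic_on_subset[OF r0(2)]]) auto
  have "(\<phi> has_field_derivative S 0) (at 0)"
    unfolding \<phi>_def[abs_def] by (rule id_times_deriv[OF analytic_isCont[OF S(1)]])
  then have "deriv \<phi> 0 \<noteq> 0" using S(2) by (simp add: DERIV_imp_deriv)
  then obtain r where r: "r > 0" "ball (0::complex) r \<subseteq> ball 0 (min r0 e)" "open (\<phi> ` ball 0 r)"
    using has_complex_derivative_locally_invertible[OF hol, of 0] r0(1) e
    by (metis centre_in_ball min_less_iff_conj open_ball)
  have "0 \<in> \<phi> ` ball 0 r" using r(1) by (auto simp: \<phi>_def image_iff intro!: bexI[of _ 0])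
  then obtain d where d: "d > 0" "ball 0 d \<subseteq> \<phi> ` ball 0 r" using r(3) openE by blast
  show ?thesis
  proof (rule that[OF d(1)])
    fix y :: complex assume "norm y < d"
    then have "y \<in> \<phi> ` ball 0 r" using d(2) by auto
    then obtain z where z: "z \<in> ball 0 r" "y = \<phi> z" by auto
    then have "norm z < e" using r(2) by (auto dest!: subsetD)
    then show "\<exists>z. norm z < e \<and> z * S z = y" using z(2) by (auto simp: \<phi>_def)
  qed
qed

lemma Sigma_germ_inject:
  assumes \<mu>: "\<mu> \<in> circle_prob" and \<nu>: "\<nu> \<in> circle_prob" and S: "Sigma_germ \<mu> S" "Sigma_germ \<nu> S"
  shows "\<mu> = \<nu>"
proof -
  have S': "S analytic_on {0}" "S 0 \<noteq> 0" using S(1) Sigma_germ_mean[OF \<mu> S(1)] by (auto simp: Sigma_germ_def)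
  have "\<forall>\<^sub>F z in nhds 0. eta \<mu> (z * S z) = z" "\<forall>\<^sub>F z in nhds 0. eta \<nu> (z * S z) = z"
    using S by (auto simp: Sigma_germ_def)
  then have "\<forall>\<^sub>F z in nhds 0. eta \<mu> (z * S z) = eta \<nu> (z * S z)" by eventually_elim simp
  then obtain e where e: "e > 0" "\<And>z. norm z < e \<Longrightarrow> eta \<mu> (z * S z) = eta \<nu> (z * S z)"
    unfolding eventually_nhds_metric by auto
  obtain d where d: "d > 0" "\<And>y. norm y < d \<Longrightarrow> \<exists>z. norm z < e \<and> z * S z = y"
    using id_times_surj[OF S' e(1)] by metis
  show ?thesis
  proof (rule circle_prob_eqI_eta[OF \<mu> \<nu> d(1)])
    fix y :: complex assume "norm y < d"
    then obtain z where "norm z < e" "z * S z = y" using d(2) by blast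
    then show "eta \<mu> y = eta \<nu> y" using e(2) by blast
  qed
qed

lemma psi_inverse_germ:
  assumes "\<mu> \<in> circle_prob_times"
  shows "psi_inverse \<mu> analytic_on {0} \<and> psi_inverse \<mu> 0 = 0 \<and>
    (\<forall>\<^sub>F w in nhds 0. psi \<mu> (psi_inverse \<mu> w) = w) \<and> (\<forall>\<^sub>F z in nhds 0. psi_inverse \<mu> (psi \<mu> z) = z)"
proof -
  have \<mu>: "\<mu> \<in> circle_prob" and m: "(\<integral>\<zeta>. \<zeta> \<partial>\<mu>) \<noteq> 0" using assms by (auto simp: circle_prob_times_def)
  define E where "E z = (\<integral>\<zeta>. \<zeta> ^ 1 / (1 - \<zeta> * z) \<partial>\<mu>)" for z
  have Eh: "E holomorphic_on ball 0 1" unfolding E_def[abs_def] by (rule kernel_holomorphic[OF circle_prob_finite[OF \<mu>]])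
  have p: "psi \<mu> z = z * E z" if "norm z < 1" for z
    using psi_eq[OF \<mu> that] Cauchy_tr_minus_one[OF \<mu> that] by (simp add: E_def)
  have hol: "(\<lambda>z. z * E z) holomorphic_on ball 0 1" by (intro holomorphic_intros Eh)
  have "isCont E 0" using holomorphic_on_imp_continuous_on[OF Eh] by (simp add: continuous_on_eq_continuous_at)
  from id_times_deriv[OF this] have "deriv (\<lambda>z. z * E z) 0 \<noteq> 0" using m by (simp add: DERIV_imp_deriv E_def)
  then obtain r where r: "r > 0" "ball (0::complex) r \<subseteq> ball 0 1" "open ((\<lambda>z. z * E z) ` ball 0 r)" "inj_on (\<lambda>z. z * E z) (ball 0 r)"
    using has_complex_derivative_locally_invertible[OF hol, of 0] by auto
  obtain g where g: "g holomorphic_on ((\<lambda>z. z * E z) ` ball 0 r)" "\<And>z. z \<in> ball 0 r \<Longrightarrow> g (z * E z) = z"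
    using holomorphic_has_inverse[OF holomorphic_on_subset[OF hol r(2)] open_ball r(4)] by metis
  have 0: "0 \<in> (\<lambda>z. z * E z) ` ball 0 r" using r(1) by (auto simp: image_iff intro!: bexI[of _ 0])
  have r1: "norm z < 1" if "z \<in> ball 0 r" for z :: complex using r(2) that by auto
  have "g analytic_on {0}" using g(1) r(3) 0 by (auto simp: analytic_at)
  moreover have "g 0 = 0" using g(2)[of 0] r(1) by simp
  moreover have "\<forall>\<^sub>F w in nhds 0. psi \<mu> (g w) = w"
    using eventually_nhds_in_open[OF r(3) 0] by (auto elim!: eventually_mono simp: g(2) p r1)
  moreover have "\<forall>\<^sub>F z in nhds 0. g (psi \<mu> z) = z"
    using eventually_nhds_in_open[OF open_ball, of 0 0 r] r(1) by (auto elim!: eventually_mono simp: p r1 g(2))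
  ultimately have "\<exists>g. g analytic_on {0} \<and> g 0 = 0 \<and> (\<forall>\<^sub>F w in nhds 0. psi \<mu> (g w) = w) \<and> (\<forall>\<^sub>F z in nhds 0. g (psi \<mu> z) = z)"
    by blast
  from someI_ex[OF this] show ?thesis unfolding psi_inverse_def .
qed

text \<open>In terms of the Cauchy transform \<open>1 + psi = 1 / (1 - eta)\<close>, the equation \<open>psi w = z / (1 - z)\<close> says \<open>eta w = z\<close>.\<close>

lemma Sigma_transform_germ:
  assumes "\<mu> \<in> circle_prob_times"
  obtains S where "Sigma_germ \<mu> S" "\<forall>\<^sub>F z in nhds 0. Sigma_transform \<mu> z = S z"
proof -
  have \<mu>: "\<mu> \<in> circle_prob" using assms by (auto simp: circle_prob_times_def)
  define g where "g = psi_inverse \<mu>"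
  have g: "g analytic_on {0}" "g 0 = 0" "\<forall>\<^sub>F w in nhds 0. psi \<mu> (g w) = w"
    using psi_inverse_germ[OF assms] by (auto simp: g_def)
  define T where "T z = g (z / (1 - z))" for z
  have q: "(\<lambda>z::complex. z / (1 - z)) analytic_on {0}" by (intro analytic_intros) auto
  have "(g \<circ> (\<lambda>z. z / (1 - z))) analytic_on {0}"
    by (rule analytic_on_compose[OF q]) (simp add: g(1))
  then have Ta: "T analytic_on {0}" by (simp add: T_def[abs_def] o_def)
  have T0: "T 0 = 0" by (simp add: T_def g(2))
  define S where "S z = (if z = 0 then deriv T 0 else T z / z)" for z
  have Sa: "S analytic_on {0}"
    by (rule pole_theorem_analytic_0[OF Ta, of 0]) (auto simp: S_def T0 intro!: exI[of _ 1])
  have zS: "z * S z = T z" for z by (simp add: S_def T0)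
  have qt: "((\<lambda>z::complex. z / (1 - z)) \<longlongrightarrow> 0) (nhds 0)"
    using isCont_nhds[OF analytic_isCont[OF q]] by simp
  have "\<forall>\<^sub>F z in nhds 0. psi \<mu> (T z) = z / (1 - z)"
    unfolding T_def using eventually_compose_filterlim[OF g(3) qt] .
  with id_times_small[OF Sa zero_less_one] eventually_nhds_norm_less[OF zero_less_one]
  have "\<forall>\<^sub>F z in nhds 0. eta \<mu> (z * S z) = z"
  proof eventually_elim
    case (elim z)
    then have T1: "norm (T z) < 1" and z1: "1 - z \<noteq> 0" by (auto simp: zS)
    have "Cauchy_tr \<mu> (T z) = 1 + z / (1 - z)" using psi_eq[OF \<mu> T1] elim by simp
    also have "\<dots> = 1 / (1 - z)" using z1 by (simp add: field_simps)
    finally show ?case unfolding zS eta_eq[OF \<mu> T1] by simp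
  qed
  then have germ: "Sigma_germ \<mu> S" using Sa by (simp add: Sigma_germ_def)
  obtain r where r: "r > 0" "S holomorphic_on ball 0 r" using Sa by (auto simp: analytic_on_def)
  have "Sigma_transform \<mu> z = S z" if z: "z \<in> ball 0 r" for z
    unfolding Sigma_transform_def
  proof (rule remove_sings_eqI)
    have "S \<midarrow>z\<rightarrow> S z"
      using holomorphic_on_imp_continuous_on[OF r(2)] z by (simp add: continuous_on_eq_continuous_at isCont_def)
    moreover have "\<forall>\<^sub>F w in at z. S w = 1 / w * psi_inverse \<mu> (w / (1 - w))"
    proof -
      have "\<forall>\<^sub>F w in at z. w \<noteq> 0" by (rule eventually_neq_at_within)
      then show ?thesis by eventually_elim (simp add: S_def T_def g_def)
    qed
    ultimately show "(\<lambda>w. 1 / w * psi_inverse \<mu> (w / (1 - w))) \<midarrow>z\<rightarrow> S z" by (rule Lim_transform_eventually)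
  qed
  then have "\<forall>\<^sub>F z in nhds 0. Sigma_transform \<mu> z = S z"
    using eventually_nhds_in_open[OF open_ball, of 0 0 r] r(1) by (auto elim!: eventually_mono)
  then show ?thesis using that germ by blast
qed

section \<open>The convolutions\<close>

context star_prob_space
begin

lemma star_pow: "x \<in> carrier A \<Longrightarrow> star (x [^] (k::nat)) = star x [^] k"
proof (induction k)
  case (Suc k)
  have "star (x [^] Suc k) = star x \<otimes> star x [^] k" using Suc by (simp add: star_mult)
  also have "\<dots> = star x [^] Suc k" using nat_pow_Suc2[OF star_closed[OF Suc.prems], of k] by simp
  finally show ?case .
qed (simp add: star_one)

text \<open>The moments of a unitary form a positive definite sequence, so Herglotz' theorem represents them.\<close>

lemma unitary_law_exists:
  assumes x: "unitary x" obtains \<rho> where "unitary_law x \<rho>"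
proof -
  have xc: "x \<in> carrier A" using x by (simp add: unitary_def)
  define m where "m k = \<phi> (x [^] (k::nat))" for k
  have m: "norm (m k) \<le> 1" for k unfolding m_def by (intro norm_state_unitary unitary_pow x)
  have m0: "m 0 = 1" by (simp add: m_def state_one)
  define P where "P z = 2 * (suminf (\<lambda>k. m k * z ^ k)) - 1" for z
  have "(\<lambda>z. (suminf (\<lambda>k. m k * z ^ k))) holomorphic_on ball 0 1"
  proof (rule power_series_holomorphic)
    fix w :: complex assume "w \<in> ball 0 1"
    then have "summable (\<lambda>k. m k * w ^ k)" by (intro summable_bounded_coeffs[OF m]) auto
    then show "(\<lambda>k. m k * (w - 0) ^ k) sums (suminf (\<lambda>k. m k * w ^ k))" by (simp add: summable_sums)
  qed
  then have "P holomorphic_on ball 0 1" unfolding P_def by (intro holomorphic_intros)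
  moreover have "Re (P z) \<ge> 0" if "norm z < 1" for z
    unfolding P_def m_def by (rule Re_moment_series_nonneg[OF x that])
  moreover have "P 0 = 1" using powser_zero[of m] by (simp add: P_def m0)
  ultimately obtain \<rho> where \<rho>: "\<rho> \<in> circle_prob" "\<And>z. norm z < 1 \<Longrightarrow> 2 * Cauchy_tr \<rho> z - 1 = P z"
    using Herglotz[of P] by metis
  have C: "Cauchy_tr \<rho> z = (suminf (\<lambda>k. m k * z ^ k))" if "norm z < 1" for z
    using \<rho>(2)[OF that] by (simp add: P_def)
  have mom: "(\<integral>\<zeta>. \<zeta> ^ k \<partial>\<rho>) = m k" for k
  proof -
    have "(\<lambda>n::nat. \<integral>\<zeta>. \<zeta> ^ k \<partial>\<rho>) \<longlonglongrightarrow> m k"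
    proof (rule coeffs_tendsto[where C = 1 and r = 1 and a = "\<lambda>n k. \<integral>\<zeta>. \<zeta> ^ k \<partial>\<rho>" and b = m])
      fix z :: complex assume z: "norm z < 1"
      show "(\<lambda>n::nat. (suminf (\<lambda>k. (\<integral>\<zeta>. \<zeta> ^ k \<partial>\<rho>) * z ^ k))) \<longlonglongrightarrow> (suminf (\<lambda>k. m k * z ^ k))"
        using C[OF z] Cauchy_tr_eq_suminf[OF circle_prob_finite[OF \<rho>(1)] z] by simp
    qed (auto intro: m norm_moment_le \<rho>(1))
    then show ?thesis by (simp add: LIMSEQ_const_iff)
  qed
  have "(\<integral>\<zeta>. cnj \<zeta> ^ k \<partial>\<rho>) = \<phi> (star x [^] k)" for k
  proof -
    have "(\<integral>\<zeta>. cnj (\<zeta> ^ k) \<partial>\<rho>) = cnj (\<integral>\<zeta>. \<zeta> ^ k \<partial>\<rho>)"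
      by (rule integral_bounded_linear[OF bounded_linear_cnj])
         (intro circle_integrable circle_prob_finite \<rho>(1) continuous_intros)
    also have "\<dots> = \<phi> (star (x [^] k))" using xc by (simp add: mom m_def state_star)
    finally show ?thesis using xc by (simp add: star_pow)
  qed
  then show ?thesis using that[of \<rho>] \<rho>(1) mom by (simp add: unitary_law_def m_def)
qed

text \<open>At \<open>\<alpha> = z S z\<close> and \<open>\<beta> = z T z\<close> the Cauchy transforms of both laws are \<open>1 / (1 - z) = 1 + s\<close> with
  \<open>s = z / (1 - z)\<close>, and \<open>(1 + s) / s = 1 / z\<close>; so the resolvent formula evaluates the Cauchy transform of the
  product at \<open>\<alpha> \<beta> / z = z S z T z\<close>.\<close>

lemma Sigma_germ_free_product:
  assumes uv: "unitary u" "unitary v" "free_elements u v"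
    and laws: "unitary_law u \<mu>" "unitary_law v \<nu>" "unitary_law (u \<otimes> v) \<rho>"
    and S: "Sigma_germ \<mu> S" and T: "Sigma_germ \<nu> T"
  shows "Sigma_germ \<rho> (\<lambda>z. S z * T z)"
proof -
  have p: "\<mu> \<in> circle_prob" "\<nu> \<in> circle_prob" "\<rho> \<in> circle_prob" using laws by (auto simp: unitary_law_def)
  have a: "S analytic_on {0}" "T analytic_on {0}" using S T by (auto simp: Sigma_germ_def)
  have e: "\<forall>\<^sub>F z in nhds 0. eta \<mu> (z * S z) = z" "\<forall>\<^sub>F z in nhds 0. eta \<nu> (z * T z) = z"
    using S T by (auto simp: Sigma_germ_def)
  \<comment> \<open>the quantity that the resolvent formula requires to be at most \<open>1/2\<close>; of its factor \<open>|z|\<^sup>2 / |z|\<close> one \<open>|z|\<close> remains, so it is small near \<open>0\<close>\<close>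
  define \<kappa> where "\<kappa> z = norm (1 - z) ^ 2 * norm z * (4 * norm (S z) * norm (T z) / ((1 - norm (z * S z)) * (1 - norm (z * T z))))" for z
  have "isCont \<kappa> 0"
    unfolding \<kappa>_def using analytic_isCont[OF a(1)] analytic_isCont[OF a(2)] by (intro continuous_intros) auto
  then have "(\<kappa> \<longlongrightarrow> \<kappa> 0) (nhds 0)" by (rule isCont_nhds)
  then have "(\<kappa> \<longlongrightarrow> 0) (nhds 0)" by (simp add: \<kappa>_def)
  then have k: "\<forall>\<^sub>F z in nhds 0. \<kappa> z < 1 / 2" by (rule order_tendstoD) simp
  have ST: "(\<lambda>z. S z * T z) analytic_on {0}" by (intro analytic_intros a)
  have "\<forall>\<^sub>F z in nhds 0. eta \<rho> (z * (S z * T z)) = z"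
    using e k id_times_small[OF a(1) zero_less_one] id_times_small[OF a(2) zero_less_one]
      id_times_small[OF ST zero_less_one] eventually_nhds_norm_less[OF zero_less_one]
  proof eventually_elim
    case (elim z)
    show ?case
    proof (cases "z = 0")
      case False
      have z1: "1 - z \<noteq> 0" using elim by auto
      define s where "s = z / (1 - z)"
      have s: "s \<noteq> 0" "1 + s = 1 / (1 - z)" "s \<noteq> - 1" using False z1 by (auto simp: s_def field_simps)
      have C: "Cauchy_tr \<mu> (z * S z) = 1 + s" "Cauchy_tr \<nu> (z * T z) = 1 + s"
        using Cauchy_tr_eq(1)[OF p(1), of "z * S z"] Cauchy_tr_eq(1)[OF p(2), of "z * T z"] elim s by auto
      have ss: "s * (1 + s) = z / (1 - z) ^ 2" unfolding s(2) by (simp add: s_def power2_eq_square)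
      have "(\<lambda>k. \<phi> ((u \<otimes> v) [^] k) * (z * (S z * T z)) ^ k) sums (1 + s)"
      proof (rule free_product_resolvent[OF uv, of "z * S z" "z * T z"])
        show "(\<lambda>j. \<phi> (u [^] j) * (z * S z) ^ j) sums (1 + s)"
          using Cauchy_tr_sums[OF circle_prob_finite[OF p(1)], of "z * S z"] elim laws(1) C by (simp add: unitary_law_def)
        show "(\<lambda>j. \<phi> (v [^] j) * (z * T z) ^ j) sums (1 + s)"
          using Cauchy_tr_sums[OF circle_prob_finite[OF p(2)], of "z * T z"] elim laws(2) C by (simp add: unitary_law_def)
        have "norm (1 / (s * (1 + s))) * (2 * norm (z * S z) / (1 - norm (z * S z)) * (2 * norm (z * T z) / (1 - norm (z * T z)))) = \<kappa> z"
          unfolding ss \<kappa>_def using False by (simp add: norm_mult norm_divide norm_power power2_eq_square)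
        then show "norm (1 / (s * (1 + s))) * (2 * norm (z * S z) / (1 - norm (z * S z)) * (2 * norm (z * T z) / (1 - norm (z * T z)))) \<le> 1 / 2"
          using elim by simp
        have "(1 + s) / s = 1 / z" unfolding s(2) using False z1 by (simp add: s_def)
        then show "z * (S z * T z) = z * S z * (z * T z) * ((1 + s) / s)" using False by simp
      qed (use elim s in auto)
      then have "Cauchy_tr \<rho> (z * (S z * T z)) = 1 + s"
        using Cauchy_tr_sums[OF circle_prob_finite[OF p(3)], of "z * (S z * T z)"] elim laws(3)
        by (auto simp: unitary_law_def dest: sums_unique2)
      then show ?thesis using eta_eq[OF p(3), of "z * (S z * T z)"] elim by (simp add: s(2))
    qed simp
  qed
  then show ?thesis using ST by (simp add: Sigma_germ_def)
qed

end

text \<open>Existence comes from the constructed free pair, uniqueness from the germ, which any realisation must have.\<close>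

theorem free_conv_Sigma_germ:
  assumes \<mu>: "\<mu> \<in> circle_prob" "Sigma_germ \<mu> S" and \<nu>: "\<nu> \<in> circle_prob" "Sigma_germ \<nu> T"
  shows "free_conv \<mu> \<nu> \<in> circle_prob" "Sigma_germ (free_conv \<mu> \<nu>) (\<lambda>z. S z * T z)"
proof -
  let ?P = "\<lambda>\<rho>. \<exists>(A :: nc_carrier ring) scl star \<phi> u v.
        star_prob_space A scl star \<phi> \<and>
        star_prob_space.unitary A star u \<and> star_prob_space.unitary A star v \<and>
        star_prob_space.free_elements A scl star \<phi> u v \<and>
        star_prob_space.unitary_law A star \<phi> u \<mu> \<and>
        star_prob_space.unitary_law A star \<phi> v \<nu> \<and>
        star_prob_space.unitary_law A star \<phi> (u \<otimes>\<^bsub>A\<^esub> v) \<rho>"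
  have good: "\<rho> \<in> circle_prob \<and> Sigma_germ \<rho> (\<lambda>z. S z * T z)" if P: "?P \<rho>" for \<rho>
  proof -
    obtain A :: "nc_carrier ring" and scl star \<phi> u v where m: "star_prob_space A scl star \<phi>"
        "star_prob_space.unitary A star u" "star_prob_space.unitary A star v"
        "star_prob_space.free_elements A scl star \<phi> u v"
        "star_prob_space.unitary_law A star \<phi> u \<mu>"
        "star_prob_space.unitary_law A star \<phi> v \<nu>"
        "star_prob_space.unitary_law A star \<phi> (u \<otimes>\<^bsub>A\<^esub> v) \<rho>"
      using P by blast
    have "\<rho> \<in> circle_prob" using m(7) by (simp add: star_prob_space.unitary_law_def[OF m(1)])
    then show ?thesis using star_prob_space.Sigma_germ_free_product[OF m \<mu>(2) \<nu>(2)] by blast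
  qed
  obtain A :: "nc_carrier ring" and scl star \<phi> u v where m: "star_prob_space A scl star \<phi>"
      "star_prob_space.unitary A star u" "star_prob_space.unitary A star v"
      "star_prob_space.free_elements A scl star \<phi> u v"
      "star_prob_space.unitary_law A star \<phi> u \<mu>" "star_prob_space.unitary_law A star \<phi> v \<nu>"
    using free_pair_exists[OF \<mu>(1) \<nu>(1)] .
  obtain \<rho> where \<rho>: "star_prob_space.unitary_law A star \<phi> (u \<otimes>\<^bsub>A\<^esub> v) \<rho>"
    using star_prob_space.unitary_law_exists[OF m(1) star_prob_space.unitary_mult[OF m(1) m(2) m(3)]] .
  have P: "?P \<rho>" using m \<rho> by blast
  have "free_conv \<mu> \<nu> = \<rho>"
    unfolding free_conv_def
  proof (rule the_equality)
    show "?P \<rho>" by (rule P)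
    fix \<rho>' assume "?P \<rho>'"
    from good[OF this] good[OF P] show "\<rho>' = \<rho>" using Sigma_germ_inject by blast
  qed
  then show "free_conv \<mu> \<nu> \<in> circle_prob" "Sigma_germ (free_conv \<mu> \<nu>) (\<lambda>z. S z * T z)"
    using good[OF P] by auto
qed

lemma circle_prob_eqI_Bf:
  assumes "\<mu> \<in> circle_prob" "\<nu> \<in> circle_prob" "\<And>z. norm z < 1 \<Longrightarrow> Bf \<mu> z = Bf \<nu> z"
  shows "\<mu> = \<nu>"
  using assms by (intro circle_prob_eqI_eta[of \<mu> \<nu> 1]) (auto simp: eta_def)

lemma boolean_conv_Bf:
  assumes "\<mu> \<in> circle_prob" "\<nu> \<in> circle_prob"
  shows "boolean_conv \<mu> \<nu> \<in> circle_prob" "norm z < 1 \<Longrightarrow> Bf (boolean_conv \<mu> \<nu>) z = Bf \<mu> z * Bf \<nu> z"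
proof -
  have "norm (Bf \<mu> z * Bf \<nu> z) \<le> 1" if "norm z < 1" for z
    using mult_mono[OF norm_Bf_le[OF assms(1) that] norm_Bf_le[OF assms(2) that]] by (simp add: norm_mult)
  with circle_prob_with_Bf[of "\<lambda>z. Bf \<mu> z * Bf \<nu> z", OF holomorphic_on_mult[OF Bf_holomorphic[OF assms(1)] Bf_holomorphic[OF assms(2)]]]
  obtain \<rho> where \<rho>: "\<rho> \<in> circle_prob" "\<And>z. norm z < 1 \<Longrightarrow> Bf \<rho> z = Bf \<mu> z * Bf \<nu> z"
    by metis
  have eq: "boolean_conv \<mu> \<nu> = \<rho>"
    unfolding boolean_conv_def
  proof (rule the_equality)
    show "\<rho> \<in> circle_prob \<and> (\<forall>z\<in>ball 0 1. B_transform \<rho> z = B_transform \<mu> z * B_transform \<nu> z)"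
      using \<rho> assms by (simp add: B_transform_eq)
    fix \<rho>' assume "\<rho>' \<in> circle_prob \<and> (\<forall>z\<in>ball 0 1. B_transform \<rho>' z = B_transform \<mu> z * B_transform \<nu> z)"
    then show "\<rho>' = \<rho>" using \<rho> assms by (intro circle_prob_eqI_Bf) (auto simp: B_transform_eq)
  qed
  show "boolean_conv \<mu> \<nu> \<in> circle_prob" "norm z < 1 \<Longrightarrow> Bf (boolean_conv \<mu> \<nu>) z = Bf \<mu> z * Bf \<nu> z"
    using \<rho> by (auto simp: eq)
qed

lemma point_mass_Bf:
  assumes "l \<in> unit_circle"
  shows "point_mass l \<in> circle_prob" "norm z < 1 \<Longrightarrow> Bf (point_mass l) z = l"
    "Sigma_germ (point_mass l) (\<lambda>_. cnj l)"
proof -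
  have sp: "l \<in> space circle_borel" using assms by (simp add: space_circle_borel)
  show p: "point_mass l \<in> circle_prob"
    using sp by (simp add: circle_prob_def point_mass_def prob_space_return)
  have int: "(\<integral>\<zeta>. f \<zeta> \<partial>point_mass l) = f l" if "continuous_on unit_circle f" for f :: "complex \<Rightarrow> complex"
    unfolding point_mass_def by (rule integral_return[OF sp circle_test_measurable[OF that]])
  have B: "Bf (point_mass l) z = l" if z: "norm z < 1" for z
    using kernel_nonzero[OF assms z] z
    by (simp add: Bf_def Cauchy_tr_def int continuous_on_kernel continuous_on_const continuous_on_id)
  then show "norm z < 1 \<Longrightarrow> Bf (point_mass l) z = l" .
  have ll: "cnj l * l = 1" using assms complex_norm_square[of l] by (simp add: mult.commute)
  have "\<forall>\<^sub>F z in nhds 0. eta (point_mass l) (z * cnj l) = z"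
    using eventually_nhds_norm_less[OF zero_less_one]
  proof eventually_elim
    case (elim z)
    then have "norm (z * cnj l) < 1" using assms by (simp add: norm_mult)
    then show ?case using ll by (simp add: eta_def B mult.assoc)
  qed
  then show "Sigma_germ (point_mass l) (\<lambda>_. cnj l)" by (simp add: Sigma_germ_def)
qed

section \<open>The limit laws\<close>

definition Herglotz_tr :: "complex measure \<Rightarrow> complex \<Rightarrow> complex" where
  "Herglotz_tr \<sigma> z = (\<integral>\<zeta>. (1 + \<zeta> * z) / (1 - \<zeta> * z) \<partial>\<sigma>)"

lemma Herglotz_tr_eq:
  assumes \<sigma>: "circle_finite \<sigma>" and z: "norm z < 1"
  shows "Herglotz_tr \<sigma> z = 2 * Cauchy_tr \<sigma> z - of_real (measure \<sigma> unit_circle)"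
proof -
  have "Herglotz_tr \<sigma> z = (\<integral>\<zeta>. 2 * (1 / (1 - \<zeta> * z)) - 1 \<partial>\<sigma>)"
    unfolding Herglotz_tr_def
  proof (rule circle_integral_cong[OF \<sigma>])
    fix \<zeta> :: complex assume "\<zeta> \<in> unit_circle"
    then have "1 - \<zeta> * z \<noteq> 0" using kernel_nonzero z by blast
    then show "(1 + \<zeta> * z) / (1 - \<zeta> * z) = 2 * (1 / (1 - \<zeta> * z)) - 1" by (simp add: field_simps)
  qed
  also have "\<dots> = (\<integral>\<zeta>. 2 * (1 / (1 - \<zeta> * z)) \<partial>\<sigma>) - (\<integral>\<zeta>. 1 \<partial>\<sigma>)"
    by (rule Bochner_Integration.integral_diff)
       (intro circle_integrable \<sigma> continuous_on_mult continuous_on_kernel z continuous_intros)+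
  also have "(\<integral>\<zeta>. 2 * (1 / (1 - \<zeta> * z)) \<partial>\<sigma>) = 2 * Cauchy_tr \<sigma> z"
    unfolding Cauchy_tr_def by (rule integral_mult_right_zero)
  also have "(\<integral>\<zeta>. (1::complex) \<partial>\<sigma>) = of_real (measure \<sigma> unit_circle)"
    by (simp add: circle_finite_space[OF \<sigma>] scaleR_conv_of_real)
  finally show ?thesis .
qed

lemma Herglotz_tr_holomorphic:
  assumes \<sigma>: "circle_finite \<sigma>"
  shows "Herglotz_tr \<sigma> holomorphic_on ball 0 1"
proof -
  have "(\<lambda>z. 2 * Cauchy_tr \<sigma> z - of_real (measure \<sigma> unit_circle)) holomorphic_on ball 0 1"
    by (intro holomorphic_intros Cauchy_tr_holomorphic \<sigma>)
  then show ?thesis by (rule holomorphic_transform) (simp add: Herglotz_tr_eq[OF \<sigma>])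
qed

lemma Re_Herglotz_kernel:
  fixes z :: complex
  assumes "\<zeta> \<in> unit_circle" "norm z < 1"
  shows "Re ((1 + \<zeta> * z) / (1 - \<zeta> * z)) \<ge> 0"
proof -
  define w where "w = \<zeta> * z"
  have "norm w < 1" using assms by (simp add: w_def norm_mult)
  then have "(norm w)\<^sup>2 \<le> 1" by (simp add: abs_square_le_1)
  then have "Re ((1 + w) * cnj (1 - w)) \<ge> 0"
    unfolding cmod_power2 by (simp add: power2_eq_square algebra_simps)
  then show ?thesis unfolding w_def[symmetric] by (subst complex_div_cnj) (simp add: Re_divide_of_real)
qed

lemma Re_Herglotz_tr:
  assumes \<sigma>: "circle_finite \<sigma>" and z: "norm z < 1"
  shows "Re (Herglotz_tr \<sigma> z) \<ge> 0"
proof -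
  have i: "integrable \<sigma> (\<lambda>\<zeta>. (1 + \<zeta> * z) / (1 - \<zeta> * z))"
    by (intro circle_integrable \<sigma> continuous_on_kernel z continuous_intros)
  have "Re (Herglotz_tr \<sigma> z) = (\<integral>\<zeta>. Re ((1 + \<zeta> * z) / (1 - \<zeta> * z)) \<partial>\<sigma>)"
    unfolding Herglotz_tr_def using i by simp
  also have "\<dots> \<ge> 0"
    using Re_Herglotz_kernel[OF _ z] circle_finite_space[OF \<sigma>] by (intro Bochner_Integration.integral_nonneg) auto
  finally show ?thesis .
qed

text \<open>The B-transform of \<open>\<nu>\<^sub>\<uplus>\<close> and, inverted, the \<open>\<Sigma>\<close>-transform of \<open>\<nu>\<^sub>\<boxtimes>\<close>.\<close>

definition limit_tr :: "complex \<Rightarrow> complex measure \<Rightarrow> complex \<Rightarrow> complex" where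
  "limit_tr \<gamma> \<sigma> z = \<gamma> * exp (- Herglotz_tr \<sigma> z)"

lemma limit_tr_holomorphic: "circle_finite \<sigma> \<Longrightarrow> limit_tr \<gamma> \<sigma> holomorphic_on ball 0 1"
  unfolding limit_tr_def[abs_def] by (intro holomorphic_intros Herglotz_tr_holomorphic)

lemma norm_limit_tr_le:
  assumes "circle_finite \<sigma>" "\<gamma> \<in> unit_circle" "norm z < 1"
  shows "norm (limit_tr \<gamma> \<sigma> z) \<le> 1"
  using assms Re_Herglotz_tr[OF assms(1,3)] by (simp add: limit_tr_def norm_mult)

lemma nu_boolean_Bf:
  assumes \<sigma>: "circle_finite \<sigma>" and \<gamma>: "\<gamma> \<in> unit_circle"
  shows "nu_boolean \<gamma> \<sigma> \<in> circle_prob" "norm z < 1 \<Longrightarrow> Bf (nu_boolean \<gamma> \<sigma>) z = limit_tr \<gamma> \<sigma> z"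
proof -
  obtain \<rho> where \<rho>: "\<rho> \<in> circle_prob" "\<And>z. norm z < 1 \<Longrightarrow> Bf \<rho> z = limit_tr \<gamma> \<sigma> z"
    using circle_prob_with_Bf[OF limit_tr_holomorphic[OF \<sigma>] norm_limit_tr_le[OF \<sigma> \<gamma>]] by metis
  have eq: "nu_boolean \<gamma> \<sigma> = \<rho>"
    unfolding nu_boolean_def Herglotz_tr_def[symmetric] limit_tr_def[symmetric]
  proof (rule the_equality)
    show "\<rho> \<in> circle_prob \<and> (\<forall>z\<in>ball 0 1. B_transform \<rho> z = limit_tr \<gamma> \<sigma> z)"
      using \<rho> by (simp add: B_transform_eq)
    fix \<rho>' assume "\<rho>' \<in> circle_prob \<and> (\<forall>z\<in>ball 0 1. B_transform \<rho>' z = limit_tr \<gamma> \<sigma> z)"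
    then show "\<rho>' = \<rho>" using \<rho> by (intro circle_prob_eqI_Bf) (auto simp: B_transform_eq)
  qed
  show "nu_boolean \<gamma> \<sigma> \<in> circle_prob" "norm z < 1 \<Longrightarrow> Bf (nu_boolean \<gamma> \<sigma>) z = limit_tr \<gamma> \<sigma> z"
    using \<rho> by (auto simp: eq)
qed

lemma holomorphic_Lipschitz:
  assumes h: "h holomorphic_on ball 0 1"
  obtains L where "L > 0" "\<And>x y. norm x < 1/2 \<Longrightarrow> norm y < 1/2 \<Longrightarrow> norm (h x - h y) \<le> L * norm (x - y :: complex)"
proof -
  have "continuous_on (cball 0 (1/2)) (deriv h)"
    by (rule continuous_on_subset[OF holomorphic_on_imp_continuous_on[OF holomorphic_deriv[OF h open_ball]]]) auto
  then have "bounded (deriv h ` cball 0 (1/2))"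
    by (intro compact_imp_bounded compact_continuous_image) auto
  then obtain L where L: "L > 0" "\<And>z. norm z \<le> 1/2 \<Longrightarrow> norm (deriv h z) \<le> L"
    unfolding bounded_pos by auto
  show ?thesis
  proof (rule that[OF L(1)])
    fix x y :: complex assume xy: "norm x < 1/2" "norm y < 1/2"
    show "norm (h x - h y) \<le> L * norm (x - y)"
    proof (rule field_differentiable_bound[of "cball 0 (1/2)" h "deriv h"])
      fix z :: complex assume z: "z \<in> cball 0 (1/2)"
      then have "z \<in> ball 0 1" by auto
      then show "(h has_field_derivative deriv h z) (at z within cball 0 (1/2))"
        using holomorphic_derivI[OF h open_ball] has_field_derivative_at_within by blast
      show "norm (deriv h z) \<le> L" using L(2) z by simp
    qed (use xy in auto)
  qed
qed

text \<open>The law with Sigma-transform \<open>1 / h\<close> has \<open>eta w = w h (eta w)\<close>. Iterating this equation through measures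
  gives a contraction near \<open>0\<close>, and any weak limit point of the iterates solves it.\<close>

lemma eta_fixed_point_exists:
  assumes h: "h holomorphic_on ball 0 1" and le: "\<And>z. norm z < 1 \<Longrightarrow> norm (h z) \<le> 1"
  obtains \<nu> r where "\<nu> \<in> circle_prob" "0 < r" "r \<le> 1" "\<And>w. norm w < r \<Longrightarrow> eta \<nu> w = w * h (eta \<nu> w)"
proof -
  have step: "\<exists>\<rho>. \<rho> \<in> circle_prob \<and> (\<forall>z. norm z < 1 \<longrightarrow> Bf \<rho> z = h (eta \<mu> z))" if \<mu>: "\<mu> \<in> circle_prob" for \<mu>
  proof -
    have "eta \<mu> ` ball 0 1 \<subseteq> ball 0 1" using norm_eta_less[OF \<mu>] by auto
    from holomorphic_on_compose_gen[OF eta_holomorphic[OF \<mu>] h this]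
    have "(\<lambda>z. h (eta \<mu> z)) holomorphic_on ball 0 1" by (simp add: o_def)
    moreover have "norm (h (eta \<mu> z)) \<le> 1" if "norm z < 1" for z using le norm_eta_less[OF \<mu> that] .
    ultimately show ?thesis using circle_prob_with_Bf[of "\<lambda>z. h (eta \<mu> z)"] by metis
  qed
  define nxt where "nxt \<mu> = (SOME \<rho>. \<rho> \<in> circle_prob \<and> (\<forall>z. norm z < 1 \<longrightarrow> Bf \<rho> z = h (eta \<mu> z)))" for \<mu>
  have nxt: "nxt \<mu> \<in> circle_prob" "norm z < 1 \<Longrightarrow> Bf (nxt \<mu>) z = h (eta \<mu> z)" if "\<mu> \<in> circle_prob" for \<mu> z
    using someI_ex[OF step[OF that]] unfolding nxt_def by blast+
  define M where "M n = (nxt ^^ n) (point_mass 1)" for n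
  have M: "M n \<in> circle_prob" for n
    by (induction n) (auto simp: M_def nxt(1) intro: point_mass_Bf)
  have M_Suc: "eta (M (Suc n)) z = z * h (eta (M n) z)" if "norm z < 1" for n z
    using nxt(2)[OF M[of n] that] by (simp add: eta_def M_def)
  have small: "norm (eta (M n) z) \<le> norm z" if "norm z < 1" for n z
    using mult_left_mono[OF norm_Bf_le[OF M that], of "norm z" n] by (simp add: eta_def norm_mult)
  obtain L where L: "L > 0" "\<And>x y. norm x < 1/2 \<Longrightarrow> norm y < 1/2 \<Longrightarrow> norm (h x - h y) \<le> L * norm (x - y)"
    using holomorphic_Lipschitz[OF h] by metis
  define r where "r = min (1/2) (1 / (2 * L))"
  have r: "0 < r" "r \<le> 1/2" "r * L \<le> 1/2" using L(1) by (auto simp: r_def min_def field_simps)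
  have contr: "norm (eta (M (Suc n)) z - eta (M n) z) \<le> (1/2) ^ n" if z: "norm z < r" for n z
  proof (induction n)
    case 0
    have "norm z < 1" using z r by simp
    then have "norm (eta (M (Suc 0)) z - eta (M 0) z) \<le> norm z + norm z"
      using norm_triangle_ineq4[of "eta (M (Suc 0)) z" "eta (M 0) z"] small[of z "Suc 0"] small[of z 0] by linarith
    then show ?case using z r by simp
  next
    case (Suc n)
    have z1: "norm z < 1" "norm z < 1/2" using z r by auto
    have "norm (eta (M (Suc (Suc n))) z - eta (M (Suc n)) z) = norm z * norm (h (eta (M (Suc n)) z) - h (eta (M n) z))"
    proof -
      have "eta (M (Suc (Suc n))) z - eta (M (Suc n)) z = z * (h (eta (M (Suc n)) z) - h (eta (M n) z))"
        using M_Suc[OF z1(1), of "Suc n"] M_Suc[OF z1(1), of n] by (metis right_diff_distrib)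
      then show ?thesis by (simp add: norm_mult)
    qed
    also have "\<dots> \<le> norm z * (L * norm (eta (M (Suc n)) z - eta (M n) z))"
      using small[OF z1(1), of n] small[OF z1(1), of "Suc n"] z1 by (intro mult_left_mono L(2)) auto
    also have "\<dots> \<le> r * (L * (1/2) ^ n)"
      using z r L(1) Suc by (intro mult_mono mult_left_mono) auto
    also have "\<dots> \<le> (1/2) ^ Suc n" using mult_right_mono[OF r(3), of "(1/2) ^ n"] by simp
    finally show ?case .
  qed
  obtain s :: "nat \<Rightarrow> nat" and \<nu> where s: "strict_mono s" "\<nu> \<in> circle_prob" "circle_weak_conv (M \<circ> s) \<nu>"
    using circle_prob_compact[of M, OF M] .
  have "eta \<nu> w = w * h (eta \<nu> w)" if w: "norm w < r" for w
  proof -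
    have w1: "norm w < 1" using w r by simp
    have "(\<lambda>n. w * Bf ((M \<circ> s) n) w) \<longlonglongrightarrow> w * Bf \<nu> w"
      using M by (intro tendsto_intros weak_conv_imp_Bf[OF s(3)] s(2) w1) auto
    then have lim: "(\<lambda>n. eta (M (s n)) w) \<longlonglongrightarrow> eta \<nu> w" by (simp add: eta_def)
    have "(\<lambda>n. eta (M (Suc n)) w - eta (M n) w) \<longlonglongrightarrow> 0"
      by (rule Lim_null_comparison[OF always_eventually[OF allI[OF contr[OF w]]]]) (intro LIMSEQ_realpow_zero; simp)
    from LIMSEQ_subseq_LIMSEQ[OF this s(1)]
    have "(\<lambda>n. (eta (M (Suc (s n))) w - eta (M (s n)) w) + eta (M (s n)) w) \<longlonglongrightarrow> 0 + eta \<nu> w"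
      by (intro tendsto_add lim) (simp add: o_def)
    then have 1: "(\<lambda>n. w * h (eta (M (s n)) w)) \<longlonglongrightarrow> eta \<nu> w" by (simp add: M_Suc[OF w1])
    have "isCont h (eta \<nu> w)"
      using holomorphic_on_imp_continuous_on[OF h] norm_eta_less[OF s(2) w1] by (simp add: continuous_on_eq_continuous_at)
    then have "(\<lambda>n. w * h (eta (M (s n)) w)) \<longlonglongrightarrow> w * h (eta \<nu> w)"
      by (intro tendsto_intros isCont_tendsto_compose[OF _ lim])
    with 1 show ?thesis by (rule LIMSEQ_unique)
  qed
  then show ?thesis using that[OF s(2) r(1)] r(2) by auto
qed

lemma nu_free_Sigma_germ:
  assumes \<sigma>: "circle_finite \<sigma>" and \<gamma>: "\<gamma> \<in> unit_circle"
  shows "nu_free \<gamma> \<sigma> \<in> circle_prob" "Sigma_germ (nu_free \<gamma> \<sigma>) (\<lambda>z. inverse (limit_tr \<gamma> \<sigma> z))"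
proof -
  let ?h = "limit_tr \<gamma> \<sigma>"
  have h: "?h holomorphic_on ball 0 1" by (rule limit_tr_holomorphic[OF \<sigma>])
  have nz: "?h z \<noteq> 0" for z using \<gamma> by (auto simp: limit_tr_def)
  define T where "T z = inverse (?h z)" for z
  have Ta: "T analytic_on {0}"
  proof -
    have "T holomorphic_on ball 0 1" unfolding T_def by (intro holomorphic_intros h) (simp add: nz)
    then show ?thesis by (auto simp: analytic_at intro!: exI[of _ "ball 0 1"])
  qed
  have T: "T z = cnj \<gamma> * exp (Herglotz_tr \<sigma> z)" for z
  proof -
    have "cnj \<gamma> * \<gamma> = 1" using \<gamma> complex_norm_square[of \<gamma>] by (simp add: mult.commute)
    then have "inverse \<gamma> = cnj \<gamma>" by (metis inverse_unique mult.commute)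
    then show ?thesis by (simp add: T_def limit_tr_def exp_minus inverse_mult_distrib)
  qed
  obtain \<nu> r where \<nu>: "\<nu> \<in> circle_prob" "0 < r" "r \<le> 1" "\<And>w. norm w < r \<Longrightarrow> eta \<nu> w = w * ?h (eta \<nu> w)"
    using eta_fixed_point_exists[OF h norm_limit_tr_le[OF \<sigma> \<gamma>]] by metis
  have mean: "(\<integral>\<zeta>. \<zeta> \<partial>\<nu>) = ?h 0"
  proof -
    have "isCont ?h 0" using holomorphic_on_imp_continuous_on[OF h] by (simp add: continuous_on_eq_continuous_at)
    moreover have "isCont (eta \<nu>) 0"
      using holomorphic_on_imp_continuous_on[OF eta_holomorphic[OF \<nu>(1)]] by (simp add: continuous_on_eq_continuous_at)
    ultimately have "isCont (\<lambda>w. ?h (eta \<nu> w)) 0" using isCont_o2[of 0 "eta \<nu>" ?h] by simp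
    then have "((\<lambda>w. ?h (eta \<nu> w)) \<longlongrightarrow> ?h 0) (at 0)" by (simp add: isCont_def)
    moreover have "\<forall>\<^sub>F w in at 0. ?h (eta \<nu> w) = Bf \<nu> w"
    proof -
      have "\<forall>\<^sub>F w in at 0. w \<noteq> (0::complex)" by (rule eventually_neq_at_within)
      with nhds_imp_at[OF eventually_nhds_norm_less[OF \<nu>(2)]] show ?thesis
        by eventually_elim (use \<nu>(4) in \<open>force simp: eta_def\<close>)
    qed
    ultimately have "(Bf \<nu> \<longlongrightarrow> ?h 0) (at 0)" by (rule Lim_transform_eventually)
    moreover have "(Bf \<nu> \<longlongrightarrow> Bf \<nu> 0) (at 0)" using Bf_isCont[OF \<nu>(1), of 0] by (simp add: isCont_def)
    ultimately have "?h 0 = Bf \<nu> 0" by (rule LIM_unique)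
    then show ?thesis by (simp add: Bf_0[OF \<nu>(1)])
  qed
  have times: "\<nu> \<in> circle_prob_times" using \<nu>(1) mean nz by (simp add: circle_prob_times_def)
  obtain S where S: "Sigma_germ \<nu> S" "\<forall>\<^sub>F z in nhds 0. Sigma_transform \<nu> z = S z"
    using Sigma_transform_germ[OF times] .
  have Sa: "S analytic_on {0}" "\<forall>\<^sub>F z in nhds 0. eta \<nu> (z * S z) = z" using S(1) by (auto simp: Sigma_germ_def)
  have ST: "\<forall>\<^sub>F z in nhds 0. S z = T z"
    using Sa(2) id_times_small[OF Sa(1) \<nu>(2)]
  proof eventually_elim
    case (elim z)
    show ?case
    proof (cases "z = 0")
      case True
      have "S 0 * ?h 0 = 1" using Sigma_germ_mean[OF \<nu>(1) S(1)] mean by simp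
      then show ?thesis using True nz[of 0] by (simp add: T_def field_simps)
    next
      case False
      have "z = z * S z * ?h z" using \<nu>(4)[OF elim(2)] elim(1) by simp
      then have "S z * ?h z = 1" using False by simp
      then show ?thesis using nz[of z] by (simp add: T_def field_simps)
    qed
  qed
  have germ: "Sigma_germ \<nu> T" by (rule Sigma_germ_cong[OF S(1) Ta ST])
  have eq: "nu_free \<gamma> \<sigma> = \<nu>"
    unfolding nu_free_def Herglotz_tr_def[symmetric] T[symmetric]
  proof (rule the_equality)
    have "\<forall>\<^sub>F z in nhds 0. Sigma_transform \<nu> z = T z" using S(2) ST by eventually_elim simp
    then show "\<nu> \<in> circle_prob_times \<and> (\<forall>\<^sub>F z in nhds 0. Sigma_transform \<nu> z = T z)" using times by blast
    fix \<nu>' assume n: "\<nu>' \<in> circle_prob_times \<and> (\<forall>\<^sub>F z in nhds 0. Sigma_transform \<nu>' z = T z)"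
    then have p: "\<nu>' \<in> circle_prob" by (simp add: circle_prob_times_def)
    obtain S' where S': "Sigma_germ \<nu>' S'" "\<forall>\<^sub>F z in nhds 0. Sigma_transform \<nu>' z = S' z"
      using Sigma_transform_germ n by blast
    have "\<forall>\<^sub>F z in nhds 0. S' z = T z" using S'(2) conjunct2[OF n] by eventually_elim simp
    then have "Sigma_germ \<nu>' T" by (rule Sigma_germ_cong[OF S'(1) Ta])
    then show "\<nu>' = \<nu>" using Sigma_germ_inject[OF p \<nu>(1) _ germ] by blast
  qed
  show "nu_free \<gamma> \<sigma> \<in> circle_prob" "Sigma_germ (nu_free \<gamma> \<sigma>) (\<lambda>z. inverse (limit_tr \<gamma> \<sigma> z))"
    using \<nu>(1) germ unfolding eq T_def by auto
qed

section \<open>Measures concentrated near one\<close>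

text \<open>The three sizes of a measure near \<open>1\<close>. Since \<open>|1 - \<zeta>|\<^sup>2 = 2 (1 - Re \<zeta>)\<close>, the defect is of second order and the
  spread of first order; the defects of a row add up to the mass of \<open>\<sigma>\<^sub>n\<close>.\<close>

definition spread :: "complex measure \<Rightarrow> real" where "spread m = (\<integral>\<zeta>. norm (1 - \<zeta>) \<partial>m)"
definition defect :: "complex measure \<Rightarrow> real" where "defect m = (\<integral>\<zeta>. 1 - Re \<zeta> \<partial>m)"
definition drift :: "complex measure \<Rightarrow> real" where "drift m = (\<integral>\<zeta>. Im \<zeta> \<partial>m)"

text \<open>The contribution of \<open>m\<close> to the logarithms of the limit transforms: an integral against \<open>(1 - Re \<zeta>) dm\<close> and a
  rotation. The kernels combine to \<open>(1 - z) (1 - \<zeta>) / (1 - \<zeta> z)\<close>.\<close>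

definition levy :: "complex measure \<Rightarrow> complex \<Rightarrow> complex" where
  "levy m z = (\<integral>\<zeta>. of_real (1 - Re \<zeta>) * ((1 + \<zeta> * z) / (1 - \<zeta> * z)) \<partial>m) - \<i> * of_real (drift m)"

lemma levy_kernel:
  fixes z :: complex
  assumes \<zeta>: "\<zeta> \<in> unit_circle" and z: "norm z < 1"
  shows "of_real (1 - Re \<zeta>) * ((1 + \<zeta> * z) / (1 - \<zeta> * z)) - \<i> * of_real (Im \<zeta>) = (1 - z) * ((1 - \<zeta>) / (1 - \<zeta> * z))"
proof -
  have nz: "1 - \<zeta> * z \<noteq> 0" by (rule kernel_nonzero[OF \<zeta> z])
  define c s where "c = complex_of_real (Re \<zeta>)" and "s = complex_of_real (Im \<zeta>)"
  have \<zeta>e: "\<zeta> = c + \<i> * s" unfolding c_def s_def by (rule complex_eq)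
  have "(Re \<zeta>)\<^sup>2 + (Im \<zeta>)\<^sup>2 = 1" using \<zeta> cmod_power2[of \<zeta>] by simp
  then have "complex_of_real ((Re \<zeta>)\<^sup>2 + (Im \<zeta>)\<^sup>2) = 1" by simp
  then have "c * c + s * s = 1" by (simp add: c_def s_def power2_eq_square)
  then have "(c * c + s * s) * z = z" by simp
  then have cs: "c * (c * z) + s * (s * z) = z" by (simp add: algebra_simps)
  have "(1 - c) * (1 + \<zeta> * z) - \<i> * s * (1 - \<zeta> * z) = (1 - z) * (1 - \<zeta>)"
    unfolding \<zeta>e using cs by (simp add: algebra_simps)
  moreover have "of_real (1 - Re \<zeta>) = 1 - c" by (simp add: c_def)
  ultimately show ?thesis using nz by (simp add: s_def[symmetric] divide_simps)
qed

lemma cont_Re_Im: "continuous_on unit_circle (\<lambda>\<zeta>. 1 - Re \<zeta>)" "continuous_on unit_circle Im"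
  "continuous_on unit_circle (\<lambda>\<zeta>::complex. norm (1 - \<zeta>))"
  by (intro continuous_intros)+

lemma cont_levy:
  assumes "norm z < 1"
  shows "continuous_on unit_circle (\<lambda>\<zeta>. of_real (1 - Re \<zeta>) * ((1 + \<zeta> * z) / (1 - \<zeta> * z)) :: complex)"
  by (intro continuous_on_mult continuous_on_kernel assms continuous_intros)

lemma levy_eq:
  assumes m: "m \<in> circle_prob" and z: "norm z < 1"
  shows "levy m z = (1 - z) * (\<integral>\<zeta>. (1 - \<zeta>) / (1 - \<zeta> * z) \<partial>m)"
proof -
  note f = circle_prob_finite[OF m]
  have "\<i> * of_real (drift m) = (\<integral>\<zeta>. \<i> * of_real (Im \<zeta>) \<partial>m)"
    by (simp add: drift_def)
  then have "levy m z = (\<integral>\<zeta>. of_real (1 - Re \<zeta>) * ((1 + \<zeta> * z) / (1 - \<zeta> * z)) \<partial>m) - (\<integral>\<zeta>. \<i> * of_real (Im \<zeta>) \<partial>m)"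
    by (simp only: levy_def)
  also have "\<dots> = (\<integral>\<zeta>. of_real (1 - Re \<zeta>) * ((1 + \<zeta> * z) / (1 - \<zeta> * z)) - \<i> * of_real (Im \<zeta>) \<partial>m)"
    by (rule Bochner_Integration.integral_diff[symmetric])
       (intro circle_integrable f cont_levy z continuous_intros)+
  also have "\<dots> = (\<integral>\<zeta>. (1 - z) * ((1 - \<zeta>) / (1 - \<zeta> * z)) \<partial>m)"
    by (rule circle_integral_cong[OF f]) (rule levy_kernel[OF _ z])
  finally show ?thesis by (simp only: integral_mult_right_zero)
qed

lemma defect_nonneg: "m \<in> circle_prob \<Longrightarrow> 0 \<le> defect m"
  unfolding defect_def
proof (rule Bochner_Integration.integral_nonneg)
  fix \<zeta> assume "m \<in> circle_prob" "\<zeta> \<in> space m"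
  then show "0 \<le> 1 - Re \<zeta>"
    using complex_Re_le_cmod[of \<zeta>] circle_finite_space[OF circle_prob_finite] by auto
qed

lemma defect_le_spread: "m \<in> circle_prob \<Longrightarrow> defect m \<le> spread m"
  unfolding defect_def spread_def
  by (intro integral_mono circle_integrable circle_prob_finite cont_Re_Im)
     (use complex_Re_le_cmod[of "1 - _"] in auto)

lemma spread_nonneg: "0 \<le> spread m"
  unfolding spread_def by (intro Bochner_Integration.integral_nonneg) auto

lemma half_kernel_ge:
  fixes z :: complex
  assumes "\<zeta> \<in> unit_circle" "norm z \<le> 1/2"
  shows "norm (1 - \<zeta> * z) \<ge> 1/2"
  using norm_kernel_ge[OF assms(1), of z] assms(2) by linarith

text \<open>The divided difference of the Cauchy transform between \<open>y\<close> and \<open>y'\<close>.\<close>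

definition divided_kernel :: "complex measure \<Rightarrow> complex \<Rightarrow> complex \<Rightarrow> complex" where
  "divided_kernel m y y' = (\<integral>\<zeta>. \<zeta> / (1 - \<zeta> * y) / (1 - \<zeta> * y') \<partial>m)"

lemma eta_diff:
  assumes m: "m \<in> circle_prob" and y: "norm y < 1" "norm y' < 1"
  shows "eta m y - eta m y' = (y - y') * divided_kernel m y y' / (Cauchy_tr m y * Cauchy_tr m y')"
proof -
  note f = circle_prob_finite[OF m]
  have "Cauchy_tr m y - Cauchy_tr m y' = (\<integral>\<zeta>. 1 / (1 - \<zeta> * y) - 1 / (1 - \<zeta> * y') \<partial>m)"
    unfolding Cauchy_tr_def
    by (rule Bochner_Integration.integral_diff[symmetric])
       (intro circle_integrable f continuous_on_kernel y continuous_intros)+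
  also have "\<dots> = (\<integral>\<zeta>. (y - y') * (\<zeta> / (1 - \<zeta> * y) / (1 - \<zeta> * y')) \<partial>m)"
  proof (rule circle_integral_cong[OF f])
    fix \<zeta> :: complex assume \<zeta>: "\<zeta> \<in> unit_circle"
    have "1 - \<zeta> * y \<noteq> 0" "1 - \<zeta> * y' \<noteq> 0" using kernel_nonzero[OF \<zeta>] y by auto
    then show "1 / (1 - \<zeta> * y) - 1 / (1 - \<zeta> * y') = (y - y') * (\<zeta> / (1 - \<zeta> * y) / (1 - \<zeta> * y'))"
      by (simp add: divide_simps) (simp add: algebra_simps)
  qed
  also have "\<dots> = (y - y') * divided_kernel m y y'" unfolding divided_kernel_def by (rule integral_mult_right_zero)
  finally have "Cauchy_tr m y - Cauchy_tr m y' = (y - y') * divided_kernel m y y'" .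
  moreover have "eta m y - eta m y' = (Cauchy_tr m y - Cauchy_tr m y') / (Cauchy_tr m y * Cauchy_tr m y')"
    using Cauchy_tr_nonzero[OF m y(1)] Cauchy_tr_nonzero[OF m y(2)]
    by (simp add: eta_eq[OF m y(1)] eta_eq[OF m y(2)] field_simps)
  ultimately show ?thesis by simp
qed

lemma norm_integral_le_const:
  fixes f :: "complex \<Rightarrow> complex"
  assumes m: "m \<in> circle_prob" and f: "continuous_on unit_circle f" "\<And>\<zeta>. \<zeta> \<in> unit_circle \<Longrightarrow> norm (f \<zeta>) \<le> C"
  shows "norm (\<integral>\<zeta>. f \<zeta> \<partial>m) \<le> C"
  using circle_integral_bound[OF circle_prob_finite[OF m] f] circle_prob_measure_space[OF m]
  by (simp add: circle_finite_space[OF circle_prob_finite[OF m]])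

lemma eta_Lipschitz:
  assumes m: "m \<in> circle_prob" and y: "norm y \<le> 1/2" "norm y' \<le> 1/2"
  shows "norm (eta m y - eta m y') \<le> 16 * norm (y - y')"
proof -
  have y1: "norm y < 1" "norm y' < 1" using y by auto
  have N: "norm (divided_kernel m y y') \<le> 4"
    unfolding divided_kernel_def
  proof (rule norm_integral_le_const[OF m])
    fix \<zeta> :: complex assume \<zeta>: "\<zeta> \<in> unit_circle"
    have "norm \<zeta> / norm (1 - \<zeta> * y) / norm (1 - \<zeta> * y') \<le> 1 / (1/2) / (1/2)"
      using half_kernel_ge[OF \<zeta> y(1)] half_kernel_ge[OF \<zeta> y(2)] \<zeta> by (intro frac_le) auto
    then show "norm (\<zeta> / (1 - \<zeta> * y) / (1 - \<zeta> * y')) \<le> 4" by (simp add: norm_divide norm_mult)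
  qed (intro continuous_on_kernel y1 continuous_intros)
  have "norm (Cauchy_tr m z) \<ge> 1/2" if "norm z < 1" for z
    using Re_Cauchy_tr[OF m that] complex_Re_le_cmod[of "Cauchy_tr m z"] by linarith
  then have "norm (Cauchy_tr m y) * norm (Cauchy_tr m y') \<ge> 1/2 * (1/2)" using y1 by (intro mult_mono) auto
  then have "norm (y - y') * norm (divided_kernel m y y') / (norm (Cauchy_tr m y) * norm (Cauchy_tr m y')) \<le> norm (y - y') * 4 / (1/2 * (1/2))"
    using N by (intro frac_le mult_left_mono) auto
  then show ?thesis unfolding eta_diff[OF m y1] by (simp add: norm_mult norm_divide)
qed

text \<open>For small \<open>y\<close>, \<open>y'\<close> the divided kernel is close to the mean of \<open>m\<close>, so \<open>eta m\<close> expands distances at a rate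
  controlled by the mean.\<close>

lemma eta_lower_Lipschitz:
  assumes m: "m \<in> circle_prob" and y: "norm y \<le> 1/2" "norm y' \<le> 1/2"
  shows "norm (y - y') * (norm (\<integral>\<zeta>. \<zeta> \<partial>m) - 6 * (norm y + norm y')) \<le> 4 * norm (eta m y - eta m y')"
proof -
  note f = circle_prob_finite[OF m]
  have y1: "norm y < 1" "norm y' < 1" using y by auto
  have ck: "continuous_on unit_circle (\<lambda>\<zeta>. \<zeta> / (1 - \<zeta> * y) / (1 - \<zeta> * y'))"
    by (intro continuous_on_kernel y1 continuous_intros)
  have "divided_kernel m y y' - (\<integral>\<zeta>. \<zeta> \<partial>m) = (\<integral>\<zeta>. \<zeta> / (1 - \<zeta> * y) / (1 - \<zeta> * y') - \<zeta> \<partial>m)"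
    unfolding divided_kernel_def
    by (rule Bochner_Integration.integral_diff[symmetric]) (intro circle_integrable f ck continuous_intros)+
  also have "norm \<dots> \<le> 6 * (norm y + norm y')"
  proof (rule norm_integral_le_const[OF m])
    fix \<zeta> :: complex assume \<zeta>: "\<zeta> \<in> unit_circle"
    have nz: "1 - \<zeta> * y \<noteq> 0" "1 - \<zeta> * y' \<noteq> 0" using kernel_nonzero[OF \<zeta>] y1 by auto
    have "\<zeta> / (1 - \<zeta> * y) / (1 - \<zeta> * y') - \<zeta> = \<zeta> * (\<zeta> * y + \<zeta> * y' - (\<zeta> * y) * (\<zeta> * y')) / ((1 - \<zeta> * y) * (1 - \<zeta> * y'))"
      using nz by (simp add: divide_simps) (simp add: algebra_simps)
    moreover have "norm (\<zeta> * y + \<zeta> * y' - (\<zeta> * y) * (\<zeta> * y')) \<le> 3/2 * (norm y + norm y')"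
    proof -
      have "norm (\<zeta> * y + \<zeta> * y' - (\<zeta> * y) * (\<zeta> * y')) \<le> norm (\<zeta> * y) + norm (\<zeta> * y') + norm ((\<zeta> * y) * (\<zeta> * y'))"
        by (meson add_right_mono norm_triangle_ineq norm_triangle_ineq4 order_trans)
      also have "\<dots> = norm y + norm y' + norm y * norm y'" using \<zeta> by (simp add: norm_mult)
      also have "norm y * norm y' \<le> 1/2 * norm y'" using y by (intro mult_right_mono) auto
      finally show ?thesis by (simp add: algebra_simps) (use norm_ge_zero[of y] in linarith)
    qed
    moreover have "norm ((1 - \<zeta> * y) * (1 - \<zeta> * y')) \<ge> 1/2 * (1/2)"
      unfolding norm_mult using half_kernel_ge[OF \<zeta> y(1)] half_kernel_ge[OF \<zeta> y(2)] by (intro mult_mono) auto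
    moreover have "norm (\<zeta> * W) = norm W" for W using \<zeta> by (simp add: norm_mult)
    ultimately have "norm (\<zeta> / (1 - \<zeta> * y) / (1 - \<zeta> * y') - \<zeta>) \<le> (3/2 * (norm y + norm y')) / (1/2 * (1/2))"
      by (simp only: norm_divide[of _ "(1 - \<zeta> * y) * (1 - \<zeta> * y')"]) (rule frac_le; simp)
    then show "norm (\<zeta> / (1 - \<zeta> * y) / (1 - \<zeta> * y') - \<zeta>) \<le> 6 * (norm y + norm y')" by simp
  qed (intro continuous_intros ck)
  finally have N: "norm (\<integral>\<zeta>. \<zeta> \<partial>m) - 6 * (norm y + norm y') \<le> norm (divided_kernel m y y')"
    using norm_triangle_ineq2[of "\<integral>\<zeta>. \<zeta> \<partial>m" "divided_kernel m y y'"] by (simp add: norm_minus_commute)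
  have C: "norm (Cauchy_tr m z) \<le> 2" if z: "norm z \<le> 1/2" for z
    unfolding Cauchy_tr_def
  proof (rule norm_integral_le_const[OF m])
    fix \<zeta> :: complex assume \<zeta>: "\<zeta> \<in> unit_circle"
    have "1 / norm (1 - \<zeta> * z) \<le> 1 / (1/2)" using half_kernel_ge[OF \<zeta> z] by (intro frac_le) auto
    then show "norm (1 / (1 - \<zeta> * z)) \<le> 2" by (simp add: norm_divide)
  qed (use z in \<open>intro continuous_on_kernel continuous_intros; simp\<close>)
  have "norm (y - y') * norm (divided_kernel m y y') = norm (eta m y - eta m y') * (norm (Cauchy_tr m y) * norm (Cauchy_tr m y'))"
    unfolding eta_diff[OF m y1] using Cauchy_tr_nonzero[OF m y1(1)] Cauchy_tr_nonzero[OF m y1(2)]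
    by (simp add: norm_mult norm_divide)
  also have "\<dots> \<le> norm (eta m y - eta m y') * (2 * 2)"
    using C[OF y(1)] C[OF y(2)] by (intro mult_left_mono mult_mono) auto
  finally show ?thesis using mult_left_mono[OF N, of "norm (y - y')"] by simp
qed

lemma norm_levy_le:
  assumes m: "m \<in> circle_prob" and z: "norm z \<le> 1/2" and C: "\<bar>drift m\<bar> \<le> C * defect m"
  shows "norm (levy m z) \<le> (C + 3) * defect m"
proof -
  note f = circle_prob_finite[OF m]
  have z1: "norm z < 1" using z by simp
  have "norm (\<integral>\<zeta>. of_real (1 - Re \<zeta>) * ((1 + \<zeta> * z) / (1 - \<zeta> * z)) \<partial>m) \<le> (\<integral>\<zeta>. 3 * (1 - Re \<zeta>) \<partial>m)"
  proof (rule circle_integral_norm_le[OF f cont_levy[OF z1]])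
    fix \<zeta> :: complex assume \<zeta>: "\<zeta> \<in> unit_circle"
    have r: "0 \<le> 1 - Re \<zeta>" using complex_Re_le_cmod[of \<zeta>] \<zeta> by simp
    have "norm (1 + \<zeta> * z) \<le> 3/2" using norm_triangle_ineq[of 1 "\<zeta> * z"] \<zeta> z by (simp add: norm_mult)
    then have "norm ((1 + \<zeta> * z) / (1 - \<zeta> * z)) \<le> (3/2) / (1/2)"
      unfolding norm_divide using half_kernel_ge[OF \<zeta> z] by (intro frac_le) auto
    then have "(1 - Re \<zeta>) * norm ((1 + \<zeta> * z) / (1 - \<zeta> * z)) \<le> (1 - Re \<zeta>) * 3"
      using r by (intro mult_left_mono) auto
    then show "norm (of_real (1 - Re \<zeta>) * ((1 + \<zeta> * z) / (1 - \<zeta> * z))) \<le> 3 * (1 - Re \<zeta>)"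
      unfolding norm_mult norm_of_real using r by (simp add: mult.commute)
  qed (intro continuous_intros)
  then have "norm (\<integral>\<zeta>. of_real (1 - Re \<zeta>) * ((1 + \<zeta> * z) / (1 - \<zeta> * z)) \<partial>m) \<le> 3 * defect m"
    unfolding defect_def integral_mult_right_zero .
  moreover have "norm (levy m z) \<le> norm (\<integral>\<zeta>. of_real (1 - Re \<zeta>) * ((1 + \<zeta> * z) / (1 - \<zeta> * z)) \<partial>m) + norm (\<i> * of_real (drift m))"
    unfolding levy_def by (rule norm_triangle_ineq4)
  moreover have "norm (\<i> * of_real (drift m)) = \<bar>drift m\<bar>" by (simp add: norm_mult)
  ultimately show ?thesis using C by (simp add: distrib_right)
qed

lemma levy_Lipschitz:
  assumes m: "m \<in> circle_prob" and z: "norm z \<le> 1/2" and y: "norm y \<le> 1/2"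
  shows "norm (levy m y - levy m z) \<le> 8 * defect m * norm (y - z)"
proof -
  note f = circle_prob_finite[OF m]
  have z1: "norm z < 1" "norm y < 1" using z y by auto
  have "levy m y - levy m z = (\<integral>\<zeta>. of_real (1 - Re \<zeta>) * ((1 + \<zeta> * y) / (1 - \<zeta> * y)) \<partial>m)
      - (\<integral>\<zeta>. of_real (1 - Re \<zeta>) * ((1 + \<zeta> * z) / (1 - \<zeta> * z)) \<partial>m)"
    by (simp only: levy_def) simp
  also have "\<dots> = (\<integral>\<zeta>. of_real (1 - Re \<zeta>) * ((1 + \<zeta> * y) / (1 - \<zeta> * y))
      - of_real (1 - Re \<zeta>) * ((1 + \<zeta> * z) / (1 - \<zeta> * z)) \<partial>m)"
    by (rule Bochner_Integration.integral_diff[symmetric]) (intro circle_integrable f cont_levy z1)+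
  also have "norm \<dots> \<le> (\<integral>\<zeta>. (8 * norm (y - z)) * (1 - Re \<zeta>) \<partial>m)"
  proof (rule circle_integral_norm_le[OF f])
    fix \<zeta> :: complex assume \<zeta>: "\<zeta> \<in> unit_circle"
    have r: "0 \<le> 1 - Re \<zeta>" using complex_Re_le_cmod[of \<zeta>] \<zeta> by simp
    have nz: "1 - \<zeta> * y \<noteq> 0" "1 - \<zeta> * z \<noteq> 0" using kernel_nonzero[OF \<zeta>] z1 by auto
    have "(1 + \<zeta> * y) / (1 - \<zeta> * y) - (1 + \<zeta> * z) / (1 - \<zeta> * z) = 2 * \<zeta> * (y - z) / ((1 - \<zeta> * y) * (1 - \<zeta> * z))"
      using nz by (simp add: divide_simps) (simp add: algebra_simps)
    moreover have "norm (2 * \<zeta> * (y - z) / ((1 - \<zeta> * y) * (1 - \<zeta> * z))) \<le> 2 * norm (y - z) / (1/2 * (1/2))"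
      unfolding norm_divide norm_mult using half_kernel_ge[OF \<zeta> y] half_kernel_ge[OF \<zeta> z] \<zeta>
      by (intro frac_le mult_mono mult_pos_pos) auto
    ultimately have "norm ((1 + \<zeta> * y) / (1 - \<zeta> * y) - (1 + \<zeta> * z) / (1 - \<zeta> * z)) \<le> 8 * norm (y - z)" by simp
    then have "(1 - Re \<zeta>) * norm ((1 + \<zeta> * y) / (1 - \<zeta> * y) - (1 + \<zeta> * z) / (1 - \<zeta> * z)) \<le> (1 - Re \<zeta>) * (8 * norm (y - z))"
      using r by (rule mult_left_mono)
    moreover have "norm (of_real (1 - Re \<zeta>) * ((1 + \<zeta> * y) / (1 - \<zeta> * y)) - of_real (1 - Re \<zeta>) * ((1 + \<zeta> * z) / (1 - \<zeta> * z)))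
      = (1 - Re \<zeta>) * norm ((1 + \<zeta> * y) / (1 - \<zeta> * y) - (1 + \<zeta> * z) / (1 - \<zeta> * z))"
      unfolding right_diff_distrib[symmetric] norm_mult norm_of_real using r by simp
    ultimately show "norm (of_real (1 - Re \<zeta>) * ((1 + \<zeta> * y) / (1 - \<zeta> * y)) - of_real (1 - Re \<zeta>) * ((1 + \<zeta> * z) / (1 - \<zeta> * z)))
      \<le> 8 * norm (y - z) * (1 - Re \<zeta>)" by (simp add: mult_ac)
  next
    show "continuous_on unit_circle (\<lambda>\<zeta>. of_real (1 - Re \<zeta>) * ((1 + \<zeta> * y) / (1 - \<zeta> * y)) - of_real (1 - Re \<zeta>) * ((1 + \<zeta> * z) / (1 - \<zeta> * z)) :: complex)"
      by (intro continuous_on_diff cont_levy z1)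
  qed (intro continuous_intros)
  finally show ?thesis unfolding defect_def integral_mult_right_zero by (simp only: mult_ac)
qed

text \<open>The identity behind both limit theorems holds with \<open>q = (1 - z) Cauchy_tr m z\<close>, which is close to \<open>1\<close>
  because \<open>(1 - z) / (1 - \<zeta> z)\<close> is, for \<open>\<zeta>\<close> close to \<open>1\<close>.\<close>

lemma one_minus_Bf:
  assumes m: "m \<in> circle_prob" and z: "norm z \<le> 1/2"
  obtains q where "levy m z = q * (1 - Bf m z)" "norm (q - 1) \<le> spread m"
proof -
  note f = circle_prob_finite[OF m]
  have z1: "norm z < 1" using z by simp
  have nz: "1 - z \<noteq> 0" using z1 by auto
  have C: "Cauchy_tr m z \<noteq> 0" by (rule Cauchy_tr_nonzero[OF m z1])
  have i: "integrable m (\<lambda>\<zeta>. 1 / (1 - \<zeta> * z))" "integrable m (\<lambda>\<zeta>. \<zeta> / (1 - \<zeta> * z))"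
    by (intro circle_integrable f continuous_on_kernel z1 continuous_intros)+
  have "1 - Bf m z = (Cauchy_tr m z - (\<integral>\<zeta>. \<zeta> / (1 - \<zeta> * z) \<partial>m)) / Cauchy_tr m z"
    using C by (simp add: Bf_def diff_divide_distrib)
  also have "Cauchy_tr m z - (\<integral>\<zeta>. \<zeta> / (1 - \<zeta> * z) \<partial>m) = (\<integral>\<zeta>. (1 - \<zeta>) / (1 - \<zeta> * z) \<partial>m)"
    unfolding Cauchy_tr_def by (simp add: Bochner_Integration.integral_diff[OF i, symmetric] diff_divide_distrib)
  finally have B: "1 - Bf m z = (\<integral>\<zeta>. (1 - \<zeta>) / (1 - \<zeta> * z) \<partial>m) / Cauchy_tr m z" .
  define q where "q = (1 - z) * Cauchy_tr m z"
  have "levy m z = q * (1 - Bf m z)"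
    using C unfolding levy_eq[OF m z1] B q_def by simp
  moreover have "norm (q - 1) \<le> spread m"
  proof -
    have "q - 1 = (\<integral>\<zeta>. (1 - z) * (1 / (1 - \<zeta> * z)) \<partial>m) - (\<integral>\<zeta>. 1 \<partial>m)"
      unfolding q_def Cauchy_tr_def circle_prob_integral_const[OF m] integral_mult_right_zero ..
    also have "\<dots> = (\<integral>\<zeta>. (1 - z) * (1 / (1 - \<zeta> * z)) - 1 \<partial>m)"
      by (rule Bochner_Integration.integral_diff[symmetric])
         (intro circle_integrable f continuous_on_mult continuous_on_kernel z1 continuous_intros)+
    also have "\<dots> = (\<integral>\<zeta>. - z * ((1 - \<zeta>) / (1 - \<zeta> * z)) \<partial>m)"
    proof (rule circle_integral_cong[OF f])
      fix \<zeta> :: complex assume "\<zeta> \<in> unit_circle"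
      then have "1 - \<zeta> * z \<noteq> 0" using kernel_nonzero z1 by blast
      then show "(1 - z) * (1 / (1 - \<zeta> * z)) - 1 = - z * ((1 - \<zeta>) / (1 - \<zeta> * z))"
        by (simp add: divide_simps) (simp add: algebra_simps)
    qed
    also have "norm \<dots> \<le> (\<integral>\<zeta>. norm (1 - \<zeta>) \<partial>m)"
    proof (rule circle_integral_norm_le[OF f])
      fix \<zeta> :: complex assume \<zeta>: "\<zeta> \<in> unit_circle"
      have "norm (- z * ((1 - \<zeta>) / (1 - \<zeta> * z))) = norm z * norm (1 - \<zeta>) / norm (1 - \<zeta> * z)"
        by (simp add: norm_mult norm_divide)
      also have "\<dots> \<le> (1/2) * norm (1 - \<zeta>) / (1/2)"
        using half_kernel_ge[OF \<zeta> z] z by (intro frac_le mult_right_mono) auto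
      finally show "norm (- z * ((1 - \<zeta>) / (1 - \<zeta> * z))) \<le> norm (1 - \<zeta>)" by simp
    qed (intro continuous_on_mult continuous_on_kernel z1 continuous_intros)+
    finally show ?thesis unfolding spread_def .
  qed
  ultimately show ?thesis using that by blast
qed

lemma exp_linear_approx:
  fixes x :: complex
  assumes "norm x \<le> 1/2"
  obtains e where "1 - x = exp (- x + e)" "norm e \<le> 2 * norm x ^ 2"
proof -
  have x1: "norm (- x) < 1" "1 - x \<noteq> 0" using assms by auto
  define e where "e = ln (1 + - x) - (- x)"
  have "norm e \<le> norm (- x) ^ 2 / (1 - norm (- x))" unfolding e_def by (rule Ln_approx_linear[OF x1(1)])
  also have "\<dots> = norm x ^ 2 / (1 - norm x)" by simp
  also have "\<dots> \<le> norm x ^ 2 / (1/2)" using assms by (intro divide_left_mono) auto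
  finally have "norm e \<le> 2 * norm x ^ 2" by simp
  moreover have "exp (- x + e) = 1 - x" using x1(2) by (simp add: e_def)
  ultimately show ?thesis using that by metis
qed

text \<open>What centering provides: the drift is dominated by the defect, so \<open>levy m\<close> is of the size of the defect
  although its kernel \<open>1 - \<zeta>\<close> is only of first order.\<close>

locale near_one =
  fixes m :: "complex measure" and K :: real
  assumes m: "m \<in> circle_prob" and K: "K \<ge> 3" and drift: "\<bar>drift m\<bar> \<le> (K - 3) * defect m"
    and spread: "spread m \<le> 1 / (16 * K)"
begin

lemma spread_small: "spread m \<le> 1/48" "K * spread m \<le> 1/16" "defect m \<le> spread m" "0 \<le> defect m" "0 \<le> spread m"
proof -
  show "defect m \<le> spread m" "0 \<le> defect m" "0 \<le> spread m"
    using defect_le_spread[OF m] defect_nonneg[OF m] spread_nonneg by auto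
  show "K * spread m \<le> 1/16" using mult_left_mono[OF spread, of K] K by simp
  have "1 / (16 * K) \<le> 1 / 48" using K by (intro divide_left_mono) auto
  then show "spread m \<le> 1/48" using spread by linarith
qed

lemma norm_levy: "norm z \<le> 1/2 \<Longrightarrow> norm (levy m z) \<le> K * defect m"
  using norm_levy_le[OF m _ drift, of z] by simp

lemma Bf_near_one:
  assumes z: "norm z \<le> 1/2"
  shows "norm (1 - Bf m z) \<le> 2 * (K * defect m)" "norm (1 - Bf m z) \<le> 1/8"
    "norm (1 - Bf m z - levy m z) \<le> 2 * (K * defect m) * spread m"
proof -
  obtain q where q: "levy m z = q * (1 - Bf m z)" "norm (q - 1) \<le> spread m" using one_minus_Bf[OF m z] .
  have "norm q \<ge> 1/2" using norm_triangle_ineq2[of 1 "1 - q"] q(2) spread_small(1) norm_minus_commute[of q 1] by simp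
  then have "1/2 * norm (1 - Bf m z) \<le> norm q * norm (1 - Bf m z)" by (intro mult_right_mono) auto
  also have "\<dots> = norm (levy m z)" by (simp add: q(1) norm_mult)
  also have "\<dots> \<le> K * defect m" by (rule norm_levy[OF z])
  finally show 1: "norm (1 - Bf m z) \<le> 2 * (K * defect m)" by simp
  have "K * defect m \<le> K * spread m" using spread_small K by (intro mult_left_mono) auto
  then show "norm (1 - Bf m z) \<le> 1/8" using 1 spread_small(2) by linarith
  have "1 - Bf m z - levy m z = (1 - Bf m z) * (1 - q)" by (simp add: q(1) algebra_simps)
  then have "norm (1 - Bf m z - levy m z) = norm (1 - Bf m z) * norm (q - 1)"
    by (simp add: norm_mult norm_minus_commute)
  also have "\<dots> \<le> 2 * (K * defect m) * spread m"
    using 1 q(2) K spread_small(4) by (intro mult_mono) auto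
  finally show "norm (1 - Bf m z - levy m z) \<le> 2 * (K * defect m) * spread m" .
qed

text \<open>The point \<open>z\<close> may differ from \<open>y\<close>. This allows replacing the inverse of \<open>eta m\<close> at \<open>z\<close> by \<open>z\<close> itself.\<close>

lemma Bf_exp_levy:
  assumes y: "norm y \<le> 1/2" and z: "norm z \<le> 1/2"
  obtains e where "Bf m y = exp (- levy m z + e)" "norm e \<le> (10 * K\<^sup>2 * spread m + 8 * norm (y - z)) * defect m"
proof -
  define x where "x = 1 - Bf m y"
  note b = Bf_near_one[OF y, folded x_def]
  obtain e where e: "1 - x = exp (- x + e)" "norm e \<le> 2 * norm x ^ 2"
    using exp_linear_approx[of x] b(2) by auto
  have "norm x ^ 2 \<le> (2 * (K * defect m)) ^ 2" using b(1) by (intro power_mono) auto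
  also have "\<dots> = 4 * K\<^sup>2 * (defect m * defect m)" by (simp add: power2_eq_square mult_ac)
  also have "\<dots> \<le> 4 * K\<^sup>2 * (spread m * defect m)" using spread_small by (intro mult_left_mono mult_right_mono) auto
  finally have x2: "norm x ^ 2 \<le> 4 * K\<^sup>2 * (spread m * defect m)" .
  have KK: "2 * K \<le> 2 * K\<^sup>2" using K by (simp add: power2_eq_square)
  define e' where "e' = e - (x - levy m y) - (levy m y - levy m z)"
  have "Bf m y = exp (- levy m z + e')" using e(1) by (simp add: e'_def x_def algebra_simps)
  moreover have "norm e' \<le> (10 * K\<^sup>2 * spread m + 8 * norm (y - z)) * defect m"
  proof -
    have "norm e' \<le> norm e + norm (x - levy m y) + norm (levy m y - levy m z)"
      unfolding e'_def by (meson norm_triangle_le_diff norm_triangle_ineq4 order_trans add_right_mono)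
    also have "\<dots> \<le> 2 * (4 * K\<^sup>2 * (spread m * defect m)) + 2 * (K * defect m) * spread m + 8 * defect m * norm (y - z)"
      using e(2) x2 b(3) levy_Lipschitz[OF m z y] by linarith
    also have "2 * (K * defect m) * spread m = 2 * K * (spread m * defect m)" by simp
    also have "2 * K * (spread m * defect m) \<le> 2 * K\<^sup>2 * (spread m * defect m)"
      using KK spread_small by (intro mult_right_mono) auto
    finally show ?thesis by (simp add: algebra_simps)
  qed
  ultimately show ?thesis using that by blast
qed

text \<open>The divided kernel is close to its value \<open>1 / ((1 - y) (1 - y'))\<close> at the point mass in \<open>1\<close>, hence not zero.\<close>

lemma eta_inj: "inj_on (eta m) (ball 0 (1/2))"
proof (rule inj_onI)
  fix y y' :: complex assume y: "y \<in> ball 0 (1/2)" "y' \<in> ball 0 (1/2)" and eq: "eta m y = eta m y'"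
  note f = circle_prob_finite[OF m]
  have y1: "norm y < 1" "norm y' < 1" "norm y \<le> 1/2" "norm y' \<le> 1/2" using y by auto
  define N where "N = divided_kernel m y y'"
  have cN: "continuous_on unit_circle (\<lambda>\<zeta>. \<zeta> / (1 - \<zeta> * y) / (1 - \<zeta> * y'))"
    by (intro continuous_on_kernel y1 continuous_intros)
  have "(y - y') * N / (Cauchy_tr m y * Cauchy_tr m y') = 0"
    using eta_diff[OF m y1(1,2)] eq by (simp add: N_def)
  then have P: "(y - y') * N = 0" using Cauchy_tr_nonzero[OF m y1(1)] Cauchy_tr_nonzero[OF m y1(2)] by simp
  have "N \<noteq> 0"
  proof
    assume N0: "N = 0"
    define N1 where "N1 = 1 / ((1 - y) * (1 - y'))"
    have "N - N1 = (\<integral>\<zeta>. \<zeta> / (1 - \<zeta> * y) / (1 - \<zeta> * y') \<partial>m) - (\<integral>\<zeta>. N1 \<partial>m)"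
      unfolding N_def divided_kernel_def circle_prob_integral_const[OF m] ..
    also have "\<dots> = (\<integral>\<zeta>. \<zeta> / (1 - \<zeta> * y) / (1 - \<zeta> * y') - N1 \<partial>m)"
      by (rule Bochner_Integration.integral_diff[symmetric]) (intro circle_integrable f cN continuous_intros)+
    also have "norm \<dots> \<le> (\<integral>\<zeta>. 20 * norm (1 - \<zeta>) \<partial>m)"
    proof (rule circle_integral_norm_le[OF f])
      fix \<zeta> :: complex assume \<zeta>: "\<zeta> \<in> unit_circle"
      have one: "(1::complex) \<in> unit_circle" by simp
      have nz: "1 - \<zeta> * y \<noteq> 0" "1 - \<zeta> * y' \<noteq> 0" "1 - y \<noteq> 0" "1 - y' \<noteq> 0"
        using kernel_nonzero[OF \<zeta>] kernel_nonzero[OF one] y1 by auto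
      define Q where "Q = ((1 - \<zeta> * y) * (1 - \<zeta> * y')) * ((1 - y) * (1 - y'))"
      have "\<zeta> / (1 - \<zeta> * y) / (1 - \<zeta> * y') - N1 = (\<zeta> - 1) * (1 - y * y' * \<zeta>) / Q"
        unfolding N1_def Q_def using nz by (simp add: divide_simps) (simp add: algebra_simps)
      moreover have "norm Q \<ge> (1/2 * (1/2)) * (1/2 * (1/2))"
        unfolding Q_def norm_mult
        using half_kernel_ge[OF \<zeta> y1(3)] half_kernel_ge[OF \<zeta> y1(4)] half_kernel_ge[OF one y1(3)] half_kernel_ge[OF one y1(4)]
        by (intro mult_mono mult_nonneg_nonneg) auto
      moreover have "norm (1 - y * y' * \<zeta>) \<le> 5/4"
      proof -
        have "norm y * norm y' \<le> 1/2 * (1/2)" using y1 by (intro mult_mono) auto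
        then show ?thesis using norm_triangle_ineq4[of 1 "y * y' * \<zeta>"] \<zeta> by (simp add: norm_mult)
      qed
      ultimately have "norm (\<zeta> / (1 - \<zeta> * y) / (1 - \<zeta> * y') - N1) \<le> norm (\<zeta> - 1) * (5/4) / ((1/2 * (1/2)) * (1/2 * (1/2)))"
        by (simp only: norm_divide norm_mult) (intro frac_le mult_left_mono; simp)
      then show "norm (\<zeta> / (1 - \<zeta> * y) / (1 - \<zeta> * y') - N1) \<le> 20 * norm (1 - \<zeta>)"
        by (simp add: norm_minus_commute)
    qed (intro continuous_intros cN)+
    finally have "norm (N - N1) \<le> 20 * spread m" unfolding spread_def integral_mult_right_zero .
    then have up: "norm N1 \<le> 20 / 48" using N0 spread_small(1) by simp
    have "norm (1 - y) \<le> 3/2" "norm (1 - y') \<le> 3/2"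
      using norm_triangle_ineq4[of 1 y] norm_triangle_ineq4[of 1 y'] y1 by auto
    then have "norm ((1 - y) * (1 - y')) \<le> 3/2 * (3/2)" unfolding norm_mult by (intro mult_mono) auto
    moreover have "0 < norm ((1 - y) * (1 - y'))" using y1 by auto
    ultimately have "norm N1 \<ge> 1 / (9/4)" unfolding N1_def norm_divide norm_one by (intro frac_le) auto
    then show False using up by simp
  qed
  then show "y = y'" using P by simp
qed

text \<open>The map \<open>eta m\<close> is injective on the disk of radius \<open>1/2\<close> and has absolute value at least \<open>1/4\<close> on its boundary, so
  the inverse \<open>g\<close> is defined on a disk that does not depend on \<open>m\<close>. There \<open>g z - z\<close> is of the size of the
  defect, so \<open>1 / B (g z)\<close> is still \<open>exp (levy m z)\<close> up to an admissible error.\<close>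

lemma Sigma_exists:
  obtains S where "Sigma_germ m S" "S holomorphic_on ball 0 (1/4)"
    "\<And>z. norm z < 1/4 \<Longrightarrow> \<exists>e. S z = exp (levy m z + e) \<and> norm e \<le> 26 * K\<^sup>2 * spread m * defect m"
proof -
  have hol: "eta m holomorphic_on ball 0 (1/2)"
    by (rule holomorphic_on_subset[OF eta_holomorphic[OF m]]) auto
  obtain g where g: "g holomorphic_on (eta m ` ball 0 (1/2))" "\<And>z. z \<in> ball 0 (1/2) \<Longrightarrow> g (eta m z) = z"
    using holomorphic_has_inverse[OF hol open_ball eta_inj] by metis
  have sub: "ball 0 (1/4) \<subseteq> eta m ` ball 0 (1/2)"
  proof -
    have "ball (eta m 0) (1/4) \<subseteq> eta m ` ball 0 (1/2)"
    proof (rule ball_subset_open_map_image)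
      show "continuous_on (closure (ball 0 (1/2))) (eta m)"
        by (rule continuous_on_subset[OF holomorphic_on_imp_continuous_on[OF eta_holomorphic[OF m]]]) auto
      show "open (eta m ` interior (ball 0 (1/2)))"
        using open_mapping_thm3[OF hol open_ball eta_inj] by simp
      fix z :: complex assume "z \<in> frontier (ball 0 (1/2))"
      then have z: "norm z = 1/2" by simp
      have "norm (Bf m z) \<ge> 1/2"
        using Bf_near_one(2)[of z] norm_triangle_ineq2[of 1 "1 - Bf m z"] z by simp
      then show "1/4 \<le> norm (eta m z - eta m 0)" by (simp add: eta_def norm_mult z)
    qed auto
    then show ?thesis by simp
  qed
  have gr: "norm (g z) < 1/2" "eta m (g z) = z" if "norm z < 1/4" for z
  proof -
    have "z \<in> eta m ` ball 0 (1/2)" using sub that by auto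
    then obtain y where "y \<in> ball 0 (1/2)" "z = eta m y" by blast
    then show "norm (g z) < 1/2" "eta m (g z) = z" using g(2) by auto
  qed
  have Bnz: "Bf m y \<noteq> 0" if "norm y < 1/2" for y
    using Bf_near_one(2)[of y] that by auto
  define S where "S z = inverse (Bf m (g z))" for z
  have zS: "z * S z = g z" if "norm z < 1/4" for z
    using gr[OF that] Bnz[of "g z"] by (simp add: S_def eta_def field_simps)
  have "(\<lambda>z. Bf m (g z)) holomorphic_on ball 0 (1/4)"
  proof -
    have "g ` ball 0 (1/4) \<subseteq> ball 0 1"
    proof
      fix w assume "w \<in> g ` ball 0 (1/4)"
      then obtain z where "norm z < 1/4" "w = g z" by auto
      then show "w \<in> ball 0 1" using gr(1)[of z] by simp
    qed
    from holomorphic_on_compose_gen[OF holomorphic_on_subset[OF g(1) sub] Bf_holomorphic[OF m] this]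
    show ?thesis by (simp add: o_def)
  qed
  then have Sh: "S holomorphic_on ball 0 (1/4)"
    unfolding S_def by (rule holomorphic_on_inverse) (use gr(1) Bnz in auto)
  have germ: "Sigma_germ m S"
    unfolding Sigma_germ_def
  proof
    show "S analytic_on {0}" using Sh by (auto simp: analytic_at intro!: exI[of _ "ball 0 (1/4)"])
    have "\<forall>\<^sub>F z in nhds (0::complex). norm z < 1/4" by (rule eventually_nhds_norm_less) simp
    then show "\<forall>\<^sub>F z in nhds 0. eta m (z * S z) = z" by eventually_elim (simp add: zS gr(2))
  qed
  have "\<exists>e. S z = exp (levy m z + e) \<and> norm e \<le> 26 * K\<^sup>2 * spread m * defect m" if z: "norm z < 1/4" for z
  proof -
    obtain e where e: "Bf m (g z) = exp (- levy m z + e)" "norm e \<le> (10 * K\<^sup>2 * spread m + 8 * norm (g z - z)) * defect m"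
      using Bf_exp_levy[of "g z" z] gr(1)[OF z] z by auto
    have "g z - z = g z * (1 - Bf m (g z))" using gr(2)[OF z] by (simp add: eta_def algebra_simps)
    then have "norm (g z - z) = norm (g z) * norm (1 - Bf m (g z))" by (simp add: norm_mult)
    also have "\<dots> \<le> 1/2 * (2 * (K * defect m))"
      using gr(1)[OF z] Bf_near_one(1)[of "g z"] by (intro mult_mono) auto
    also have "\<dots> \<le> K * spread m" using spread_small K by (simp add: mult_left_mono)
    also have "\<dots> \<le> K\<^sup>2 * spread m" using K spread_small by (intro mult_right_mono) (auto simp: power2_eq_square)
    finally have n: "norm (g z - z) \<le> K\<^sup>2 * spread m" .
    have A: "0 \<le> K\<^sup>2 * spread m" using spread_small(5) by simp
    have "10 * K\<^sup>2 * spread m + 8 * norm (g z - z) \<le> 10 * (K\<^sup>2 * spread m) + 8 * (K\<^sup>2 * spread m)"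
      using n by (simp add: mult.commute)
    also have "\<dots> \<le> 26 * (K\<^sup>2 * spread m)" using A by linarith
    finally have "10 * K\<^sup>2 * spread m + 8 * norm (g z - z) \<le> 26 * K\<^sup>2 * spread m" by simp
    then have "norm e \<le> 26 * K\<^sup>2 * spread m * defect m"
      using e(2) spread_small(4) by (meson mult_right_mono order_trans)
    moreover have "S z = exp (levy m z + - e)"
      unfolding S_def e(1) by (simp flip: exp_minus)
    ultimately show ?thesis by (metis norm_minus_cancel)
  qed
  then show ?thesis using that[OF germ Sh] by blast
qed

end

section \<open>Centering\<close>

lemma abs_sin_minus_id_le: "\<bar>sin x - x\<bar> \<le> \<bar>x\<bar> ^ 3 / 6" for x :: real
  using Maclaurin_sin_bound[of x 3] by (simp add: sin_coeff_def eval_nat_numeral)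

text \<open>The bound \<open>17/5\<close> exceeds \<open>\<pi> + 1/5\<close> and so covers \<open>Arg \<zeta> - \<beta>\<close> for the small shifts \<open>\<beta>\<close> that occur.\<close>

lemma one_minus_cos_ge:
  fixes x :: real
  assumes "\<bar>x\<bar> \<le> 17/5"
  shows "x\<^sup>2 / 8 \<le> 1 - cos x"
proof -
  define t where "t = \<bar>x / 2\<bar>"
  have t: "0 \<le> t" "t \<le> 17/10" using assms by (auto simp: t_def)
  have "t ^ 3 \<le> 3 * t"
  proof -
    have "t * t \<le> 17/10 * (17/10)" using t by (intro mult_mono) auto
    then have "t * t * t \<le> 3 * t" using t by (intro mult_right_mono) auto
    then show ?thesis by (simp add: eval_nat_numeral)
  qed
  then have "\<bar>sin (x / 2) - x / 2\<bar> \<le> t / 2" using abs_sin_minus_id_le[of "x / 2"] by (simp add: t_def)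
  then have "\<bar>sin (x / 2)\<bar> \<ge> t / 2" unfolding t_def by linarith
  then have "(t / 2)\<^sup>2 \<le> (\<bar>sin (x / 2)\<bar>)\<^sup>2" using t by (intro power_mono) auto
  then have "(t / 2)\<^sup>2 \<le> (sin (x / 2))\<^sup>2" by simp
  moreover have "cos x = 1 - 2 * (sin (x / 2))\<^sup>2" using cos_double_sin[of "x / 2"] by simp
  ultimately show ?thesis by (simp add: t_def power2_eq_square)
qed

lemma pi_upper: "pi < 16/5"
  using pi_approx by simp

lemma circle_cis_Arg: "\<zeta> \<in> unit_circle \<Longrightarrow> cis (Arg \<zeta>) = \<zeta>"
proof -
  assume "\<zeta> \<in> unit_circle"
  then have "\<zeta> \<noteq> 0" "sgn \<zeta> = \<zeta>" by (auto simp: sgn_eq)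
  then show ?thesis by (simp add: cis_Arg)
qed

lemma norm_one_minus_sq: "\<zeta> \<in> unit_circle \<Longrightarrow> (norm (1 - \<zeta>))\<^sup>2 = 2 * (1 - Re \<zeta>)"
proof -
  assume "\<zeta> \<in> unit_circle"
  then have "(Re \<zeta>)\<^sup>2 + (Im \<zeta>)\<^sup>2 = 1" using cmod_power2[of \<zeta>] by simp
  then show ?thesis unfolding cmod_power2 by (simp add: power2_eq_square algebra_simps)
qed

lemma abs_Arg_le:
  assumes \<zeta>: "\<zeta> \<in> unit_circle" shows "\<bar>Arg \<zeta>\<bar> \<le> 2 * norm (1 - \<zeta>)"
proof -
  have b: "\<bar>Arg \<zeta>\<bar> \<le> pi" using Arg_bounded[of \<zeta>] by auto
  then have "\<bar>Arg \<zeta>\<bar> \<le> 17/5" using pi_upper by linarith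
  from one_minus_cos_ge[OF this] have "(Arg \<zeta>)\<^sup>2 / 8 \<le> 1 - Re (cis (Arg \<zeta>))" by simp
  then have "(Arg \<zeta>)\<^sup>2 / 8 \<le> 1 - Re \<zeta>" by (simp only: circle_cis_Arg[OF \<zeta>])
  then have "\<bar>Arg \<zeta>\<bar>\<^sup>2 \<le> (2 * norm (1 - \<zeta>))\<^sup>2"
    using norm_one_minus_sq[OF \<zeta>] by (simp add: power_mult_distrib)
  then show ?thesis by (rule power2_le_imp_le) simp
qed

lemma norm_cis_minus_one_le: "norm (cis x - 1) \<le> \<bar>x\<bar>"
proof -
  have "(norm (1 - cis x))\<^sup>2 = 2 * (1 - cos x)" using norm_one_minus_sq[of "cis x"] by simp
  also have "cos x = 1 - 2 * (sin (x / 2))\<^sup>2" using cos_double_sin[of "x / 2"] by simp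
  also have "2 * (1 - (1 - 2 * (sin (x / 2))\<^sup>2)) = (2 * \<bar>sin (x / 2)\<bar>)\<^sup>2" by (simp add: power_mult_distrib)
  also have "\<dots> \<le> \<bar>x\<bar>\<^sup>2"
    using abs_sin_x_le_abs_x[of "x / 2"] by (intro power_mono) auto
  finally have "norm (1 - cis x) \<le> \<bar>x\<bar>" by (rule power2_le_imp_le) simp
  then show ?thesis by (simp add: norm_minus_commute)
qed

lemma bounded_borel_integrable:
  fixes f :: "complex \<Rightarrow> real"
  assumes m: "m \<in> circle_prob" and f: "f \<in> borel_measurable borel" "\<And>\<zeta>. \<zeta> \<in> unit_circle \<Longrightarrow> \<bar>f \<zeta>\<bar> \<le> B"
  shows "integrable m f"
  using circle_finite_borel_measurable[OF circle_prob_finite[OF m] f(1)] f(2)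
    circle_finite_space[OF circle_prob_finite[OF m]] circle_prob_finite[OF m]
  by (intro finite_measure.integrable_const_bound[where B = B] AE_I2) (auto simp: circle_finite_def)

lemma centered_integral:
  fixes f :: "complex \<Rightarrow> 'b::{banach, second_countable_topology}"
  assumes \<mu>: "\<mu> \<in> circle_prob"
  shows "centered \<tau> \<mu> \<in> circle_prob"
    "continuous_on unit_circle f \<Longrightarrow> (\<integral>\<zeta>. f \<zeta> \<partial>centered \<tau> \<mu>) = (\<integral>\<zeta>. f (\<zeta> / center \<tau> \<mu>) \<partial>\<mu>)"
proof -
  have n: "norm (center \<tau> \<mu>) = 1" by (simp add: center_def)
  have meas: "(\<lambda>\<zeta>. \<zeta> / center \<tau> \<mu>) \<in> measurable \<mu> circle_borel"
  proof (rule measurable_circle_borelI)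
    show "(\<lambda>\<zeta>. \<zeta> / center \<tau> \<mu>) \<in> borel_measurable \<mu>"
      using n by (intro circle_finite_measurable circle_prob_finite \<mu> continuous_intros) auto
    fix \<zeta> assume "\<zeta> \<in> space \<mu>"
    then show "\<zeta> / center \<tau> \<mu> \<in> unit_circle"
      using n circle_finite_space[OF circle_prob_finite[OF \<mu>]] by (simp add: norm_divide)
  qed
  have ps: "prob_space \<mu>" using \<mu> by (simp add: circle_prob_def)
  show "centered \<tau> \<mu> \<in> circle_prob"
    unfolding centered_def by (rule circle_prob_distr[OF ps meas])
  assume "continuous_on unit_circle f"
  then show "(\<integral>\<zeta>. f \<zeta> \<partial>centered \<tau> \<mu>) = (\<integral>\<zeta>. f (\<zeta> / center \<tau> \<mu>) \<partial>\<mu>)"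
    unfolding centered_def by (intro integral_distr meas circle_test_measurable)
qed

text \<open>Centering by the truncated mean \<open>\<beta>\<close> of the argument \<open>\<theta>\<close> keeps the drift \<open>\<integral> sin (\<theta> - \<beta>)\<close> below a multiple
  of the defect: subtracting the mean-zero function \<open>1\<^bsub>\<bar>\<theta>\<bar> < \<tau>\<^esub> \<theta> - \<beta>\<close> leaves an integrand dominated by
  \<open>1 - cos (\<theta> - \<beta>)\<close>. For \<open>|\<theta>| < \<tau>\<close> the integrand is \<open>sin x - x\<close> with \<open>x = \<theta> - \<beta>\<close>; otherwise
  \<open>|\<beta>| \<le> \<tau> / 2\<close> keeps \<open>\<theta> - \<beta>\<close> away from \<open>0\<close>.\<close>

lemma centered_near_one:
  assumes \<tau>: "0 < \<tau>" and \<mu>: "\<mu> \<in> circle_prob" and small: "spread \<mu> \<le> 1/10" "spread \<mu> \<le> \<tau> / 4"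
  shows "\<bar>drift (centered \<tau> \<mu>)\<bar> \<le> (6 + 64 / \<tau>\<^sup>2) * defect (centered \<tau> \<mu>)"
    "spread (centered \<tau> \<mu>) \<le> 3 * spread \<mu>" "norm (center \<tau> \<mu> - 1) \<le> 2 * spread \<mu>"
proof -
  note f = circle_prob_finite[OF \<mu>]
  define T where "T = {\<zeta> \<in> unit_circle. \<bar>Arg \<zeta>\<bar> < \<tau>}"
  define g where "g \<zeta> = indicator T \<zeta> * Arg \<zeta>" for \<zeta>
  define \<beta> where "\<beta> = (\<integral>\<zeta>. g \<zeta> \<partial>\<mu>)"
  have Tm: "T \<in> sets borel"
  proof -
    have "T = unit_circle \<inter> Arg -` {-\<tau><..<\<tau>}" by (auto simp: T_def)
    moreover have "Arg -` {-\<tau><..<\<tau>} \<in> sets borel" using measurable_sets[OF Arg_measurable, of "{-\<tau><..<\<tau>}"] by simp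
    ultimately show ?thesis by simp
  qed
  have gm: "g \<in> borel_measurable borel"
    unfolding g_def using Tm Arg_measurable by (intro borel_measurable_times borel_measurable_indicator) auto
  have Ab: "\<bar>Arg \<zeta>\<bar> \<le> pi" for \<zeta> using Arg_bounded[of \<zeta>] by auto
  have gb: "\<bar>g \<zeta>\<bar> \<le> \<bar>Arg \<zeta>\<bar>" for \<zeta> by (auto simp: g_def indicator_def)
  have gi: "integrable \<mu> g"
    by (rule bounded_borel_integrable[OF \<mu> gm]) (rule order_trans[OF gb Ab])
  have c: "center \<tau> \<mu> = cis \<beta>"
    unfolding center_def \<beta>_def g_def set_lebesgue_integral_def T_def cis_conv_exp by simp
  have \<beta>: "\<bar>\<beta>\<bar> \<le> 2 * spread \<mu>"
  proof -
    have "\<bar>\<beta>\<bar> \<le> (\<integral>\<zeta>. \<bar>g \<zeta>\<bar> \<partial>\<mu>)" unfolding \<beta>_def by (rule integral_abs_bound)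
    also have "\<dots> \<le> (\<integral>\<zeta>. 2 * norm (1 - \<zeta>) \<partial>\<mu>)"
    proof (rule integral_mono)
      show "integrable \<mu> (\<lambda>\<zeta>. 2 * norm (1 - \<zeta>))" by (intro circle_integrable f continuous_intros)
      fix \<zeta> assume "\<zeta> \<in> space \<mu>"
      then show "\<bar>g \<zeta>\<bar> \<le> 2 * norm (1 - \<zeta>)"
        using order_trans[OF gb abs_Arg_le] circle_finite_space[OF f] by simp
    qed (rule integrable_abs[OF gi])
    finally show ?thesis by (simp add: spread_def)
  qed
  show cn: "norm (center \<tau> \<mu> - 1) \<le> 2 * spread \<mu>"
    unfolding c using norm_cis_minus_one_le[of \<beta>] \<beta> by linarith
  have \<beta>5: "\<bar>\<beta>\<bar> \<le> 1/5" "\<bar>\<beta>\<bar> \<le> \<tau> / 2" using \<beta> small by linarith+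
  have rot: "\<zeta> / center \<tau> \<mu> = cis (Arg \<zeta> - \<beta>)" if "\<zeta> \<in> unit_circle" for \<zeta>
    unfolding c using circle_cis_Arg[OF that] cis_divide[of "Arg \<zeta>" \<beta>] by simp
  have D: "defect (centered \<tau> \<mu>) = (\<integral>\<zeta>. 1 - cos (Arg \<zeta> - \<beta>) \<partial>\<mu>)"
    unfolding defect_def centered_integral(2)[OF \<mu> cont_Re_Im(1)]
    by (rule circle_integral_cong[OF f]) (simp only: rot cis.simps)
  have A: "drift (centered \<tau> \<mu>) = (\<integral>\<zeta>. sin (Arg \<zeta> - \<beta>) \<partial>\<mu>)"
    unfolding drift_def centered_integral(2)[OF \<mu> cont_Re_Im(2)]
    by (rule circle_integral_cong[OF f]) (simp only: rot cis.simps)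
  have sm: "(\<lambda>\<zeta>. sin (Arg \<zeta> - \<beta>)) \<in> borel_measurable borel" "(\<lambda>\<zeta>. 1 - cos (Arg \<zeta> - \<beta>)) \<in> borel_measurable borel"
    using Arg_measurable by measurable
  have si: "integrable \<mu> (\<lambda>\<zeta>. sin (Arg \<zeta> - \<beta>))"
    by (rule bounded_borel_integrable[OF \<mu> sm(1), of 1]) simp
  have ci: "integrable \<mu> (\<lambda>\<zeta>. 1 - cos (Arg \<zeta> - \<beta>))"
    by (rule bounded_borel_integrable[OF \<mu> sm(2), of 2]) (use cos_le_one cos_ge_minus_one in \<open>auto simp: abs_le_iff\<close>)
  have ki: "integrable \<mu> (\<lambda>_. \<beta>)" by (intro circle_integrable f continuous_intros)
  have "drift (centered \<tau> \<mu>) = (\<integral>\<zeta>. sin (Arg \<zeta> - \<beta>) \<partial>\<mu>) - (\<integral>\<zeta>. g \<zeta> \<partial>\<mu>) + (\<integral>\<zeta>. \<beta> \<partial>\<mu>)"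
    using circle_prob_integral_const[OF \<mu>, of \<beta>] by (simp add: A \<beta>_def)
  also have "\<dots> = (\<integral>\<zeta>. sin (Arg \<zeta> - \<beta>) - g \<zeta> + \<beta> \<partial>\<mu>)"
    using Bochner_Integration.integral_add[OF Bochner_Integration.integrable_diff[OF si gi] ki]
      Bochner_Integration.integral_diff[OF si gi] by simp
  finally have A': "drift (centered \<tau> \<mu>) = (\<integral>\<zeta>. sin (Arg \<zeta> - \<beta>) - g \<zeta> + \<beta> \<partial>\<mu>)" .
  have pw: "\<bar>sin (Arg \<zeta> - \<beta>) - g \<zeta> + \<beta>\<bar> \<le> (6 + 64 / \<tau>\<^sup>2) * (1 - cos (Arg \<zeta> - \<beta>))" if \<zeta>: "\<zeta> \<in> unit_circle" for \<zeta>
  proof -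
    define x where "x = Arg \<zeta> - \<beta>"
    have x: "\<bar>x\<bar> \<le> 17/5" using Ab[of \<zeta>] \<beta>5(1) pi_upper unfolding x_def by linarith
    have x2: "x\<^sup>2 \<le> 8 * (1 - cos x)" using one_minus_cos_ge[OF x] by simp
    have cn: "0 \<le> 1 - cos x" by simp
    have tt: "0 \<le> 64 / \<tau>\<^sup>2" by simp
    show ?thesis
    proof (cases "\<zeta> \<in> T")
      case True
      then have "sin (Arg \<zeta> - \<beta>) - g \<zeta> + \<beta> = sin x - x" by (simp add: g_def x_def)
      moreover have "\<bar>sin x - x\<bar> \<le> 6 * (1 - cos x)"
      proof -
        have "\<bar>x\<bar> ^ 3 = \<bar>x\<bar> * x\<^sup>2" by (simp add: eval_nat_numeral abs_mult_self_eq)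
        also have "\<dots> \<le> 17/5 * (8 * (1 - cos x))" using x x2 by (intro mult_mono) auto
        finally show ?thesis using abs_sin_minus_id_le[of x] cn by linarith
      qed
      moreover have "6 * (1 - cos x) \<le> (6 + 64 / \<tau>\<^sup>2) * (1 - cos x)" using cn tt by (intro mult_right_mono) auto
      ultimately show ?thesis by (simp add: x_def)
    next
      case False
      then have "\<bar>Arg \<zeta>\<bar> \<ge> \<tau>" using \<zeta> by (auto simp: T_def)
      then have "\<tau> / 2 \<le> \<bar>x\<bar>" using \<beta>5(2) unfolding x_def by linarith
      then have "(\<tau> / 2)\<^sup>2 \<le> \<bar>x\<bar>\<^sup>2" using \<tau> by (intro power_mono) auto
      then have "\<tau>\<^sup>2 / 32 \<le> 1 - cos x" using x2 by (simp add: power_divide)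
      then have "64 / \<tau>\<^sup>2 * (\<tau>\<^sup>2 / 32) \<le> 64 / \<tau>\<^sup>2 * (1 - cos x)" using tt by (rule mult_left_mono)
      then have "2 \<le> 64 / \<tau>\<^sup>2 * (1 - cos x)" using \<tau> by simp
      also have "\<dots> \<le> (6 + 64 / \<tau>\<^sup>2) * (1 - cos x)" using cn by (intro mult_right_mono) auto
      finally have "2 \<le> (6 + 64 / \<tau>\<^sup>2) * (1 - cos x)" .
      moreover have "sin (Arg \<zeta> - \<beta>) - g \<zeta> + \<beta> = sin x + \<beta>" using False by (simp add: g_def x_def)
      moreover have "\<bar>sin x + \<beta>\<bar> \<le> 2" using abs_sin_le_one[of x] \<beta>5(1) by linarith
      ultimately show ?thesis unfolding x_def by linarith
    qed
  qed
  have "\<bar>drift (centered \<tau> \<mu>)\<bar> \<le> (\<integral>\<zeta>. \<bar>sin (Arg \<zeta> - \<beta>) - g \<zeta> + \<beta>\<bar> \<partial>\<mu>)"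
    unfolding A' by (rule integral_abs_bound)
  also have "\<dots> \<le> (\<integral>\<zeta>. (6 + 64 / \<tau>\<^sup>2) * (1 - cos (Arg \<zeta> - \<beta>)) \<partial>\<mu>)"
    using pw circle_finite_space[OF f]
    by (intro integral_mono integrable_abs Bochner_Integration.integrable_add Bochner_Integration.integrable_diff si gi ki integrable_mult_right ci) auto
  also have "\<dots> = (6 + 64 / \<tau>\<^sup>2) * defect (centered \<tau> \<mu>)" unfolding D by (rule integral_mult_right_zero)
  finally show "\<bar>drift (centered \<tau> \<mu>)\<bar> \<le> (6 + 64 / \<tau>\<^sup>2) * defect (centered \<tau> \<mu>)" .
  have nb: "norm (center \<tau> \<mu>) = 1" "center \<tau> \<mu> \<noteq> 0" by (auto simp: c)
  have "spread (centered \<tau> \<mu>) = (\<integral>\<zeta>. norm (1 - \<zeta> / center \<tau> \<mu>) \<partial>\<mu>)"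
    unfolding spread_def by (rule centered_integral(2)[OF \<mu> cont_Re_Im(3)])
  also have "\<dots> \<le> (\<integral>\<zeta>. norm (center \<tau> \<mu> - 1) + norm (1 - \<zeta>) \<partial>\<mu>)"
  proof (rule integral_mono)
    fix \<zeta> assume "\<zeta> \<in> space \<mu>"
    have "norm (1 - \<zeta> / center \<tau> \<mu>) = norm (center \<tau> \<mu> - \<zeta>)"
    proof -
      have "1 - \<zeta> / center \<tau> \<mu> = (center \<tau> \<mu> - \<zeta>) / center \<tau> \<mu>" using nb by (simp add: field_simps)
      then show ?thesis using nb by (simp add: norm_divide)
    qed
    also have "\<dots> \<le> norm (center \<tau> \<mu> - 1) + norm (1 - \<zeta>)"
      using norm_triangle_ineq[of "center \<tau> \<mu> - 1" "1 - \<zeta>"] by simp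
    finally show "norm (1 - \<zeta> / center \<tau> \<mu>) \<le> norm (center \<tau> \<mu> - 1) + norm (1 - \<zeta>)" .
  qed (use nb in \<open>intro circle_integrable f continuous_intros; simp\<close>)+
  also have "\<dots> = norm (center \<tau> \<mu> - 1) + spread \<mu>"
    unfolding spread_def
    by (subst Bochner_Integration.integral_add) (auto intro!: circle_integrable f continuous_intros simp: circle_prob_measure_space[OF \<mu>])
  finally show "spread (centered \<tau> \<mu>) \<le> 3 * spread \<mu>" using cn by simp
qed

lemma centered_eta:
  assumes \<mu>: "\<mu> \<in> circle_prob" and z: "norm z < 1"
  shows "Bf \<mu> z = center \<tau> \<mu> * Bf (centered \<tau> \<mu>) (center \<tau> \<mu> * z)"
proof -
  note f = circle_prob_finite[OF \<mu>]
  define b where "b = center \<tau> \<mu>"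
  have b: "norm b = 1" "b \<noteq> 0" by (auto simp: b_def center_def)
  have bz: "norm (b * z) < 1" using z b by (simp add: norm_mult)
  have k: "\<zeta> / b * (b * z) = \<zeta> * z" for \<zeta> using b by simp
  note ci = centered_integral(2)[OF \<mu> continuous_on_kernel[OF bz], of _ \<tau>, folded b_def, unfolded k]
  have "Cauchy_tr (centered \<tau> \<mu>) (b * z) = Cauchy_tr \<mu> z"
    unfolding Cauchy_tr_def by (rule ci) (rule continuous_on_const)
  moreover have "(\<integral>\<zeta>. \<zeta> / (1 - \<zeta> * (b * z)) \<partial>centered \<tau> \<mu>) = (\<integral>\<zeta>. \<zeta> / b / (1 - \<zeta> * z) \<partial>\<mu>)"
    by (rule ci) (rule continuous_on_id)
  moreover have "(\<integral>\<zeta>. \<zeta> / b / (1 - \<zeta> * z) \<partial>\<mu>) = (\<integral>\<zeta>. \<zeta> / (1 - \<zeta> * z) \<partial>\<mu>) / b"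
    unfolding integral_divide_zero[symmetric]
    by (intro Bochner_Integration.integral_cong) (auto simp: mult.commute)
  ultimately show ?thesis using b by (simp add: Bf_def b_def[symmetric])
qed

lemma centered_Sigma_germ:
  assumes \<mu>: "\<mu> \<in> circle_prob" and S: "Sigma_germ (centered \<tau> \<mu>) S"
  shows "Sigma_germ \<mu> (\<lambda>z. inverse (center \<tau> \<mu>) * S z)"
proof -
  define b where "b = center \<tau> \<mu>"
  have b: "norm b = 1" "b \<noteq> 0" by (auto simp: b_def center_def)
  have a: "S analytic_on {0}" "\<forall>\<^sub>F z in nhds 0. eta (centered \<tau> \<mu>) (z * S z) = z" using S by (auto simp: Sigma_germ_def)
  have "\<forall>\<^sub>F z in nhds 0. eta \<mu> (z * (inverse b * S z)) = z"
    using a(2) id_times_small[OF a(1) zero_less_one]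
  proof eventually_elim
    case (elim z)
    have "norm (z * (inverse b * S z)) < 1" using elim(2) b by (simp add: norm_mult norm_inverse)
    moreover have bb: "b * (z * (inverse b * S z)) = z * S z" using b by simp
    ultimately have ce: "Bf \<mu> (z * (inverse b * S z)) = b * Bf (centered \<tau> \<mu>) (z * S z)"
      using centered_eta[OF \<mu>, of "z * (inverse b * S z)" \<tau>, folded b_def, unfolded bb] by blast
    have "eta \<mu> (z * (inverse b * S z)) = eta (centered \<tau> \<mu>) (z * S z)"
      using b by (simp add: eta_def ce)
    then show ?case using elim(1) by simp
  qed
  moreover have "(\<lambda>z. inverse b * S z) analytic_on {0}" by (intro analytic_intros a)
  ultimately show ?thesis by (simp add: Sigma_germ_def b_def)
qed

text \<open>An entry is a rotation by its center of a measure to which the expansions near \<open>1\<close> apply. The rotation also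
  moves the argument of the B-transform, by \<open>|center - 1| |z|\<close>; this costs only an error of the
  admissible size.\<close>

lemma entry_expansions:
  assumes \<tau>: "0 < \<tau>"
  obtains C \<delta> where "C > 0" "\<delta> > 0"
    "\<And>\<mu> z. \<mu> \<in> circle_prob \<Longrightarrow> spread \<mu> \<le> \<delta> \<Longrightarrow> norm z < 1/4 \<Longrightarrow>
       \<exists>e. Bf \<mu> z = center \<tau> \<mu> * exp (- levy (centered \<tau> \<mu>) z + e) \<and> norm e \<le> C * spread \<mu> * defect (centered \<tau> \<mu>)"
    "\<And>\<mu>. \<mu> \<in> circle_prob \<Longrightarrow> spread \<mu> \<le> \<delta> \<Longrightarrow>
       \<exists>S. Sigma_germ \<mu> S \<and> S holomorphic_on ball 0 (1/4) \<and> (\<forall>z. norm z < 1/4 \<longrightarrow>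
         (\<exists>e. S z = inverse (center \<tau> \<mu>) * exp (levy (centered \<tau> \<mu>) z + e) \<and> norm e \<le> C * spread \<mu> * defect (centered \<tau> \<mu>)))"
proof -
  define K where "K = 9 + 64 / \<tau>\<^sup>2"
  have K: "K \<ge> 3" "K - 3 = 6 + 64 / \<tau>\<^sup>2" by (auto simp: K_def)
  define \<delta> where "\<delta> = min (1/10) (min (\<tau> / 4) (1 / (48 * K)))"
  have d: "\<delta> \<le> 1/10" "\<delta> \<le> \<tau> / 4" "\<delta> \<le> 1 / (48 * K)" by (auto simp: \<delta>_def)
  have "0 < 1 / (48 * K)" using K(1) by simp
  then have d0: "\<delta> > 0" using \<tau> by (simp add: \<delta>_def)
  define C where "C = 78 * K\<^sup>2"
  have C0: "C > 0" using K(1) by (simp add: C_def)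
  have near: "near_one (centered \<tau> \<mu>) K" "spread (centered \<tau> \<mu>) \<le> 3 * spread \<mu>" "norm (center \<tau> \<mu> - 1) \<le> 2 * spread \<mu>"
    if \<mu>: "\<mu> \<in> circle_prob" "spread \<mu> \<le> \<delta>" for \<mu>
  proof -
    have s: "spread \<mu> \<le> 1/10" "spread \<mu> \<le> \<tau> / 4" using \<mu>(2) d by linarith+
    note c = centered_near_one[OF \<tau> \<mu>(1) s]
    show "spread (centered \<tau> \<mu>) \<le> 3 * spread \<mu>" "norm (center \<tau> \<mu> - 1) \<le> 2 * spread \<mu>" by (rule c)+
    have "3 * spread \<mu> \<le> 3 * (1 / (48 * K))" using \<mu>(2) d by linarith
    also have "\<dots> = 1 / (16 * K)" by simp
    finally have "spread (centered \<tau> \<mu>) \<le> 1 / (16 * K)" using c(2) by linarith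
    then show "near_one (centered \<tau> \<mu>) K"
      using c(1) K centered_integral(1)[OF \<mu>(1)] by unfold_locales auto
  qed
  have KK: "K\<^sup>2 \<ge> 1" using K(1) power_mono[of 1 K 2] by simp
  show ?thesis
  proof (rule that[OF C0 d0])
    fix \<mu> z assume \<mu>: "\<mu> \<in> circle_prob" "spread \<mu> \<le> \<delta>" and z: "norm (z::complex) < 1/4"
    interpret near_one "centered \<tau> \<mu>" K by (rule near(1)[OF \<mu>])
    define b where "b = center \<tau> \<mu>"
    have b: "norm b = 1" by (simp add: b_def center_def)
    have "norm (b * z) \<le> 1/2" "norm z \<le> 1/2" "norm z < 1" using z b by (auto simp: norm_mult)
    then obtain e where e: "Bf (centered \<tau> \<mu>) (b * z) = exp (- levy (centered \<tau> \<mu>) z + e)"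
      "norm e \<le> (10 * K\<^sup>2 * spread (centered \<tau> \<mu>) + 8 * norm (b * z - z)) * defect (centered \<tau> \<mu>)"
      using Bf_exp_levy by blast
    have "norm (b * z - z) = norm (b - 1) * norm z" by (simp flip: norm_mult add: algebra_simps)
    also have "\<dots> \<le> (2 * spread \<mu>) * (1/4)" using near(3)[OF \<mu>] z by (intro mult_mono) (auto simp: b_def spread_nonneg)
    finally have 1: "8 * norm (b * z - z) \<le> 4 * spread \<mu>" by simp
    have 2: "10 * K\<^sup>2 * spread (centered \<tau> \<mu>) \<le> 10 * K\<^sup>2 * (3 * spread \<mu>)"
      using near(2)[OF \<mu>] by (intro mult_left_mono) auto
    have 3: "4 * spread \<mu> \<le> 48 * (K\<^sup>2 * spread \<mu>)"
      using mult_right_mono[OF KK spread_nonneg[of \<mu>]] spread_nonneg[of \<mu>] by linarith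
    have "10 * K\<^sup>2 * spread (centered \<tau> \<mu>) + 8 * norm (b * z - z) \<le> C * spread \<mu>"
      using 1 2 3 unfolding C_def by (simp add: algebra_simps)
    then have "norm e \<le> C * spread \<mu> * defect (centered \<tau> \<mu>)"
      using e(2) spread_small(4) by (meson mult_right_mono order_trans)
    moreover have "Bf \<mu> z = b * exp (- levy (centered \<tau> \<mu>) z + e)"
      using centered_eta[OF \<mu>(1) \<open>norm z < 1\<close>, of \<tau>] e(1) by (simp add: b_def)
    ultimately show "\<exists>e. Bf \<mu> z = center \<tau> \<mu> * exp (- levy (centered \<tau> \<mu>) z + e) \<and> norm e \<le> C * spread \<mu> * defect (centered \<tau> \<mu>)"
      unfolding b_def by blast
  next
    fix \<mu> assume \<mu>: "\<mu> \<in> circle_prob" "spread \<mu> \<le> \<delta>"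
    interpret near_one "centered \<tau> \<mu>" K by (rule near(1)[OF \<mu>])
    obtain S where S: "Sigma_germ (centered \<tau> \<mu>) S" "S holomorphic_on ball 0 (1/4)"
      "\<And>z. norm z < 1/4 \<Longrightarrow> \<exists>e. S z = exp (levy (centered \<tau> \<mu>) z + e) \<and> norm e \<le> 26 * K\<^sup>2 * spread (centered \<tau> \<mu>) * defect (centered \<tau> \<mu>)"
      using Sigma_exists by blast
    have "26 * K\<^sup>2 * spread (centered \<tau> \<mu>) \<le> 26 * K\<^sup>2 * (3 * spread \<mu>)"
      using near(2)[OF \<mu>] by (intro mult_left_mono) auto
    then have le: "26 * K\<^sup>2 * spread (centered \<tau> \<mu>) * defect (centered \<tau> \<mu>) \<le> C * spread \<mu> * defect (centered \<tau> \<mu>)"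
      using spread_small(4) by (intro mult_right_mono) (auto simp: C_def)
    show "\<exists>S. Sigma_germ \<mu> S \<and> S holomorphic_on ball 0 (1/4) \<and> (\<forall>z. norm z < 1/4 \<longrightarrow>
         (\<exists>e. S z = inverse (center \<tau> \<mu>) * exp (levy (centered \<tau> \<mu>) z + e) \<and> norm e \<le> C * spread \<mu> * defect (centered \<tau> \<mu>)))"
    proof (intro exI[of _ "\<lambda>z. inverse (center \<tau> \<mu>) * S z"] conjI allI impI)
      show "Sigma_germ \<mu> (\<lambda>z. inverse (center \<tau> \<mu>) * S z)" by (rule centered_Sigma_germ[OF \<mu>(1) S(1)])
      show "(\<lambda>z. inverse (center \<tau> \<mu>) * S z) holomorphic_on ball 0 (1/4)" by (intro holomorphic_intros S(2))
      fix z :: complex assume "norm z < 1/4"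
      then obtain e where "S z = exp (levy (centered \<tau> \<mu>) z + e)" "norm e \<le> 26 * K\<^sup>2 * spread (centered \<tau> \<mu>) * defect (centered \<tau> \<mu>)"
        using S(3) by blast
      then show "\<exists>e. inverse (center \<tau> \<mu>) * S z = inverse (center \<tau> \<mu>) * exp (levy (centered \<tau> \<mu>) z + e) \<and> norm e \<le> C * spread \<mu> * defect (centered \<tau> \<mu>)"
        using le by (intro exI[of _ e]) auto
    qed
  qed
qed

section \<open>Finite sums of measures\<close>

text \<open>The approximation of measurable functions by simple functions reduces additivity to the defining formula
  for sets.\<close>

lemma measure_of_sum_nn_integral:
  assumes N: "\<And>j. j \<in> I \<Longrightarrow> sets (N j) = sets circle_borel"
    and M: "M = measure_of unit_circle (sets circle_borel) (\<lambda>A. \<Sum>j\<in>I. emeasure (N j) A)"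
  shows "sets M = sets circle_borel"
    and "f \<in> borel_measurable circle_borel \<Longrightarrow> (\<integral>\<^sup>+ \<zeta>. f \<zeta> \<partial>M) = (\<Sum>j\<in>I. \<integral>\<^sup>+ \<zeta>. f \<zeta> \<partial>N j)"
proof -
  have sp: "unit_circle = space circle_borel" by (simp add: space_circle_borel)
  show sM: "sets M = sets circle_borel"
    unfolding M sp by (rule sets.sets_measure_of_eq)
  have emM: "emeasure M A = (\<Sum>j\<in>I. emeasure (N j) A)" if A: "A \<in> sets circle_borel" for A
    unfolding M
  proof (rule emeasure_measure_of_sigma[OF _ _ _ A])
    show "sigma_algebra unit_circle (sets circle_borel)"
      unfolding sp by (rule sets.sigma_algebra_axioms)
    show "positive (sets circle_borel) (\<lambda>A. \<Sum>j\<in>I. emeasure (N j) A)"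
      by (simp add: positive_def)
    show "countably_additive (sets circle_borel) (\<lambda>A. \<Sum>j\<in>I. emeasure (N j) A)"
    proof (rule countably_additiveI)
      fix A :: "nat \<Rightarrow> complex set"
      assume A: "range A \<subseteq> sets circle_borel" "disjoint_family A"
      have "suminf (\<lambda>i. \<Sum>j\<in>I. emeasure (N j) (A i)) = (\<Sum>j\<in>I. suminf (\<lambda>i. emeasure (N j) (A i)))"
        by (rule suminf_sum) simp
      also have "\<dots> = (\<Sum>j\<in>I. emeasure (N j) (\<Union>i. A i))"
        using A N by (intro sum.cong refl suminf_emeasure) auto
      finally show "suminf (\<lambda>i. \<Sum>j\<in>I. emeasure (N j) (A i)) = (\<Sum>j\<in>I. emeasure (N j) (\<Union>i. A i))" .
    qed
  qed
  have spM: "space M = unit_circle" using sets_eq_imp_space_eq[OF sM] sp by simp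
  have spN: "space (N j) = unit_circle" if "j \<in> I" for j using sets_eq_imp_space_eq[OF N[OF that]] sp by simp
  have mM: "g \<in> borel_measurable M" if "g \<in> borel_measurable circle_borel" for g :: "complex \<Rightarrow> ennreal"
    using that by (simp only: measurable_cong_sets[OF sM refl])
  have mN: "g \<in> borel_measurable (N j)" if "g \<in> borel_measurable circle_borel" "j \<in> I" for g :: "complex \<Rightarrow> ennreal" and j
    using that(1) by (simp only: measurable_cong_sets[OF N[OF that(2)] refl])
  show "f \<in> borel_measurable circle_borel \<Longrightarrow> (\<integral>\<^sup>+ \<zeta>. f \<zeta> \<partial>M) = (\<Sum>j\<in>I. \<integral>\<^sup>+ \<zeta>. f \<zeta> \<partial>N j)"
  proof (induction f rule: borel_measurable_induct)
    case (cong f g)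
    have "(\<integral>\<^sup>+ \<zeta>. f \<zeta> \<partial>M) = (\<integral>\<^sup>+ \<zeta>. g \<zeta> \<partial>M)"
      by (rule nn_integral_cong) (simp add: spM sp cong(3))
    moreover have "(\<integral>\<^sup>+ \<zeta>. f \<zeta> \<partial>N j) = (\<integral>\<^sup>+ \<zeta>. g \<zeta> \<partial>N j)" if "j \<in> I" for j
      by (rule nn_integral_cong) (simp add: spN[OF that] sp cong(3))
    ultimately show ?case using cong(4) by simp
  next
    case (set A)
    then show ?case using emM[OF set] sM N by simp
  next
    case (mult u c)
    then show ?case using mM[OF mult(2)] mN[OF mult(2)] by (simp add: nn_integral_cmult sum_distrib_left)
  next
    case (add u v)
    then show ?case
      using mM[OF add(1)] mN[OF add(1)] mM[OF add(3)] mN[OF add(3)] by (simp add: nn_integral_add sum.distrib)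
  next
    case (seq U)
    have U: "(SUP i. U i) = (\<lambda>x. SUP i. U i x)" by (simp add: fun_eq_iff image_comp)
    have "(\<integral>\<^sup>+ \<zeta>. (SUP i. U i \<zeta>) \<partial>M) = (SUP i. integral\<^sup>N M (U i))"
      using seq by (intro nn_integral_monotone_convergence_SUP mM) auto
    also have "\<dots> = (SUP i. \<Sum>j\<in>I. integral\<^sup>N (N j) (U i))" using seq by simp
    also have "\<dots> = (\<Sum>j\<in>I. SUP i. integral\<^sup>N (N j) (U i))"
      using seq by (intro ennreal_SUP_sum) (auto simp: incseq_def le_fun_def intro!: nn_integral_mono)
    also have "\<dots> = (\<Sum>j\<in>I. \<integral>\<^sup>+ \<zeta>. (SUP i. U i \<zeta>) \<partial>N j)"
      using seq by (intro sum.cong refl nn_integral_monotone_convergence_SUP[symmetric] mN) auto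
    finally show ?case by (simp add: U)
  qed
qed

lemma measure_of_sum_integral:
  fixes f :: "complex \<Rightarrow> complex"
  assumes N: "\<And>j :: 'a. j \<in> I \<Longrightarrow> circle_finite (N j)"
    and M: "M = measure_of unit_circle (sets circle_borel) (\<lambda>A. \<Sum>j\<in>I. emeasure (N j) A)"
  shows "circle_finite M"
    and "continuous_on unit_circle f \<Longrightarrow> (\<integral>\<zeta>. f \<zeta> \<partial>M) = (\<Sum>j\<in>I. \<integral>\<zeta>. f \<zeta> \<partial>N j)"
proof -
  have sN: "sets (N j) = sets circle_borel" if "j \<in> I" for j using N[OF that] by (simp add: circle_finite_def)
  note nn = measure_of_sum_nn_integral[OF sN M]
  have fin: "(\<Sum>j\<in>I. g j) < \<infinity>" if "\<And>j. j \<in> I \<Longrightarrow> g j < \<infinity>" for g :: "'a \<Rightarrow> ennreal"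
    using that by (induction I rule: infinite_finite_induct) auto
  have "emeasure M (space M) = (\<integral>\<^sup>+ \<zeta>. 1 \<partial>M)" by simp
  also have "\<dots> = (\<Sum>j\<in>I. \<integral>\<^sup>+ \<zeta>. 1 \<partial>N j)" by (rule nn(2)) simp_all
  also have "\<dots> = (\<Sum>j\<in>I. emeasure (N j) (space (N j)))" by simp
  also have "\<dots> < \<infinity>"
    using N by (intro fin) (simp add: circle_finite_def finite_measure.emeasure_finite less_top[symmetric])
  finally have "finite_measure M" by (intro finite_measureI) simp
  then show cM: "circle_finite M" using nn(1) by (simp add: circle_finite_def)
  have real: "(\<integral>\<zeta>. g \<zeta> \<partial>M) = (\<Sum>j\<in>I. \<integral>\<zeta>. g \<zeta> \<partial>N j)" if g: "continuous_on unit_circle g" for g :: "complex \<Rightarrow> real"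
  proof -
    have part: "enn2real (\<integral>\<^sup>+ \<zeta>. ennreal (h \<zeta>) \<partial>M) = (\<Sum>j\<in>I. enn2real (\<integral>\<^sup>+ \<zeta>. ennreal (h \<zeta>) \<partial>N j))"
      if h: "continuous_on unit_circle h" for h :: "complex \<Rightarrow> real"
    proof -
      have "(\<integral>\<^sup>+ \<zeta>. ennreal (h \<zeta>) \<partial>M) = (\<Sum>j\<in>I. \<integral>\<^sup>+ \<zeta>. ennreal (h \<zeta>) \<partial>N j)"
        using circle_test_measurable[OF h] by (intro nn(2)) simp_all
      moreover have "(\<integral>\<^sup>+ \<zeta>. ennreal (h \<zeta>) \<partial>N j) < \<infinity>" if "j \<in> I" for j
        using circle_integrable[OF N[OF that] h] real_integrable_def[of "N j" h] by (simp add: less_top)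
      ultimately show ?thesis by (simp add: enn2real_sum)
    qed
    have "continuous_on unit_circle (\<lambda>\<zeta>. - g \<zeta>)" using g by (intro continuous_intros)
    note p = part[OF g] part[OF this]
    have "(\<integral>\<zeta>. g \<zeta> \<partial>N j) = enn2real (\<integral>\<^sup>+ \<zeta>. ennreal (g \<zeta>) \<partial>N j) - enn2real (\<integral>\<^sup>+ \<zeta>. ennreal (- g \<zeta>) \<partial>N j)" if "j \<in> I" for j
      by (rule real_lebesgue_integral_def[OF circle_integrable[OF N[OF that] g]])
    moreover have "(\<integral>\<zeta>. g \<zeta> \<partial>M) = enn2real (\<integral>\<^sup>+ \<zeta>. ennreal (g \<zeta>) \<partial>M) - enn2real (\<integral>\<^sup>+ \<zeta>. ennreal (- g \<zeta>) \<partial>M)"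
      by (rule real_lebesgue_integral_def[OF circle_integrable[OF cM g]])
    ultimately show ?thesis using p by (simp add: sum_subtractf)
  qed
  show "(\<integral>\<zeta>. f \<zeta> \<partial>M) = (\<Sum>j\<in>I. \<integral>\<zeta>. f \<zeta> \<partial>N j)" if f: "continuous_on unit_circle f"
  proof -
    have c: "continuous_on unit_circle (\<lambda>\<zeta>. Re (f \<zeta>))" "continuous_on unit_circle (\<lambda>\<zeta>. Im (f \<zeta>))"
      using f by (intro continuous_intros; assumption)+
    have iN: "integrable (N j) f" if "j \<in> I" for j by (rule circle_integrable[OF N[OF that] f])
    have iM: "integrable M f" by (rule circle_integrable[OF cM f])
    show ?thesis
      using real[OF c(1)] real[OF c(2)] iN iM by (intro complex_eqI) simp_all
  qed
qed

lemma weighted_integral: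
  fixes f :: "complex \<Rightarrow> complex"
  assumes m: "m \<in> circle_prob"
  shows "circle_finite (density m (\<lambda>\<zeta>. ennreal (1 - Re \<zeta>)))"
    and "continuous_on unit_circle f \<Longrightarrow>
      (\<integral>\<zeta>. f \<zeta> \<partial>density m (\<lambda>\<zeta>. ennreal (1 - Re \<zeta>))) = (\<integral>\<zeta>. of_real (1 - Re \<zeta>) * f \<zeta> \<partial>m)"
proof -
  note fm = circle_prob_finite[OF m]
  have g: "(\<lambda>\<zeta>. 1 - Re \<zeta>) \<in> borel_measurable m" by (rule circle_finite_measurable[OF fm cont_Re_Im(1)])
  have "0 \<le> 1 - Re \<zeta>" if "\<zeta> \<in> space m" for \<zeta>
    using complex_Re_le_cmod[of \<zeta>] that circle_finite_space[OF fm] by simp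
  then have ae: "AE \<zeta> in m. 0 \<le> 1 - Re \<zeta>" by (rule AE_I2)
  have "emeasure (density m (\<lambda>\<zeta>. ennreal (1 - Re \<zeta>))) (space m) = (\<integral>\<^sup>+ \<zeta>. ennreal (1 - Re \<zeta>) * indicator (space m) \<zeta> \<partial>m)"
    using g by (intro emeasure_density) simp_all
  also have "\<dots> = (\<integral>\<^sup>+ \<zeta>. ennreal (1 - Re \<zeta>) \<partial>m)" by (rule nn_integral_cong) simp
  also have "\<dots> = ennreal (\<integral>\<zeta>. 1 - Re \<zeta> \<partial>m)"
    by (rule nn_integral_eq_integral[OF circle_integrable[OF fm cont_Re_Im(1)] ae])
  also have "\<dots> < \<infinity>" by simp
  finally have "finite_measure (density m (\<lambda>\<zeta>. ennreal (1 - Re \<zeta>)))" by (intro finite_measureI) simp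
  then show "circle_finite (density m (\<lambda>\<zeta>. ennreal (1 - Re \<zeta>)))" using fm by (simp add: circle_finite_def)
  show "(\<integral>\<zeta>. f \<zeta> \<partial>density m (\<lambda>\<zeta>. ennreal (1 - Re \<zeta>))) = (\<integral>\<zeta>. of_real (1 - Re \<zeta>) * f \<zeta> \<partial>m)"
    if f: "continuous_on unit_circle f"
    using integral_density[OF circle_finite_measurable[OF fm f] g ae] by (simp add: scaleR_conv_of_real)
qed

lemma sigma_row_integral:
  fixes f :: "complex \<Rightarrow> complex"
  assumes \<mu>: "\<And>j. j \<in> {1..k n} \<Longrightarrow> \<mu> n j \<in> circle_prob"
  shows "circle_finite (sigma_row \<tau> k \<mu> n)"
    and "continuous_on unit_circle f \<Longrightarrow>
      (\<integral>\<zeta>. f \<zeta> \<partial>sigma_row \<tau> k \<mu> n) = (\<Sum>j=1..k n. \<integral>\<zeta>. of_real (1 - Re \<zeta>) * f \<zeta> \<partial>centered \<tau> (\<mu> n j))"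
proof -
  have w: "circle_finite (density (centered \<tau> (\<mu> n j)) (\<lambda>\<zeta>. ennreal (1 - Re \<zeta>)))" if "j \<in> {1..k n}" for j
    by (rule weighted_integral(1)[OF centered_integral(1)[OF \<mu>[OF that]]])
  show "circle_finite (sigma_row \<tau> k \<mu> n)"
    by (rule measure_of_sum_integral(1)[OF _ sigma_row_def]) (rule w)
  show "(\<integral>\<zeta>. f \<zeta> \<partial>sigma_row \<tau> k \<mu> n) = (\<Sum>j=1..k n. \<integral>\<zeta>. of_real (1 - Re \<zeta>) * f \<zeta> \<partial>centered \<tau> (\<mu> n j))"
    if f: "continuous_on unit_circle f"
  proof -
    have "(\<integral>\<zeta>. f \<zeta> \<partial>sigma_row \<tau> k \<mu> n) = (\<Sum>j=1..k n. \<integral>\<zeta>. f \<zeta> \<partial>density (centered \<tau> (\<mu> n j)) (\<lambda>\<zeta>. ennreal (1 - Re \<zeta>)))"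
      by (rule measure_of_sum_integral(2)[of "{1..k n}" "\<lambda>j. density (centered \<tau> (\<mu> n j)) (\<lambda>\<zeta>. ennreal (1 - Re \<zeta>))", OF w sigma_row_def[of \<tau> k \<mu> n] f])
    also have "\<dots> = (\<Sum>j=1..k n. \<integral>\<zeta>. of_real (1 - Re \<zeta>) * f \<zeta> \<partial>centered \<tau> (\<mu> n j))"
      by (intro sum.cong refl weighted_integral(2)[OF centered_integral(1)[OF \<mu>] f])
    finally show ?thesis .
  qed
qed

lemma circle_finite_mass: "circle_finite m \<Longrightarrow> (\<integral>\<zeta>. (1::complex) \<partial>m) = of_real (measure m unit_circle)"
  by (simp add: circle_finite_space scaleR_conv_of_real)

lemma sigma_row_mass:
  assumes \<mu>: "\<And>j. j \<in> {1..k n} \<Longrightarrow> \<mu> n j \<in> circle_prob"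
  shows "measure (sigma_row \<tau> k \<mu> n) unit_circle = (\<Sum>j=1..k n. defect (centered \<tau> (\<mu> n j)))"
proof -
  have "complex_of_real (measure (sigma_row \<tau> k \<mu> n) unit_circle) = (\<integral>\<zeta>. 1 \<partial>sigma_row \<tau> k \<mu> n)"
    by (rule circle_finite_mass[OF sigma_row_integral(1)[of k n \<mu>, OF \<mu>], symmetric])
  also have "\<dots> = (\<Sum>j=1..k n. \<integral>\<zeta>. of_real (1 - Re \<zeta>) * 1 \<partial>centered \<tau> (\<mu> n j))"
    by (rule sigma_row_integral(2)[of k n \<mu>, OF \<mu> continuous_on_const])
  also have "\<dots> = (\<Sum>j=1..k n. of_real (defect (centered \<tau> (\<mu> n j))))"
    unfolding defect_def integral_complex_of_real[symmetric] by simp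
  also have "\<dots> = of_real (\<Sum>j=1..k n. defect (centered \<tau> (\<mu> n j)))" by simp
  finally show ?thesis by (simp only: of_real_eq_iff)
qed

lemma sigma_row_Herglotz_tr:
  assumes \<mu>: "\<And>j. j \<in> {1..k n} \<Longrightarrow> \<mu> n j \<in> circle_prob" and z: "norm z < 1"
  shows "Herglotz_tr (sigma_row \<tau> k \<mu> n) z =
    (\<Sum>j=1..k n. levy (centered \<tau> (\<mu> n j)) z) + \<i> * of_real (\<Sum>j=1..k n. drift (centered \<tau> (\<mu> n j)))"
proof -
  have c: "continuous_on unit_circle (\<lambda>\<zeta>. (1 + \<zeta> * z) / (1 - \<zeta> * z))"
    by (intro continuous_on_kernel z continuous_intros)
  have "Herglotz_tr (sigma_row \<tau> k \<mu> n) z =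
      (\<Sum>j=1..k n. \<integral>\<zeta>. of_real (1 - Re \<zeta>) * ((1 + \<zeta> * z) / (1 - \<zeta> * z)) \<partial>centered \<tau> (\<mu> n j))"
    unfolding Herglotz_tr_def by (rule sigma_row_integral(2)[of k n \<mu>, OF \<mu> c])
  also have "\<dots> = (\<Sum>j=1..k n. levy (centered \<tau> (\<mu> n j)) z + \<i> * of_real (drift (centered \<tau> (\<mu> n j))))"
    by (simp add: levy_def)
  finally show ?thesis by (simp add: sum.distrib sum_distrib_left)
qed

section \<open>Rows of the array\<close>

lemma spread_le:
  assumes m: "m \<in> circle_prob" and e: "e \<ge> 0"
  shows "spread m \<le> e + 2 * measure m {\<zeta> \<in> unit_circle. cmod (\<zeta> - 1) \<ge> e}"
proof -
  note fm = circle_prob_finite[OF m]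
  interpret prob_space m using m by (simp add: circle_prob_def)
  define A where "A = {\<zeta> \<in> unit_circle. cmod (\<zeta> - 1) \<ge> e}"
  have "(\<lambda>\<zeta>. cmod (\<zeta> - 1)) \<in> borel_measurable m"
    by (intro circle_finite_measurable[OF fm] continuous_intros)
  then have "{\<zeta> \<in> space m. e \<le> cmod (\<zeta> - 1)} \<in> sets m" by measurable
  then have A: "A \<in> sets m" by (simp add: A_def circle_finite_space[OF fm])
  have i: "integrable m (\<lambda>\<zeta>. indicat_real A \<zeta>)" using A by (simp add: integrable_indicator_iff less_top[symmetric])
  have "spread m \<le> (\<integral>\<zeta>. e + 2 * indicat_real A \<zeta> \<partial>m)"
    unfolding spread_def
  proof (rule integral_mono)
    show "integrable m (\<lambda>\<zeta>. norm (1 - \<zeta>))" by (rule circle_integrable[OF fm cont_Re_Im(3)])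
    show "integrable m (\<lambda>\<zeta>. e + 2 * indicat_real A \<zeta>)" using i by simp
    fix \<zeta> assume "\<zeta> \<in> space m"
    then have \<zeta>: "norm \<zeta> = 1" by (simp add: circle_finite_space[OF fm])
    have "norm (1 - \<zeta>) \<le> 2" using norm_triangle_ineq4[of 1 \<zeta>] \<zeta> by simp
    then show "norm (1 - \<zeta>) \<le> e + 2 * indicat_real A \<zeta>"
      using \<zeta> e by (auto simp: A_def indicator_def norm_minus_commute)
  qed
  also have "\<dots> = e + 2 * measure m A"
    using A i by (simp add: prob_space)
  finally show ?thesis by (simp add: A_def)
qed

text \<open>The measure outside the disk of radius \<open>a/4\<close> around \<open>1\<close> contributes at most twice its mass to the spread.\<close>

lemma infinitesimal_spread:
  assumes inf: "infinitesimal k \<mu>" and k: "\<And>n. 1 \<le> n \<Longrightarrow> 1 \<le> k n"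
    and \<mu>: "\<And>n j. 1 \<le> n \<Longrightarrow> j \<in> {1..k n} \<Longrightarrow> \<mu> n j \<in> circle_prob"
  shows "(\<lambda>n. MAX j\<in>{1..k n}. spread (\<mu> n j)) \<longlonglongrightarrow> 0"
proof (rule order_tendstoI)
  fix a :: real assume "a < 0"
  show "\<forall>\<^sub>F n in sequentially. a < (MAX j\<in>{1..k n}. spread (\<mu> n j))"
    using eventually_ge_at_top[of 1]
  proof eventually_elim
    case (elim n)
    then have "1 \<in> {1..k n}" using k by simp
    then have "spread (\<mu> n 1) \<le> (MAX j\<in>{1..k n}. spread (\<mu> n j))" by (intro Max_ge) auto
    with spread_nonneg[of "\<mu> n 1"] \<open>a < 0\<close> show ?case by linarith
  qed
next
  fix a :: real assume a: "0 < a"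
  then have "(\<lambda>n. MAX j\<in>{1..k n}. measure (\<mu> n j) {\<zeta> \<in> unit_circle. cmod (\<zeta> - 1) \<ge> a / 4}) \<longlonglongrightarrow> 0"
    using inf[unfolded infinitesimal_def, rule_format, of "a / 4"] by simp
  then have "\<forall>\<^sub>F n in sequentially. (MAX j\<in>{1..k n}. measure (\<mu> n j) {\<zeta> \<in> unit_circle. cmod (\<zeta> - 1) \<ge> a / 4}) < a / 4"
    using a by (intro order_tendstoD) auto
  then show "\<forall>\<^sub>F n in sequentially. (MAX j\<in>{1..k n}. spread (\<mu> n j)) < a"
    using eventually_ge_at_top[of 1]
  proof eventually_elim
    case (elim n)
    have "spread (\<mu> n j) < a" if j: "j \<in> {1..k n}" for j
    proof -
      have "measure (\<mu> n j) {\<zeta> \<in> unit_circle. cmod (\<zeta> - 1) \<ge> a / 4} < a / 4"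
        using elim(1) j by (subst (asm) Max_less_iff) auto
      moreover have "spread (\<mu> n j) \<le> a / 4 + 2 * measure (\<mu> n j) {\<zeta> \<in> unit_circle. cmod (\<zeta> - 1) \<ge> a / 4}"
        using a by (intro spread_le \<mu> elim j) simp
      ultimately show ?thesis using a by linarith
    qed
    then show ?case using k[OF elim(2)] by (subst Max_less_iff) auto
  qed
qed

lemma boolean_row:
  assumes "m \<in> circle_prob" "\<And>j. j \<in> set js \<Longrightarrow> \<mu> j \<in> circle_prob"
  shows "foldl boolean_conv m (map \<mu> js) \<in> circle_prob \<and>
    (\<forall>z. norm z < 1 \<longrightarrow> Bf (foldl boolean_conv m (map \<mu> js)) z = Bf m z * (\<Prod>j\<leftarrow>js. Bf (\<mu> j) z))"
  using assms
proof (induction js arbitrary: m)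
  case (Cons j js)
  have j: "\<mu> j \<in> circle_prob" and js: "\<And>i. i \<in> set js \<Longrightarrow> \<mu> i \<in> circle_prob" using Cons.prems(2) by simp_all
  note b = boolean_conv_Bf[OF Cons.prems(1) j]
  show ?case using Cons.IH[OF b(1) js] b(2) by simp
qed simp

lemma free_row:
  assumes "m \<in> circle_prob" "Sigma_germ m T"
    and "\<And>j. j \<in> set js \<Longrightarrow> \<mu> j \<in> circle_prob" "\<And>j. j \<in> set js \<Longrightarrow> Sigma_germ (\<mu> j) (S j)"
  shows "foldl free_conv m (map \<mu> js) \<in> circle_prob \<and>
    Sigma_germ (foldl free_conv m (map \<mu> js)) (\<lambda>z. T z * (\<Prod>j\<leftarrow>js. S j z))"
  using assms
proof (induction js arbitrary: m T)
  case (Cons j js)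
  have j: "\<mu> j \<in> circle_prob" "Sigma_germ (\<mu> j) (S j)"
    and js: "\<And>i. i \<in> set js \<Longrightarrow> \<mu> i \<in> circle_prob" "\<And>i. i \<in> set js \<Longrightarrow> Sigma_germ (\<mu> i) (S i)"
    using Cons.prems(3,4) by simp_all
  note b = free_conv_Sigma_germ[OF Cons.prems(1,2) j]
  show ?case using Cons.IH[OF b js] by (simp add: mult.assoc)
qed simp

lemma prod_list_upt: "(\<Prod>j\<leftarrow>[1..<Suc k]. f j) = (\<Prod>j=1..k. f j)" for f :: "nat \<Rightarrow> 'a::comm_monoid_mult"
proof -
  have "(\<Prod>j=1..k. f j) = prod f (set [1..<Suc k])" by (simp only: set_upt atLeastLessThanSuc_atLeastAtMost)
  also have "\<dots> = (\<Prod>j\<leftarrow>[1..<Suc k]. f j)" by (rule prod.distinct_set_conv_list) simp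
  finally show ?thesis ..
qed

lemma center_unit: "center \<tau> m \<in> unit_circle"
  by (simp add: center_def)

lemma gamma_row_eq:
  assumes l: "l n \<in> unit_circle"
  shows "gamma_row \<tau> k \<mu> l n =
    l n * (\<Prod>j=1..k n. center \<tau> (\<mu> n j)) * exp (\<i> * of_real (\<Sum>j=1..k n. drift (centered \<tau> (\<mu> n j))))"
proof -
  have e: "exp (\<i> * of_real (Arg x)) = x" if "x \<in> unit_circle" for x
    using circle_cis_Arg[OF that] by (simp add: cis_conv_exp)
  have "exp (\<i> * of_real (\<Sum>j=1..k n. Arg (center \<tau> (\<mu> n j)))) = (\<Prod>j=1..k n. center \<tau> (\<mu> n j))"
    by (simp add: sum_distrib_left exp_sum e[OF center_unit])
  then show ?thesis by (simp add: gamma_row_def exp_add e[OF l] drift_def)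
qed

lemma norm_gamma_row: "gamma_row \<tau> k \<mu> l n \<in> unit_circle"
  by (simp add: gamma_row_def norm_exp_eq_Re del: of_real_sum)

section \<open>Limits of exponential expansions\<close>

text \<open>In the unit disk the principal logarithm inverts \<open>exp\<close>, and \<open>exp v\<close> stays away from its branch cut.\<close>

lemma exp_tendsto_cancel:
  fixes w :: "nat \<Rightarrow> complex"
  assumes lim: "(\<lambda>n. exp (w n)) \<longlonglongrightarrow> exp v" and w: "\<forall>\<^sub>F n in sequentially. norm (w n) \<le> 1" and v: "norm v \<le> 1"
  shows "w \<longlonglongrightarrow> v"
proof -
  have ln: "Ln (exp u) = u" if "norm u \<le> 1" for u :: complex
    using abs_Im_le_cmod[of u] that pi_gt3 by (intro Ln_exp) auto
  have "cos (Im v) > 0"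
    using abs_Im_le_cmod[of v] v pi_gt3 by (intro cos_gt_zero_pi) auto
  then have "Re (exp v) > 0" by (simp add: Re_exp)
  then have "exp v \<notin> \<real>\<^sub>\<le>\<^sub>0" by (auto simp: complex_nonpos_Reals_iff)
  then have "(\<lambda>n. Ln (exp (w n))) \<longlonglongrightarrow> Ln (exp v)" by (intro tendsto_Ln lim)
  moreover have "\<forall>\<^sub>F n in sequentially. Ln (exp (w n)) = w n"
    using w by eventually_elim (rule ln)
  ultimately show ?thesis by (simp add: ln[OF v] tendsto_cong)
qed

lemma norm_Herglotz_tr_le:
  assumes s: "circle_finite s" and z: "norm z < 1/4"
  shows "norm (Herglotz_tr s z) \<le> 2 * measure s unit_circle"
  unfolding Herglotz_tr_def
proof (rule circle_integral_bound[OF s])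
  have z1: "norm z < 1" using z by linarith
  show "continuous_on unit_circle (\<lambda>\<zeta>. (1 + \<zeta> * z) / (1 - \<zeta> * z))"
    by (intro continuous_on_kernel z1 continuous_intros)
  fix \<zeta> :: complex assume \<zeta>: "\<zeta> \<in> unit_circle"
  have "norm (1 + \<zeta> * z) \<le> 5 / 4"
    using norm_triangle_ineq[of 1 "\<zeta> * z"] \<zeta> z by (simp add: norm_mult)
  moreover have "norm (1 - \<zeta> * z) \<ge> 3 / 4" using norm_kernel_ge[OF \<zeta>, of z] z by linarith
  ultimately show "norm ((1 + \<zeta> * z) / (1 - \<zeta> * z)) \<le> 2"
    by (simp add: norm_divide divide_simps)
qed

lemma Herglotz_tr_0: "circle_finite s \<Longrightarrow> Herglotz_tr s 0 = of_real (measure s unit_circle)"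
  using circle_finite_mass[of s] by (simp add: Herglotz_tr_def)

lemma Herglotz_tr_near_mass:
  assumes s: "circle_finite s" and z: "norm z \<le> 1/2"
  shows "norm (of_real (measure s unit_circle) - Herglotz_tr s z) \<le> 4 * norm z * measure s unit_circle"
proof -
  have z1: "norm z < 1" using z by linarith
  have "Herglotz_tr s z - of_real (measure s unit_circle) = (\<integral>\<zeta>. (1 + \<zeta> * z) / (1 - \<zeta> * z) \<partial>s) - (\<integral>\<zeta>. 1 \<partial>s)"
    by (simp only: Herglotz_tr_def circle_finite_mass[OF s])
  also have "\<dots> = (\<integral>\<zeta>. (1 + \<zeta> * z) / (1 - \<zeta> * z) - 1 \<partial>s)"
    by (rule Bochner_Integration.integral_diff[symmetric])
       (intro circle_integrable s continuous_on_kernel z1 continuous_intros)+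
  also have "norm \<dots> \<le> 4 * norm z * measure s unit_circle"
  proof (rule circle_integral_bound[OF s])
    show "continuous_on unit_circle (\<lambda>\<zeta>. (1 + \<zeta> * z) / (1 - \<zeta> * z) - 1)"
      by (intro continuous_on_kernel z1 continuous_intros)
    fix \<zeta> :: complex assume \<zeta>: "\<zeta> \<in> unit_circle"
    have nz: "1 - \<zeta> * z \<noteq> 0" by (rule kernel_nonzero[OF \<zeta> z1])
    have h: "norm (1 - \<zeta> * z) \<ge> 1/2" by (rule half_kernel_ge[OF \<zeta> z])
    have "(1 + \<zeta> * z) / (1 - \<zeta> * z) - 1 = 2 * (\<zeta> * z) / (1 - \<zeta> * z)" using nz by (simp add: divide_simps)
    then have "norm ((1 + \<zeta> * z) / (1 - \<zeta> * z) - 1) = 2 * norm z / norm (1 - \<zeta> * z)"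
      using \<zeta> by (simp add: norm_divide norm_mult)
    also have "\<dots> \<le> 2 * norm z / (1/2)" using h by (intro divide_left_mono) auto
    finally show "norm ((1 + \<zeta> * z) / (1 - \<zeta> * z) - 1) \<le> 4 * norm z" by simp
  qed
  finally show ?thesis by (simp only: norm_minus_commute)
qed

lemma weak_conv_imp_Herglotz_tr:
  assumes w: "circle_weak_conv s \<sigma>" and s: "\<And>n. circle_finite (s n)" "circle_finite \<sigma>" and z: "norm z < 1"
  shows "(\<lambda>n. Herglotz_tr (s n) z) \<longlonglongrightarrow> Herglotz_tr \<sigma> z"
  unfolding Herglotz_tr_def
  by (rule circle_weak_convD[OF w s]) (intro continuous_on_kernel z continuous_intros)

lemma weak_conv_imp_mass:
  assumes w: "circle_weak_conv s \<sigma>" and s: "\<And>n. circle_finite (s n)" "circle_finite \<sigma>"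
  shows "(\<lambda>n. measure (s n) unit_circle) \<longlonglongrightarrow> measure \<sigma> unit_circle"
proof -
  have "(\<lambda>n. Re (Herglotz_tr (s n) 0)) \<longlonglongrightarrow> Re (Herglotz_tr \<sigma> 0)"
    by (intro tendsto_Re weak_conv_imp_Herglotz_tr[OF w s]) simp
  then show ?thesis by (simp add: Herglotz_tr_0 s)
qed

lemma circle_weak_conv_shift: "circle_weak_conv (\<lambda>n. M (n + N)) L \<longleftrightarrow> circle_weak_conv M L"
proof -
  have seq: "(\<lambda>n. x (n + N)) \<longlonglongrightarrow> y \<longleftrightarrow> x \<longlonglongrightarrow> y" for x :: "nat \<Rightarrow> real" and y
    by (rule iffI[OF LIMSEQ_offset LIMSEQ_ignore_initial_segment])
  then show ?thesis
    unfolding circle_weak_conv_def by (simp only: seq[of "\<lambda>n. integral\<^sup>L (M n) f" for f])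
qed

lemma weak_conv_of_Herglotz_tr:
  assumes s: "\<And>n. circle_finite (s n)" "circle_finite \<sigma>" and r: "0 < r" "r \<le> 1"
    and mass: "(\<lambda>n. measure (s n) unit_circle) \<longlonglongrightarrow> measure \<sigma> unit_circle"
    and lim: "\<And>z. z \<noteq> 0 \<Longrightarrow> norm z < r \<Longrightarrow> (\<lambda>n. Herglotz_tr (s n) z) \<longlonglongrightarrow> Herglotz_tr \<sigma> z"
  shows "circle_weak_conv s \<sigma>"
proof (rule weak_conv_of_moments[OF s])
  obtain C0 where C0: "\<And>n. norm (measure (s n) unit_circle) \<le> C0"
    using convergent_imp_Bseq[OF convergentI[OF mass]] unfolding Bseq_def by blast
  define C where "C = max C0 (measure \<sigma> unit_circle)"
  have bound: "norm (\<integral>\<zeta>. \<zeta> ^ k \<partial>m) \<le> C" if "circle_finite m" "measure m unit_circle \<le> C" for m k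
  proof -
    have "norm (\<integral>\<zeta>. \<zeta> ^ k \<partial>m) \<le> 1 * measure m unit_circle"
      by (rule circle_integral_bound[OF that(1)]) (auto intro!: continuous_intros simp: norm_power)
    with that(2) show ?thesis by simp
  qed
  fix k
  show "(\<lambda>n. \<integral>\<zeta>. \<zeta> ^ k \<partial>s n) \<longlonglongrightarrow> (\<integral>\<zeta>. \<zeta> ^ k \<partial>\<sigma>)"
  proof (rule coeffs_tendsto[OF _ _ r])
    show "norm (\<integral>\<zeta>. \<zeta> ^ k \<partial>s n) \<le> C" for n k
      using C0[of n] by (intro bound s) (simp add: C_def)
    show "norm (\<integral>\<zeta>. \<zeta> ^ k \<partial>\<sigma>) \<le> C" for k by (intro bound s) (simp add: C_def)
    fix z :: complex assume z: "z \<noteq> 0" "norm z < r"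
    have z1: "norm z < 1" using z r by linarith
    have ct: "Cauchy_tr m z = (Herglotz_tr m z + of_real (measure m unit_circle)) / 2" if "circle_finite m" for m
      by (simp add: Herglotz_tr_eq[OF that z1])
    have "(\<lambda>n. (Herglotz_tr (s n) z + of_real (measure (s n) unit_circle)) / 2)
        \<longlonglongrightarrow> (Herglotz_tr \<sigma> z + of_real (measure \<sigma> unit_circle)) / 2"
      by (intro tendsto_intros lim[OF z] mass) simp
    then have "(\<lambda>n. Cauchy_tr (s n) z) \<longlonglongrightarrow> Cauchy_tr \<sigma> z" by (simp only: ct s)
    then show "(\<lambda>n. suminf (\<lambda>k. (\<integral>\<zeta>. \<zeta> ^ k \<partial>s n) * z ^ k)) \<longlonglongrightarrow> suminf (\<lambda>k. (\<integral>\<zeta>. \<zeta> ^ k \<partial>\<sigma>) * z ^ k)"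
      by (simp only: Cauchy_tr_eq_suminf[OF s(1) z1] Cauchy_tr_eq_suminf[OF s(2) z1])
  qed
qed

text \<open>The common shape of both kinds of rows: up to an error that is small relative to the mass
  of \<open>s n\<close>, the function \<open>R n\<close> is the transform of a limit law.\<close>

locale exponential_rows =
  fixes s :: "nat \<Rightarrow> complex measure" and g :: "nat \<Rightarrow> complex" and \<sigma> :: "complex measure" and \<gamma> :: complex
    and R :: "nat \<Rightarrow> complex \<Rightarrow> complex" and \<epsilon> :: "nat \<Rightarrow> real"
  assumes s: "\<And>n. circle_finite (s n)" and \<sigma>: "circle_finite \<sigma>"
    and g: "\<And>n. g n \<in> unit_circle" and \<gamma>: "\<gamma> \<in> unit_circle"
    and R: "\<And>n z. norm z < 1/4 \<Longrightarrow>
      \<exists>e. R n z = g n * exp (- Herglotz_tr (s n) z + e) \<and> norm e \<le> \<epsilon> n * measure (s n) unit_circle"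
    and \<epsilon>: "\<epsilon> \<longlonglongrightarrow> 0"
begin

definition err :: "nat \<Rightarrow> complex \<Rightarrow> complex" where
  "err n z = (SOME e. R n z = g n * exp (- Herglotz_tr (s n) z + e) \<and> norm e \<le> \<epsilon> n * measure (s n) unit_circle)"

lemma err:
  assumes "norm z < 1/4"
  shows "R n z = g n * exp (- Herglotz_tr (s n) z + err n z)" "norm (err n z) \<le> \<epsilon> n * measure (s n) unit_circle"
  using someI_ex[OF R[OF assms, of n]] unfolding err_def by blast+

lemma err_tendsto:
  assumes B: "\<forall>\<^sub>F n in sequentially. measure (s n) unit_circle \<le> B" and z: "norm z < 1/4"
  shows "(\<lambda>n. err n z) \<longlonglongrightarrow> 0"
proof (rule Lim_null_comparison)
  show "\<forall>\<^sub>F n in sequentially. norm (err n z) \<le> \<bar>\<epsilon> n\<bar> * B"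
    using B
  proof eventually_elim
    case (elim n)
    have "\<epsilon> n * measure (s n) unit_circle \<le> \<bar>\<epsilon> n\<bar> * measure (s n) unit_circle" by (intro mult_right_mono) auto
    also have "\<dots> \<le> \<bar>\<epsilon> n\<bar> * B" using elim by (intro mult_left_mono) auto
    finally show ?case using err(2)[OF z, of n] by linarith
  qed
  have "(\<lambda>n. \<bar>\<epsilon> n\<bar> * B) \<longlonglongrightarrow> \<bar>0\<bar> * B" by (intro tendsto_intros \<epsilon>)
  then show "(\<lambda>n. \<bar>\<epsilon> n\<bar> * B) \<longlonglongrightarrow> 0" by simp
qed

lemma R_nonzero: "norm z < 1/4 \<Longrightarrow> R n z \<noteq> 0"
  using err(1)[of z n] g[of n] by auto

lemma limit_tr_nonzero: "limit_tr \<gamma> \<sigma> z \<noteq> 0"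
  using \<gamma> by (auto simp: limit_tr_def)

lemma norm_R: "norm z < 1/4 \<Longrightarrow> norm (R n z) = exp (- Re (Herglotz_tr (s n) z) + Re (err n z))"
  using g[of n] by (simp add: err(1) norm_mult)

lemma R_tendsto:
  assumes w: "circle_weak_conv s \<sigma>" and lim: "g \<longlonglongrightarrow> \<gamma>" and z: "norm z < 1/4"
  shows "(\<lambda>n. R n z) \<longlonglongrightarrow> limit_tr \<gamma> \<sigma> z"
proof -
  have z1: "norm z < 1" using z by linarith
  have "\<forall>\<^sub>F n in sequentially. measure (s n) unit_circle < measure \<sigma> unit_circle + 1"
    by (rule order_tendstoD(2)[OF weak_conv_imp_mass[OF w s \<sigma>]]) simp
  then have "\<forall>\<^sub>F n in sequentially. measure (s n) unit_circle \<le> measure \<sigma> unit_circle + 1"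
    by eventually_elim simp
  from err_tendsto[OF this z] have "(\<lambda>n. g n * exp (- Herglotz_tr (s n) z + err n z)) \<longlonglongrightarrow> \<gamma> * exp (- Herglotz_tr \<sigma> z + 0)"
    by (intro tendsto_intros lim weak_conv_imp_Herglotz_tr[OF w s \<sigma> z1])
  then show ?thesis by (simp only: err(1)[OF z, symmetric] limit_tr_def add_0_right)
qed

text \<open>The value at the origin alone controls the masses, because \<open>|R n 0|\<close> is
  \<open>exp (- measure (s n) unit_circle)\<close> up to a factor close to one in the exponent.\<close>

lemma mass_bounded:
  assumes lim: "(\<lambda>n. R n 0) \<longlonglongrightarrow> limit_tr \<gamma> \<sigma> 0"
  obtains B where "B \<ge> 0" "\<forall>\<^sub>F n in sequentially. measure (s n) unit_circle \<le> B"
proof -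
  define a where "a = norm (limit_tr \<gamma> \<sigma> 0) / 2"
  have a: "0 < a" using limit_tr_nonzero[of 0] by (simp add: a_def)
  have "(\<lambda>n. norm (R n 0)) \<longlonglongrightarrow> norm (limit_tr \<gamma> \<sigma> 0)" by (intro tendsto_norm lim)
  then have "\<forall>\<^sub>F n in sequentially. a < norm (R n 0)" using a by (intro order_tendstoD(1)) (auto simp: a_def)
  moreover have "\<forall>\<^sub>F n in sequentially. \<epsilon> n < 1/2" by (intro order_tendstoD(2)[OF \<epsilon>]) simp
  ultimately have "\<forall>\<^sub>F n in sequentially. measure (s n) unit_circle \<le> \<bar>2 * ln a\<bar>"
  proof eventually_elim
    case (elim n)
    define m where "m = measure (s n) unit_circle"
    have m0: "0 \<le> m" by (simp add: m_def)
    have "Re (err n 0) \<le> norm (err n 0)" by (rule complex_Re_le_cmod)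
    also have "\<dots> \<le> \<epsilon> n * m" unfolding m_def by (rule err(2)) simp
    also have "\<dots> \<le> 1/2 * m" using elim(2) m0 by (intro mult_right_mono) auto
    finally have e: "Re (err n 0) \<le> 1/2 * m" .
    have "a < exp (- m + Re (err n 0))"
      using elim(1) norm_R[of 0 n] by (simp add: Herglotz_tr_0[OF s] m_def)
    then have "ln a < ln (exp (- m + Re (err n 0)))" using a by (intro ln_strict_mono) auto
    then have "ln a < - m + Re (err n 0)" by simp
    with e have "m \<le> \<bar>2 * ln a\<bar>" by linarith
    then show ?case by (simp only: m_def)
  qed
  then show ?thesis by (intro that) auto
qed

text \<open>The modulus at \<open>0\<close> yields the masses, and then the value at \<open>0\<close> yields the phases \<open>g n\<close>. After dividing by
  the values at \<open>0\<close>, the exponents are small in a small disk, where \<open>exp\<close> can be cancelled; this gives the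
  Herglotz transforms and hence the measures.\<close>

lemma parameters_tendsto:
  assumes r: "0 < r" "r \<le> 1/4" and lim: "\<And>z. norm z < r \<Longrightarrow> (\<lambda>n. R n z) \<longlonglongrightarrow> limit_tr \<gamma> \<sigma> z"
  shows "circle_weak_conv s \<sigma>" "g \<longlonglongrightarrow> \<gamma>"
proof -
  have lim0: "(\<lambda>n. R n 0) \<longlonglongrightarrow> limit_tr \<gamma> \<sigma> 0" using lim[of 0] r by simp
  obtain B where B: "B \<ge> 0" "\<forall>\<^sub>F n in sequentially. measure (s n) unit_circle \<le> B" by (rule mass_bounded[OF lim0])
  note e0 = err_tendsto[OF B(2)]
  let ?m = "\<lambda>n. measure (s n) unit_circle" and ?M = "measure \<sigma> unit_circle"
  have "(\<lambda>n. ln (norm (R n 0))) \<longlonglongrightarrow> ln (norm (limit_tr \<gamma> \<sigma> 0))"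
    using limit_tr_nonzero[of 0] by (intro tendsto_ln tendsto_norm lim0) simp
  moreover have "norm (limit_tr \<gamma> \<sigma> 0) = exp (- ?M)"
    using \<gamma> by (simp add: limit_tr_def norm_mult Herglotz_tr_0[OF \<sigma>])
  moreover have "norm (R n 0) = exp (- ?m n + Re (err n 0))" for n
    using norm_R[of 0 n] by (simp add: Herglotz_tr_0[OF s])
  ultimately have "(\<lambda>n. - ?m n + Re (err n 0)) \<longlonglongrightarrow> - ?M" by simp
  then have "(\<lambda>n. Re (err n 0) - (- ?m n + Re (err n 0))) \<longlonglongrightarrow> Re 0 - (- ?M)"
    using e0[of 0] by (intro tendsto_diff tendsto_Re) simp_all
  then have mass: "?m \<longlonglongrightarrow> ?M" by simp
  have massc: "(\<lambda>n. complex_of_real (?m n)) \<longlonglongrightarrow> of_real ?M" by (intro tendsto_of_real mass)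
  have "(\<lambda>n. R n 0 * exp (of_real (?m n) - err n 0)) \<longlonglongrightarrow> limit_tr \<gamma> \<sigma> 0 * exp (of_real ?M - 0)"
    by (intro tendsto_mult lim0 tendsto_exp tendsto_diff massc e0) simp
  moreover have "R n 0 * exp (of_real (?m n) - err n 0) = g n" for n
    by (simp add: err(1)[of 0 n] Herglotz_tr_0[OF s] mult.assoc exp_add[symmetric])
  moreover have "limit_tr \<gamma> \<sigma> 0 * exp (of_real ?M - 0) = \<gamma>"
    by (simp add: limit_tr_def Herglotz_tr_0[OF \<sigma>] mult.assoc exp_add[symmetric])
  ultimately show g_lim: "g \<longlonglongrightarrow> \<gamma>" by simp
  have MB: "?M \<le> B" by (rule tendsto_upperbound[OF mass B(2)]) simp
  define \<rho> where "\<rho> = min r (1 / (4 * (B + 1)))"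
  have \<rho>: "0 < \<rho>" "\<rho> \<le> r" "\<rho> \<le> 1 / (4 * (B + 1))" using r B(1) by (auto simp: \<rho>_def)
  show "circle_weak_conv s \<sigma>"
  proof (rule weak_conv_of_Herglotz_tr[OF s \<sigma> \<rho>(1) _ mass])
    show "\<rho> \<le> 1" using \<rho>(2) r(2) by linarith
    fix z :: complex assume z: "norm z < \<rho>"
    have zr: "norm z < r" "norm z < 1/4" "norm z \<le> 1/2" using z \<rho>(2) r(2) by linarith+
    have small: "norm (of_real (measure m unit_circle) - Herglotz_tr m z) \<le> 1"
      if m: "circle_finite m" "measure m unit_circle \<le> B" for m
    proof -
      have "norm (of_real (measure m unit_circle) - Herglotz_tr m z) \<le> 4 * norm z * measure m unit_circle"
        by (rule Herglotz_tr_near_mass[OF m(1) zr(3)])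
      also have "\<dots> \<le> 4 * (1 / (4 * (B + 1))) * (B + 1)"
        using z \<rho>(3) m(2) B(1) by (intro mult_mono) auto
      also have "\<dots> = 1" using B(1) by simp
      finally show ?thesis .
    qed
    have lt: "limit_tr \<gamma> \<sigma> z = \<gamma> * exp (- Herglotz_tr \<sigma> z)" by (simp add: limit_tr_def)
    have \<gamma>0: "\<gamma> \<noteq> 0" and g0: "g n \<noteq> 0" for n using \<gamma> g[of n] by auto
    have "(\<lambda>n. R n z / g n * exp (of_real (?m n) - err n z)) \<longlonglongrightarrow> limit_tr \<gamma> \<sigma> z / \<gamma> * exp (of_real ?M - 0)"
      by (intro tendsto_mult tendsto_divide lim zr g_lim \<gamma>0 tendsto_exp tendsto_diff massc e0)
    moreover have "R n z / g n * exp (of_real (?m n) - err n z) = exp (of_real (?m n) - Herglotz_tr (s n) z)" for n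
      using g0[of n] by (simp add: err(1)[OF zr(2), of n] exp_add[symmetric])
    moreover have "limit_tr \<gamma> \<sigma> z / \<gamma> * exp (of_real ?M - 0) = exp (of_real ?M - Herglotz_tr \<sigma> z)"
      using \<gamma>0 by (simp add: lt exp_add[symmetric])
    ultimately have "(\<lambda>n. exp (of_real (?m n) - Herglotz_tr (s n) z)) \<longlonglongrightarrow> exp (of_real ?M - Herglotz_tr \<sigma> z)" by simp
    moreover have "\<forall>\<^sub>F n in sequentially. norm (of_real (?m n) - Herglotz_tr (s n) z) \<le> 1"
      using B(2) by eventually_elim (rule small[OF s])
    ultimately have "(\<lambda>n. of_real (?m n) - Herglotz_tr (s n) z) \<longlonglongrightarrow> of_real ?M - Herglotz_tr \<sigma> z"
      by (rule exp_tendsto_cancel) (rule small[OF \<sigma> MB])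
    from tendsto_diff[OF massc this] show "(\<lambda>n. Herglotz_tr (s n) z) \<longlonglongrightarrow> Herglotz_tr \<sigma> z" by simp
  qed
qed

theorem boolean_limit:
  assumes \<rho>: "\<And>n. \<rho> n \<in> circle_prob" and RB: "\<And>n z. norm z < 1/4 \<Longrightarrow> Bf (\<rho> n) z = R n z"
  shows "circle_weak_conv \<rho> (nu_boolean \<gamma> \<sigma>) \<longleftrightarrow> circle_weak_conv s \<sigma> \<and> g \<longlonglongrightarrow> \<gamma>"
proof
  note nu = nu_boolean_Bf[OF \<sigma> \<gamma>]
  assume w: "circle_weak_conv \<rho> (nu_boolean \<gamma> \<sigma>)"
  have "(\<lambda>n. R n z) \<longlonglongrightarrow> limit_tr \<gamma> \<sigma> z" if z: "norm z < 1/4" for z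
  proof -
    have z1: "norm z < 1" using z by linarith
    show ?thesis using weak_conv_imp_Bf[OF w \<rho> nu(1) z1] by (simp only: RB[OF z] nu(2)[OF z1])
  qed
  from parameters_tendsto[of "1/4", OF _ _ this] show "circle_weak_conv s \<sigma> \<and> g \<longlonglongrightarrow> \<gamma>" by simp
next
  note nu = nu_boolean_Bf[OF \<sigma> \<gamma>]
  assume w: "circle_weak_conv s \<sigma> \<and> g \<longlonglongrightarrow> \<gamma>"
  show "circle_weak_conv \<rho> (nu_boolean \<gamma> \<sigma>)"
  proof (rule weak_conv_of_eta[OF \<rho> nu(1)])
    show "0 < (1/4::real)" by simp
    fix z :: complex assume z: "norm z < 1/4"
    have z1: "norm z < 1" using z by linarith
    have "(\<lambda>n. z * R n z) \<longlonglongrightarrow> z * limit_tr \<gamma> \<sigma> z" using w by (intro tendsto_intros R_tendsto z) auto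
    then show "(\<lambda>n. eta (\<rho> n) z) \<longlonglongrightarrow> eta (nu_boolean \<gamma> \<sigma>) z"
      by (simp only: eta_def RB[OF z] nu(2)[OF z1])
  qed
qed

end

text \<open>The identity persists by analytic continuation as long as \<open>z S z\<close> stays in the disk.\<close>

lemma Sigma_germ_extend:
  assumes \<rho>: "\<rho> \<in> circle_prob" and S: "Sigma_germ \<rho> S" "S holomorphic_on ball 0 r"
    and less: "\<And>z. norm z < r \<Longrightarrow> norm (z * S z) < 1" and z: "norm z < r"
  shows "eta \<rho> (z * S z) = z"
proof -
  have r: "0 < r" using z norm_ge_zero[of z] by linarith
  have "\<forall>\<^sub>F z in nhds 0. eta \<rho> (z * S z) = z" using S(1) by (simp add: Sigma_germ_def)
  then obtain d where d: "d > 0" "\<And>z. dist z 0 < d \<Longrightarrow> eta \<rho> (z * S z) = z"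
    unfolding eventually_nhds_metric by blast
  have "(eta \<rho> \<circ> (\<lambda>z. z * S z)) holomorphic_on ball 0 r"
    by (rule holomorphic_on_compose_gen[OF _ eta_holomorphic[OF \<rho>]])
       (use less in \<open>auto intro!: holomorphic_intros S\<close>)
  then have h: "(\<lambda>z. eta \<rho> (z * S z)) holomorphic_on ball 0 r" by (simp add: o_def)
  show ?thesis
  proof (rule analytic_continuation_open[of "ball 0 (min d r)" "ball 0 r" "\<lambda>z. eta \<rho> (z * S z)" "\<lambda>z. z"])
    show "z \<in> ball 0 r" using z by simp
    show "ball 0 (min d r) \<noteq> ({}::complex set)" using d r by simp
    show "ball 0 (min d r) \<subseteq> (ball 0 r :: complex set)" by auto
    show "eta \<rho> (w * S w) = w" if "w \<in> ball 0 (min d r)" for w using that by (intro d) simp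
  qed (simp_all add: h holomorphic_on_ident)
qed

locale free_rows = exponential_rows +
  fixes \<rho> :: "nat \<Rightarrow> complex measure"
  assumes \<rho>: "\<And>n. \<rho> n \<in> circle_prob" and germ: "\<And>n. Sigma_germ (\<rho> n) (\<lambda>z. inverse (R n z))"
    and R_holomorphic: "\<And>n. (\<lambda>z. inverse (R n z)) holomorphic_on ball 0 (1/4)"
begin

text \<open>Bounded masses bound the functions \<open>inverse (R n)\<close>, which makes their germs invert
  \<open>eta (\<rho> n)\<close> on a disk that does not depend on \<open>n\<close>.\<close>

lemma common_disk:
  assumes B: "\<forall>\<^sub>F n in sequentially. measure (s n) unit_circle \<le> B" "B \<ge> 0"
  obtains D r where "D \<ge> 1" "0 < r" "r \<le> 1/4"
    "\<And>z. norm z < r \<Longrightarrow> \<forall>\<^sub>F n in sequentially. norm (z * inverse (R n z)) \<le> norm z * D \<and>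
       norm (z * inverse (R n z)) \<le> 1/2 \<and> eta (\<rho> n) (z * inverse (R n z)) = z"
proof -
  define D where "D = exp (3 * B)"
  have D: "D \<ge> 1" using B(2) by (simp add: D_def)
  define r where "r = 1 / (4 * D)"
  have r: "0 < r" "r \<le> 1/4" "r * D = 1/4" using D by (auto simp: r_def divide_simps)
  have "\<forall>\<^sub>F n in sequentially. \<epsilon> n < 1" by (intro order_tendstoD(2)[OF \<epsilon>]) simp
  with B(1) have ev: "\<forall>\<^sub>F n in sequentially. measure (s n) unit_circle \<le> B \<and> \<epsilon> n < 1"
    by eventually_elim simp
  have ok: "norm (z * inverse (R n z)) \<le> norm z * D \<and>
      norm (z * inverse (R n z)) \<le> 1/2 \<and> eta (\<rho> n) (z * inverse (R n z)) = z"
    if n: "measure (s n) unit_circle \<le> B \<and> \<epsilon> n < 1" and z: "norm z < r" for n z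
  proof -
    have le: "norm (w * inverse (R n w)) \<le> norm w * D \<and> norm (w * inverse (R n w)) \<le> 1/2" if w: "norm w < r" for w
    proof -
      have w4: "norm w < 1/4" using w r(2) by linarith
      have "\<epsilon> n * measure (s n) unit_circle \<le> 1 * measure (s n) unit_circle" using n by (intro mult_right_mono) auto
      then have "norm (err n w) \<le> B" using err(2)[OF w4, of n] n by linarith
      moreover have "norm (Herglotz_tr (s n) w) \<le> 2 * B" using norm_Herglotz_tr_le[OF s w4, of n] n by linarith
      ultimately have "Re (Herglotz_tr (s n) w) - Re (err n w) \<le> 3 * B"
        using abs_Re_le_cmod[of "Herglotz_tr (s n) w"] abs_Re_le_cmod[of "err n w"] by linarith
      then have "exp (Re (Herglotz_tr (s n) w) - Re (err n w)) \<le> D" by (simp add: D_def)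
      moreover have "norm (inverse (R n w)) = exp (Re (Herglotz_tr (s n) w) - Re (err n w))"
        by (simp add: norm_inverse norm_R[OF w4] exp_minus[symmetric])
      ultimately have le: "norm (w * inverse (R n w)) \<le> norm w * D"
        by (simp add: norm_mult mult_left_mono)
      have "norm w * D \<le> r * D" using w D by (intro mult_right_mono) auto
      with le r(3) show ?thesis by linarith
    qed
    have "eta (\<rho> n) (z * inverse (R n z)) = z"
    proof (rule Sigma_germ_extend[OF \<rho> germ _ _ z])
      show "(\<lambda>z. inverse (R n z)) holomorphic_on ball 0 r"
        by (rule holomorphic_on_subset[OF R_holomorphic]) (use r(2) in auto)
      show "norm (w * inverse (R n w)) < 1" if "norm w < r" for w using le[OF that] by linarith
    qed
    with le[OF z] show ?thesis by simp
  qed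
  show ?thesis
  proof (rule that[OF D r(1,2)])
    fix z :: complex assume z: "norm z < r"
    show "\<forall>\<^sub>F n in sequentially. norm (z * inverse (R n z)) \<le> norm z * D \<and>
       norm (z * inverse (R n z)) \<le> 1/2 \<and> eta (\<rho> n) (z * inverse (R n z)) = z"
      by (rule eventually_mono[OF ev ok[OF _ z]])
  qed
qed

lemma limit_germ:
  shows "(\<lambda>z. inverse (limit_tr \<gamma> \<sigma> z)) analytic_on {0}"
    and "e > 0 \<Longrightarrow> \<exists>d>0. \<forall>z. norm z < d \<longrightarrow> norm (z * inverse (limit_tr \<gamma> \<sigma> z)) < e \<and>
      eta (nu_free \<gamma> \<sigma>) (z * inverse (limit_tr \<gamma> \<sigma> z)) = z"
proof -
  note G = nu_free_Sigma_germ(2)[OF \<sigma> \<gamma>, unfolded Sigma_germ_def]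
  then show a: "(\<lambda>z. inverse (limit_tr \<gamma> \<sigma> z)) analytic_on {0}" by blast
  assume e: "e > 0"
  have "\<forall>\<^sub>F z in nhds 0. norm (z * inverse (limit_tr \<gamma> \<sigma> z)) < e \<and>
      eta (nu_free \<gamma> \<sigma>) (z * inverse (limit_tr \<gamma> \<sigma> z)) = z"
    using id_times_small[OF a e] conjunct2[OF G] by eventually_elim simp
  then show "\<exists>d>0. \<forall>z. norm z < d \<longrightarrow> norm (z * inverse (limit_tr \<gamma> \<sigma> z)) < e \<and>
      eta (nu_free \<gamma> \<sigma>) (z * inverse (limit_tr \<gamma> \<sigma> z)) = z"
    by (simp add: eventually_nhds_metric dist_norm)
qed

text \<open>Every small \<open>y\<close> is \<open>z \<Sigma> (z)\<close> for the limit law and some \<open>z\<close>. For this \<open>z\<close>, the points \<open>z / R n z\<close>, at which \<open>eta (\<rho> n)\<close> equals \<open>z\<close>, tend to \<open>y\<close>,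
  and \<open>eta (\<rho> n)\<close> is Lipschitz uniformly in \<open>n\<close>; so \<open>eta (\<rho> n) y\<close> tends to \<open>z\<close>.\<close>

lemma free_weak_conv:
  assumes w: "circle_weak_conv s \<sigma>" and lim: "g \<longlonglongrightarrow> \<gamma>"
  shows "circle_weak_conv \<rho> (nu_free \<gamma> \<sigma>)"
proof -
  let ?Q = "\<lambda>z. inverse (limit_tr \<gamma> \<sigma> z)"
  have "\<forall>\<^sub>F n in sequentially. measure (s n) unit_circle < measure \<sigma> unit_circle + 1"
    by (rule order_tendstoD(2)[OF weak_conv_imp_mass[OF w s \<sigma>]]) simp
  then have B: "\<forall>\<^sub>F n in sequentially. measure (s n) unit_circle \<le> measure \<sigma> unit_circle + 1"
    by eventually_elim simp
  have B0: "0 \<le> measure \<sigma> unit_circle + 1" by simp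
  obtain D r where r: "0 < r" "r \<le> 1/4"
    and disk: "\<And>z. norm z < r \<Longrightarrow> \<forall>\<^sub>F n in sequentially. norm (z * inverse (R n z)) \<le> norm z * D \<and>
       norm (z * inverse (R n z)) \<le> 1/2 \<and> eta (\<rho> n) (z * inverse (R n z)) = z"
    by (rule common_disk[OF B B0]) (rule that)
  obtain d where d: "d > 0" "\<And>z. norm z < d \<Longrightarrow> norm (z * ?Q z) < 1/2 \<and> eta (nu_free \<gamma> \<sigma>) (z * ?Q z) = z"
    using limit_germ(2)[of "1/2"] by auto
  have "?Q 0 \<noteq> 0" using limit_tr_nonzero by simp
  moreover have "0 < min d r" using d(1) r(1) by simp
  ultimately obtain c where c: "c > 0" "\<And>y. norm y < c \<Longrightarrow> \<exists>z. norm z < min d r \<and> z * ?Q z = y"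
    using id_times_surj[OF limit_germ(1)] by blast
  show ?thesis
  proof (rule weak_conv_of_eta[OF \<rho> nu_free_Sigma_germ(1)[OF \<sigma> \<gamma>] c(1)])
    fix y :: complex assume "norm y < c"
    then obtain z where z: "norm z < min d r" and y: "z * ?Q z = y" using c(2) by blast
    have zd: "norm z < d" "norm z < r" "norm z < 1/4" using z r(2) by auto
    have nu: "norm y \<le> 1/2" "eta (nu_free \<gamma> \<sigma>) y = z" using d(2)[OF zd(1)] by (auto simp: y)
    have yn: "(\<lambda>n. z * inverse (R n z)) \<longlonglongrightarrow> y"
      unfolding y[symmetric]
      by (intro tendsto_mult tendsto_inverse tendsto_const R_tendsto w lim zd limit_tr_nonzero)
    have "(\<lambda>n. eta (\<rho> n) y - z) \<longlonglongrightarrow> 0"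
    proof (rule Lim_null_comparison)
      show "\<forall>\<^sub>F n in sequentially. norm (eta (\<rho> n) y - z) \<le> 16 * norm (y - z * inverse (R n z))"
        using disk[OF zd(2)]
      proof eventually_elim
        case (elim n)
        then have e: "norm (z * inverse (R n z)) \<le> 1/2" "eta (\<rho> n) (z * inverse (R n z)) = z" by blast+
        show ?case using eta_Lipschitz[OF \<rho> nu(1) e(1), of n] by (simp only: e(2))
      qed
      have "(\<lambda>n. 16 * norm (y - z * inverse (R n z))) \<longlonglongrightarrow> 16 * norm (y - y)"
        by (intro tendsto_mult tendsto_const tendsto_norm tendsto_diff yn)
      then show "(\<lambda>n. 16 * norm (y - z * inverse (R n z))) \<longlonglongrightarrow> 0" by simp
    qed
    then show "(\<lambda>n. eta (\<rho> n) y) \<longlonglongrightarrow> eta (nu_free \<gamma> \<sigma>) y"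
      unfolding nu(2) by (rule LIM_zero_cancel)
  qed
qed

text \<open>Here \<open>R n 0\<close> is the mean of \<open>\<rho> n\<close>, so weak convergence bounds the masses. The means also stay away from \<open>0\<close>,
  so by the lower Lipschitz bound \<open>eta (\<rho> n) (z / R n z) = z\<close> and \<open>eta (\<rho> n) y \<longlonglongrightarrow> z\<close> force \<open>z / R n z \<longlonglongrightarrow> y\<close>.\<close>

lemma free_parameters:
  assumes w: "circle_weak_conv \<rho> (nu_free \<gamma> \<sigma>)"
  shows "circle_weak_conv s \<sigma>" "g \<longlonglongrightarrow> \<gamma>"
proof -
  let ?Q = "\<lambda>z. inverse (limit_tr \<gamma> \<sigma> z)" and ?\<nu> = "nu_free \<gamma> \<sigma>"
  note nu = nu_free_Sigma_germ[OF \<sigma> \<gamma>]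
  have mean: "R n 0 = (\<integral>\<zeta>. \<zeta> \<partial>\<rho> n)" for n
    using Sigma_germ_mean[OF \<rho> germ, of n] R_nonzero[of 0 n] by (simp add: field_simps)
  have meanl: "limit_tr \<gamma> \<sigma> 0 = (\<integral>\<zeta>. \<zeta> \<partial>?\<nu>)"
    using Sigma_germ_mean[OF nu] limit_tr_nonzero[of 0] by (simp add: field_simps)
  have lim0: "(\<lambda>n. R n 0) \<longlonglongrightarrow> limit_tr \<gamma> \<sigma> 0"
    using weak_conv_imp_Bf[OF w \<rho> nu(1), of 0] by (simp add: mean meanl Bf_0 \<rho> nu(1))
  obtain B where B: "B \<ge> 0" "\<forall>\<^sub>F n in sequentially. measure (s n) unit_circle \<le> B" by (rule mass_bounded[OF lim0])
  obtain D r where D: "D \<ge> 1" and r: "0 < r" "r \<le> 1/4"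
    and disk: "\<And>z. norm z < r \<Longrightarrow> \<forall>\<^sub>F n in sequentially. norm (z * inverse (R n z)) \<le> norm z * D \<and>
       norm (z * inverse (R n z)) \<le> 1/2 \<and> eta (\<rho> n) (z * inverse (R n z)) = z"
    by (rule common_disk[OF B(2,1)]) (rule that)
  \<comment> \<open>an eventual lower bound for the means; for \<open>|x|, |y| \<le> a / 24\<close> the lower Lipschitz constant is at least \<open>a / 8\<close>\<close>
  define a where "a = min 1 (norm (limit_tr \<gamma> \<sigma> 0) / 2)"
  have a: "0 < a" "a \<le> 1" "a < norm (limit_tr \<gamma> \<sigma> 0)" using limit_tr_nonzero[of 0] by (auto simp: a_def min_def)
  have meanlow: "\<forall>\<^sub>F n in sequentially. a < norm (\<integral>\<zeta>. \<zeta> \<partial>\<rho> n)"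
    unfolding mean[symmetric] by (intro order_tendstoD(1)[OF tendsto_norm[OF lim0]] a)
  have "0 < a / 24" using a by simp
  from limit_germ(2)[OF this] obtain d where d: "d > 0"
    "\<And>z. norm z < d \<Longrightarrow> norm (z * ?Q z) < a / 24 \<and> eta ?\<nu> (z * ?Q z) = z" by auto
  define q where "q = min r (min d (a / (24 * D)))"
  have q: "0 < q" "q \<le> r" "q \<le> d" "q \<le> a / (24 * D)" using r d a D by (auto simp: q_def)
  have lim: "(\<lambda>n. R n z) \<longlonglongrightarrow> limit_tr \<gamma> \<sigma> z" if z: "norm z < q" for z
  proof (cases "z = 0")
    case True
    then show ?thesis using lim0 by simp
  next
    case False
    have zr: "norm z < r" "norm z < d" using z q by linarith+
    define y where "y = z * ?Q z"
    have y: "norm y < a / 24" "eta ?\<nu> y = z" using d(2)[OF zr(2)] by (auto simp: y_def)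
    have yh: "norm y \<le> 1/2" using y(1) a(2) by linarith
    have y1: "norm y < 1" using yh by linarith
    have "norm z * D \<le> a / (24 * D) * D" using z q(4) D by (intro mult_right_mono) auto
    then have zD: "norm z * D \<le> a / 24" using D by simp
    have "(\<lambda>n. y * Bf (\<rho> n) y) \<longlonglongrightarrow> y * Bf ?\<nu> y"
      by (intro tendsto_intros weak_conv_imp_Bf[OF w \<rho> nu(1) y1])
    then have eta_lim: "(\<lambda>n. eta (\<rho> n) y) \<longlonglongrightarrow> z" by (simp only: eta_def[symmetric] y(2))
    have "(\<lambda>n. z * inverse (R n z) - y) \<longlonglongrightarrow> 0"
    proof (rule Lim_null_comparison)
      show "\<forall>\<^sub>F n in sequentially. norm (z * inverse (R n z) - y) \<le> 8 / a * norm (z - eta (\<rho> n) y)"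
        using disk[OF zr(1)] meanlow
      proof eventually_elim
        case (elim n)
        define x where "x = z * inverse (R n z)"
        have x: "norm x \<le> a / 24" "norm x \<le> 1/2" "eta (\<rho> n) x = z" using elim(1) zD by (auto simp: x_def)
        have "norm (x - y) * (a / 2) \<le> norm (x - y) * (norm (\<integral>\<zeta>. \<zeta> \<partial>\<rho> n) - 6 * (norm x + norm y))"
          using x(1) y(1) elim(2) by (intro mult_left_mono) auto
        also have "\<dots> \<le> 4 * norm (z - eta (\<rho> n) y)"
          using eta_lower_Lipschitz[OF \<rho> x(2) yh, of n] by (simp only: x(3))
        finally show ?case using a(1) by (simp add: x_def divide_simps mult.commute)
      qed
      have "(\<lambda>n. 8 / a * norm (z - eta (\<rho> n) y)) \<longlonglongrightarrow> 8 / a * norm (z - z)"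
        by (intro tendsto_mult tendsto_const tendsto_norm tendsto_diff eta_lim)
      then show "(\<lambda>n. 8 / a * norm (z - eta (\<rho> n) y)) \<longlonglongrightarrow> 0" by simp
    qed
    then have yn: "(\<lambda>n. z * inverse (R n z)) \<longlonglongrightarrow> y" by (rule LIM_zero_cancel)
    have y0: "y \<noteq> 0" using False limit_tr_nonzero[of z] by (simp add: y_def)
    have "(\<lambda>n. z / (z * inverse (R n z))) \<longlonglongrightarrow> z / y" by (intro tendsto_divide tendsto_const yn y0)
    moreover have "z / (z * inverse (R n z)) = R n z" for n using False by (simp add: divide_simps)
    moreover have "z / y = limit_tr \<gamma> \<sigma> z" using False limit_tr_nonzero[of z] by (simp add: y_def divide_simps)
    ultimately show ?thesis by simp
  qed
  have "q \<le> 1/4" using q(2) r(2) by linarith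
  from parameters_tendsto[OF q(1) this lim] show "circle_weak_conv s \<sigma>" "g \<longlonglongrightarrow> \<gamma>" by simp_all
qed

end

section \<open>Equivalence of the boolean and the free limit theorem\<close>

lemma prod_exp_expansion:
  fixes f a b :: "'i \<Rightarrow> complex"
  assumes "\<And>j. j \<in> J \<Longrightarrow> \<exists>e. f j = a j * exp (b j + e) \<and> norm e \<le> d j"
  shows "\<exists>e. (\<Prod>j\<in>J. f j) = (\<Prod>j\<in>J. a j) * exp ((\<Sum>j\<in>J. b j) + e) \<and> norm e \<le> (\<Sum>j\<in>J. d j)"
proof (cases "finite J")
  case True
  obtain e where e: "\<And>j. j \<in> J \<Longrightarrow> f j = a j * exp (b j + e j) \<and> norm (e j) \<le> d j"
    using bchoice[of J "\<lambda>j e. f j = a j * exp (b j + e) \<and> norm e \<le> d j"] assms by blast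
  have "(\<Prod>j\<in>J. f j) = (\<Prod>j\<in>J. a j * exp (b j + e j))" by (rule prod.cong) (use e in auto)
  also have "\<dots> = (\<Prod>j\<in>J. a j) * exp ((\<Sum>j\<in>J. b j) + (\<Sum>j\<in>J. e j))"
    by (simp add: prod.distrib exp_sum[OF True, symmetric] sum.distrib)
  finally have "(\<Prod>j\<in>J. f j) = (\<Prod>j\<in>J. a j) * exp ((\<Sum>j\<in>J. b j) + (\<Sum>j\<in>J. e j))" .
  moreover have "norm (\<Sum>j\<in>J. e j) \<le> (\<Sum>j\<in>J. d j)" by (rule sum_norm_le) (use e in auto)
  ultimately show ?thesis by blast
qed simp

theorem theorem3p5:
  fixes \<gamma> :: complex and \<sigma> :: "complex measure" and \<tau> :: real
    and k :: "nat \<Rightarrow> nat" and \<mu> :: "nat \<Rightarrow> nat \<Rightarrow> complex measure" and l :: "nat \<Rightarrow> complex"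
  assumes "0 < \<tau>" and "\<tau> < pi"
    and "\<gamma> \<in> unit_circle"
    and "finite_measure \<sigma>" and "sets \<sigma> = sets circle_borel"
    and "\<And>n. 1 \<le> n \<Longrightarrow> 1 \<le> k n"
    and "\<And>n j. 1 \<le> n \<Longrightarrow> 1 \<le> j \<Longrightarrow> j \<le> k n \<Longrightarrow> \<mu> n j \<in> circle_prob_times"
    and "infinitesimal k \<mu>"
    and "\<And>n. 1 \<le> n \<Longrightarrow> l n \<in> unit_circle"
  shows
    "(circle_weak_conv
        (\<lambda>n. foldl boolean_conv (point_mass (l n)) (map (\<mu> n) [1..<Suc (k n)])) (nu_boolean \<gamma> \<sigma>)
      \<longleftrightarrow>
      circle_weak_conv
        (\<lambda>n. foldl free_conv (point_mass (l n)) (map (\<mu> n) [1..<Suc (k n)])) (nu_free \<gamma> \<sigma>))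
     \<and>
     (circle_weak_conv
        (\<lambda>n. foldl free_conv (point_mass (l n)) (map (\<mu> n) [1..<Suc (k n)])) (nu_free \<gamma> \<sigma>)
      \<longleftrightarrow>
      circle_weak_conv (sigma_row \<tau> k \<mu>) \<sigma> \<and> gamma_row \<tau> k \<mu> l \<longlonglongrightarrow> \<gamma>)"
proof -
  note tau = \<open>0 < \<tau>\<close> and gam = \<open>\<gamma> \<in> unit_circle\<close>
  have sig: "circle_finite \<sigma>" using \<open>finite_measure \<sigma>\<close> \<open>sets \<sigma> = sets circle_borel\<close> by (simp add: circle_finite_def)
  have mu: "\<mu> n j \<in> circle_prob" if "1 \<le> n" "j \<in> {1..k n}" for n j
    using assms(7)[of n j] that by (simp add: circle_prob_times_def)
  define M where "M = (\<lambda>n. MAX j\<in>{1..k n}. spread (\<mu> n j))"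
  have M0: "M \<longlonglongrightarrow> 0" unfolding M_def by (rule infinitesimal_spread[OF assms(8,6) mu])
  obtain C \<delta> where C: "C > 0" and \<delta>: "\<delta> > 0"
    and B_exp: "\<And>\<mu> z. \<mu> \<in> circle_prob \<Longrightarrow> spread \<mu> \<le> \<delta> \<Longrightarrow> norm z < 1/4 \<Longrightarrow>
       \<exists>e. Bf \<mu> z = center \<tau> \<mu> * exp (- levy (centered \<tau> \<mu>) z + e) \<and> norm e \<le> C * spread \<mu> * defect (centered \<tau> \<mu>)"
    and S_exp: "\<And>\<mu>. \<mu> \<in> circle_prob \<Longrightarrow> spread \<mu> \<le> \<delta> \<Longrightarrow>
       \<exists>S. Sigma_germ \<mu> S \<and> S holomorphic_on ball 0 (1/4) \<and> (\<forall>z. norm z < 1/4 \<longrightarrow>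
         (\<exists>e. S z = inverse (center \<tau> \<mu>) * exp (levy (centered \<tau> \<mu>) z + e) \<and> norm e \<le> C * spread \<mu> * defect (centered \<tau> \<mu>)))"
    using entry_expansions[OF tau] by metis
  \<comment> \<open>the expansions hold from row \<open>N\<close> on, so the abstract theorem is applied to the shifted sequences\<close>
  have "\<forall>\<^sub>F n in sequentially. M n < \<delta>" by (rule order_tendstoD(2)[OF M0 \<delta>])
  then have "\<forall>\<^sub>F n in sequentially. M n < \<delta> \<and> 1 \<le> n" by (intro eventually_conj eventually_ge_at_top)
  then obtain N where N: "\<And>n. N \<le> n \<Longrightarrow> M n < \<delta> \<and> 1 \<le> n" unfolding eventually_sequentially by blast
  have entry: "\<mu> n j \<in> circle_prob" "spread (\<mu> n j) \<le> \<delta>" "C * spread (\<mu> n j) * defect (centered \<tau> (\<mu> n j)) \<le> C * M n * defect (centered \<tau> (\<mu> n j))"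
    if n: "N \<le> n" and j: "j \<in> {1..k n}" for n j
  proof -
    show p: "\<mu> n j \<in> circle_prob" using mu N[OF n] j by blast
    have le: "spread (\<mu> n j) \<le> M n" unfolding M_def by (rule Max_ge) (use j in auto)
    with N[OF n] show "spread (\<mu> n j) \<le> \<delta>" by linarith
    show "C * spread (\<mu> n j) * defect (centered \<tau> (\<mu> n j)) \<le> C * M n * defect (centered \<tau> (\<mu> n j))"
      using le C defect_nonneg[OF centered_integral(1)[OF p]] by (intro mult_right_mono mult_left_mono) auto
  qed
  have ln: "l n \<in> unit_circle" if "N \<le> n" for n using assms(9) N[OF that] by blast
  have mass: "(\<Sum>j=1..k n. C * M n * defect (centered \<tau> (\<mu> n j))) = C * M n * measure (sigma_row \<tau> k \<mu> n) unit_circle" if n: "N \<le> n" for n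
    by (simp only: sigma_row_mass[of k n \<mu>, OF entry(1)[OF n]] sum_distrib_left)
  have trace: "gamma_row \<tau> k \<mu> l n * exp (- Herglotz_tr (sigma_row \<tau> k \<mu> n) z + e) =
      l n * (\<Prod>j=1..k n. center \<tau> (\<mu> n j)) * exp ((\<Sum>j=1..k n. - levy (centered \<tau> (\<mu> n j)) z) + e)"
    if n: "N \<le> n" and z: "norm z < 1/4" for n z e
  proof -
    have z1: "norm z < 1" using z by linarith
    define h d where "h = (\<Sum>j=1..k n. levy (centered \<tau> (\<mu> n j)) z)" and "d = (\<Sum>j=1..k n. drift (centered \<tau> (\<mu> n j)))"
    have H: "Herglotz_tr (sigma_row \<tau> k \<mu> n) z = h + \<i> * of_real d"
      unfolding h_def d_def by (rule sigma_row_Herglotz_tr[of k n \<mu>, OF entry(1)[OF n] z1])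
    have "gamma_row \<tau> k \<mu> l n = l n * (\<Prod>j=1..k n. center \<tau> (\<mu> n j)) * exp (\<i> * of_real d)"
      unfolding d_def by (rule gamma_row_eq[of l, OF ln[OF n]])
    moreover have "exp (\<i> * of_real d) * exp (- (h + \<i> * of_real d) + e) = exp (- h + e)"
      by (simp add: exp_add[symmetric])
    ultimately show ?thesis unfolding H sum_negf h_def[symmetric] by (simp only: mult.assoc)
  qed
  let ?\<beta> = "\<lambda>n. foldl boolean_conv (point_mass (l n)) (map (\<mu> n) [1..<Suc (k n)])"
  let ?\<rho> = "\<lambda>n. foldl free_conv (point_mass (l n)) (map (\<mu> n) [1..<Suc (k n)])"
  have js: "set [1..<Suc (k n)] = {1..k n}" for n by (simp only: set_upt atLeastLessThanSuc_atLeastAtMost)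
  have bool: "?\<beta> n \<in> circle_prob \<and> (\<forall>z. norm z < 1 \<longrightarrow> Bf (?\<beta> n) z = l n * (\<Prod>j=1..k n. Bf (\<mu> n j) z))"
    if n: "N \<le> n" for n
  proof -
    have "?\<beta> n \<in> circle_prob \<and> (\<forall>z. norm z < 1 \<longrightarrow> Bf (?\<beta> n) z = Bf (point_mass (l n)) z * (\<Prod>j\<leftarrow>[1..<Suc (k n)]. Bf (\<mu> n j) z))"
      by (rule boolean_row[OF point_mass_Bf(1)[OF ln[OF n]]]) (use entry(1)[OF n] js in blast)
    then show ?thesis unfolding prod_list_upt by (simp add: point_mass_Bf(2)[OF ln[OF n]])
  qed
  define S where "S = (\<lambda>n j. SOME S. Sigma_germ (\<mu> n j) S \<and> S holomorphic_on ball 0 (1/4) \<and> (\<forall>z. norm z < 1/4 \<longrightarrow>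
         (\<exists>e. S z = inverse (center \<tau> (\<mu> n j)) * exp (levy (centered \<tau> (\<mu> n j)) z + e) \<and>
            norm e \<le> C * spread (\<mu> n j) * defect (centered \<tau> (\<mu> n j)))))"
  have S: "Sigma_germ (\<mu> n j) (S n j) \<and> S n j holomorphic_on ball 0 (1/4) \<and> (\<forall>z. norm z < 1/4 \<longrightarrow>
         (\<exists>e. S n j z = inverse (center \<tau> (\<mu> n j)) * exp (levy (centered \<tau> (\<mu> n j)) z + e) \<and>
            norm e \<le> C * spread (\<mu> n j) * defect (centered \<tau> (\<mu> n j))))"
    if n: "N \<le> n" and j: "j \<in> {1..k n}" for n j
    unfolding S_def by (rule someI_ex[OF S_exp[OF entry(1,2)[OF n j]]])
  \<comment> \<open>a representative on the disk of radius \<open>1/4\<close> of the germ of the free row\<close>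
  define Q where "Q = (\<lambda>n z. cnj (l n) * (\<Prod>j=1..k n. S n j z))"
  have free: "?\<rho> n \<in> circle_prob \<and> Sigma_germ (?\<rho> n) (Q n)" if n: "N \<le> n" for n
  proof -
    have "?\<rho> n \<in> circle_prob \<and> Sigma_germ (?\<rho> n) (\<lambda>z. cnj (l n) * (\<Prod>j\<leftarrow>[1..<Suc (k n)]. S n j z))"
      by (rule free_row[OF point_mass_Bf(1,3)[OF ln[OF n]]]) (use entry(1)[OF n] S[OF n] js in blast)+
    then show ?thesis unfolding Q_def prod_list_upt .
  qed
  have Q_hol: "Q n holomorphic_on ball 0 (1/4)" if n: "N \<le> n" for n
    unfolding Q_def using S[OF n] by (intro holomorphic_intros) blast
  have \<epsilon>: "(\<lambda>n. C * M (n + N)) \<longlonglongrightarrow> 0"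
    using tendsto_mult[OF tendsto_const[of C] LIMSEQ_ignore_initial_segment[OF M0, of N]] by simp
  have params: "circle_finite (sigma_row \<tau> k \<mu> n)" if "N \<le> n" for n
    by (rule sigma_row_integral(1)[of k n \<mu>, OF entry(1)[OF that]])
  have B_row: "\<exists>e. Bf (?\<beta> n) z = gamma_row \<tau> k \<mu> l n * exp (- Herglotz_tr (sigma_row \<tau> k \<mu> n) z + e) \<and>
      norm e \<le> C * M n * measure (sigma_row \<tau> k \<mu> n) unit_circle" if n: "N \<le> n" and z: "norm z < 1/4" for n z
  proof -
    have z1: "norm z < 1" using z by linarith
    have "\<exists>e. (\<Prod>j=1..k n. Bf (\<mu> n j) z) = (\<Prod>j=1..k n. center \<tau> (\<mu> n j)) * exp ((\<Sum>j=1..k n. - levy (centered \<tau> (\<mu> n j)) z) + e) \<and>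
        norm e \<le> (\<Sum>j=1..k n. C * M n * defect (centered \<tau> (\<mu> n j)))"
    proof (rule prod_exp_expansion)
      fix j assume j: "j \<in> {1..k n}"
      show "\<exists>e. Bf (\<mu> n j) z = center \<tau> (\<mu> n j) * exp (- levy (centered \<tau> (\<mu> n j)) z + e) \<and> norm e \<le> C * M n * defect (centered \<tau> (\<mu> n j))"
        using B_exp[OF entry(1,2)[OF n j] z] entry(3)[OF n j] by (meson order_trans)
    qed
    then obtain e where e: "(\<Prod>j=1..k n. Bf (\<mu> n j) z) = (\<Prod>j=1..k n. center \<tau> (\<mu> n j)) * exp ((\<Sum>j=1..k n. - levy (centered \<tau> (\<mu> n j)) z) + e)"
      "norm e \<le> C * M n * measure (sigma_row \<tau> k \<mu> n) unit_circle" unfolding mass[OF n] by blast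
    have "Bf (?\<beta> n) z = l n * (\<Prod>j=1..k n. Bf (\<mu> n j) z)" using bool[OF n] z1 by blast
    then have "Bf (?\<beta> n) z = gamma_row \<tau> k \<mu> l n * exp (- Herglotz_tr (sigma_row \<tau> k \<mu> n) z + e)"
      unfolding trace[OF n z] e(1) by (simp only: mult.assoc)
    with e(2) show ?thesis by blast
  qed
  have Q_row: "\<exists>e. inverse (Q n z) = gamma_row \<tau> k \<mu> l n * exp (- Herglotz_tr (sigma_row \<tau> k \<mu> n) z + e) \<and>
      norm e \<le> C * M n * measure (sigma_row \<tau> k \<mu> n) unit_circle" if n: "N \<le> n" and z: "norm z < 1/4" for n z
  proof -
    have "\<exists>e. (\<Prod>j=1..k n. S n j z) = (\<Prod>j=1..k n. inverse (center \<tau> (\<mu> n j))) * exp ((\<Sum>j=1..k n. levy (centered \<tau> (\<mu> n j)) z) + e) \<and>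
        norm e \<le> (\<Sum>j=1..k n. C * M n * defect (centered \<tau> (\<mu> n j)))"
    proof (rule prod_exp_expansion)
      fix j assume j: "j \<in> {1..k n}"
      have "\<exists>e. S n j z = inverse (center \<tau> (\<mu> n j)) * exp (levy (centered \<tau> (\<mu> n j)) z + e) \<and>
            norm e \<le> C * spread (\<mu> n j) * defect (centered \<tau> (\<mu> n j))" using S[OF n j] z by blast
      then show "\<exists>e. S n j z = inverse (center \<tau> (\<mu> n j)) * exp (levy (centered \<tau> (\<mu> n j)) z + e) \<and> norm e \<le> C * M n * defect (centered \<tau> (\<mu> n j))"
        using entry(3)[OF n j] by (meson order_trans)
    qed
    then obtain e where e: "(\<Prod>j=1..k n. S n j z) = (\<Prod>j=1..k n. inverse (center \<tau> (\<mu> n j))) * exp ((\<Sum>j=1..k n. levy (centered \<tau> (\<mu> n j)) z) + e)"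
      "norm e \<le> C * M n * measure (sigma_row \<tau> k \<mu> n) unit_circle" unfolding mass[OF n] by blast
    have "l n * cnj (l n) = 1" using ln[OF n] complex_norm_square[of "l n"] by simp
    then have il: "inverse (cnj (l n)) = l n" by (rule inverse_unique[OF trans[OF mult.commute]])
    have "inverse (Q n z) = l n * (\<Prod>j=1..k n. center \<tau> (\<mu> n j)) * exp ((\<Sum>j=1..k n. - levy (centered \<tau> (\<mu> n j)) z) + - e)"
      unfolding Q_def e(1)
      by (simp add: il prod_inversef[symmetric] o_def exp_minus[symmetric] sum_negf mult.assoc add.commute)
    then have "inverse (Q n z) = gamma_row \<tau> k \<mu> l n * exp (- Herglotz_tr (sigma_row \<tau> k \<mu> n) z + - e)"
      unfolding trace[OF n z] .
    moreover have "norm (- e) \<le> C * M n * measure (sigma_row \<tau> k \<mu> n) unit_circle" using e(2) by simp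
    ultimately show ?thesis by blast
  qed
  have N': "N \<le> n + N" for n by simp
  interpret b: exponential_rows "\<lambda>n. sigma_row \<tau> k \<mu> (n + N)" "\<lambda>n. gamma_row \<tau> k \<mu> l (n + N)" \<sigma> \<gamma>
    "\<lambda>n. Bf (?\<beta> (n + N))" "\<lambda>n. C * M (n + N)"
    by (unfold_locales; (rule params[OF N'] sig norm_gamma_row gam B_row[OF N'] \<epsilon>)?; assumption?)
  interpret f: free_rows "\<lambda>n. sigma_row \<tau> k \<mu> (n + N)" "\<lambda>n. gamma_row \<tau> k \<mu> l (n + N)" \<sigma> \<gamma>
    "\<lambda>n z. inverse (Q (n + N) z)" "\<lambda>n. C * M (n + N)" "\<lambda>n. ?\<rho> (n + N)"
  proof unfold_locales
    show "\<exists>e. inverse (Q (n + N) z) = gamma_row \<tau> k \<mu> l (n + N) * exp (- Herglotz_tr (sigma_row \<tau> k \<mu> (n + N)) z + e) \<and>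
        norm e \<le> C * M (n + N) * measure (sigma_row \<tau> k \<mu> (n + N)) unit_circle" if "norm z < 1/4" for n z
      by (rule Q_row[OF N' that])
    show "?\<rho> (n + N) \<in> circle_prob" for n using free[OF N'] by blast
    show "Sigma_germ (?\<rho> (n + N)) (\<lambda>z. inverse (inverse (Q (n + N) z)))" for n
      using free[OF N', of n] by simp
    show "(\<lambda>z. inverse (inverse (Q (n + N) z))) holomorphic_on ball 0 (1/4)" for n
      using Q_hol[OF N', of n] by simp
  qed (rule params[OF N'] sig norm_gamma_row gam \<epsilon>)+
  have shift: "circle_weak_conv (\<lambda>n. sigma_row \<tau> k \<mu> (n + N)) \<sigma> \<longleftrightarrow> circle_weak_conv (sigma_row \<tau> k \<mu>) \<sigma>"
    "(\<lambda>n. gamma_row \<tau> k \<mu> l (n + N)) \<longlonglongrightarrow> \<gamma> \<longleftrightarrow> gamma_row \<tau> k \<mu> l \<longlonglongrightarrow> \<gamma>"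
    by (rule circle_weak_conv_shift) (rule iffI[OF LIMSEQ_offset LIMSEQ_ignore_initial_segment])
  have "circle_weak_conv (\<lambda>n. ?\<beta> (n + N)) (nu_boolean \<gamma> \<sigma>) \<longleftrightarrow>
      circle_weak_conv (sigma_row \<tau> k \<mu>) \<sigma> \<and> gamma_row \<tau> k \<mu> l \<longlonglongrightarrow> \<gamma>"
    unfolding shift[symmetric] using bool[OF N'] by (intro b.boolean_limit) simp_all
  then have 1: "circle_weak_conv ?\<beta> (nu_boolean \<gamma> \<sigma>) \<longleftrightarrow>
      circle_weak_conv (sigma_row \<tau> k \<mu>) \<sigma> \<and> gamma_row \<tau> k \<mu> l \<longlonglongrightarrow> \<gamma>"
    unfolding circle_weak_conv_shift[of ?\<beta>] .
  have "circle_weak_conv (\<lambda>n. ?\<rho> (n + N)) (nu_free \<gamma> \<sigma>) \<longleftrightarrow>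
      circle_weak_conv (sigma_row \<tau> k \<mu>) \<sigma> \<and> gamma_row \<tau> k \<mu> l \<longlonglongrightarrow> \<gamma>"
    unfolding shift[symmetric] using f.free_weak_conv f.free_parameters by blast
  then have 2: "circle_weak_conv ?\<rho> (nu_free \<gamma> \<sigma>) \<longleftrightarrow>
      circle_weak_conv (sigma_row \<tau> k \<mu>) \<sigma> \<and> gamma_row \<tau> k \<mu> l \<longlonglongrightarrow> \<gamma>"
    unfolding circle_weak_conv_shift[of ?\<rho>] .
  show ?thesis unfolding 1 2 by simp
qed

end
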